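(* Consider the sequence of stationary polling systems indexed by $n\ge1$ described in the context, all operating under the binomial-exhaustive policy with the same parameter $\mathbf r\in\mathcal R$, with switchover times $V_i^n$ satisfying: $\bar V_i^n:=V_i^n/n\Rightarrow s_i$ (convergence in distribution) as $n\to\infty$, and $\mathbb E[V_i^n]=ns_i$ for all $n\ge 1$, for all $i\in\mathcal I$. Let $(q_k(a_i),\ k\in\mathcal K,\ i\in\mathcal I)$ be the unique solution of the linear system given in the context. Then: (i) $\mathbb E[\bar Q_k^n(\bar A_i^n)]=q_k(a_i)$ for all $n\ge1$, $k\in\mathcal K$, $i\in\mathcal I$. (ii) If (a) $\mathbb E[S_k^2]<\infty$ for all $k\in\mathcal K$, (b) $\mathbb E[(V_i^n)^2]<\infty$ for all $i\in\mathcal I$, $n\ge1$, and (c) $\mathbb E[(\bar V_i^n)^2]\to s_i^2$ as $n\to\infty$ for all $i\in\mathcal I$, then $\mathbb E[Q_k^n(A_i^n)Q_j^n(A_i^n)]<\infty$ for all $n\ge1$, and $$\lim_{n\to\infty}\mathbb E[\bar Q_k^n(\bar A_i^n)\,\bar Q_j^n(\bar A_i^n)]=q_k(a_i)\,q_j(a_i)\quad\text{for all }k,j\in\mathcal K\text{ and }i\in\mathcal I.$$ (iii) If (a) for each $k\in\mathcal K$ there exists $\epsilon_k>0$ such that $\mathbb E[e^{tS_k}]<\infty$ for all $t\in(-\epsilon_k,\epsilon_k)$, (b) $\mathbb E[e^{tV_i^n}]<\infty$ for all $t\in[0,\infty)$, $i\in\mathcal I$, $n\ge1$, and (c) $\mathbb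 E[(\bar V_i^n)^\ell]\to s_i^\ell$ as $n\to\infty$ for all integers $\ell\ge3$ and all $i\in\mathcal I$, then $\mathbb E[Q_k^n(A_i^n)^\ell]<\infty$ for all $n\ge1$, and $$\lim_{n\to\infty}\mathbb E[\bar Q_k^n(\bar A_i^n)^\ell]=(q_k(a_i))^\ell\quad\text{for all integers }\ell\ge3,\ k\in\mathcal K,\ i\in\mathcal I.$$
   Context: Model. A single server attends $K$ queues, indexed by $\mathcal K=\{1,\dots,K\}$. In system $n$ ($n\ge1$), customers arrive at queue $k$ according to a Poisson process with rate $\lambda_k>0$ and wait in an infinite buffer; service times at queue $k$ are i.i.d., distributed as a nonnegative random variable $S_k$ with mean $1/\mu_k<\infty$ (arrival rates and service distributions do not depend on $n$). The server visits queues according to a polling table with $I\ge K$ stages, $\mathcal I=\{1,\dots,I\}$; $p:\mathcal I\to\mathcal K$ maps a stage to the queue visited at that stage. Stages are visited cyclically $1,\dots,I,1,\dots$. In system $n$, each transition from stage $i$ to the next stage (stage $I+1$ meaning stage $1$) incurs a switchover time distributed as a nonnegative random variable $V_i^n$. The constants $s_i\ge 0$ satisfy $s:=\sum_{i\in\mathcal I}s_i>0$. All arrival processes, service times and switchover times are mutually independent. Put $\rho_k:=\lambda_k/\mu_k$, $\rho:=\sum_{k\in\mathcal K}\rho_k$, and assume $\rho<1$. Binomial-exhaustive policy (BEP). It has a parameter $\mathbf r=(r_1,\dots,r_I)\in\mathcal R:=\{\mathbf r\in[0,1]^I:\ \sum_{i\in\mathcal I:\,p(i)=k}r_i>0\text{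 for all }k\in\mathcal K\}$. If the server finds $N$ customers in queue $p(i)$ at the start of a visit at stage $i$, then it serves queue $p(i)$ until its queue length is reduced to $N-Y_i(N,r_i)$, where $Y_i(N,r_i)$ is a binomial random variable with parameters $N$ and $r_i$, independent of everything else. (Equivalently, each of the $N$ customers is independently selected with probability $r_i$, and each selected customer generates an independent $M/G/1$ busy period with arrival rate $\lambda_{p(i)}$ and service times distributed as $S_{p(i)}$.) Steady state and scaling. The polling epoch of a stage is the starting time of the visit; a cycle is the time between consecutive polling epochs of stage $1$. $Q^n(t)=(Q_k^n(t))_{k\in\mathcal K}$ is the vector of numbers of customers in the queues at time $t$ in system $n$. Since $\rho<1$, for each $n$ the chain of queue-length vectors at successive polling epochs of stage $1$ is an ergodic discrete-time Markov chain, and each system is assumed to be in the corresponding steady state; $A_i^n$ denotes a generic polling epoch of stage $i$ in steady state, so $Q^n(A_i^n)$ has the stationary distribution of the queue-length vector at polling epochs of stage $i$. Fluid-scaled quantities: $\bar Q^n(t):=Q^n(nt)/n$ and $\bar A_i^n:=A_i^n/n$, so $\bar Q_k^n(\bar A_i^n)=Q_k^n(A_i^n)/n$. Linear system. $(q_k(a_i),\ k\in\mathcal K,\ i\in\mathcal I)$ denotes the unique solution of the $IK$ equations $$q_k(a_{i+1})=s_i\lambda_k+(1-r_i)\,q_k(a_i)\quad\text{if }k=p(i),$$ $$q_k(a_{i+1})=s_i\lambda_k+q_k(a_i)+q_{p(i)}(a_i)\,r_i\,\lambda_k\,\frac{1}{\mu_{p(i)}(1-\rho_{p(i)})}\quad\text{if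 }k\neq p(i),$$ for $k\in\mathcal K$, $i\in\mathcal I$, with stage index $I+1$ identified with $1$. *)

theory Defs
  imports "HOL-Probability.Probability"
begin

text \<open>
  Queues are numbered \<open>1..K\<close>, stages \<open>1..I\<close>. \<open>SD k\<close> is the law of the service times at queue
  \<open>k\<close>; \<open>r\<close> is the parameter of the binomial-exhaustive policy.
\<close>

locale polling_model =
  fixes K I :: nat
    and p :: "nat \<Rightarrow> nat"
    and lam mu :: "nat \<Rightarrow> real"
    and SD :: "nat \<Rightarrow> real measure"
    and s r :: "nat \<Rightarrow> real"
  assumes stages: "K \<le> I"
    and polling_table: "\<And>i. i \<in> {1..I} \<Longrightarrow> p i \<in> {1..K}"
    and arrival_rate: "\<And>k. k \<in> {1..K} \<Longrightarrow> 0 < lam k"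
    and service_rate: "\<And>k. k \<in> {1..K} \<Longrightarrow> 0 < mu k"
    and service_law: "\<And>k. k \<in> {1..K} \<Longrightarrow> prob_space (SD k)"
      "\<And>k. k \<in> {1..K} \<Longrightarrow> sets (SD k) = sets borel"
      "\<And>k. k \<in> {1..K} \<Longrightarrow> AE x in SD k. 0 \<le> x"
    and service_mean: "\<And>k. k \<in> {1..K} \<Longrightarrow> has_bochner_integral (SD k) (\<lambda>x. x) (1 / mu k)"
    and stability: "(\<Sum>k\<in>{1..K}. lam k / mu k) < 1"
    and switch_nonneg: "\<And>i. i \<in> {1..I} \<Longrightarrow> 0 \<le> s i"
    and switch_total: "0 < (\<Sum>i\<in>{1..I}. s i)"
    and policy_range: "\<And>i. i \<in> {1..I} \<Longrightarrow> 0 \<le> r i \<and> r i \<le> 1"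
    and policy_active: "\<And>k. k \<in> {1..K} \<Longrightarrow> 0 < (\<Sum>i | i \<in> {1..I} \<and> p i = k. r i)"

text \<open>The value \<open>q k i\<close> stands for $q_k(a_i)$.\<close>

definition polling_equations ::
  "nat \<Rightarrow> nat \<Rightarrow> (nat \<Rightarrow> nat) \<Rightarrow> (nat \<Rightarrow> real) \<Rightarrow> (nat \<Rightarrow> real) \<Rightarrow> (nat \<Rightarrow> real) \<Rightarrow> (nat \<Rightarrow> real)
    \<Rightarrow> (nat \<Rightarrow> nat \<Rightarrow> real) \<Rightarrow> bool" where
  "polling_equations K I p lam mu s r q \<longleftrightarrow>
    (\<forall>k\<in>{1..K}. \<forall>i\<in>{1..I}.
      q k (if i = I then 1 else i + 1) =
        (if k = p i then s i * lam k + (1 - r i) * q k i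
         else s i * lam k + q k i
              + q (p i) i * r i * lam k * (1 / (mu (p i) * (1 - lam (p i) / mu (p i))))))"

definition poisson_process :: "'w measure \<Rightarrow> real \<Rightarrow> (real \<Rightarrow> 'w \<Rightarrow> nat) \<Rightarrow> bool" where
  "poisson_process M l N \<longleftrightarrow>
    (\<forall>t\<ge>0. N t \<in> measurable M (count_space UNIV)) \<and>
    (\<forall>\<omega>\<in>space M. N 0 \<omega> = 0 \<and> mono_on {0..} (\<lambda>t. N t \<omega>) \<and>
      (\<forall>t\<ge>0. continuous (at_right t) (\<lambda>u. real (N u \<omega>)))) \<and>
    (\<forall>u t. 0 \<le> u \<longrightarrow> u < t \<longrightarrow>
      distr M (count_space UNIV) (\<lambda>\<omega>. N t \<omega> - N u \<omega>) = measure_pmf (poisson_pmf (l * (t - u)))) \<and>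
    (\<forall>(\<tau> :: nat \<Rightarrow> real) m. 0 \<le> \<tau> 0 \<longrightarrow> mono \<tau> \<longrightarrow>
      prob_space.indep_vars M (\<lambda>_. count_space UNIV) (\<lambda>j \<omega>. N (\<tau> (Suc j)) \<omega> - N (\<tau> j) \<omega>) {..<m})"

text \<open>
  The primitive random elements of one system. Cycles are numbered from 0 and the polling epoch of
  stage 1 in cycle 0 is time 0. Here \<open>arrivals X k t\<close> counts the arrivals to queue \<open>k\<close> during
  \<open>(0, t]\<close>, \<open>service_time X k l\<close> is the duration of the service number \<open>l\<close> (from 0) given at queue
  \<open>k\<close>, and \<open>switchover_time X c i\<close> is the switchover time out of stage \<open>i\<close> in cycle \<open>c\<close>.
  The variable \<open>binomial_draw X c i N\<close> is the $Y_i(N, r_i)$ used by the visit at stage \<open>i\<close> in cycle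
  \<open>c\<close> when that visit starts with \<open>N\<close> customers in its queue.
\<close>

record 'w polling_primitives =
  sample_space :: "'w measure"
  initial_queue :: "nat \<Rightarrow> 'w \<Rightarrow> nat"
  arrivals :: "nat \<Rightarrow> real \<Rightarrow> 'w \<Rightarrow> nat"
  service_time :: "nat \<Rightarrow> nat \<Rightarrow> 'w \<Rightarrow> real"
  switchover_time :: "nat \<Rightarrow> nat \<Rightarrow> 'w \<Rightarrow> real"
  binomial_draw :: "nat \<Rightarrow> nat \<Rightarrow> nat \<Rightarrow> 'w \<Rightarrow> nat"

text \<open>
  The state of the system between two actions of the server is a pair \<open>(t, D)\<close> of the current time
  and the numbers \<open>D k\<close> of customers that have departed from each queue \<open>k\<close>.
\<close>

definition queue_length :: "'w polling_primitives \<Rightarrow> 'w \<Rightarrow> real \<times> (nat \<Rightarrow> nat) \<Rightarrow> nat \<Rightarrow> nat" where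
  "queue_length X \<omega> = (\<lambda>(t, D) k. initial_queue X k \<omega> + arrivals X k t \<omega> - D k)"

definition after_services ::
  "'w polling_primitives \<Rightarrow> 'w \<Rightarrow> nat \<Rightarrow> nat \<Rightarrow> real \<times> (nat \<Rightarrow> nat) \<Rightarrow> real \<times> (nat \<Rightarrow> nat)" where
  "after_services X \<omega> k j =
    (\<lambda>(t, D). (t + (\<Sum>l<j. service_time X k (D k + l) \<omega>), D(k := D k + j)))"

text \<open>
  The server works at queue \<open>k\<close> until the queue length first equals the initial length minus \<open>y\<close>.
  As a service reduces the queue by at most one, this level cannot be skipped, and the natural
  subtraction in the queue length does not truncate before the level is reached. If the level is
  never reached (a null event for a stable system), \<open>LEAST\<close> is a fixed but unspecified number.
\<close>

definition services_in_visit ::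
  "'w polling_primitives \<Rightarrow> 'w \<Rightarrow> nat \<Rightarrow> nat \<Rightarrow> real \<times> (nat \<Rightarrow> nat) \<Rightarrow> nat" where
  "services_in_visit X \<omega> k y \<sigma> =
    (LEAST j. queue_length X \<omega> (after_services X \<omega> k j \<sigma>) k = queue_length X \<omega> \<sigma> k - y)"

definition visit_and_switch ::
  "(nat \<Rightarrow> nat) \<Rightarrow> 'w polling_primitives \<Rightarrow> 'w \<Rightarrow> nat \<Rightarrow> nat
    \<Rightarrow> real \<times> (nat \<Rightarrow> nat) \<Rightarrow> real \<times> (nat \<Rightarrow> nat)" where
  "visit_and_switch p X \<omega> c i \<sigma> =
    (let k = p i;
         y = binomial_draw X c i (queue_length X \<omega> \<sigma> k) \<omega>;
         (t, D) = after_services X \<omega> k (services_in_visit X \<omega> k y \<sigma>) \<sigma>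
     in (t + switchover_time X c i \<omega>, D))"

text \<open>
  The polling epoch number \<open>m\<close> belongs to stage \<open>m mod I + 1\<close> of cycle \<open>m div I\<close>; the first component
  of the state is the epoch itself, that is, $A_i$ for this stage and cycle.
\<close>

primrec epoch_state ::
  "nat \<Rightarrow> (nat \<Rightarrow> nat) \<Rightarrow> 'w polling_primitives \<Rightarrow> 'w \<Rightarrow> nat \<Rightarrow> real \<times> (nat \<Rightarrow> nat)" where
  "epoch_state I p X \<omega> 0 = (0, \<lambda>_. 0)"
| "epoch_state I p X \<omega> (Suc m) =
    visit_and_switch p X \<omega> (m div I) (m mod I + 1) (epoch_state I p X \<omega> m)"

text \<open>
  \<open>queue_at_epoch I p X c i k\<close> is $Q_k(A_i)$ for the polling epoch $A_i$ in cycle \<open>c\<close>. It is read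
  off the state rather than from a process in continuous time: several polling epochs and services
  can coincide in time when switchover and service times vanish, and $Q_k(A_i)$ is what the server
  finds on arrival, before the first service of the visit.
\<close>

definition queue_at_epoch ::
  "nat \<Rightarrow> (nat \<Rightarrow> nat) \<Rightarrow> 'w polling_primitives \<Rightarrow> nat \<Rightarrow> nat \<Rightarrow> nat \<Rightarrow> 'w \<Rightarrow> nat" where
  "queue_at_epoch I p X c i k \<omega> = queue_length X \<omega> (epoch_state I p X \<omega> (c * I + (i - 1))) k"

datatype randomness_source =
  Initial | Arrivals nat | Service nat nat | Switchover nat nat | Draw nat nat nat

definition sources :: "nat \<Rightarrow> nat \<Rightarrow> randomness_source set" where
  "sources K I =
    {Initial} \<union> {Arrivals k | k. k \<in> {1..K}} \<union> {Service k l | k l. k \<in> {1..K}}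
    \<union> {Switchover c i | c i. i \<in> {1..I}} \<union> {Draw c i N | c i N. i \<in> {1..I}}"

primrec source_events ::
  "nat \<Rightarrow> 'w polling_primitives \<Rightarrow> randomness_source \<Rightarrow> 'w set set" where
  "source_events K X Initial =
    sets (vimage_algebra (space (sample_space X)) (\<lambda>\<omega>. \<lambda>k\<in>{1..K}. initial_queue X k \<omega>)
      (Pi\<^sub>M {1..K} (\<lambda>_. count_space UNIV)))"
| "source_events K X (Arrivals k) =
    sets (vimage_algebra (space (sample_space X)) (\<lambda>\<omega>. \<lambda>t\<in>{0..}. arrivals X k t \<omega>)
      (Pi\<^sub>M {0..} (\<lambda>_. count_space UNIV)))"
| "source_events K X (Service k l) =
    sets (vimage_algebra (space (sample_space X)) (service_time X k l) borel)"
| "source_events K X (Switchover c i) =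
    sets (vimage_algebra (space (sample_space X)) (switchover_time X c i) borel)"
| "source_events K X (Draw c i N) =
    sets (vimage_algebra (space (sample_space X)) (binomial_draw X c i N) (count_space UNIV))"

text \<open>\<open>VD i\<close> is the law of the switchover times out of stage \<open>i\<close>.\<close>

locale bep_system =
  fixes K I :: nat
    and p :: "nat \<Rightarrow> nat"
    and lam :: "nat \<Rightarrow> real"
    and SD :: "nat \<Rightarrow> real measure"
    and r :: "nat \<Rightarrow> real"
    and VD :: "nat \<Rightarrow> real measure"
    and X :: "'w polling_primitives"
  assumes prob_space_sample: "prob_space (sample_space X)"
    and initial_measurable:
      "\<And>k. k \<in> {1..K} \<Longrightarrow> initial_queue X k \<in> measurable (sample_space X) (count_space UNIV)"
    and poisson_arrivals:
      "\<And>k. k \<in> {1..K} \<Longrightarrow> poisson_process (sample_space X) (lam k) (arrivals X k)"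
    and service_measurable:
      "\<And>k l. k \<in> {1..K} \<Longrightarrow> service_time X k l \<in> borel_measurable (sample_space X)"
    and service_nonneg:
      "\<And>k l \<omega>. k \<in> {1..K} \<Longrightarrow> \<omega> \<in> space (sample_space X) \<Longrightarrow> 0 \<le> service_time X k l \<omega>"
    and service_distr:
      "\<And>k l. k \<in> {1..K} \<Longrightarrow> distr (sample_space X) borel (service_time X k l) = SD k"
    and switchover_measurable:
      "\<And>c i. i \<in> {1..I} \<Longrightarrow> switchover_time X c i \<in> borel_measurable (sample_space X)"
    and switchover_nonneg:
      "\<And>c i \<omega>. i \<in> {1..I} \<Longrightarrow> \<omega> \<in> space (sample_space X) \<Longrightarrow> 0 \<le> switchover_time X c i \<omega>"
    and switchover_distr:
      "\<And>c i. i \<in> {1..I} \<Longrightarrow> distr (sample_space X) borel (switchover_time X c i) = VD i"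
    and draw_measurable:
      "\<And>c i N. i \<in> {1..I} \<Longrightarrow>
        binomial_draw X c i N \<in> measurable (sample_space X) (count_space UNIV)"
    and draw_distr:
      "\<And>c i N. i \<in> {1..I} \<Longrightarrow>
        distr (sample_space X) (count_space UNIV) (binomial_draw X c i N)
          = measure_pmf (binomial_pmf N (r i))"
    and independence:
      "prob_space.indep_sets (sample_space X) (source_events K X) (sources K I)"

text \<open>
  The queue-length vectors at the polling epochs of stage 1 form a time-homogeneous Markov chain
  started in \<open>initial_queue X\<close>, so the system is in steady state when one step of the chain
  preserves the initial law.
\<close>

definition queue_law ::
  "nat \<Rightarrow> nat \<Rightarrow> (nat \<Rightarrow> nat) \<Rightarrow> 'w polling_primitives \<Rightarrow> nat \<Rightarrow> nat \<Rightarrow> (nat \<Rightarrow> nat) measure" where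
  "queue_law K I p X c i =
    distr (sample_space X) (Pi\<^sub>M {1..K} (\<lambda>_. count_space UNIV))
      (\<lambda>\<omega>. \<lambda>k\<in>{1..K}. queue_at_epoch I p X c i k \<omega>)"

locale stationary_bep_system = bep_system +
  assumes steady_state: "queue_law K I p X 1 1 = queue_law K I p X 0 1"

end

theory Submission
  imports Defs
begin

text \<open>
  By the strong Markov property of the Poisson streams, the queue lengths at successive polling
  epochs form a Markov chain whose kernel depends periodically on the stage: a visit is a random
  walk stopped when it hits a random level, and a switchover adds mixed Poisson arrivals. Since
  $\rho < 1$, there are positive stage-dependent weights for which the matrix of mean changes of every
  stage is a contraction of the weighted $\ell^1$-norm. Powers of the weighted total queue length
  therefore satisfy a geometric drift inequality, and truncation together with stationarity turns
  it into moment bounds of the order $n^\ell$. The contraction also shows that the recursion for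
  the means has only one periodic solution, which is $n q$. The squared weighted deviation from
  these means satisfies a drift inequality whose error is of the order $n$ plus the variance of the
  switchover times, so the scaled queue lengths converge to $q$ in $L^2$. Interpolation with the
  moment bounds extends the convergence to all powers.
\<close>

subsection \<open>Mixed Poisson vectors\<close>

text \<open>The systems are given pathwise, so their Markov property has to be proved. Two obstacles
  shape that proof. The polling epochs are real-valued random times; they are approximated from
  above by grid times. And which service variable is consulted next depends on the departures so
  far; the sample space is therefore cut into pieces on which the departure vector is fixed, so that
  the set of consulted sources is deterministic on each piece. Queue vectors lie in a countable set,
  hence conditional laws can be stated as identities between the probabilities of events that fix
  single values.

  No moment of the stationary law is known to be finite in advance. Expectations are therefore taken
  in the extended nonnegative reals, identities are arranged so that nothing has to be subtracted,
  and a drift inequality is combined with stationarity only after truncation. Powers satisfy a drift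
  inequality only far from the origin; shifting the weighted queue length by a large constant makes
  it hold everywhere. All constants are chosen before the switchover laws, so that they serve every
  \<open>n\<close>.\<close>

definition vecs :: "'a set \<Rightarrow> ('a \<Rightarrow> nat) set" where
  "vecs A = {f. \<forall>x. x \<notin> A \<longrightarrow> f x = 0}"

text \<open>The set is the support of a product of Poisson laws, and the support of a
  \<open>pmf\<close> is countable. Countability is what allows conditioning on queue and arrival
  vectors value by value.\<close>

lemma countable_vecs: "finite A \<Longrightarrow> countable (vecs A)"
proof -
  assume A: "finite A"
  have "set_pmf (Pi_pmf A 0 (\<lambda>_. poisson_pmf 1)) = vecs A"
    using A by (subst set_Pi_pmf) (auto simp: PiE_dflt_def vecs_def)
  then show ?thesis by (metis countable_set_pmf)
qed

text \<open>The point mass at 0 covers intervals of length 0, which occur because service and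
  switchover times may vanish. Its use for negative rates is a convention.\<close>

definition pois :: "real \<Rightarrow> nat pmf" where
  "pois l = (if 0 < l then poisson_pmf l else return_pmf 0)"

lemma pmf_pois: "0 \<le> l \<Longrightarrow> pmf (pois l) n = l ^ n / fact n * exp (- l)"
  by (cases "l = 0") (auto simp: pois_def indicator_def)

lemma measurable_pmf_pois [measurable]: "(\<lambda>l. pmf (pois l) n) \<in> borel_measurable borel"
proof -
  have "(\<lambda>l. pmf (pois l) n) =
      (\<lambda>l. if 0 < l then l ^ n / fact n * exp (- l) else indicator {0} n)"
    by (auto simp: pois_def fun_eq_iff indicator_def)
  then show ?thesis by simp
qed

text \<open>Shifting the summation index works because (n + 1) P(n + 1) = l P(n). This is the
  Stein-Chen identity, from which all Poisson moments below are derived.\<close>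

lemma pois_factor:
  assumes "0 \<le> l"
  shows "(\<integral>\<^sup>+n. of_nat n * f n \<partial>pois l) = ennreal l * (\<integral>\<^sup>+n. f (Suc n) \<partial>pois l)"
proof -
  have "(\<integral>\<^sup>+n. of_nat n * f n \<partial>pois l) = (\<Sum>n. ennreal (pmf (pois l) n) * (of_nat n * f n))"
    by (simp add: nn_integral_measure_pmf nn_integral_count_space_nat)
  also have "\<dots> = (\<Sum>n. ennreal (pmf (pois l) (n + 1)) * (of_nat (n + 1) * f (n + 1)))
      + (\<Sum>n<1. ennreal (pmf (pois l) n) * (of_nat n * f n))"
    by (rule suminf_offset) auto
  also have "\<dots> = (\<Sum>n. ennreal (pmf (pois l) (n + 1)) * (of_nat (n + 1) * f (n + 1)))"
    by simp
  also have "\<dots> = (\<Sum>n. ennreal l * (ennreal (pmf (pois l) n) * f (Suc n)))"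
  proof (intro suminf_cong)
    fix n
    have "pmf (pois l) (n + 1) * real (n + 1) = l * pmf (pois l) n"
      using assms by (simp add: pmf_pois)
    then have "ennreal (pmf (pois l) (n + 1)) * of_nat (n + 1) = ennreal l * ennreal (pmf (pois l) n)"
      by (metis assms ennreal_mult ennreal_of_nat_eq_real_of_nat of_nat_0_le_iff pmf_nonneg)
    then show "ennreal (pmf (pois l) (n + 1)) * (of_nat (n + 1) * f (n + 1))
        = ennreal l * (ennreal (pmf (pois l) n) * f (Suc n))"
      by (metis mult.assoc Suc_eq_plus1)
  qed
  also have "\<dots> = ennreal l * (\<integral>\<^sup>+n. f (Suc n) \<partial>pois l)"
    by (simp add: nn_integral_measure_pmf nn_integral_count_space_nat)
  finally show ?thesis .
qed

lemma pois_mean: "0 \<le> l \<Longrightarrow> (\<integral>\<^sup>+n. of_nat n \<partial>pois l) = ennreal l"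
  using pois_factor[of l "\<lambda>_. 1"] by simp

lemma pois_square: "0 \<le> l \<Longrightarrow> (\<integral>\<^sup>+n. of_nat n ^ 2 \<partial>pois l) = ennreal (l ^ 2 + l)"
proof -
  assume l: "0 \<le> l"
  have "(\<integral>\<^sup>+n. of_nat n ^ 2 \<partial>pois l) = (\<integral>\<^sup>+n. of_nat n * of_nat n \<partial>pois l)"
    by (simp add: power2_eq_square)
  also have "\<dots> = ennreal l * (\<integral>\<^sup>+n. of_nat n + 1 \<partial>pois l)"
    using pois_factor[OF l, of of_nat] by (simp add: add.commute)
  also have "\<dots> = ennreal l * (ennreal l + 1)"
    using l by (subst nn_integral_add) (auto simp: pois_mean)
  also have "\<dots> = ennreal (l ^ 2 + l)"
    using l by (simp add: power2_eq_square distrib_left flip: ennreal_plus ennreal_1 ennreal_mult')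
  finally show ?thesis .
qed

lemma power_add_le:
  fixes a b :: real
  assumes "0 \<le> a" "0 \<le> b"
  shows "(a + b) ^ l \<le> 2 ^ l * (a ^ l + b ^ l)"
proof -
  have "(a + b) ^ l \<le> (2 * max a b) ^ l"
    using assms by (intro power_mono) auto
  also have "\<dots> \<le> 2 ^ l * (a ^ l + b ^ l)"
    using assms by (auto simp: power_mult_distrib max_def)
  finally show ?thesis .
qed

text \<open>Induction on the degree through \<open>pois_factor\<close>. One constant serves all
  rates \<open>s\<close>, so the bound can be integrated over a random duration.\<close>

lemma pois_moment:
  "\<exists>C\<ge>0. \<forall>s\<ge>0. (\<integral>\<^sup>+n. ennreal (real n ^ l) \<partial>pois s) \<le> ennreal (C * (1 + s ^ l))"
proof (induction l)
  case 0
  then show ?case by (intro exI[of _ 1]) (auto simp: emeasure_pmf one_add_one)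
next
  case (Suc l)
  then obtain C where C: "C \<ge> 0"
    "\<And>s. s \<ge> 0 \<Longrightarrow> (\<integral>\<^sup>+n. ennreal (real n ^ l) \<partial>pois s) \<le> ennreal (C * (1 + s ^ l))" by blast
  show ?case
  proof (intro exI[of _ "2 ^ l * (2 * C + 1)"] conjI allI impI)
    show "0 \<le> 2 ^ l * (2 * C + 1)" using C(1) by simp
    fix s :: real assume s: "0 \<le> s"
    have "(\<integral>\<^sup>+n. ennreal (real n ^ Suc l) \<partial>pois s)
        = (\<integral>\<^sup>+n. of_nat n * ennreal (real n ^ l) \<partial>pois s)"
      by (simp add: ennreal_mult' ennreal_of_nat_eq_real_of_nat)
    also have "\<dots> = ennreal s * (\<integral>\<^sup>+n. ennreal (real (Suc n) ^ l) \<partial>pois s)"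
      by (rule pois_factor[OF s])
    also have "(\<integral>\<^sup>+n. ennreal (real (Suc n) ^ l) \<partial>pois s)
        \<le> (\<integral>\<^sup>+n. ennreal (2 ^ l) * (ennreal (real n ^ l) + 1) \<partial>pois s)"
    proof (intro nn_integral_mono)
      fix n :: nat
      have "real (Suc n) ^ l \<le> 2 ^ l * (real n ^ l + 1)"
        using power_add_le[of "real n" 1 l] by (simp add: add.commute)
      then show "ennreal (real (Suc n) ^ l) \<le> ennreal (2 ^ l) * (ennreal (real n ^ l) + 1)"
        by (simp flip: ennreal_plus ennreal_mult ennreal_1 add: ennreal_leI)
    qed
    also have "\<dots> = ennreal (2 ^ l) * ((\<integral>\<^sup>+n. ennreal (real n ^ l) \<partial>pois s) + 1)"
      by (simp add: nn_integral_cmult nn_integral_add emeasure_pmf)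
    also have "\<dots> \<le> ennreal (2 ^ l) * (ennreal (C * (1 + s ^ l)) + 1)"
      using C(2)[OF s] by (intro mult_left_mono add_mono) auto
    also have "\<dots> = ennreal (2 ^ l * (C * (1 + s ^ l) + 1))"
      using C(1) s by (simp flip: ennreal_plus ennreal_mult ennreal_1)
    also have "ennreal s * \<dots> = ennreal (s * (2 ^ l * (C * (1 + s ^ l) + 1)))"
      using s C(1) by (simp add: ennreal_mult')
    also have "\<dots> \<le> ennreal (2 ^ l * (2 * C + 1) * (1 + s ^ Suc l))"
    proof (intro ennreal_leI)
      have a: "s \<le> 1 + s ^ Suc l"
        using s self_le_power[of s "Suc l"] zero_le_power[of s "Suc l"] by linarith
      have "s * (2 ^ l * (C * (1 + s ^ l) + 1)) = 2 ^ l * ((C + 1) * s + C * s ^ Suc l)"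
        by (simp add: algebra_simps)
      also have "\<dots> \<le> 2 ^ l * ((C + 1) * (1 + s ^ Suc l) + C * (1 + s ^ Suc l))"
        using a C(1) s by (intro mult_left_mono add_mono) auto
      also have "\<dots> = 2 ^ l * (2 * C + 1) * (1 + s ^ Suc l)" by (simp add: algebra_simps)
      finally show "s * (2 ^ l * (C * (1 + s ^ l) + 1)) \<le> 2 ^ l * (2 * C + 1) * (1 + s ^ Suc l)" .
    qed
    finally show "(\<integral>\<^sup>+n. ennreal (real n ^ Suc l) \<partial>pois s) \<le> \<dots>"
      by (simp add: mult_left_mono)
  qed
qed

definition vec_pois :: "'a set \<Rightarrow> ('a \<Rightarrow> real) \<Rightarrow> real \<Rightarrow> ('a \<Rightarrow> nat) pmf" where
  "vec_pois A lam s = Pi_pmf A 0 (\<lambda>k. pois (lam k * s))"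

lemma pmf_vec_pois:
  "finite A \<Longrightarrow> pmf (vec_pois A lam s) a =
    (if a \<in> vecs A then \<Prod>k\<in>A. pmf (pois (lam k * s)) (a k) else 0)"
  unfolding vec_pois_def vecs_def by (subst pmf_Pi) auto

lemma measurable_pmf_vec_pois:
  "finite A \<Longrightarrow> (\<lambda>s. pmf (vec_pois A lam s) a) \<in> borel_measurable borel"
  by (simp add: pmf_vec_pois)

text \<open>A mixed Poisson law: the arrivals at all queues during a duration of law
  \<open>\<nu>\<close> that is independent of the streams. The coordinates are dependent through the
  common duration.\<close>

definition arrival_law :: "'a set \<Rightarrow> ('a \<Rightarrow> real) \<Rightarrow> real measure \<Rightarrow> ('a \<Rightarrow> nat) pmf" where
  "arrival_law A lam \<nu> = embed_pmf (\<lambda>a. \<integral>s. pmf (vec_pois A lam s) a \<partial>\<nu>)"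

context
  fixes A :: "'a set" and lam :: "'a \<Rightarrow> real" and \<nu> :: "real measure"
  assumes A: "finite A" and \<nu>: "prob_space \<nu>" "sets \<nu> = sets borel"
begin

interpretation \<nu>: prob_space \<nu> by fact

declare \<nu>(2) [measurable_cong]

lemma measurable_pmf_vec_pois' [measurable]:
  "(\<lambda>s. pmf (vec_pois A lam s) a) \<in> borel_measurable \<nu>"
  using measurable_pmf_vec_pois[OF A] measurable_cong_sets[OF \<nu>(2) refl] by blast

lemma arrival_weight:
  "ennreal (\<integral>s. pmf (vec_pois A lam s) a \<partial>\<nu>) = (\<integral>\<^sup>+s. pmf (vec_pois A lam s) a \<partial>\<nu>)"
  by (rule nn_integral_eq_integral[symmetric])
     (auto intro!: \<nu>.integrable_const_bound[where B=1] simp: pmf_le_1)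

lemma mixture_swap:
  "(\<integral>\<^sup>+a. (\<integral>\<^sup>+s. pmf (vec_pois A lam s) a \<partial>\<nu>) * F a \<partial>count_space UNIV)
    = (\<integral>\<^sup>+s. \<integral>\<^sup>+a. F a \<partial>vec_pois A lam s \<partial>\<nu>)"
proof -
  \<comment> \<open>Counting measure on all functions need not be \<sigma>-finite, so Fubini is
    applied on the countable set \<open>vecs A\<close>, outside of which the integrand
    vanishes.\<close>
  interpret V: sigma_finite_measure "count_space (vecs A)"
    by (intro sigma_finite_measure_count_space_countable countable_vecs A)
  interpret P: pair_sigma_finite "count_space (vecs A)" \<nu> ..
  have z: "pmf (vec_pois A lam s) a = 0" if "a \<notin> vecs A" for a s
    using A that by (simp add: pmf_vec_pois)
  have m: "(\<lambda>(a, s). ennreal (pmf (vec_pois A lam s) a) * F a)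
      \<in> borel_measurable (count_space (vecs A) \<Otimes>\<^sub>M \<nu>)"
    by (intro measurable_pair_measure_countable1 countable_vecs A) simp
  have "(\<integral>\<^sup>+a. (\<integral>\<^sup>+s. pmf (vec_pois A lam s) a \<partial>\<nu>) * F a \<partial>count_space UNIV)
      = (\<integral>\<^sup>+a. (\<integral>\<^sup>+s. pmf (vec_pois A lam s) a * F a \<partial>\<nu>) \<partial>count_space UNIV)"
    by (simp add: nn_integral_multc)
  also have "\<dots> = (\<integral>\<^sup>+a. (\<integral>\<^sup>+s. pmf (vec_pois A lam s) a * F a \<partial>\<nu>) \<partial>count_space (vecs A))"
    by (rule nn_integral_count_space_eq[symmetric]) (auto simp: z)
  also have "\<dots> = (\<integral>\<^sup>+s. (\<integral>\<^sup>+a. pmf (vec_pois A lam s) a * F a \<partial>count_space (vecs A)) \<partial>\<nu>)"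
    using P.Fubini'[OF m] by simp
  also have "\<dots> = (\<integral>\<^sup>+s. (\<integral>\<^sup>+a. pmf (vec_pois A lam s) a * F a \<partial>count_space UNIV) \<partial>\<nu>)"
    by (intro nn_integral_cong nn_integral_count_space_eq) (auto simp: z)
  also have "\<dots> = (\<integral>\<^sup>+s. \<integral>\<^sup>+a. F a \<partial>vec_pois A lam s \<partial>\<nu>)"
    by (simp add: nn_integral_measure_pmf)
  finally show ?thesis .
qed

lemma pmf_arrival_law: "pmf (arrival_law A lam \<nu>) a = (\<integral>s. pmf (vec_pois A lam s) a \<partial>\<nu>)"
  unfolding arrival_law_def
proof (rule pmf_embed_pmf)
  show "0 \<le> (\<integral>s. pmf (vec_pois A lam s) a \<partial>\<nu>)" for a by simp
  show "(\<integral>\<^sup>+a. ennreal (\<integral>s. pmf (vec_pois A lam s) a \<partial>\<nu>) \<partial>count_space UNIV) = 1"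
    using mixture_swap[of "\<lambda>_. 1"] by (simp add: arrival_weight emeasure_pmf \<nu>.emeasure_space_1)
qed

lemma nn_integral_arrival_law:
  "(\<integral>\<^sup>+a. F a \<partial>arrival_law A lam \<nu>) = (\<integral>\<^sup>+s. \<integral>\<^sup>+a. F a \<partial>vec_pois A lam s \<partial>\<nu>)"
proof -
  have "(\<integral>\<^sup>+a. F a \<partial>arrival_law A lam \<nu>)
      = (\<integral>\<^sup>+a. ennreal (pmf (arrival_law A lam \<nu>) a) * F a \<partial>count_space UNIV)"
    by (rule nn_integral_measure_pmf)
  then show ?thesis unfolding pmf_arrival_law arrival_weight mixture_swap .
qed

lemma nn_integral_arrival_law_component:
  assumes "k \<in> A"
  shows "(\<integral>\<^sup>+a. f (a k) \<partial>arrival_law A lam \<nu>) = (\<integral>\<^sup>+s. \<integral>\<^sup>+n. f n \<partial>pois (lam k * s) \<partial>\<nu>)"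
proof -
  have "(\<integral>\<^sup>+a. f (a k) \<partial>vec_pois A lam s) = (\<integral>\<^sup>+n. f n \<partial>pois (lam k * s))" for s
    using Pi_pmf_component[OF A, of k 0 "\<lambda>k. pois (lam k * s)"] assms
    unfolding vec_pois_def by (metis (no_types, lifting) nn_integral_cong nn_integral_map_pmf)
  then show ?thesis by (simp add: nn_integral_arrival_law)
qed

lemma arrival_law_mean:
  assumes "k \<in> A" "0 \<le> lam k" "AE s in \<nu>. 0 \<le> s"
  shows "(\<integral>\<^sup>+a. of_nat (a k) \<partial>arrival_law A lam \<nu>) = ennreal (lam k) * (\<integral>\<^sup>+s. ennreal s \<partial>\<nu>)"
proof -
  have "(\<integral>\<^sup>+a. of_nat (a k) \<partial>arrival_law A lam \<nu>) = (\<integral>\<^sup>+s. \<integral>\<^sup>+n. of_nat n \<partial>pois (lam k * s) \<partial>\<nu>)"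
    by (rule nn_integral_arrival_law_component) fact
  also have "\<dots> = (\<integral>\<^sup>+s. ennreal (lam k) * ennreal s \<partial>\<nu>)"
    using assms(2,3) by (intro nn_integral_cong_AE) (auto simp: pois_mean ennreal_mult')
  also have "\<dots> = ennreal (lam k) * (\<integral>\<^sup>+s. ennreal s \<partial>\<nu>)"
    by (intro nn_integral_cmult) measurable
  finally show ?thesis .
qed

lemma arrival_law_square:
  assumes "k \<in> A" "0 \<le> lam k" "AE s in \<nu>. 0 \<le> s"
  shows "(\<integral>\<^sup>+a. of_nat (a k) ^ 2 \<partial>arrival_law A lam \<nu>)
    = ennreal ((lam k) ^ 2) * (\<integral>\<^sup>+s. ennreal (s ^ 2) \<partial>\<nu>) + ennreal (lam k) * (\<integral>\<^sup>+s. ennreal s \<partial>\<nu>)"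
proof -
  have "(\<integral>\<^sup>+a. of_nat (a k) ^ 2 \<partial>arrival_law A lam \<nu>) = (\<integral>\<^sup>+s. \<integral>\<^sup>+n. of_nat n ^ 2 \<partial>pois (lam k * s) \<partial>\<nu>)"
    by (rule nn_integral_arrival_law_component) fact
  also have "\<dots> = (\<integral>\<^sup>+s. ennreal ((lam k) ^ 2) * ennreal (s ^ 2) + ennreal (lam k) * ennreal s \<partial>\<nu>)"
    using assms(2,3) by (intro nn_integral_cong_AE)
      (auto simp: pois_square ennreal_mult' power_mult_distrib)
  also have "\<dots> = ennreal ((lam k) ^ 2) * (\<integral>\<^sup>+s. ennreal (s ^ 2) \<partial>\<nu>) + ennreal (lam k) * (\<integral>\<^sup>+s. ennreal s \<partial>\<nu>)"
    by (simp add: nn_integral_add nn_integral_cmult)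
  finally show ?thesis .
qed

end

subsection \<open>Serving one queue down to a level\<close>

text \<open>One service at queue \<open>k\<close> with arrivals \<open>a\<close> in the meantime.
  The walk takes a step only from \<open>z k > \<tau>\<close>, so \<open>z k\<close> is positive and
  the natural subtraction does not truncate.\<close>

definition serve :: "'a \<Rightarrow> ('a \<Rightarrow> nat) \<Rightarrow> ('a \<Rightarrow> nat) \<Rightarrow> 'a \<Rightarrow> nat" where
  "serve k z a = (\<lambda>j. if j = k then z k + a k - 1 else z j + a j)"

primrec walk ::
  "('a \<Rightarrow> nat) pmf \<Rightarrow> 'a \<Rightarrow> nat \<Rightarrow> nat \<Rightarrow> ('a \<Rightarrow> nat) \<Rightarrow> ('a \<Rightarrow> nat) pmf" where
  "walk \<pi> k \<tau> 0 z = return_pmf z"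
| "walk \<pi> k \<tau> (Suc n) z =
    (if z k \<le> \<tau> then return_pmf z else bind_pmf \<pi> (\<lambda>a. walk \<pi> k \<tau> n (serve k z a)))"

lemma walk_stopped: "z k \<le> \<tau> \<Longrightarrow> walk \<pi> k \<tau> n z = return_pmf z"
  by (cases n) auto

lemma walk_add: "walk \<pi> k \<tau> (m + n) z = bind_pmf (walk \<pi> k \<tau> m z) (walk \<pi> k \<tau> n)"
proof (induction m arbitrary: z)
  case (Suc m)
  then show ?case
    by (cases "z k \<le> \<tau>") (auto simp: bind_assoc_pmf bind_return_pmf walk_stopped)
qed (simp add: bind_return_pmf)

text \<open>The defining recursion splits off the first step, whereas the sample path of a visit is
  extended at its end. This form is the one that matches sample paths.\<close>

lemma walk_Suc:
  "walk \<pi> k \<tau> (Suc n) z = bind_pmf (walk \<pi> k \<tau> n z)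
    (\<lambda>z. if z k \<le> \<tau> then return_pmf z else map_pmf (serve k z) \<pi>)"
proof -
  have "walk \<pi> k \<tau> (Suc n) z = bind_pmf (walk \<pi> k \<tau> n z) (walk \<pi> k \<tau> (Suc 0))"
    using walk_add[of \<pi> k \<tau> n 1 z] by simp
  also have "walk \<pi> k \<tau> (Suc 0) = (\<lambda>z. if z k \<le> \<tau> then return_pmf z else map_pmf (serve k z) \<pi>)"
    by (auto simp: map_pmf_def fun_eq_iff)
  finally show ?thesis .
qed

lemma walk_supermartingale:
  fixes \<pi> :: "('a \<Rightarrow> nat) pmf" and F :: "('a \<Rightarrow> nat) \<Rightarrow> ennreal"
  assumes "\<And>z. \<tau> < z k \<Longrightarrow> (\<integral>\<^sup>+a. F (serve k z a) \<partial>\<pi>) \<le> F z"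
  shows "(\<integral>\<^sup>+z'. F z' \<partial>walk \<pi> k \<tau> n z) \<le> F z"
proof (induction n arbitrary: z)
  case (Suc n)
  show ?case
  proof (cases "z k \<le> \<tau>")
    case False
    have "(\<integral>\<^sup>+z'. F z' \<partial>walk \<pi> k \<tau> (Suc n) z) \<le> (\<integral>\<^sup>+a. F (serve k z a) \<partial>\<pi>)"
      using False Suc by (simp add: nn_integral_mono)
    also have "\<dots> \<le> F z" using assms False by simp
    finally show ?thesis .
  qed simp
qed simp

lemma walk_martingale:
  fixes \<pi> :: "('a \<Rightarrow> nat) pmf" and F :: "('a \<Rightarrow> nat) \<Rightarrow> ennreal"
  assumes "\<And>z. \<tau> < z k \<Longrightarrow> (\<integral>\<^sup>+a. F (serve k z a) \<partial>\<pi>) = F z"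
  shows "(\<integral>\<^sup>+z'. F z' \<partial>walk \<pi> k \<tau> n z) = F z"
  using assms by (induction n arbitrary: z) auto

text \<open>Counting only paths that are already absorbed makes the quantity increase with
  \<open>n\<close>, so the law at the hitting time arises as a monotone limit.\<close>

definition stopped_integral ::
  "('a \<Rightarrow> nat) pmf \<Rightarrow> 'a \<Rightarrow> nat \<Rightarrow> nat \<Rightarrow> ('a \<Rightarrow> nat) \<Rightarrow> (('a \<Rightarrow> nat) \<Rightarrow> ennreal) \<Rightarrow> ennreal" where
  "stopped_integral \<pi> k \<tau> n z F = (\<integral>\<^sup>+z'. F z' * indicator {z'. z' k \<le> \<tau>} z' \<partial>walk \<pi> k \<tau> n z)"

lemma stopped_integral_Suc_le:
  "stopped_integral \<pi> k \<tau> n z F \<le> stopped_integral \<pi> k \<tau> (Suc n) z F"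
proof (induction n arbitrary: z)
  case 0
  then show ?case by (auto simp: stopped_integral_def)
next
  case (Suc n)
  then show ?case
    by (cases "z k \<le> \<tau>") (auto simp: stopped_integral_def intro!: nn_integral_mono)
qed

lemma mono_stopped_integral: "mono (\<lambda>n. stopped_integral \<pi> k \<tau> n z F)"
  by (rule incseq_SucI) (rule stopped_integral_Suc_le)

lemma stopped_integral_pmf:
  "z' k \<le> \<tau> \<Longrightarrow> ennreal (pmf (walk \<pi> k \<tau> n z) z') = stopped_integral \<pi> k \<tau> n z (indicator {z'})"
proof -
  assume "z' k \<le> \<tau>"
  then have "stopped_integral \<pi> k \<tau> n z (indicator {z'}) = (\<integral>\<^sup>+y. indicator {z'} y \<partial>walk \<pi> k \<tau> n z)"
    unfolding stopped_integral_def by (intro nn_integral_cong) (auto simp: indicator_def)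
  then show ?thesis by (simp add: emeasure_pmf_single)
qed

text \<open>The law of the state when the level is first reached: absorbed mass is never lost again,
  so the supremum is a limit. That the masses add up to 1 depends on the negative drift and is part
  of \<open>pmf_visit_law\<close>.\<close>

definition visit_law ::
  "('a \<Rightarrow> nat) pmf \<Rightarrow> 'a \<Rightarrow> nat \<Rightarrow> ('a \<Rightarrow> nat) \<Rightarrow> ('a \<Rightarrow> nat) pmf" where
  "visit_law \<pi> k \<tau> z =
    embed_pmf (\<lambda>z'. SUP n. if z' k \<le> \<tau> then pmf (walk \<pi> k \<tau> n z) z' else 0)"

locale stopped_walk =
  fixes \<pi> :: "('a \<Rightarrow> nat) pmf" and k :: 'a and \<rho> :: real
  assumes mean: "(\<integral>\<^sup>+a. of_nat (a k) \<partial>\<pi>) = ennreal \<rho>"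
    and load: "0 \<le> \<rho>" "\<rho> < 1"
begin

definition active :: "nat \<Rightarrow> nat \<Rightarrow> ('a \<Rightarrow> nat) \<Rightarrow> real" where
  "active \<tau> n z = measure (walk \<pi> k \<tau> n z) {z'. \<tau> < z' k}"

lemma excess_serve:
  assumes "\<tau> < z k"
  shows "(of_nat (serve k z a k - \<tau>) :: ennreal) = of_nat (z k - \<tau> - 1) + of_nat (a k)"
proof -
  have "serve k z a k - \<tau> = (z k - \<tau> - 1) + a k"
    using assms by (simp add: serve_def)
  then show ?thesis by simp
qed

text \<open>A service removes one customer and brings \<rho> new ones in the mean. The loss is added
  on the left because subtraction of extended reals would truncate.\<close>

lemma excess_step:
  assumes "\<tau> < z k"
  shows "(\<integral>\<^sup>+a. of_nat (serve k z a k - \<tau>) \<partial>\<pi>) + ennreal (1 - \<rho>) = of_nat (z k - \<tau>)"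
proof -
  have "(\<integral>\<^sup>+a. of_nat (serve k z a k - \<tau>) \<partial>\<pi>) = of_nat (z k - \<tau> - 1) + ennreal \<rho>"
    using assms by (simp add: excess_serve nn_integral_add mean emeasure_pmf)
  then have "(\<integral>\<^sup>+a. of_nat (serve k z a k - \<tau>) \<partial>\<pi>) + ennreal (1 - \<rho>)
      = of_nat (z k - \<tau> - 1) + (ennreal \<rho> + ennreal (1 - \<rho>))"
    by (simp add: add.assoc)
  also have "\<dots> = of_nat (z k - \<tau> - 1) + 1"
    using load by (simp flip: ennreal_plus)
  also have "\<dots> = of_nat (z k - \<tau> - 1 + 1)" by simp
  also have "z k - \<tau> - 1 + 1 = z k - \<tau>" using assms by simp
  finally show ?thesis .
qed

lemma active_Suc:
  "\<tau> < z k \<Longrightarrow> ennreal (active \<tau> (Suc n) z) = (\<integral>\<^sup>+a. ennreal (active \<tau> n (serve k z a)) \<partial>\<pi>)"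
  unfolding active_def by (simp add: measure_pmf.emeasure_eq_measure[symmetric])

lemma active_stopped: "z k \<le> \<tau> \<Longrightarrow> active \<tau> n z = 0"
  by (simp add: active_def walk_stopped measure_return)

lemma active_le_1: "active \<tau> n z \<le> 1" and active_nonneg: "0 \<le> active \<tau> n z"
  by (simp_all add: active_def)

lemma active_convex_le_1: "(1 - \<rho>) * active \<tau> n z + \<rho> \<le> 1"
proof -
  have "0 \<le> (1 - \<rho>) * (1 - active \<tau> n z)"
    using load active_le_1 by (intro mult_nonneg_nonneg) auto
  then show ?thesis by (simp add: algebra_simps)
qed

text \<open>Each step taken while the walk is active costs 1 - \<rho> of mean excess, and a walk
  active at time \<open>n\<close> was active all the time before. The initial excess has to pay for
  all these steps.\<close>

lemma active_bound: "ennreal ((1 - \<rho>) * real n * active \<tau> n z) \<le> of_nat (z k - \<tau>)"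
proof (induction n arbitrary: z)
  case (Suc n)
  show ?case
  proof (cases "z k \<le> \<tau>")
    case False
    then have z: "\<tau> < z k" by simp
    have "ennreal ((1 - \<rho>) * real (Suc n) * active \<tau> (Suc n) z)
        = ennreal ((1 - \<rho>) * real n) * ennreal (active \<tau> (Suc n) z) + ennreal ((1 - \<rho>) * active \<tau> (Suc n) z)"
      using load active_nonneg[of \<tau> "Suc n" z]
      by (subst ennreal_mult[symmetric], simp, simp, subst ennreal_plus[symmetric])
        (auto intro!: mult_nonneg_nonneg arg_cong[where f = ennreal] simp del: ennreal_plus, simp add: algebra_simps)
    also have "\<dots> \<le> (\<integral>\<^sup>+a. of_nat (serve k z a k - \<tau>) \<partial>\<pi>) + ennreal (1 - \<rho>)"
    proof (intro add_mono)
      have "ennreal ((1 - \<rho>) * real n) * ennreal (active \<tau> (Suc n) z)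
          = (\<integral>\<^sup>+a. ennreal ((1 - \<rho>) * real n * active \<tau> n (serve k z a)) \<partial>\<pi>)"
        using load z by (simp add: active_Suc nn_integral_cmult[symmetric] ennreal_mult' active_nonneg)
      also have "\<dots> \<le> (\<integral>\<^sup>+a. of_nat (serve k z a k - \<tau>) \<partial>\<pi>)"
        by (intro nn_integral_mono Suc)
      finally show "ennreal ((1 - \<rho>) * real n) * ennreal (active \<tau> (Suc n) z) \<le> \<dots>" .
      show "ennreal ((1 - \<rho>) * active \<tau> (Suc n) z) \<le> ennreal (1 - \<rho>)"
        using load active_le_1 by (intro ennreal_leI) (simp add: mult_left_le)
    qed
    also have "\<dots> = of_nat (z k - \<tau>)" by (rule excess_step[of \<tau> z, OF z])
    finally show ?thesis .
  qed (simp add: active_stopped)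
qed simp

lemma active_tendsto_0: "(\<lambda>n. active \<tau> n z) \<longlonglongrightarrow> 0"
proof (rule real_tendsto_sandwich[of "\<lambda>_. 0" _ _ "\<lambda>n. real (z k - \<tau>) / (1 - \<rho>) * inverse (real n)"])
  show "\<forall>\<^sub>F n in sequentially. active \<tau> n z \<le> real (z k - \<tau>) / (1 - \<rho>) * inverse (real n)"
  proof (intro eventually_sequentiallyI[of 1])
    fix n :: nat assume n: "1 \<le> n"
    have "(1 - \<rho>) * real n * active \<tau> n z \<le> real (z k - \<tau>)"
      using active_bound[of n \<tau> z]
      by (simp add: ennreal_of_nat_eq_real_of_nat)
    then show "active \<tau> n z \<le> real (z k - \<tau>) / (1 - \<rho>) * inverse (real n)"
      using n load by (simp add: field_simps)
  qed
  show "(\<lambda>n. real (z k - \<tau>) / (1 - \<rho>) * inverse (real n)) \<longlonglongrightarrow> 0"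
    by (rule tendsto_mult_right_zero[OF lim_inverse_n])
qed (simp_all add: active_nonneg)

lemma stopped_integral_1: "stopped_integral \<pi> k \<tau> n z (\<lambda>_. 1) = ennreal (1 - active \<tau> n z)"
proof -
  have "stopped_integral \<pi> k \<tau> n z (\<lambda>_. 1) = emeasure (walk \<pi> k \<tau> n z) {z'. z' k \<le> \<tau>}"
    unfolding stopped_integral_def by simp
  also have "{z'. z' k \<le> \<tau>} = space (walk \<pi> k \<tau> n z) - {z'. \<tau> < z' k}" by auto
  also have "emeasure (walk \<pi> k \<tau> n z) \<dots> = ennreal (1 - active \<tau> n z)"
    unfolding measure_pmf.emeasure_eq_measure active_def
    by (subst measure_pmf.prob_compl) auto
  finally show ?thesis .
qed

lemma nn_integral_visit_aux:
  "ennreal (SUP n. if z' k \<le> \<tau> then pmf (walk \<pi> k \<tau> n z) z' else 0)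
    = (SUP n. stopped_integral \<pi> k \<tau> n z (indicator {z'}))"
proof -
  have eq: "ennreal (if z' k \<le> \<tau> then pmf (walk \<pi> k \<tau> n z) z' else 0)
      = stopped_integral \<pi> k \<tau> n z (indicator {z'})" for n
  proof (cases "z' k \<le> \<tau>")
    case False
    then have "stopped_integral \<pi> k \<tau> n z (indicator {z'}) = (\<integral>\<^sup>+y. 0 \<partial>walk \<pi> k \<tau> n z)"
      unfolding stopped_integral_def by (intro nn_integral_cong) (auto simp: indicator_def)
    then show ?thesis using False by simp
  qed (simp add: stopped_integral_pmf)
  have "(SUP n. ennreal (if z' k \<le> \<tau> then pmf (walk \<pi> k \<tau> n z) z' else 0)) \<le> 1"
    by (intro SUP_least) (simp add: pmf_le_1)
  then have "(SUP n. ennreal (if z' k \<le> \<tau> then pmf (walk \<pi> k \<tau> n z) z' else 0)) \<noteq> \<top>"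
    by (metis ennreal_one_less_top not_le)
  then show ?thesis unfolding eq[symmetric] by (intro ennreal_SUP) auto
qed

lemma visit_sum:
  "(\<integral>\<^sup>+z'. (SUP n. stopped_integral \<pi> k \<tau> n z (indicator {z'})) * F z' \<partial>count_space UNIV)
    = (SUP n. stopped_integral \<pi> k \<tau> n z F)"
proof -
  have "(\<integral>\<^sup>+z'. (SUP n. stopped_integral \<pi> k \<tau> n z (indicator {z'})) * F z' \<partial>count_space UNIV)
      = (\<integral>\<^sup>+z'. (SUP n. stopped_integral \<pi> k \<tau> n z (indicator {z'}) * F z') \<partial>count_space UNIV)"
    by (simp add: SUP_mult_right_ennreal)
  also have "\<dots> = (SUP n. \<integral>\<^sup>+z'. stopped_integral \<pi> k \<tau> n z (indicator {z'}) * F z' \<partial>count_space UNIV)"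
    using mono_stopped_integral[of \<pi> k \<tau> z]
    by (intro nn_integral_monotone_convergence_SUP) (auto simp: mono_def le_fun_def intro!: mult_right_mono)
  also have "\<dots> = (SUP n. stopped_integral \<pi> k \<tau> n z F)"
  proof (intro SUP_cong refl)
    fix n
    have "stopped_integral \<pi> k \<tau> n z (indicator {z'}) * F z'
        = ennreal (pmf (walk \<pi> k \<tau> n z) z') * (F z' * indicator {z'. z' k \<le> \<tau>} z')" for z'
    proof (cases "z' k \<le> \<tau>")
      case False
      then have "stopped_integral \<pi> k \<tau> n z (indicator {z'}) = (\<integral>\<^sup>+y. 0 \<partial>walk \<pi> k \<tau> n z)"
        unfolding stopped_integral_def by (intro nn_integral_cong) (auto simp: indicator_def)
      then show ?thesis using False by simp
    qed (simp add: stopped_integral_pmf)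
    then show "(\<integral>\<^sup>+z'. stopped_integral \<pi> k \<tau> n z (indicator {z'}) * F z' \<partial>count_space UNIV)
        = stopped_integral \<pi> k \<tau> n z F"
      unfolding stopped_integral_def[of _ _ _ _ _ F] by (simp add: nn_integral_measure_pmf)
  qed
  finally show ?thesis .
qed

lemma SUP_stopped_integral_1: "(SUP n. stopped_integral \<pi> k \<tau> n z (\<lambda>_. 1)) = 1"
proof -
  have "(\<lambda>n. ennreal (1 - active \<tau> n z)) \<longlonglongrightarrow> ennreal (1 - 0)"
    by (intro tendsto_intros active_tendsto_0)
  moreover have "(\<lambda>n. stopped_integral \<pi> k \<tau> n z (\<lambda>_. 1)) \<longlonglongrightarrow> (SUP n. stopped_integral \<pi> k \<tau> n z (\<lambda>_. 1))"
    by (intro LIMSEQ_SUP mono_stopped_integral)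
  ultimately show ?thesis
    unfolding stopped_integral_1 by (auto dest: LIMSEQ_unique)
qed

text \<open>Total mass 1 says that the level is reached almost surely, which is
  \<open>active_tendsto_0\<close> in the form \<open>SUP_stopped_integral_1\<close>.\<close>

lemma pmf_visit_law:
  "pmf (visit_law \<pi> k \<tau> z) z' = (SUP n. if z' k \<le> \<tau> then pmf (walk \<pi> k \<tau> n z) z' else 0)"
  unfolding visit_law_def
proof (rule pmf_embed_pmf)
  show "0 \<le> (SUP n. if x k \<le> \<tau> then pmf (walk \<pi> k \<tau> n z) x else 0)" for x
    by (rule cSUP_upper2[of _ _ 0]) (auto intro!: bdd_aboveI[of _ 1] simp: pmf_le_1)
  show "(\<integral>\<^sup>+x. ennreal (SUP n. if x k \<le> \<tau> then pmf (walk \<pi> k \<tau> n z) x else 0) \<partial>count_space UNIV) = 1"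
    unfolding nn_integral_visit_aux using visit_sum[of \<tau> z "\<lambda>_. 1"]
    by (simp add: SUP_stopped_integral_1)
qed

lemma ennreal_pmf_visit_law:
  "ennreal (pmf (visit_law \<pi> k \<tau> z) z') = (SUP n. stopped_integral \<pi> k \<tau> n z (indicator {z'}))"
  by (simp only: pmf_visit_law nn_integral_visit_aux)

lemma nn_integral_visit_law:
  "(\<integral>\<^sup>+z'. F z' \<partial>visit_law \<pi> k \<tau> z) = (SUP n. stopped_integral \<pi> k \<tau> n z F)"
proof -
  have "(\<integral>\<^sup>+z'. F z' \<partial>visit_law \<pi> k \<tau> z)
      = (\<integral>\<^sup>+z'. ennreal (pmf (visit_law \<pi> k \<tau> z) z') * F z' \<partial>count_space UNIV)"
    by (rule nn_integral_measure_pmf)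
  then show ?thesis unfolding ennreal_pmf_visit_law visit_sum .
qed

text \<open>Optional stopping at an unbounded time. Because \<open>F\<close> is nonnegative, each
  stopped integral is at most the integral over the walk at a fixed time, and the hitting law is the
  supremum of the stopped integrals.\<close>

lemma visit_supermartingale:
  fixes F :: "('a \<Rightarrow> nat) \<Rightarrow> ennreal"
  assumes "\<And>z. \<tau> < z k \<Longrightarrow> (\<integral>\<^sup>+a. F (serve k z a) \<partial>\<pi>) \<le> F z"
  shows "(\<integral>\<^sup>+z'. F z' \<partial>visit_law \<pi> k \<tau> z) \<le> F z"
  unfolding nn_integral_visit_law
proof (rule SUP_least)
  fix n
  have "stopped_integral \<pi> k \<tau> n z F \<le> (\<integral>\<^sup>+z'. F z' \<partial>walk \<pi> k \<tau> n z)"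
    unfolding stopped_integral_def by (intro nn_integral_mono) (auto simp: indicator_def)
  also have "\<dots> \<le> F z" by (rule walk_supermartingale) (rule assms)
  finally show "stopped_integral \<pi> k \<tau> n z F \<le> F z" .
qed

lemma set_visit_law:
  assumes "z' \<in> set_pmf (visit_law \<pi> k \<tau> z)" "\<tau> \<le> z k"
  shows "z' k = \<tau>" "j \<noteq> k \<Longrightarrow> z j \<le> z' j"
proof -
  \<comment> \<open>The indicator of the states that are below the level or have lost customers in
    another queue. A step from above the level lowers queue \<open>k\<close> by at most one and
    other queues never shrink, so this is a supermartingale; it starts at 0.\<close>
  define F :: "('a \<Rightarrow> nat) \<Rightarrow> ennreal" where
    "F = indicator {y. \<not> (\<tau> \<le> y k \<and> (\<forall>j. j \<noteq> k \<longrightarrow> z j \<le> y j))}"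
  have "(\<integral>\<^sup>+a. F (serve k y a) \<partial>\<pi>) \<le> F y" if "\<tau> < y k" for y
  proof (cases "F y = 0")
    case True
    then have "F (serve k y a) = 0" for a
      using that by (auto simp: F_def serve_def indicator_def split: if_splits intro: trans_le_add1)
    then show ?thesis by simp
  next
    case False
    then have "F y = 1" by (auto simp: F_def indicator_def split: if_splits)
    moreover have "(\<integral>\<^sup>+a. F (serve k y a) \<partial>\<pi>) \<le> (\<integral>\<^sup>+a. 1 \<partial>\<pi>)"
      by (intro nn_integral_mono) (auto simp: F_def indicator_def)
    ultimately show ?thesis by (simp add: emeasure_pmf)
  qed
  then have "(\<integral>\<^sup>+y. F y \<partial>visit_law \<pi> k \<tau> z) \<le> F z" by (rule visit_supermartingale)
  also have "F z = 0" using assms(2) by (simp add: F_def)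
  finally have "AE y in visit_law \<pi> k \<tau> z. F y = 0"
    by (subst (asm) le_zero_eq, subst (asm) nn_integral_0_iff_AE) auto
  then have 1: "F z' = 0" using assms(1) by (simp add: AE_measure_pmf_iff)
  \<comment> \<open>Stopped integrals see only states at or below the level, so together with the
    previous part the level is hit exactly.\<close>
  have "(\<integral>\<^sup>+y. indicator {y. \<tau> < y k} y \<partial>visit_law \<pi> k \<tau> z) = (SUP n::nat. 0)"
    unfolding nn_integral_visit_law stopped_integral_def
    by (intro SUP_cong refl) (auto simp: indicator_def intro!: nn_integral_zero')
  then have "(\<integral>\<^sup>+y. indicator {y. \<tau> < y k} y \<partial>visit_law \<pi> k \<tau> z) = 0" by simp
  then have "AE y in visit_law \<pi> k \<tau> z. (indicator {y. \<tau> < y k} y :: ennreal) = 0"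
    by (subst (asm) nn_integral_0_iff_AE) auto
  then have "z' k \<le> \<tau>" using assms(1) by (auto simp: AE_measure_pmf_iff indicator_def split: if_splits)
  with 1 show "z' k = \<tau>" "j \<noteq> k \<Longrightarrow> z j \<le> z' j" by (auto simp: F_def indicator_def split: if_splits)
qed

lemma visit_law_restart:
  "(\<integral>\<^sup>+z'. F z' \<partial>visit_law \<pi> k \<tau> z) = (\<integral>\<^sup>+y. \<integral>\<^sup>+z'. F z' \<partial>visit_law \<pi> k \<tau> y \<partial>walk \<pi> k \<tau> n z)"
proof -
  have "(\<integral>\<^sup>+y. \<integral>\<^sup>+z'. F z' \<partial>visit_law \<pi> k \<tau> y \<partial>walk \<pi> k \<tau> n z)
      = (SUP m. \<integral>\<^sup>+y. stopped_integral \<pi> k \<tau> m y F \<partial>walk \<pi> k \<tau> n z)"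
    unfolding nn_integral_visit_law
    by (intro nn_integral_monotone_convergence_SUP) (auto simp: incseq_SucI le_fun_def stopped_integral_Suc_le)
  also have "\<dots> = (SUP m. stopped_integral \<pi> k \<tau> (m + n) z F)"
    by (simp add: stopped_integral_def add.commute[of _ n] walk_add)
  also have "\<dots> = (SUP m. stopped_integral \<pi> k \<tau> m z F)"
  proof (intro SUP_eq)
    show "\<exists>j\<in>UNIV. stopped_integral \<pi> k \<tau> (i + n) z F \<le> stopped_integral \<pi> k \<tau> j z F" for i
      by blast
    show "\<exists>i\<in>UNIV. stopped_integral \<pi> k \<tau> j z F \<le> stopped_integral \<pi> k \<tau> (i + n) z F" for j
      by (intro bexI[of _ j] monoD[OF mono_stopped_integral]) auto
  qed
  finally show ?thesis by (simp add: nn_integral_visit_law)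
qed

definition excess :: "nat \<Rightarrow> nat \<Rightarrow> ('a \<Rightarrow> nat) \<Rightarrow> ennreal" where
  "excess \<tau> n z = (\<integral>\<^sup>+z'. of_nat (z' k - \<tau>) \<partial>walk \<pi> k \<tau> n z)"

text \<open>The factor lies between \<rho> and 1 and tends to \<rho> as activity dies out. In the
  induction the excess after one step consists of the customers left over, which carry the factor,
  and of the new arrivals, whose factor is bounded by 1 and whose mean number is \<rho>; this \<rho>
  is absorbed because the factor is at least \<rho>.\<close>

lemma excess_le:
  "excess \<tau> n z \<le> of_nat (z k - \<tau>) * ennreal ((1 - \<rho>) * active \<tau> n z + \<rho>)"
proof (induction n arbitrary: z)
  case 0
  then show ?case using load
    by (cases "\<tau> < z k") (auto simp: excess_def active_def measure_return)
next
  case (Suc n)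
  show ?case
  proof (cases "z k \<le> \<tau>")
    case True
    then show ?thesis by (simp add: excess_def walk_stopped)
  next
    case False
    then have z: "\<tau> < z k" by simp
    let ?d = "of_nat (z k - \<tau> - 1) :: ennreal"
    let ?h = "\<lambda>n z. (1 - \<rho>) * active \<tau> n z + \<rho>"
    have h: "0 \<le> ?h n z" "?h n z \<le> 1" for n z
      using load active_nonneg active_convex_le_1 by simp_all
    have "excess \<tau> (Suc n) z = (\<integral>\<^sup>+a. excess \<tau> n (serve k z a) \<partial>\<pi>)"
      using z by (simp add: excess_def)
    also have "\<dots> \<le> (\<integral>\<^sup>+a. ?d * ennreal (?h n (serve k z a)) + of_nat (a k) \<partial>\<pi>)"
    proof (intro nn_integral_mono)
      fix a
      have "excess \<tau> n (serve k z a) \<le> (?d + of_nat (a k)) * ennreal (?h n (serve k z a))"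
        using Suc[of "serve k z a"] z by (simp only: excess_serve)
      also have "\<dots> \<le> ?d * ennreal (?h n (serve k z a)) + of_nat (a k) * 1"
        using h by (subst distrib_right) (intro add_left_mono mult_left_mono, auto simp: ennreal_le_1)
      finally show "excess \<tau> n (serve k z a) \<le> ?d * ennreal (?h n (serve k z a)) + of_nat (a k)" by simp
    qed
    also have "\<dots> = ?d * (\<integral>\<^sup>+a. ennreal (?h n (serve k z a)) \<partial>\<pi>) + ennreal \<rho>"
      by (simp add: nn_integral_add nn_integral_cmult mean)
    also have "(\<integral>\<^sup>+a. ennreal (?h n (serve k z a)) \<partial>\<pi>)
        = (\<integral>\<^sup>+a. ennreal (1 - \<rho>) * ennreal (active \<tau> n (serve k z a)) + ennreal \<rho> \<partial>\<pi>)"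
      using load by (simp add: ennreal_mult' active_nonneg)
    also have "\<dots> = ennreal (1 - \<rho>) * ennreal (active \<tau> (Suc n) z) + ennreal \<rho>"
      using z by (simp add: nn_integral_add nn_integral_cmult active_Suc emeasure_pmf)
    also have "\<dots> = ennreal (?h (Suc n) z)"
      using load by (simp add: ennreal_mult' active_nonneg)
    also have "?d * ennreal (?h (Suc n) z) + ennreal \<rho> \<le> ?d * ennreal (?h (Suc n) z) + ennreal (?h (Suc n) z)"
      using load active_nonneg by (intro add_left_mono ennreal_leI) simp
    also have "\<dots> = (?d + 1) * ennreal (?h (Suc n) z)" by (simp add: distrib_right)
    also have "?d + 1 = of_nat (z k - \<tau> - 1 + 1)" by simp
    also have "z k - \<tau> - 1 + 1 = z k - \<tau>" using z by simp
    finally show ?thesis .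
  qed
qed

text \<open>Only the first moment of a step is available, so uniform integrability cannot come from
  a second moment. Instead, the mean excess decreases to a limit \<open>g\<close>. Restarting at
  time \<open>m\<close> and applying \<open>excess_le\<close> with dominated convergence gives
  \<open>g \<le> \<rho> * excess \<tau> m z\<close>; letting \<open>m\<close> grow gives
  \<open>g \<le> \<rho> * g\<close>, hence \<open>g = 0\<close>.\<close>

lemma excess_tendsto_0: "(\<lambda>n. excess \<tau> n z) \<longlonglongrightarrow> 0"
proof -
  define g where "g = (INF n. excess \<tau> n z)"
  have super: "(\<integral>\<^sup>+a. of_nat (serve k z a k - \<tau>) \<partial>\<pi>) \<le> (of_nat (z k - \<tau>) :: ennreal)" if "\<tau> < z k" for z
    using excess_step[of \<tau> z, OF that] by (metis add_increasing2 order_refl zero_le)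
  have fin: "excess \<tau> m y \<le> of_nat (y k - \<tau>)" for m y
    unfolding excess_def by (rule walk_supermartingale) (rule super)
  have add: "excess \<tau> (m + n) z = (\<integral>\<^sup>+y. excess \<tau> n y \<partial>walk \<pi> k \<tau> m z)" for m n
    by (simp add: excess_def walk_add)
  have "excess \<tau> (Suc n) z \<le> excess \<tau> n z" for n
    using add[of n 1] fin[of 1] by (simp add: excess_def[of \<tau> n] nn_integral_mono)
  then have dec: "decseq (\<lambda>n. excess \<tau> n z)" by (rule decseq_SucI)
  then have lim: "(\<lambda>n. excess \<tau> n z) \<longlonglongrightarrow> g" unfolding g_def by (rule LIMSEQ_INF)
  have gm: "g \<le> ennreal \<rho> * excess \<tau> m z" for m
  proof (rule LIMSEQ_le)
    show "(\<lambda>n. excess \<tau> (m + n) z) \<longlonglongrightarrow> g"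
      using LIMSEQ_ignore_initial_segment[OF lim, of m] by (simp add: add.commute)
    let ?b = "\<lambda>n y. of_nat (y k - \<tau>) * ennreal ((1 - \<rho>) * active \<tau> n y + \<rho>) :: ennreal"
    have "(\<lambda>n. \<integral>\<^sup>+y. ?b n y \<partial>walk \<pi> k \<tau> m z) \<longlonglongrightarrow> (\<integral>\<^sup>+y. of_nat (y k - \<tau>) * ennreal \<rho> \<partial>walk \<pi> k \<tau> m z)"
    proof (rule nn_integral_dominated_convergence[where w = "\<lambda>y. of_nat (y k - \<tau>)"])
      show "AE y in walk \<pi> k \<tau> m z. ?b n y \<le> of_nat (y k - \<tau>)" for n
      proof (rule AE_I2)
        fix y
        show "?b n y \<le> of_nat (y k - \<tau>)"
          using mult_left_mono[of "ennreal ((1 - \<rho>) * active \<tau> n y + \<rho>)" 1 "of_nat (y k - \<tau>)"]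
          active_convex_le_1
          by (simp add: ennreal_le_1)
      qed
      show "(\<integral>\<^sup>+y. of_nat (y k - \<tau>) \<partial>walk \<pi> k \<tau> m z) < \<infinity>"
        using fin[of m z] unfolding excess_def
        by (rule order.strict_trans1) (simp add: ennreal_of_nat_eq_real_of_nat)
      show "AE y in walk \<pi> k \<tau> m z. (\<lambda>n. ?b n y) \<longlonglongrightarrow> of_nat (y k - \<tau>) * ennreal \<rho>"
      proof (rule AE_I2)
        fix y
        have "(\<lambda>n. ennreal ((1 - \<rho>) * active \<tau> n y + \<rho>)) \<longlonglongrightarrow> ennreal ((1 - \<rho>) * 0 + \<rho>)"
          by (intro tendsto_intros active_tendsto_0)
        then show "(\<lambda>n. ?b n y) \<longlonglongrightarrow> of_nat (y k - \<tau>) * ennreal \<rho>"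
          by (intro ennreal_tendsto_cmult) (auto simp: ennreal_of_nat_eq_real_of_nat)
      qed
    qed auto
    then show "(\<lambda>n. \<integral>\<^sup>+y. ?b n y \<partial>walk \<pi> k \<tau> m z) \<longlonglongrightarrow> ennreal \<rho> * excess \<tau> m z"
      by (subst (asm) nn_integral_multc) (simp_all add: excess_def mult.commute)
    show "\<exists>N. \<forall>n\<ge>N. excess \<tau> (m + n) z \<le> (\<integral>\<^sup>+y. ?b n y \<partial>walk \<pi> k \<tau> m z)"
      unfolding add by (auto intro!: nn_integral_mono excess_le)
  qed
  have "(\<lambda>m. ennreal \<rho> * excess \<tau> m z) \<longlonglongrightarrow> ennreal \<rho> * g"
    by (intro ennreal_tendsto_cmult lim) simp
  then have gg: "g \<le> ennreal \<rho> * g"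
    by (rule LIMSEQ_le_const) (use gm in auto)
  have "g \<le> of_nat (z k - \<tau>)"
    unfolding g_def by (rule INF_lower2[of 0]) (auto intro: fin)
  then obtain r where r: "g = ennreal r" "0 \<le> r"
    by (cases g) (auto simp: ennreal_of_nat_eq_real_of_nat top_unique)
  have "r \<le> \<rho> * r" using gg r load by (simp flip: ennreal_mult')
  then have "(1 - \<rho>) * r \<le> 0" by (simp add: algebra_simps)
  then have "r = 0" using r load by (simp add: mult_le_0_iff)
  then show ?thesis using lim r by simp
qed

text \<open>A Wald identity: queue \<open>j\<close> plus a multiple of the excess of queue
  \<open>k\<close> is a martingale. Optional stopping gives one inequality; the other holds because
  the excess that the walk still carries at time \<open>n\<close> vanishes in the mean.\<close>

theorem visit_mean:
  assumes j: "j \<noteq> k" and m: "(\<integral>\<^sup>+a. of_nat (a j) \<partial>\<pi>) = ennreal m" "0 \<le> m" and z: "\<tau> \<le> z k"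
  shows "(\<integral>\<^sup>+z'. of_nat (z' j) \<partial>visit_law \<pi> k \<tau> z) = of_nat (z j) + ennreal (m / (1 - \<rho>)) * of_nat (z k - \<tau>)"
    (is "?E z = ?F z")
proof (rule antisym)
  let ?c = "m / (1 - \<rho>)"
  have martingale: "(\<integral>\<^sup>+a. ?F (serve k y a) \<partial>\<pi>) = ?F y" if y: "\<tau> < y k" for y
  proof -
    have "(\<integral>\<^sup>+a. ?F (serve k y a) \<partial>\<pi>)
        = (of_nat (y j) + ennreal m) + ennreal ?c * (\<integral>\<^sup>+a. of_nat (serve k y a k - \<tau>) \<partial>\<pi>)"
      using j by (simp add: nn_integral_add nn_integral_cmult serve_def m emeasure_pmf)
    also have "ennreal m = ennreal ?c * ennreal (1 - \<rho>)"
      using load m by (simp flip: ennreal_mult')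
    also have "of_nat (y j) + ennreal ?c * ennreal (1 - \<rho>) + ennreal ?c * (\<integral>\<^sup>+a. of_nat (serve k y a k - \<tau>) \<partial>\<pi>)
       = of_nat (y j) + ennreal ?c * ((\<integral>\<^sup>+a. of_nat (serve k y a k - \<tau>) \<partial>\<pi>) + ennreal (1 - \<rho>))"
      by (simp add: distrib_left add_ac)
    also have "\<dots> = ?F y" unfolding excess_step[of \<tau> y, OF y] ..
    finally show ?thesis .
  qed
  have "?E z \<le> (\<integral>\<^sup>+z'. ?F z' \<partial>visit_law \<pi> k \<tau> z)" by (intro nn_integral_mono) simp
  also have "\<dots> \<le> ?F z" by (rule visit_supermartingale) (simp only: martingale order_refl)
  finally show "?E z \<le> ?F z" .
  have "?F z \<le> ?E z + ennreal ?c * excess \<tau> n z" for n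
  proof -
    \<comment> \<open>From any intermediate state queue \<open>j\<close> can only grow until the
      visit ends. Below the level the walk does not move at all.\<close>
    have le: "of_nat (y j) \<le> ?E y" if "y \<in> set_pmf (walk \<pi> k \<tau> n z)" for y
    proof (cases "\<tau> \<le> y k")
      case True
      have "of_nat (y j) = (\<integral>\<^sup>+z'. of_nat (y j) \<partial>visit_law \<pi> k \<tau> y)" by (simp add: emeasure_pmf)
      also have "\<dots> \<le> ?E y"
        using set_visit_law(2)[of _ \<tau> y j, OF _ True j] by (intro nn_integral_mono_AE) (auto simp: AE_measure_pmf_iff)
      finally show ?thesis .
    next
      case False
      then have "?E y = (SUP n::nat. of_nat (y j))"
        unfolding nn_integral_visit_law by (simp add: stopped_integral_def walk_stopped)
      then show ?thesis by simp
    qed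
    have "?F z = (\<integral>\<^sup>+y. ?F y \<partial>walk \<pi> k \<tau> n z)" by (rule walk_martingale[symmetric]) (rule martingale)
    also have "\<dots> = (\<integral>\<^sup>+y. of_nat (y j) \<partial>walk \<pi> k \<tau> n z) + ennreal ?c * excess \<tau> n z"
      by (simp add: nn_integral_add nn_integral_cmult excess_def)
    also have "\<dots> \<le> (\<integral>\<^sup>+y. ?E y \<partial>walk \<pi> k \<tau> n z) + ennreal ?c * excess \<tau> n z"
      using le by (intro add_right_mono nn_integral_mono_AE) (auto simp: AE_measure_pmf_iff)
    also have "(\<integral>\<^sup>+y. ?E y \<partial>walk \<pi> k \<tau> n z) = ?E z" by (rule visit_law_restart[symmetric])
    finally show ?thesis .
  qed
  moreover have "(\<lambda>n. ?E z + ennreal ?c * excess \<tau> n z) \<longlonglongrightarrow> ?E z + ennreal ?c * 0"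
    by (intro tendsto_add tendsto_const ennreal_tendsto_cmult excess_tendsto_0) simp
  ultimately show "?F z \<le> ?E z"
    by (intro LIMSEQ_le_const) auto
qed

end

subsection \<open>Strong Markov property of the arrival streams\<close>

lemma measurable_nat_diff:
  fixes f g :: "'a \<Rightarrow> nat"
  assumes f: "f \<in> measurable M (count_space UNIV)" and g: "g \<in> measurable M (count_space UNIV)"
  shows "(\<lambda>x. f x - g x) \<in> measurable M (count_space UNIV)"
proof (rule measurable_compose_countable[OF _ f])
  show "(\<lambda>x. a - g x) \<in> measurable M (count_space UNIV)" for a
    by (rule measurable_compose[OF g]) simp
qed

text \<open>Refines an independent family: every member is replaced by two subfamilies that are
  independent of each other. For an arrival stream these will be its past and an increment after the
  present time.\<close>

lemma (in prob_space) indep_sets_split: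
  fixes G :: "'i \<Rightarrow> bool \<Rightarrow> 'a set set"
  assumes E: "indep_sets E S" "\<And>a A B. a \<in> S \<Longrightarrow> A \<in> E a \<Longrightarrow> B \<in> E a \<Longrightarrow> A \<inter> B \<in> E a"
    and G: "\<And>a b. a \<in> S \<Longrightarrow> G a b \<subseteq> E a" "\<And>a b. a \<in> S \<Longrightarrow> space M \<in> G a b"
    and split: "\<And>a A B. a \<in> S \<Longrightarrow> A \<in> G a False \<Longrightarrow> B \<in> G a True \<Longrightarrow> prob (A \<inter> B) = prob A * prob B"
  shows "indep_sets (\<lambda>(a, b). G a b) (S \<times> UNIV)"
proof (rule indep_setsI)
  have ev: "E a \<subseteq> events" if "a \<in> S" for a
    using E(1) that by (auto simp: indep_sets_def)
  show "(case i of (a, b) \<Rightarrow> G a b) \<subseteq> events" if "i \<in> S \<times> UNIV" for i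
  proof -
    have "fst i \<in> S" using that by auto
    then have "G (fst i) (snd i) \<subseteq> events" using G(1) ev by blast
    then show ?thesis by (simp add: case_prod_beta)
  qed
  fix A J assume J: "J \<noteq> {}" "J \<subseteq> S \<times> (UNIV :: bool set)" "finite J"
    and A: "\<forall>j\<in>J. A j \<in> (case j of (a, b) \<Rightarrow> G a b)"
  \<comment> \<open>Padding with the whole space makes both halves of every source that occurs
    present, so that they can be merged into one event per source.\<close>
  define A' where "A' = (\<lambda>j. if j \<in> J then A j else space M)"
  define T where "T = fst ` J"
  have T: "finite T" "T \<noteq> {}" "T \<subseteq> S" using J by (auto simp: T_def)
  have A': "A' (a, b) \<in> G a b" if "a \<in> T" for a b
    using that T A G(2) by (auto simp: A'_def T_def)
  have sub: "A j \<subseteq> space M" if "j \<in> J" for j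
  proof -
    have "A j \<in> G (fst j) (snd j)" "fst j \<in> S" using that A J by (auto simp: case_prod_beta)
    then have "A j \<in> events" using G(1) ev by blast
    then show ?thesis by (rule sets.sets_into_space)
  qed
  have "(\<Inter>j\<in>J. A j) = (\<Inter>a\<in>T. A' (a, False) \<inter> A' (a, True))" (is "?L = ?R")
  proof
    show "?L \<subseteq> ?R"
    proof
      fix w assume w: "w \<in> ?L"
      moreover obtain j where "j \<in> J" using J by blast
      ultimately have "w \<in> space M" using sub by blast
      with w have "w \<in> A' j" for j by (auto simp: A'_def)
      then show "w \<in> ?R" by blast
    qed
    show "?R \<subseteq> ?L"
    proof
      fix w assume w: "w \<in> ?R"
      show "w \<in> ?L"
      proof
        fix j assume j: "j \<in> J"
        then have "fst j \<in> T" by (simp add: T_def)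
        then have "w \<in> A' (fst j, False) \<inter> A' (fst j, True)" using w by blast
        then have "w \<in> A' j" by (cases j; cases "snd j") auto
        then show "w \<in> A j" using j by (simp add: A'_def)
      qed
    qed
  qed
  also have "prob \<dots> = (\<Prod>a\<in>T. prob (A' (a, False) \<inter> A' (a, True)))"
  proof (intro indep_setsD[OF E(1)] ballI)
    fix a assume a: "a \<in> T"
    then have "A' (a, b) \<in> E a" for b using A'[of a b] G(1)[of a b] T by auto
    then show "A' (a, False) \<inter> A' (a, True) \<in> E a" using a T by (intro E(2)) auto
  qed (use T in auto)
  also have "\<dots> = (\<Prod>a\<in>T. \<Prod>b\<in>UNIV. prob (A' (a, b)))"
    using T A' by (intro prod.cong refl) (auto simp: UNIV_bool intro!: split)
  also have "\<dots> = (\<Prod>j\<in>T \<times> UNIV. prob (A' j))" by (simp add: prod.cartesian_product case_prod_eta)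
  also have "\<dots> = (\<Prod>j\<in>J. prob (A' j))"
    using T by (intro prod.mono_neutral_right) (auto simp: T_def A'_def prob_space intro: rev_image_eqI)
  also have "\<dots> = (\<Prod>j\<in>J. prob (A j))" by (simp add: A'_def)
  finally show "prob (\<Inter>j\<in>J. A j) = (\<Prod>j\<in>J. prob (A j))" .
qed

context prob_space
begin

context
  fixes l :: real and N :: "real \<Rightarrow> 'a \<Rightarrow> nat"
  assumes N: "poisson_process M l N" and l: "0 < l"
begin

lemma poisson_measurable: "0 \<le> t \<Longrightarrow> N t \<in> measurable M (count_space UNIV)"
  and poisson_0: "\<omega> \<in> space M \<Longrightarrow> N 0 \<omega> = 0"
  and poisson_mono: "\<omega> \<in> space M \<Longrightarrow> 0 \<le> u \<Longrightarrow> u \<le> t \<Longrightarrow> N u \<omega> \<le> N t \<omega>"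
  and poisson_right: "\<omega> \<in> space M \<Longrightarrow> 0 \<le> t \<Longrightarrow> continuous (at_right t) (\<lambda>u. real (N u \<omega>))"
  using N by (auto simp: poisson_process_def mono_on_def)

text \<open>Integers at distance less than 1 agree, so right-continuity becomes constancy on an
  interval to the right.\<close>

lemma poisson_right_constant:
  assumes "\<omega> \<in> space M" "0 \<le> t"
  shows "\<exists>b>t. \<forall>u. t \<le> u \<longrightarrow> u < b \<longrightarrow> N u \<omega> = N t \<omega>"
proof -
  have "((\<lambda>u. real (N u \<omega>)) \<longlongrightarrow> real (N t \<omega>)) (at_right t)"
    using poisson_right[OF assms] by (simp add: continuous_within)
  then have "eventually (\<lambda>u. dist (real (N u \<omega>)) (real (N t \<omega>)) < 1) (at_right t)"
    by (rule tendstoD) simp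
  then obtain b where b: "b > t" "\<And>u. t < u \<Longrightarrow> u < b \<Longrightarrow> dist (real (N u \<omega>)) (real (N t \<omega>)) < 1"
    unfolding eventually_at_right_field by blast
  have "N u \<omega> = N t \<omega>" if "t \<le> u" "u < b" for u
    using b(2)[of u] that by (cases "u = t") (auto simp: dist_real_def)
  then show ?thesis using b(1) by blast
qed

lemma poisson_increment:
  assumes "0 \<le> t" "0 \<le> u"
  shows "prob {\<omega> \<in> space M. N (t + u) \<omega> - N t \<omega> = n} = pmf (pois (l * u)) n"
proof (cases "u = 0")
  case True
  then show ?thesis by (simp add: pois_def indicator_def prob_space)
next
  case False
  then have u: "0 < u" using assms by simp
  have "measure (distr M (count_space UNIV) (\<lambda>\<omega>. N (t + u) \<omega> - N t \<omega>)) {n} = pmf (poisson_pmf (l * (t + u - t))) n"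
    using N assms u by (simp add: poisson_process_def pmf.rep_eq)
  moreover have "(\<lambda>\<omega>. N (t + u) \<omega> - N t \<omega>) \<in> measurable M (count_space UNIV)"
    using assms by (intro measurable_nat_diff poisson_measurable) auto
  ultimately show ?thesis
    using u l by (simp add: measure_distr vimage_def Int_def conj_commute pois_def)
qed

text \<open>Observing the stream at finitely many times is the same as observing its increments
  along the sorted times, started from \<open>N 0 = 0\<close>. The prescribed values are those of a
  sample point, hence monotone, so that natural-number increments determine them.\<close>

lemma poisson_past_increment:
  assumes tu: "0 \<le> t" "0 \<le> u" and U: "finite U" "U \<subseteq> {0..t}" and \<omega>0: "\<omega>0 \<in> space M"
  shows "prob ({\<omega> \<in> space M. \<forall>v\<in>U. N v \<omega> = N v \<omega>0} \<inter> {\<omega> \<in> space M. N (t + u) \<omega> - N t \<omega> \<in> B})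
    = prob {\<omega> \<in> space M. \<forall>v\<in>U. N v \<omega> = N v \<omega>0} * prob {\<omega> \<in> space M. N (t + u) \<omega> - N t \<omega> \<in> B}"
proof -
  define xs where "xs = sorted_list_of_set (insert 0 U)"
  define m where "m = length xs - 1"
  have set_xs: "set xs = insert 0 U" and sorted: "sorted xs"
    using U unfolding xs_def by (simp_all del: sorted_list_of_set_insert_remove)
  then have "xs \<noteq> []" by auto
  then have len: "length xs = Suc m" by (simp add: m_def)
  have xs_range: "0 \<le> xs ! j \<and> xs ! j \<le> t" if "j \<le> m" for j
  proof -
    have "xs ! j \<in> set xs" using that len by simp
    then show ?thesis using set_xs U tu by auto
  qed
  have xs0: "xs ! 0 = 0"
  proof -
    obtain j where j: "j < length xs" "xs ! j = 0" using set_xs by (metis in_set_conv_nth insertI1)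
    then have "xs ! 0 \<le> xs ! j" using sorted_nth_mono[OF sorted, of 0 j] by simp
    then show ?thesis using j xs_range[of 0] by simp
  qed
  \<comment> \<open>The sorted observation times are continued by \<open>t\<close> and
    \<open>t + u\<close>. Increment number \<open>m\<close>, from the last observation to
    \<open>t\<close>, is left out below; number \<open>Suc m\<close> is the future one.\<close>
  define \<tau> where "\<tau> = (\<lambda>j. if j \<le> m then xs ! j else if j = Suc m then t else t + u)"
  have mono: "mono \<tau>"
  proof (rule monoI)
    fix i j :: nat assume "i \<le> j"
    then show "\<tau> i \<le> \<tau> j"
      using xs_range[of i] tu sorted len by (auto simp: \<tau>_def sorted_nth_mono)
  qed
  define D where "D = (\<lambda>j \<omega>. N (\<tau> (Suc j)) \<omega> - N (\<tau> j) \<omega>)"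
  have ind: "indep_vars (\<lambda>_. count_space UNIV) D {..<m + 2}"
  proof -
    have "\<forall>(\<tau> :: nat \<Rightarrow> real) m. 0 \<le> \<tau> 0 \<longrightarrow> mono \<tau> \<longrightarrow>
        indep_vars (\<lambda>_. count_space UNIV) (\<lambda>j \<omega>. N (\<tau> (Suc j)) \<omega> - N (\<tau> j) \<omega>) {..<m}"
      using N unfolding poisson_process_def by (elim conjE) assumption
    moreover have "0 \<le> \<tau> 0" by (simp add: \<tau>_def xs0)
    ultimately show ?thesis using mono unfolding D_def by blast
  qed
  let ?C = "{\<omega> \<in> space M. \<forall>v\<in>U. N v \<omega> = N v \<omega>0}"
  let ?I = "{\<omega> \<in> space M. N (t + u) \<omega> - N t \<omega> \<in> B}"
  define A where "A = (\<lambda>j. if j < m then {D j \<omega>0} else B)"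
  have nonneg: "0 \<le> \<tau> j" for j using xs_range[of j] tu by (auto simp: \<tau>_def)
  have C: "\<omega> \<in> ?C \<longleftrightarrow> (\<forall>j<m. D j \<omega> = D j \<omega>0)" if \<omega>: "\<omega> \<in> space M" for \<omega>
  proof
    assume "\<omega> \<in> ?C"
    then have "N v \<omega> = N v \<omega>0" if "v \<in> set xs" for v
      using that \<omega> \<omega>0 set_xs by (auto simp: poisson_0)
    then show "\<forall>j<m. D j \<omega> = D j \<omega>0" using len by (auto simp: D_def \<tau>_def)
  next
    assume *: "\<forall>j<m. D j \<omega> = D j \<omega>0"
    have "N (xs ! j) \<omega> = N (xs ! j) \<omega>0" if "j \<le> m" for j
      using that
    proof (induction j)
      case 0
      then show ?case using xs0 \<omega> \<omega>0 by (simp add: poisson_0)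
    next
      case (Suc j)
      have le: "N (xs ! j) w \<le> N (xs ! Suc j) w" if "w \<in> space M" for w
        using Suc.prems len sorted xs_range[of j] that by (intro poisson_mono) (auto simp: sorted_nth_mono)
      have "D j \<omega> = D j \<omega>0" using * Suc.prems by simp
      then show ?case using Suc le[OF \<omega>] le[OF \<omega>0] by (simp add: D_def \<tau>_def)
    qed
    then have "N v \<omega> = N v \<omega>0" if "v \<in> set xs" for v
      using that len by (auto simp: in_set_conv_nth less_Suc_eq_le)
    then show "\<omega> \<in> ?C" using \<omega> set_xs by auto
  qed
  have I: "?I = D (Suc m) -` A (Suc m) \<inter> space M"
    by (auto simp: D_def A_def \<tau>_def)
  show ?thesis
  proof (cases "m = 0")
    case True
    then have "?C = space M" using C by blast
    then have "?C \<inter> ?I = ?I" by blast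
    then show ?thesis using \<open>?C = space M\<close> by (simp add: prob_space)
  next
    case False
    have C': "?C = (\<Inter>j\<in>{..<m}. D j -` A j \<inter> space M)"
      using False C by (auto simp: A_def)
    have "?C \<inter> ?I = (\<Inter>j\<in>insert (Suc m) {..<m}. D j -` A j \<inter> space M)"
      unfolding C' I by auto
    also have "prob \<dots> = (\<Prod>j\<in>insert (Suc m) {..<m}. prob (D j -` A j \<inter> space M))"
      by (rule indep_varsD[OF ind]) auto
    also have "\<dots> = prob ?I * (\<Prod>j<m. prob (D j -` A j \<inter> space M))"
      unfolding I by (rule prod.insert) auto
    also have "(\<Prod>j<m. prob (D j -` A j \<inter> space M)) = prob ?C"
      unfolding C' using False by (intro indep_varsD[OF ind, symmetric]) auto
    finally show ?thesis by (simp add: mult.commute)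
  qed
qed

end

end

section \<open>Independence of past and future at a fixed time\<close>

locale bep_model = polling_model K I p lam mu SD s r + bep_system K I p lam SD r VD X
  for K I p lam mu SD s r VD and X :: "'w polling_primitives"
begin

sublocale P: prob_space "sample_space X" by (rule prob_space_sample)

abbreviation "\<Omega> \<equiv> space (sample_space X)"

abbreviation "arrival_sources \<equiv> Arrivals ` {1..K}"

definition "other_sources = sources K I - range Arrivals"

lemma sources_split: "sources K I = arrival_sources \<union> other_sources"
  by (auto simp: sources_def other_sources_def)

lemma arr_measurable: "k \<in> {1..K} \<Longrightarrow> 0 \<le> t \<Longrightarrow> arrivals X k t \<in> measurable (sample_space X) (count_space UNIV)"
  using P.poisson_measurable[OF poisson_arrivals arrival_rate] .

lemma arr_mono: "k \<in> {1..K} \<Longrightarrow> \<omega> \<in> \<Omega> \<Longrightarrow> 0 \<le> t \<Longrightarrow> t \<le> t' \<Longrightarrow> arrivals X k t \<omega> \<le> arrivals X k t' \<omega>"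
  using P.poisson_mono[OF poisson_arrivals arrival_rate] .

lemma source_algebra: "\<exists>V. source_events K X a = sets V \<and> space V = \<Omega>"
proof (cases a)
  case Initial
  show ?thesis unfolding Initial source_events.simps by (rule exI, rule conjI, rule refl) simp
next
  case (Arrivals k)
  show ?thesis unfolding Arrivals source_events.simps by (rule exI, rule conjI, rule refl) simp
next
  case (Service k l)
  show ?thesis unfolding Service source_events.simps by (rule exI, rule conjI, rule refl) simp
next
  case (Switchover c i)
  show ?thesis unfolding Switchover source_events.simps by (rule exI, rule conjI, rule refl) simp
next
  case (Draw c i N)
  show ?thesis unfolding Draw source_events.simps by (rule exI, rule conjI, rule refl) simp
qed

lemma source_event_Int:
  "A \<in> source_events K X a \<Longrightarrow> B \<in> source_events K X a \<Longrightarrow> A \<inter> B \<in> source_events K X a"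
  using source_algebra[of a] by auto

lemma space_source_event: "\<Omega> \<in> source_events K X a"
  using source_algebra[of a] by (metis sets.top)

lemma source_events: "a \<in> sources K I \<Longrightarrow> source_events K X a \<subseteq> P.events"
  using independence by (auto simp: P.indep_sets_def)

lemma arrival_source_event:
  assumes "0 \<le> t"
  shows "{\<omega> \<in> \<Omega>. arrivals X k t \<omega> \<in> B} \<in> source_events K X (Arrivals k)"
proof -
  let ?V = "vimage_algebra \<Omega> (\<lambda>\<omega>. \<lambda>t\<in>{0..}. arrivals X k t \<omega>) (Pi\<^sub>M {0..} (\<lambda>_. count_space UNIV))"
  have "(\<lambda>\<omega>. (\<lambda>t\<in>{0..}. arrivals X k t \<omega>) t) \<in> measurable ?V (count_space UNIV)"
    using assms by (intro measurable_compose[OF measurable_vimage_algebra1 measurable_component_singleton])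
      (auto simp: space_PiM split: if_splits)
  then have "arrivals X k t \<in> measurable ?V (count_space UNIV)" using assms by simp
  then have "arrivals X k t -` B \<inter> space ?V \<in> sets ?V" by (rule measurable_sets) simp
  then show ?thesis by (simp add: vimage_def Int_def conj_commute)
qed

text \<open>Prescribing the values through a sample point keeps these generators closed under
  intersection, since a common point can serve for both. The empty set is included because two of
  them may be disjoint.\<close>

definition cylinders :: "nat \<Rightarrow> real \<Rightarrow> 'w set set" where
  "cylinders k t = insert {} {{\<omega> \<in> \<Omega>. \<forall>v\<in>U. arrivals X k v \<omega> = arrivals X k v \<omega>0} | U \<omega>0.
    finite U \<and> U \<subseteq> {0..t} \<and> \<omega>0 \<in> \<Omega>}"

definition increments :: "nat \<Rightarrow> real \<Rightarrow> real \<Rightarrow> 'w set set" where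
  "increments k t u = {{\<omega> \<in> \<Omega>. arrivals X k (t + u) \<omega> - arrivals X k t \<omega> \<in> B} | B. True}"

lemma cylinders_subset:
  assumes "k \<in> {1..K}"
  shows "cylinders k t \<subseteq> source_events K X (Arrivals k)"
proof -
  let ?V = "vimage_algebra \<Omega> (\<lambda>\<omega>. \<lambda>t\<in>{0..}. arrivals X k t \<omega>) (Pi\<^sub>M {0..} (\<lambda>_. count_space UNIV))"
  have "{\<omega> \<in> space ?V. \<forall>v\<in>U. arrivals X k v \<omega> = arrivals X k v \<omega>0} \<in> sets ?V"
    if "finite U" "U \<subseteq> {0..t}" for U \<omega>0
    using that arrival_source_event[of _ k "{arrivals X k v \<omega>0}" for v]
    by (intro sets.sets_Collect_finite_All) auto
  then show ?thesis by (auto simp: cylinders_def)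
qed

lemma Int_stable_cylinders: "Int_stable (cylinders k t)"
proof (rule Int_stableI)
  fix A B assume A: "A \<in> cylinders k t" and B: "B \<in> cylinders k t"
  show "A \<inter> B \<in> cylinders k t"
  proof (cases "A \<inter> B = {}")
    case True
    then show ?thesis by (simp add: cylinders_def)
  next
    case False
    then obtain \<omega>1 where 1: "\<omega>1 \<in> A" "\<omega>1 \<in> B" by blast
    from A 1 obtain U \<omega>0 where U: "finite U" "U \<subseteq> {0..t}" "A = {\<omega> \<in> \<Omega>. \<forall>v\<in>U. arrivals X k v \<omega> = arrivals X k v \<omega>0}"
      by (auto simp: cylinders_def)
    from B 1 obtain U' \<omega>0' where U': "finite U'" "U' \<subseteq> {0..t}" "B = {\<omega> \<in> \<Omega>. \<forall>v\<in>U'. arrivals X k v \<omega> = arrivals X k v \<omega>0'}"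
      by (auto simp: cylinders_def)
    have "A \<inter> B = {\<omega> \<in> \<Omega>. \<forall>v\<in>U \<union> U'. arrivals X k v \<omega> = arrivals X k v \<omega>1}"
      using 1 unfolding U(3) U'(3) by auto
    then show ?thesis
      unfolding cylinders_def using U U' 1 by (auto intro!: exI[of _ "U \<union> U'"] exI[of _ \<omega>1])
  qed
qed

lemma Int_stable_increments: "Int_stable (increments k t u)"
proof (rule Int_stableI)
  fix A B assume "A \<in> increments k t u" "B \<in> increments k t u"
  then obtain C D where "A = {\<omega> \<in> \<Omega>. arrivals X k (t + u) \<omega> - arrivals X k t \<omega> \<in> C}"
    "B = {\<omega> \<in> \<Omega>. arrivals X k (t + u) \<omega> - arrivals X k t \<omega> \<in> D}"
    by (auto simp: increments_def)
  then have "A \<inter> B = {\<omega> \<in> \<Omega>. arrivals X k (t + u) \<omega> - arrivals X k t \<omega> \<in> C \<inter> D}" by auto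
  then show "A \<inter> B \<in> increments k t u" unfolding increments_def by blast
qed

lemma increments_subset:
  assumes "0 \<le> t" "0 \<le> u"
  shows "increments k t u \<subseteq> source_events K X (Arrivals k)"
proof -
  let ?V = "vimage_algebra \<Omega> (\<lambda>\<omega>. \<lambda>t\<in>{0..}. arrivals X k t \<omega>) (Pi\<^sub>M {0..} (\<lambda>_. count_space UNIV))"
  have m: "arrivals X k v \<in> measurable ?V (count_space UNIV)" if "0 \<le> v" for v
    using arrival_source_event[OF that, of k] by (auto simp: measurable_def vimage_def Int_def conj_commute)
  have "(\<lambda>\<omega>. arrivals X k (t + u) \<omega> - arrivals X k t \<omega>) \<in> measurable ?V (count_space UNIV)"
    using assms by (intro measurable_nat_diff m) auto
  then have "(\<lambda>\<omega>. arrivals X k (t + u) \<omega> - arrivals X k t \<omega>) -` B \<inter> space ?V \<in> sets ?V" for B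
    by (rule measurable_sets) simp
  then show ?thesis by (auto simp: increments_def vimage_def Int_def conj_commute)
qed

text \<open>What is known at time \<open>t\<close> to an observer who has also seen the sources \<open>J\<close>.\<close>

definition past :: "randomness_source set \<Rightarrow> real \<Rightarrow> 'w measure" where
  "past J t = sigma \<Omega> ((\<Union>a\<in>J. source_events K X a) \<union> (\<Union>k\<in>{1..K}. cylinders k t))"

text \<open>The value 0 outside the queues places the vectors in the countable set
  \<open>vecs {1..K}\<close>.\<close>

definition arrived :: "real \<Rightarrow> real \<Rightarrow> 'w \<Rightarrow> nat \<Rightarrow> nat" where
  "arrived t t' \<omega> = (\<lambda>k. if k \<in> {1..K} then arrivals X k t' \<omega> - arrivals X k t \<omega> else 0)"

end

context bep_model
begin

declare One_nat_def [simp del] source_events.simps [simp del]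

lemma past_generators: "J \<subseteq> other_sources \<Longrightarrow>
  (\<Union>a\<in>J. source_events K X a) \<union> (\<Union>k\<in>{1..K}. cylinders k t) \<subseteq> P.events"
proof -
  assume J: "J \<subseteq> other_sources"
  have "source_events K X a \<subseteq> P.events" if "a \<in> J" for a
    using J that by (intro source_events) (auto simp: sources_split)
  moreover have "cylinders k t \<subseteq> P.events" if "k \<in> {1..K}" for k
  proof -
    have "Arrivals k \<in> sources K I" unfolding sources_split using that by (intro UnI1 imageI)
    then have "source_events K X (Arrivals k) \<subseteq> P.events" by (rule source_events)
    with cylinders_subset[OF that] show ?thesis by (rule order_trans)
  qed
  ultimately show ?thesis by blast
qed

lemma generators_space: "J \<subseteq> other_sources \<Longrightarrow>
  (\<Union>a\<in>J. source_events K X a) \<union> (\<Union>k\<in>{1..K}. cylinders k t) \<subseteq> Pow \<Omega>"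
  using past_generators[of J t] sets.space_closed[of "sample_space X"] by (rule order_trans)

lemma sets_past: "J \<subseteq> other_sources \<Longrightarrow> sets (past J t) =
    sigma_sets \<Omega> ((\<Union>a\<in>J. source_events K X a) \<union> (\<Union>k\<in>{1..K}. cylinders k t))"
  unfolding past_def by (rule sets_measure_of) (rule generators_space)

lemma space_past [simp]: "J \<subseteq> other_sources \<Longrightarrow> space (past J t) = \<Omega>"
  unfolding past_def by (rule space_measure_of) (rule generators_space)

lemma past_subset: "J \<subseteq> other_sources \<Longrightarrow> sets (past J t) \<subseteq> P.events"
  unfolding sets_past by (rule sets.sigma_sets_subset) (rule past_generators)

lemma past_mono:
  assumes "J \<subseteq> J'" "J' \<subseteq> other_sources" "t \<le> t'"
  shows "sets (past J t) \<subseteq> sets (past J' t')"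
proof -
  have "cylinders k t \<subseteq> cylinders k t'" for k
  proof
    fix A assume "A \<in> cylinders k t"
    then consider "A = {}" | U \<omega>0 where "finite U" "U \<subseteq> {0..t}" "\<omega>0 \<in> \<Omega>"
        "A = {\<omega> \<in> \<Omega>. \<forall>v\<in>U. arrivals X k v \<omega> = arrivals X k v \<omega>0}"
      unfolding cylinders_def by blast
    then show "A \<in> cylinders k t'"
    proof cases
      case 2
      moreover from 2 have "U \<subseteq> {0..t'}" using assms(3) by auto
      ultimately show ?thesis unfolding cylinders_def by blast
    qed (simp add: cylinders_def)
  qed
  then have sub: "(\<Union>a\<in>J. source_events K X a) \<union> (\<Union>k\<in>{1..K}. cylinders k t)
      \<subseteq> (\<Union>a\<in>J'. source_events K X a) \<union> (\<Union>k\<in>{1..K}. cylinders k t')"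
    using assms(1) by (intro Un_mono UN_mono) auto
  have "J \<subseteq> other_sources" using assms by blast
  then show ?thesis unfolding sets_past[OF assms(2)] sets_past[OF \<open>J \<subseteq> other_sources\<close>]
    by (intro sigma_sets_mono' sub)
qed

lemma source_in_past: "J \<subseteq> other_sources \<Longrightarrow> a \<in> J \<Longrightarrow> F \<in> source_events K X a \<Longrightarrow> F \<in> sets (past J t)"
  unfolding sets_past by (rule sigma_sets.Basic) blast

lemma arrivals_in_past:
  assumes "J \<subseteq> other_sources" "k \<in> {1..K}" "0 \<le> u" "u \<le> t"
  shows "{\<omega> \<in> \<Omega>. arrivals X k u \<omega> \<in> B} \<in> sets (past J t)"
proof -
  have 1: "{\<omega> \<in> \<Omega>. arrivals X k u \<omega> = n} \<in> sets (past J t)" for n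
  proof (cases "{\<omega> \<in> \<Omega>. arrivals X k u \<omega> = n} = {}")
    case True
    then show ?thesis by (simp only: sets.empty_sets)
  next
    case False
    then obtain \<omega>0 where "\<omega>0 \<in> \<Omega>" "arrivals X k u \<omega>0 = n" by blast
    then have "{\<omega> \<in> \<Omega>. arrivals X k u \<omega> = n} \<in> cylinders k t"
      using assms unfolding cylinders_def by (auto intro!: exI[of _ "{u}"] exI[of _ \<omega>0])
    then show ?thesis unfolding sets_past[OF assms(1)] using assms(2) by (intro sigma_sets.Basic) blast
  qed
  have "{\<omega> \<in> \<Omega>. arrivals X k u \<omega> \<in> B} = (\<Union>n\<in>B. {\<omega> \<in> \<Omega>. arrivals X k u \<omega> = n})" by auto
  also have "\<dots> \<in> sets (past J t)" by (intro sets.countable_UN'' 1) auto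
  finally show ?thesis .
qed

lemma arrived_law:
  assumes "0 \<le> t" "0 \<le> u"
  shows "(\<Prod>k\<in>{1..K}. P.prob {\<omega> \<in> \<Omega>. arrivals X k (t + u) \<omega> - arrivals X k t \<omega> \<in> {x k}})
    = (\<Prod>k\<in>{1..K}. pmf (pois (lam k * u)) (x k))"
  using assms P.poisson_increment[OF poisson_arrivals arrival_rate] by (intro prod.cong) auto

text \<open>The Markov property at a deterministic time, jointly with a source that has not been
  consulted. The generators of the past, of the source and of the K increments are separate groups
  of the refined independent family, and independence passes to the \<sigma>-algebras they
  generate.\<close>

lemma past_indep:
  assumes J: "J \<subseteq> other_sources" and a: "a \<in> other_sources" "a \<notin> J" and tu: "0 \<le> t" "0 \<le> u"
    and E: "E \<in> sets (past J t)" and F: "F \<in> source_events K X a"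
  shows "P.prob (E \<inter> F \<inter> {\<omega> \<in> \<Omega>. arrived t (t + u) \<omega> = x})
    = P.prob E * P.prob F * pmf (vec_pois {1..K} lam u) x"
proof (cases "x \<in> vecs {1..K}")
  case False
  then have "{\<omega> \<in> \<Omega>. arrived t (t + u) \<omega> = x} = {}" by (auto simp: arrived_def vecs_def)
  moreover have "pmf (vec_pois {1..K} lam u) x = 0" using False by (simp add: pmf_vec_pois)
  ultimately show ?thesis by (simp only: Int_empty_right measure_empty mult_zero_right)
next
  case True
  \<comment> \<open>Only arrival streams are really split in two; for any other source the second
    half is trivial.\<close>
  define G where "G = (\<lambda>a b. case a of Arrivals k \<Rightarrow> (if b then increments k t u else cylinders k t)
    | _ \<Rightarrow> (if b then {\<Omega>} else source_events K X a))"
  have G_other: "G a True = {\<Omega>}" "G a False = source_events K X a" if "a \<in> other_sources" for a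
    using that by (auto simp: G_def other_sources_def split: randomness_source.splits)
  have G_arr: "G (Arrivals k) True = increments k t u" "G (Arrivals k) False = cylinders k t" for k
    by (simp_all add: G_def)
  obtain \<omega>1 where \<omega>1: "\<omega>1 \<in> \<Omega>" using P.not_empty by blast
  have top: "\<Omega> \<in> G a b" if "a \<in> sources K I" for a b
  proof -
    have "\<Omega> \<in> increments k t u" for k unfolding increments_def by (auto intro!: exI[of _ UNIV])
    moreover have "\<Omega> \<in> cylinders k t" for k
      unfolding cylinders_def using \<omega>1 by (auto intro!: exI[of _ "{}"] exI[of _ \<omega>1])
    ultimately show ?thesis
      using that unfolding sources_split by (cases b) (auto simp: G_arr G_other space_source_event)
  qed
  have ind: "P.indep_sets (\<lambda>(a, b). G a b) (sources K I \<times> UNIV)"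
  proof (rule P.indep_sets_split[OF independence source_event_Int _ top])
    show "G a b \<subseteq> source_events K X a" if aS: "a \<in> sources K I" for a b
    proof (cases "a \<in> other_sources")
      case True
      then show ?thesis by (cases b) (simp_all add: G_other space_source_event)
    next
      case False
      then obtain k where "k \<in> {1..K}" "a = Arrivals k" using aS unfolding sources_split by auto
      then show ?thesis using cylinders_subset increments_subset[OF tu]
        by (cases b) (simp_all only: G_arr)
    qed
    fix a A B assume a: "a \<in> sources K I" and AB: "A \<in> G a False" "B \<in> G a True"
    show "P.prob (A \<inter> B) = P.prob A * P.prob B"
    proof (cases "a \<in> other_sources")
      case True
      then have "A \<in> P.events" using AB source_events[OF a] by (auto simp: G_other)
      then show ?thesis using AB True by (simp add: G_other P.prob_space Int_absorb2 sets.sets_into_space)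
    next
      case False
      then obtain k where k: "k \<in> {1..K}" "a = Arrivals k" using a unfolding sources_split by auto
      then show ?thesis
        using AB P.poisson_past_increment[OF poisson_arrivals[OF k(1)] arrival_rate[OF k(1)] tu]
        by (auto simp: G_arr cylinders_def increments_def)
    qed
  qed
  \<comment> \<open>The group \<open>None\<close> gathers everything known at time \<open>t\<close>:
    the sources \<open>J\<close> and the pasts of all streams. The source \<open>a\<close> and each
    increment form groups of their own.\<close>
  let ?grp = "case_option ((J \<union> arrival_sources) \<times> {False}) (\<lambda>i. {i})"
  let ?ix = "insert None (insert (Some (a, False)) ((\<lambda>k. Some (Arrivals k, True)) ` {1..K}))"
  let ?E = "\<lambda>j. sigma_sets \<Omega> (\<Union>i\<in>?grp j. (\<lambda>(a, b). G a b) i)"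
  have "P.indep_sets ?E ?ix"
  proof (rule P.indep_sets_collect_sigma)
    have "(\<Union>j\<in>?ix. ?grp j) \<subseteq> sources K I \<times> UNIV"
      using J a unfolding sources_split by auto
    then show "P.indep_sets (\<lambda>(a, b). G a b) (\<Union>j\<in>?ix. ?grp j)"
      using ind by (rule P.indep_sets_mono_index)
    show "disjoint_family_on ?grp ?ix"
      using a J by (auto simp: disjoint_family_on_def other_sources_def)
    have "Int_stable (G a b)" if "a \<in> sources K I" for a b
      using that Int_stable_cylinders Int_stable_increments unfolding sources_split
      by (cases b) (auto simp: G_arr G_other Int_stable_def source_event_Int)
    moreover have "i \<in> sources K I \<times> UNIV" if "j \<in> ?ix" "i \<in> ?grp j" for i j
      using that J a unfolding sources_split by auto
    ultimately show "Int_stable (case i of (a, b) \<Rightarrow> G a b)" if "j \<in> ?ix" "i \<in> ?grp j" for i j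
      using that by (metis (no_types, lifting) case_prod_conv mem_Sigma_iff surj_pair)
  qed
  define A where "A = (\<lambda>j. case j of None \<Rightarrow> E
    | Some (Arrivals k, True) \<Rightarrow> {\<omega> \<in> \<Omega>. arrivals X k (t + u) \<omega> - arrivals X k t \<omega> \<in> {x k}} | _ \<Rightarrow> F)"
  have A: "A None = E" "A (Some (a, False)) = F"
    "A (Some (Arrivals k, True)) = {\<omega> \<in> \<Omega>. arrivals X k (t + u) \<omega> - arrivals X k t \<omega> \<in> {x k}}" for k
    using a by (auto simp: A_def other_sources_def split: randomness_source.splits)
  have "P.prob (\<Inter>j\<in>?ix. A j) = (\<Prod>j\<in>?ix. P.prob (A j))"
  proof (rule P.indep_setsD[OF \<open>P.indep_sets ?E ?ix\<close>])
    have "E \<in> ?E None"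
    proof -
      have "source_events K X a \<subseteq> (\<Union>i\<in>?grp None. (\<lambda>(a, b). G a b) i)" if "a \<in> J" for a
        using that J by (intro SUP_upper2[of "(a, False)"]) (auto simp: G_other)
      moreover have "cylinders k t \<subseteq> (\<Union>i\<in>?grp None. (\<lambda>(a, b). G a b) i)" if "k \<in> {1..K}" for k
        using that by (intro SUP_upper2[of "(Arrivals k, False)"]) (auto simp: G_arr)
      ultimately have "(\<Union>a\<in>J. source_events K X a) \<union> (\<Union>k\<in>{1..K}. cylinders k t)
          \<subseteq> (\<Union>i\<in>?grp None. (\<lambda>(a, b). G a b) i)"
        by (intro Un_least UN_least)
      then show ?thesis using E unfolding sets_past[OF J] by (rule subsetD[OF sigma_sets_mono'])
    qed
    moreover have "F \<in> ?E (Some (a, False))" using F a by (auto simp: G_other)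
    moreover have "A (Some (Arrivals k, True)) \<in> ?E (Some (Arrivals k, True))" for k
      unfolding A by (rule sigma_sets.Basic) (auto simp: G_arr increments_def)
    ultimately show "\<forall>j\<in>?ix. A j \<in> ?E j" by (auto simp: A)
  qed auto
  also have "(\<Inter>j\<in>?ix. A j) = E \<inter> F \<inter> (\<Inter>k\<in>{1..K}. A (Some (Arrivals k, True)))"
    by (simp only: INT_insert A(1,2) INT_simps image_image Int_assoc)
  also have "\<dots> = E \<inter> F \<inter> {\<omega> \<in> \<Omega>. arrived t (t + u) \<omega> = x}"
  proof -
    have "E \<subseteq> \<Omega>" using E past_subset[OF J, of t] by (intro sets.sets_into_space) auto
    moreover have "\<omega> \<in> (\<Inter>k\<in>{1..K}. A (Some (Arrivals k, True))) \<longleftrightarrow> arrived t (t + u) \<omega> = x"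
      if "\<omega> \<in> \<Omega>" for \<omega>
      using True that unfolding A arrived_def fun_eq_iff vecs_def by auto
    ultimately show ?thesis by blast
  qed
  also have "(\<Prod>j\<in>?ix. P.prob (A j)) = P.prob E * (P.prob F * (\<Prod>k\<in>{1..K}. P.prob (A (Some (Arrivals k, True)))))"
  proof -
    have "(\<Prod>j\<in>(\<lambda>k. Some (Arrivals k, True)) ` {1..K}. P.prob (A j))
        = (\<Prod>k\<in>{1..K}. P.prob (A (Some (Arrivals k, True))))"
      by (subst prod.reindex) (auto simp: inj_on_def)
    then show ?thesis by (subst prod.insert; (subst prod.insert)?) (auto simp: A(1,2))
  qed
  also have "(\<Prod>k\<in>{1..K}. P.prob (A (Some (Arrivals k, True)))) = (\<Prod>k\<in>{1..K}. pmf (pois (lam k * u)) (x k))"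
    unfolding A by (rule arrived_law[OF tu])
  also have "\<dots> = pmf (vec_pois {1..K} lam u) x"
    using True by (simp only: pmf_vec_pois finite_atLeastAtMost if_True)
  finally show ?thesis by (simp add: mult.assoc)
qed

end

lemma tendsto_pmf_vec_pois:
  assumes "finite A" "\<And>k. k \<in> A \<Longrightarrow> 0 \<le> lam k" "s \<longlonglongrightarrow> s0" "\<And>n. 0 \<le> s n" "0 \<le> s0"
  shows "(\<lambda>n. pmf (vec_pois A lam (s n)) x) \<longlonglongrightarrow> pmf (vec_pois A lam s0) x"
proof (cases "x \<in> vecs A")
  case True
  have "(\<lambda>n. \<Prod>k\<in>A. (lam k * s n) ^ x k / fact (x k) * exp (- (lam k * s n)))
      \<longlonglongrightarrow> (\<Prod>k\<in>A. (lam k * s0) ^ x k / fact (x k) * exp (- (lam k * s0)))"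
    by (intro tendsto_intros assms) auto
  then show ?thesis
    using assms True by (simp add: pmf_vec_pois pmf_pois)
qed (use assms in \<open>simp add: pmf_vec_pois\<close>)

section \<open>Events known at a stopping time, and the strong Markov property\<close>

context bep_model
begin

declare One_nat_def [simp del] source_events.simps [simp del]

text \<open>\<open>A\<close> is an event of the \<open>\<sigma>\<close>-algebra of the stopping time \<open>T\<close>; only the values of \<open>T\<close> on \<open>A\<close> matter.\<close>

definition hist :: "randomness_source set \<Rightarrow> ('w \<Rightarrow> real) \<Rightarrow> 'w set \<Rightarrow> bool" where
  "hist J T A \<longleftrightarrow> J \<subseteq> other_sources \<and> A \<subseteq> \<Omega> \<and> (\<forall>\<omega>\<in>A. 0 \<le> T \<omega>) \<and>
    (\<forall>t. {\<omega> \<in> A. T \<omega> \<le> t} \<in> sets (past J t))"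

lemma histD:
  assumes "hist J T A"
  shows "J \<subseteq> other_sources" "A \<subseteq> \<Omega>" "\<omega> \<in> A \<Longrightarrow> 0 \<le> T \<omega>" "{\<omega> \<in> A. T \<omega> \<le> t} \<in> sets (past J t)"
  using assms by (auto simp: hist_def)

lemma hist_events: "hist J T A \<Longrightarrow> A \<in> P.events"
proof -
  assume H: "hist J T A"
  have "{\<omega> \<in> A. T \<omega> \<le> real n} \<in> P.events" for n
    by (rule subsetD[OF past_subset[OF histD(1)[OF H]] histD(4)[OF H]])
  then have "(\<Union>n\<in>UNIV. {\<omega> \<in> A. T \<omega> \<le> real n}) \<in> P.events"
    by (intro sets.countable_UN'') auto
  also have "(\<Union>n\<in>UNIV. {\<omega> \<in> A. T \<omega> \<le> real n}) = A" using real_arch_simple by auto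
  finally show ?thesis .
qed

lemma hist_mono: "hist J T A \<Longrightarrow> J \<subseteq> J' \<Longrightarrow> J' \<subseteq> other_sources \<Longrightarrow> hist J' T A"
proof -
  assume H: "hist J T A" and J: "J \<subseteq> J'" "J' \<subseteq> other_sources"
  have "{\<omega> \<in> A. T \<omega> \<le> t} \<in> sets (past J' t)" for t
    by (rule subsetD[OF past_mono[OF J order_refl] histD(4)[OF H]])
  then show ?thesis using histD(2,3)[OF H] J(2) by (simp add: hist_def)
qed

lemma hist_cong: "hist J T A \<Longrightarrow> (\<And>\<omega>. \<omega> \<in> A \<Longrightarrow> T \<omega> = T' \<omega>) \<Longrightarrow> hist J T' A"
proof -
  assume H: "hist J T A" and eq: "\<And>\<omega>. \<omega> \<in> A \<Longrightarrow> T \<omega> = T' \<omega>"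
  have "{\<omega> \<in> A. T' \<omega> \<le> t} = {\<omega> \<in> A. T \<omega> \<le> t}" for t using eq by auto
  then show ?thesis using H eq unfolding hist_def by simp
qed

lemma hist_UN:
  assumes "countable I'" "I' \<noteq> {}" "\<And>i. i \<in> I' \<Longrightarrow> hist J T (A i)"
  shows "hist J T (\<Union>i\<in>I'. A i)"
proof -
  have "{\<omega> \<in> \<Union>i\<in>I'. A i. T \<omega> \<le> t} = (\<Union>i\<in>I'. {\<omega> \<in> A i. T \<omega> \<le> t})" for t by auto
  moreover have "(\<Union>i\<in>I'. {\<omega> \<in> A i. T \<omega> \<le> t}) \<in> sets (past J t)" for t
    using assms(1) histD(4)[OF assms(3)] by (intro sets.countable_UN'') auto
  ultimately have "{\<omega> \<in> \<Union>i\<in>I'. A i. T \<omega> \<le> t} \<in> sets (past J t)" for t by simp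
  moreover have "J \<subseteq> other_sources" using assms(2,3) by (auto dest: histD(1))
  moreover have "(\<Union>i\<in>I'. A i) \<subseteq> \<Omega>" using assms(3) by (intro UN_least histD(2))
  moreover have "\<forall>\<omega>\<in>\<Union>i\<in>I'. A i. 0 \<le> T \<omega>" using histD(3)[OF assms(3)] by blast
  ultimately show ?thesis unfolding hist_def by blast
qed

lemma hist_empty: "J \<subseteq> other_sources \<Longrightarrow> hist J T {}"
  by (auto simp: hist_def)

lemma hist_Diff: "hist J T A \<Longrightarrow> hist J T B \<Longrightarrow> hist J T (A - B)"
proof -
  assume H: "hist J T A" "hist J T B"
  have "{\<omega> \<in> A - B. T \<omega> \<le> t} = {\<omega> \<in> A. T \<omega> \<le> t} - {\<omega> \<in> B. T \<omega> \<le> t}" for t by auto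
  moreover have "{\<omega> \<in> A. T \<omega> \<le> t} - {\<omega> \<in> B. T \<omega> \<le> t} \<in> sets (past J t)" for t
    by (intro sets.Diff histD(4) H)
  moreover have "A - B \<subseteq> \<Omega>" using histD(2)[OF H(1)] by (rule order_trans[OF Diff_subset])
  ultimately show ?thesis using histD(1,3)[OF H(1)] by (simp add: hist_def)
qed

lemma hist_source: "hist J T A \<Longrightarrow> a \<in> J \<Longrightarrow> F \<in> source_events K X a \<Longrightarrow> hist J T (A \<inter> F)"
proof -
  assume H: "hist J T A" and a: "a \<in> J" "F \<in> source_events K X a"
  have "{\<omega> \<in> A \<inter> F. T \<omega> \<le> t} = {\<omega> \<in> A. T \<omega> \<le> t} \<inter> F" for t by auto
  moreover have "{\<omega> \<in> A. T \<omega> \<le> t} \<inter> F \<in> sets (past J t)" for t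
    by (intro sets.Int histD(4) H source_in_past[OF _ a] histD(1)[OF H])
  moreover have "A \<inter> F \<subseteq> \<Omega>" using histD(2)[OF H] by (rule order_trans[OF Int_lower1])
  ultimately show ?thesis using histD(1,3)[OF H] by (simp add: hist_def)
qed

lemma hist_arrivals_le:
  assumes H: "hist J T A" and k: "k \<in> {1..K}"
  shows "hist J T {\<omega> \<in> A. arrivals X k (T \<omega>) \<omega> \<le> n}"
proof -
  note J = histD(1)[OF H]
  have "{\<omega> \<in> {\<omega> \<in> A. arrivals X k (T \<omega>) \<omega> \<le> n}. T \<omega> \<le> t} \<in> sets (past J t)" for t
  proof (cases "0 \<le> t")
    case False
    then have "{\<omega> \<in> {\<omega> \<in> A. arrivals X k (T \<omega>) \<omega> \<le> n}. T \<omega> \<le> t} = {}"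
      using histD(3)[OF H] by fastforce
    then show ?thesis by (simp only: sets.empty_sets)
  next
    case t: True
    \<comment> \<open>By monotonicity and right-continuity, at most \<open>n\<close> arrivals up to
      \<open>T\<close> means at most \<open>n\<close> arrivals up to some rational \<open>q\<close>
      after \<open>T\<close>. The time \<open>q\<close> must not exceed \<open>t\<close> to belong
      to the past, so \<open>t\<close> itself is added for the case \<open>T = t\<close>.\<close>
    define Q where "Q = insert t {q \<in> \<rat>. 0 \<le> q \<and> q \<le> t}"
    have Q: "countable Q" unfolding Q_def
      using countable_rat by (auto intro: countable_subset[of _ "\<rat>"])
    have "{\<omega> \<in> {\<omega> \<in> A. arrivals X k (T \<omega>) \<omega> \<le> n}. T \<omega> \<le> t}
        = (\<Union>q\<in>Q. {\<omega> \<in> A. T \<omega> \<le> q} \<inter> {\<omega> \<in> \<Omega>. arrivals X k q \<omega> \<in> {..n}})" (is "?L = ?R")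
    proof (intro equalityI subsetI)
      fix \<omega> assume \<omega>: "\<omega> \<in> ?L"
      then have T: "0 \<le> T \<omega>" "T \<omega> \<le> t" "\<omega> \<in> \<Omega>" using histD(2,3)[OF H] by auto
      show "\<omega> \<in> ?R"
      proof (cases "T \<omega> = t")
        case True
        then show ?thesis using \<omega> T by (auto simp: Q_def)
      next
        case False
        obtain b where b: "b > T \<omega>" "\<And>u. T \<omega> \<le> u \<Longrightarrow> u < b \<Longrightarrow> arrivals X k u \<omega> = arrivals X k (T \<omega>) \<omega>"
          using P.poisson_right_constant[OF poisson_arrivals[OF k] arrival_rate[OF k] T(3,1)] by blast
        have "T \<omega> < min b t" using b(1) T False by simp
        then obtain q where q: "q \<in> \<rat>" "T \<omega> < q" "q < min b t" using Rats_dense_in_real by blast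
        then have "q \<in> Q" "arrivals X k q \<omega> \<le> n" using T b(2)[of q] \<omega> by (auto simp: Q_def)
        then show ?thesis using \<omega> T q by (auto intro!: bexI[of _ q])
      qed
    next
      fix \<omega> assume "\<omega> \<in> ?R"
      then obtain q where q: "q \<in> Q" "\<omega> \<in> A" "T \<omega> \<le> q" "arrivals X k q \<omega> \<le> n" by auto
      moreover have "arrivals X k (T \<omega>) \<omega> \<le> arrivals X k q \<omega>"
        using q histD(2,3)[OF H] by (intro arr_mono[OF k]) auto
      moreover have "q \<le> t" using q(1) by (auto simp: Q_def)
      ultimately show "\<omega> \<in> ?L" by auto
    qed
    also have "\<dots> \<in> sets (past J t)"
    proof (intro sets.countable_UN'' Q sets.Int)
      fix q assume "q \<in> Q"
      then have q: "0 \<le> q" "q \<le> t" using t by (auto simp: Q_def)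
      show "{\<omega> \<in> A. T \<omega> \<le> q} \<in> sets (past J t)"
        by (rule subsetD[OF past_mono[OF order_refl J q(2)] histD(4)[OF H]])
      show "{\<omega> \<in> \<Omega>. arrivals X k q \<omega> \<in> {..n}} \<in> sets (past J t)"
        by (rule arrivals_in_past[OF J k q])
    qed
    finally show ?thesis .
  qed
  moreover have "{\<omega> \<in> A. arrivals X k (T \<omega>) \<omega> \<le> n} \<subseteq> \<Omega>"
    using histD(2)[OF H] by (rule order_trans[OF Collect_restrict])
  ultimately show ?thesis using histD(1,3)[OF H] by (simp add: hist_def)
qed

lemma hist_arrivals:
  assumes H: "hist J T A" and k: "k \<in> {1..K}"
  shows "hist J T {\<omega> \<in> A. arrivals X k (T \<omega>) \<omega> = n}"
proof (cases n)
  case 0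
  then show ?thesis using hist_arrivals_le[OF H k, of 0] by simp
next
  case (Suc m)
  have "{\<omega> \<in> A. arrivals X k (T \<omega>) \<omega> = n}
      = {\<omega> \<in> A. arrivals X k (T \<omega>) \<omega> \<le> n} - {\<omega> \<in> A. arrivals X k (T \<omega>) \<omega> \<le> m}"
    unfolding Suc by auto
  then show ?thesis using hist_Diff[OF hist_arrivals_le[OF H k] hist_arrivals_le[OF H k]] by simp
qed

lemma hist_add:
  assumes H: "hist J T A" and a: "a \<in> J" and S: "\<And>B. B \<in> sets borel \<Longrightarrow> S -` B \<inter> \<Omega> \<in> source_events K X a"
    and nonneg: "\<And>\<omega>. \<omega> \<in> \<Omega> \<Longrightarrow> 0 \<le> S \<omega>"
  shows "hist J (\<lambda>\<omega>. T \<omega> + S \<omega>) A"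
proof -
  note J = histD(1)[OF H]
  have "{\<omega> \<in> A. T \<omega> + S \<omega> \<le> t} \<in> sets (past J t)" for t
  proof -
    \<comment> \<open>\<open>T\<close> is known only on the event where it is at most
      \<open>t\<close>. Elsewhere it is replaced by \<open>t + 1\<close>, which keeps the sum above
      \<open>t\<close> because \<open>S\<close> is nonnegative.\<close>
    define T' where "T' = (\<lambda>\<omega>. if \<omega> \<in> A \<and> T \<omega> \<le> t then T \<omega> else t + 1)"
    have T'_le: "{\<omega> \<in> \<Omega>. T' \<omega> \<le> c} \<in> sets (past J t)" for c
    proof -
      consider "t + 1 \<le> c" | "t \<le> c" "c < t + 1" | "c < t" by linarith
      then show ?thesis
      proof cases
        case 1
        then have "{\<omega> \<in> \<Omega>. T' \<omega> \<le> c} = space (past J t)" using J by (auto simp: T'_def)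
        then show ?thesis by (simp only: sets.top)
      next
        case 2
        then have "{\<omega> \<in> \<Omega>. T' \<omega> \<le> c} = {\<omega> \<in> A. T \<omega> \<le> t}" using histD(2)[OF H] by (auto simp: T'_def)
        then show ?thesis using histD(4)[OF H] by simp
      next
        case 3
        then have "{\<omega> \<in> \<Omega>. T' \<omega> \<le> c} = {\<omega> \<in> A. T \<omega> \<le> c}" using histD(2)[OF H] by (auto simp: T'_def)
        moreover have "sets (past J c) \<subseteq> sets (past J t)" using 3 J by (intro past_mono) auto
        ultimately show ?thesis using histD(4)[OF H, of c] by auto
      qed
    qed
    have m1: "T' \<in> borel_measurable (past J t)"
      unfolding borel_measurable_iff_le using T'_le J by simp
    have m2: "S \<in> borel_measurable (past J t)"
      using S source_in_past[OF J a] J by (auto simp: measurable_def)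
    have "{\<omega> \<in> space (past J t). T' \<omega> + S \<omega> \<le> t} \<in> sets (past J t)"
      using m1 m2 by measurable
    also have "{\<omega> \<in> space (past J t). T' \<omega> + S \<omega> \<le> t} = {\<omega> \<in> A. T \<omega> + S \<omega> \<le> t}"
    proof (intro equalityI subsetI)
      fix \<omega> assume w: "\<omega> \<in> {\<omega> \<in> space (past J t). T' \<omega> + S \<omega> \<le> t}"
      then have "0 \<le> S \<omega>" using J nonneg by simp
      then show "\<omega> \<in> {\<omega> \<in> A. T \<omega> + S \<omega> \<le> t}" using w by (auto simp: T'_def split: if_splits)
    next
      fix \<omega> assume w: "\<omega> \<in> {\<omega> \<in> A. T \<omega> + S \<omega> \<le> t}"
      then have "\<omega> \<in> \<Omega>" "0 \<le> S \<omega>" using histD(2)[OF H] nonneg by auto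
      then show "\<omega> \<in> {\<omega> \<in> space (past J t). T' \<omega> + S \<omega> \<le> t}" using w J by (auto simp: T'_def)
    qed
    finally show ?thesis .
  qed
  moreover have "0 \<le> T \<omega> + S \<omega>" if "\<omega> \<in> A" for \<omega>
    using histD(3)[OF H that] nonneg[OF subsetD[OF histD(2)[OF H] that]] by simp
  ultimately show ?thesis using histD(1,2)[OF H] by (simp add: hist_def)
qed

lemma hist_arrived:
  assumes H: "hist J T A" and a: "a \<in> J" and S: "\<And>B. B \<in> sets borel \<Longrightarrow> S -` B \<inter> \<Omega> \<in> source_events K X a"
    and nonneg: "\<And>\<omega>. \<omega> \<in> \<Omega> \<Longrightarrow> 0 \<le> S \<omega>"
  shows "hist J (\<lambda>\<omega>. T \<omega> + S \<omega>) {\<omega> \<in> A. arrived (T \<omega>) (T \<omega> + S \<omega>) \<omega> = x}"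
proof -
  have one: "hist J (\<lambda>\<omega>. T \<omega> + S \<omega>) {\<omega> \<in> B. arrivals X k (T \<omega> + S \<omega>) \<omega> - arrivals X k (T \<omega>) \<omega> = x k}"
    if B: "hist J T B" and k: "k \<in> {1..K}" for B k
  proof -
    have 1: "{\<omega> \<in> B. arrivals X k (T \<omega> + S \<omega>) \<omega> - arrivals X k (T \<omega>) \<omega> = x k}
        = (\<Union>n. {\<omega> \<in> {\<omega> \<in> B. arrivals X k (T \<omega>) \<omega> = n}. arrivals X k (T \<omega> + S \<omega>) \<omega> = n + x k})"
    proof -
      have "arrivals X k (T \<omega>) \<omega> \<le> arrivals X k (T \<omega> + S \<omega>) \<omega>" if "\<omega> \<in> B" for \<omega>
        using that histD(2,3)[OF B] nonneg by (intro arr_mono[OF k]) auto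
      then show ?thesis by fastforce
    qed
    show ?thesis unfolding 1
      by (intro hist_UN hist_arrivals[OF _ k] hist_add[OF _ a S nonneg] hist_arrivals[OF B k]) auto
  qed
  show ?thesis
  proof (cases "x \<in> vecs {1..K} \<and> {1..K} \<noteq> {}")
    case False
    have "{\<omega> \<in> A. arrived (T \<omega>) (T \<omega> + S \<omega>) \<omega> = x} = (if x \<in> vecs {1..K} then A else {})"
      using False by (auto simp: arrived_def vecs_def fun_eq_iff)
    then show ?thesis using hist_add[OF H a S nonneg] hist_empty[OF histD(1)[OF H]] by simp
  next
    case True
    let ?E = "\<lambda>k. {\<omega> \<in> A. arrivals X k (T \<omega> + S \<omega>) \<omega> - arrivals X k (T \<omega>) \<omega> = x k}"
    have "{\<omega> \<in> A. arrived (T \<omega>) (T \<omega> + S \<omega>) \<omega> = x} = A - (\<Union>k\<in>{1..K}. A - ?E k)"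
      using True by (auto simp: arrived_def vecs_def fun_eq_iff)
    also have "hist J (\<lambda>\<omega>. T \<omega> + S \<omega>) \<dots>"
      using True by (intro hist_Diff hist_UN hist_add[OF H a S nonneg] one[OF H]) auto
    finally show ?thesis .
  qed
qed

text \<open>The duration \<open>S\<close> comes from a source outside \<open>J\<close>, so it is
  independent of everything known at \<open>T\<close>. The arrivals during it therefore follow the
  mixed Poisson law, whatever the history.\<close>

theorem strong_markov:
  assumes H: "hist J T A" and a: "a \<in> other_sources" "a \<notin> J"
    and S_measurable: "S \<in> borel_measurable (sample_space X)"
    and S: "\<And>B. B \<in> sets borel \<Longrightarrow> S -` B \<inter> \<Omega> \<in> source_events K X a"
    and nonneg: "\<And>\<omega>. \<omega> \<in> \<Omega> \<Longrightarrow> 0 \<le> S \<omega>"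
  shows "P.prob {\<omega> \<in> A. arrived (T \<omega>) (T \<omega> + S \<omega>) \<omega> = x}
    = P.prob A * pmf (arrival_law {1..K} lam (distr (sample_space X) borel S)) x"
proof -
  note J = histD(1)[OF H] and A = histD(2)[OF H] and T = histD(3)[OF H]
  let ?M = "sample_space X"
  have A_ev [measurable]: "A \<in> sets ?M" by (rule hist_events[OF H])
  note S_measurable [measurable]
  \<comment> \<open>Replace \<open>T\<close> and \<open>S\<close> by the next multiples of \<open>1 / (n + 1)\<close>; by right-continuity the
    arrivals do not change for large \<open>n\<close>.\<close>
  define g where "g = (\<lambda>n z. nat \<lceil>z * real (Suc n)\<rceil>)"
  define d where "d = (\<lambda>n z. real (g n z) / real (Suc n))"
  have g_le: "g n z \<le> i \<longleftrightarrow> z \<le> real i / real (Suc n)" for n z i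
    unfolding g_def by (simp add: nat_le_iff ceiling_le_iff pos_le_divide_eq)
  have d_ge: "z \<le> d n z" for n z
    using g_le[of n z "g n z"] by (simp add: d_def)
  have d_le: "d n z \<le> z + 1 / real (Suc n)" if "0 \<le> z" for n z
  proof -
    have "real (g n z) = of_int \<lceil>z * real (Suc n)\<rceil>"
      unfolding g_def using that by (intro of_nat_nat) (simp add: le_ceiling_iff order.strict_trans2[of _ 0])
    then have "real (g n z) \<le> z * real (Suc n) + 1" by linarith
    then have "real (g n z) / real (Suc n) \<le> (z * real (Suc n) + 1) / real (Suc n)"
      by (rule divide_right_mono) simp
    also have "\<dots> = z + 1 / real (Suc n)" by (subst add_divide_distrib) simp
    finally show ?thesis unfolding d_def .
  qed
  have d_tendsto: "(\<lambda>n. d n z) \<longlonglongrightarrow> z" if "0 \<le> z" for z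
  proof (rule real_tendsto_sandwich[of "\<lambda>_. z" _ _ "\<lambda>n. z + 1 / real (Suc n)"])
    have "(\<lambda>n. z + 1 / real (Suc n)) \<longlonglongrightarrow> z + 0"
      by (intro tendsto_add tendsto_const LIMSEQ_Suc[OF lim_1_over_n])
    then show "(\<lambda>n. z + 1 / real (Suc n)) \<longlonglongrightarrow> z" by simp
  qed (use d_ge d_le that in auto)
  have d_nonneg: "0 \<le> d n z" for n z by (simp add: d_def)
  define D where "D = (\<lambda>n. {\<omega> \<in> A. arrived (d n (T \<omega>)) (d n (T \<omega>) + d n (S \<omega>)) \<omega> = x})"
  define DT where "DT = {\<omega> \<in> A. arrived (T \<omega>) (T \<omega> + S \<omega>) \<omega> = x}"
  have F_eq: "{\<omega> \<in> \<Omega>. g n (S \<omega>) = j} = S -` {s. g n s = j} \<inter> \<Omega>" for n j by auto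
  have g_borel: "{s. g n s = j} \<in> sets borel" for n j
  proof -
    have "g n \<in> measurable borel (count_space UNIV)" unfolding g_def by measurable
    from measurable_sets[OF this, of "{j}"] show ?thesis by (simp add: vimage_def)
  qed
  have F: "{\<omega> \<in> \<Omega>. g n (S \<omega>) = j} \<in> source_events K X a" for n j
    unfolding F_eq by (rule S[OF g_borel])
  have F_ev: "{\<omega> \<in> \<Omega>. g n (S \<omega>) = j} \<in> sets ?M" for n j
    unfolding F_eq by (rule measurable_sets[OF S_measurable g_borel])
  have E: "{\<omega> \<in> A. g n (T \<omega>) = i} \<in> sets (past J (real i / real (Suc n)))" for n i
  proof (cases i)
    case 0
    have "{\<omega> \<in> A. g n (T \<omega>) = i} = {\<omega> \<in> A. T \<omega> \<le> real i / real (Suc n)}"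
      using g_le[of n _ i] unfolding 0 by auto
    then show ?thesis using histD(4)[OF H] by simp
  next
    case (Suc i')
    have "{\<omega> \<in> A. g n (T \<omega>) = i}
        = {\<omega> \<in> A. T \<omega> \<le> real i / real (Suc n)} - {\<omega> \<in> A. T \<omega> \<le> real i' / real (Suc n)}"
      unfolding g_le[symmetric] Suc by auto
    moreover have "{\<omega> \<in> A. T \<omega> \<le> real i' / real (Suc n)} \<in> sets (past J (real i / real (Suc n)))"
      by (rule subsetD[OF past_mono[OF order_refl J] histD(4)[OF H]])
        (simp add: Suc divide_right_mono)
    ultimately show ?thesis using sets.Diff[OF histD(4)[OF H]] by simp
  qed
  have E_ev: "{\<omega> \<in> A. g n (T \<omega>) = i} \<in> sets ?M" for n i
    by (rule subsetD[OF past_subset[OF J] E])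
  let ?t = "\<lambda>n i. real i / real (Suc n)"
  have R_ev: "{\<omega> \<in> \<Omega>. arrived t (t + u) \<omega> = x} \<in> sets ?M" if "0 \<le> t" "0 \<le> u" for t u
  proof -
    have "{\<omega> \<in> \<Omega>. arrived t (t + u) \<omega> = x}
        = (if x \<in> vecs {1..K} then {\<omega> \<in> \<Omega>. \<forall>k\<in>{1..K}. arrivals X k (t + u) \<omega> - arrivals X k t \<omega> = x k} else {})"
      by (auto simp: arrived_def vecs_def fun_eq_iff)
    moreover have "{\<omega> \<in> \<Omega>. arrivals X k (t + u) \<omega> - arrivals X k t \<omega> = x k} \<in> sets ?M" if "k \<in> {1..K}" for k
    proof -
      have "(\<lambda>\<omega>. arrivals X k (t + u) \<omega> - arrivals X k t \<omega>) \<in> measurable ?M (count_space UNIV)"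
        using \<open>0 \<le> t\<close> \<open>0 \<le> u\<close> that by (intro measurable_nat_diff arr_measurable) auto
      from measurable_sets[OF this, of "{x k}"] show ?thesis
        by (simp add: vimage_def Int_def conj_commute)
    qed
    ultimately show ?thesis by (simp add: sets.sets_Collect_finite_All)
  qed
  \<comment> \<open>On one block both rounded times are constants, so the deterministic version
    applies.\<close>
  have block: "emeasure ?M ({\<omega> \<in> A. g n (T \<omega>) = i} \<inter> {\<omega> \<in> \<Omega>. g n (S \<omega>) = j}
        \<inter> {\<omega> \<in> \<Omega>. arrived (?t n i) (?t n i + ?t n j) \<omega> = x})
      = emeasure ?M {\<omega> \<in> A. g n (T \<omega>) = i} *
        (emeasure ?M {\<omega> \<in> \<Omega>. g n (S \<omega>) = j} * pmf (vec_pois {1..K} lam (?t n j)) x)" for n i j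
    using past_indep[OF J a _ _ E F, of i n "?t n j" n j x]
    by (simp add: P.emeasure_eq_measure ennreal_mult'[symmetric] mult.assoc)
  have split: "D n = (\<Union>i. \<Union>j. {\<omega> \<in> A. g n (T \<omega>) = i} \<inter> {\<omega> \<in> \<Omega>. g n (S \<omega>) = j}
        \<inter> {\<omega> \<in> \<Omega>. arrived (?t n i) (?t n i + ?t n j) \<omega> = x})" for n
    using A by (auto simp: D_def d_def)
  have D_ev: "D n \<in> sets ?M" for n
    unfolding split by (intro sets.countable_UN'' sets.Int E_ev F_ev R_ev) auto
  have fubini: "emeasure ?M (D n) = emeasure ?M A * (\<integral>\<^sup>+\<omega>. pmf (vec_pois {1..K} lam (d n (S \<omega>))) x \<partial>?M)" for n
  proof -
    let ?B = "\<lambda>i j. {\<omega> \<in> A. g n (T \<omega>) = i} \<inter> {\<omega> \<in> \<Omega>. g n (S \<omega>) = j}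
        \<inter> {\<omega> \<in> \<Omega>. arrived (?t n i) (?t n i + ?t n j) \<omega> = x}"
    have B_ev: "?B i j \<in> sets ?M" for i j
      by (intro sets.Int E_ev F_ev R_ev) auto
    have "emeasure ?M (D n) = (\<Sum>i. emeasure ?M (\<Union>j. ?B i j))"
      unfolding split using B_ev by (intro suminf_emeasure[symmetric]) (auto simp: disjoint_family_on_def)
    also have "\<dots> = (\<Sum>i. \<Sum>j. emeasure ?M (?B i j))"
      using B_ev by (intro suminf_cong suminf_emeasure[symmetric]) (auto simp: disjoint_family_on_def)
    also have "\<dots> = (\<Sum>i. emeasure ?M {\<omega> \<in> A. g n (T \<omega>) = i})
        * (\<Sum>j. emeasure ?M {\<omega> \<in> \<Omega>. g n (S \<omega>) = j} * pmf (vec_pois {1..K} lam (?t n j)) x)"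
      unfolding block by simp
    also have "(\<Sum>i. emeasure ?M {\<omega> \<in> A. g n (T \<omega>) = i}) = emeasure ?M A"
    proof -
      have "(\<Sum>i. emeasure ?M {\<omega> \<in> A. g n (T \<omega>) = i}) = emeasure ?M (\<Union>i. {\<omega> \<in> A. g n (T \<omega>) = i})"
        using E_ev by (intro suminf_emeasure) (auto simp: disjoint_family_on_def)
      also have "(\<Union>i. {\<omega> \<in> A. g n (T \<omega>) = i}) = A" by auto
      finally show ?thesis .
    qed
    also have "(\<Sum>j. emeasure ?M {\<omega> \<in> \<Omega>. g n (S \<omega>) = j} * pmf (vec_pois {1..K} lam (?t n j)) x)
        = (\<Sum>j. \<integral>\<^sup>+\<omega>. ennreal (pmf (vec_pois {1..K} lam (?t n j)) x) * indicator {\<omega> \<in> \<Omega>. g n (S \<omega>) = j} \<omega> \<partial>?M)"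
      using F_ev by (simp add: nn_integral_cmult_indicator mult.commute)
    also have "\<dots> = (\<integral>\<^sup>+\<omega>. (\<Sum>j. ennreal (pmf (vec_pois {1..K} lam (?t n j)) x) * indicator {\<omega> \<in> \<Omega>. g n (S \<omega>) = j} \<omega>) \<partial>?M)"
      using F_ev by (intro nn_integral_suminf[symmetric]) auto
    also have "\<dots> = (\<integral>\<^sup>+\<omega>. pmf (vec_pois {1..K} lam (d n (S \<omega>))) x \<partial>?M)"
      by (intro nn_integral_cong, subst suminf_cmult_indicator) (auto simp: d_def disjoint_family_on_def)
    finally show ?thesis .
  qed
  have v_meas: "(\<lambda>\<omega>. pmf (vec_pois {1..K} lam (h \<omega>)) x) \<in> borel_measurable ?M" if "h \<in> borel_measurable ?M" for h
    by (rule measurable_compose[OF that measurable_pmf_vec_pois]) simp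
  have d_meas: "(\<lambda>\<omega>. d n (S \<omega>)) \<in> borel_measurable ?M" for n
    unfolding d_def g_def by measurable
  have D_prob: "P.prob (D n) = P.prob A * (\<integral>\<omega>. pmf (vec_pois {1..K} lam (d n (S \<omega>))) x \<partial>?M)" for n
  proof -
    have "(\<integral>\<^sup>+\<omega>. pmf (vec_pois {1..K} lam (d n (S \<omega>))) x \<partial>?M)
        = ennreal (\<integral>\<omega>. pmf (vec_pois {1..K} lam (d n (S \<omega>))) x \<partial>?M)"
      using v_meas[OF d_meas]
      by (intro nn_integral_eq_integral P.integrable_const_bound[where B = 1]) (auto simp: pmf_le_1)
    then show ?thesis
      using fubini[of n] by (simp add: P.emeasure_eq_measure ennreal_mult'[symmetric])
  qed
  have DT_ev: "DT \<in> sets ?M"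
  proof -
    \<comment> \<open>Counting \<open>a\<close> among the known sources makes \<open>T + S\<close> a
      time at which the arrivals can be observed, whence measurability of the limit event.\<close>
    have "hist (insert a J) T A" using H a J by (intro hist_mono[OF H]) auto
    from hist_arrived[OF this _ S nonneg] show ?thesis unfolding DT_def by (intro hist_events) auto
  qed
  have ev_const: "\<forall>\<^sub>F n in sequentially. arrivals X k (u n) \<omega> = arrivals X k v \<omega>"
    if k: "k \<in> {1..K}" and w: "\<omega> \<in> \<Omega>" "0 \<le> v" and u: "u \<longlonglongrightarrow> v" "\<And>n. v \<le> u n" for k \<omega> u v
  proof -
    obtain b where b: "b > v" "\<And>u. v \<le> u \<Longrightarrow> u < b \<Longrightarrow> arrivals X k u \<omega> = arrivals X k v \<omega>"
      using P.poisson_right_constant[OF poisson_arrivals[OF k] arrival_rate[OF k] w] by blast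
    have "\<forall>\<^sub>F n in sequentially. u n < b" using u(1) b(1) by (rule order_tendstoD(2))
    then show ?thesis by eventually_elim (use b(2) u(2) in auto)
  qed
  have ptw: "(\<lambda>n. indicator (D n) \<omega> :: real) \<longlonglongrightarrow> indicator DT \<omega>" if "\<omega> \<in> \<Omega>" for \<omega>
  proof (cases "\<omega> \<in> A")
    case True
    have "0 \<le> T \<omega>" "0 \<le> S \<omega>" using T True nonneg that by auto
    then have "\<forall>\<^sub>F n in sequentially. \<forall>k\<in>{1..K}. arrivals X k (d n (T \<omega>)) \<omega> = arrivals X k (T \<omega>) \<omega> \<and>
        arrivals X k (d n (T \<omega>) + d n (S \<omega>)) \<omega> = arrivals X k (T \<omega> + S \<omega>) \<omega>"
      using that by (intro eventually_ball_finite ballI eventually_conj ev_const tendsto_add d_tendsto d_ge add_mono) auto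
    then have "\<forall>\<^sub>F n in sequentially. indicator (D n) \<omega> = (indicator DT \<omega> :: real)"
    proof eventually_elim
      case (elim n)
      then have "arrived (d n (T \<omega>)) (d n (T \<omega>) + d n (S \<omega>)) \<omega> = arrived (T \<omega>) (T \<omega> + S \<omega>) \<omega>"
        by (auto simp: arrived_def fun_eq_iff)
      then show ?case by (simp add: D_def DT_def indicator_def)
    qed
    then show ?thesis by (rule tendsto_eventually)
  qed (simp add: D_def DT_def)
  have "(\<lambda>n. \<integral>\<omega>. indicator (D n) \<omega> \<partial>?M) \<longlonglongrightarrow> (\<integral>\<omega>. (indicator DT \<omega> :: real) \<partial>?M)"
    using D_ev DT_ev ptw
    by (intro integral_dominated_convergence[where w = "\<lambda>_. 1"]) (auto simp: indicator_def)
  then have lim1: "(\<lambda>n. P.prob (D n)) \<longlonglongrightarrow> P.prob DT"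
    using D_ev DT_ev by simp
  have "(\<lambda>n. \<integral>\<omega>. pmf (vec_pois {1..K} lam (d n (S \<omega>))) x \<partial>?M) \<longlonglongrightarrow> (\<integral>\<omega>. pmf (vec_pois {1..K} lam (S \<omega>)) x \<partial>?M)"
  proof (rule integral_dominated_convergence[where w = "\<lambda>_. 1"])
    show "AE \<omega> in ?M. (\<lambda>n. pmf (vec_pois {1..K} lam (d n (S \<omega>))) x) \<longlonglongrightarrow> pmf (vec_pois {1..K} lam (S \<omega>)) x"
      using arrival_rate d_tendsto d_nonneg nonneg
      by (intro AE_I2 tendsto_pmf_vec_pois) (auto intro: less_imp_le)
  qed (auto simp: pmf_le_1 intro!: v_meas d_meas S_measurable)
  then have lim2: "(\<lambda>n. P.prob (D n)) \<longlonglongrightarrow> P.prob A * (\<integral>\<omega>. pmf (vec_pois {1..K} lam (S \<omega>)) x \<partial>?M)"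
    unfolding D_prob by (rule tendsto_mult_left)
  have "pmf (arrival_law {1..K} lam (distr ?M borel S)) x = (\<integral>\<omega>. pmf (vec_pois {1..K} lam (S \<omega>)) x \<partial>?M)"
    by (subst pmf_arrival_law) (auto intro!: P.prob_space_distr integral_distr measurable_pmf_vec_pois)
  with LIMSEQ_unique[OF lim1 lim2] show ?thesis by (simp add: DT_def)
qed

end

subsection \<open>Discrete conditional laws\<close>

lemma emeasure_partition:
  assumes "H \<in> sets M" "countable C" "\<And>\<omega>. \<omega> \<in> H \<Longrightarrow> f \<omega> \<in> C"
    and "\<And>z. z \<in> C \<Longrightarrow> {\<omega> \<in> H. f \<omega> = z} \<in> sets M"
  shows "emeasure M H = (\<integral>\<^sup>+z. emeasure M {\<omega> \<in> H. f \<omega> = z} \<partial>count_space UNIV)"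
proof -
  have "emeasure M H = emeasure M (\<Union>z\<in>C. {\<omega> \<in> H. f \<omega> = z})"
    using assms(3) by (intro arg_cong[where f = "emeasure M"]) auto
  also have "\<dots> = (\<integral>\<^sup>+z. emeasure M {\<omega> \<in> H. f \<omega> = z} \<partial>count_space C)"
    using assms by (intro emeasure_UN_countable) (auto simp: disjoint_family_on_def)
  also have "\<dots> = (\<integral>\<^sup>+z. emeasure M {\<omega> \<in> H. f \<omega> = z} \<partial>count_space UNIV)"
  proof (rule nn_integral_count_space_eq)
    fix z assume "z \<in> UNIV - C"
    then have "{\<omega> \<in> H. f \<omega> = z} = {}" using assms(3) by auto
    then show "emeasure M {\<omega> \<in> H. f \<omega> = z} = 0" by (simp only: emeasure_empty)
  qed auto
  finally show ?thesis .
qed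

text \<open>Total probability over the values of \<open>f\<close>. In the applications
  \<open>c\<close> is the mass of \<open>H\<close>, \<mu> the conditional law of \<open>f\<close> on
  \<open>H\<close>, and \<kappa> the conditional probability of \<open>G\<close> given the value of
  \<open>f\<close>.\<close>

lemma emeasure_bind_law:
  assumes G: "G \<subseteq> H" "G \<in> sets M" and C: "countable C" "\<And>\<omega>. \<omega> \<in> H \<Longrightarrow> f \<omega> \<in> C"
    and f: "\<And>z. emeasure M {\<omega> \<in> H. f \<omega> = z} = c * ennreal (pmf \<mu> z)"
    and g: "\<And>z. {\<omega> \<in> G. f \<omega> = z} \<in> sets M"
      "\<And>z. emeasure M {\<omega> \<in> G. f \<omega> = z} = emeasure M {\<omega> \<in> H. f \<omega> = z} * \<kappa> z"
  shows "emeasure M G = c * (\<integral>\<^sup>+z. \<kappa> z \<partial>measure_pmf \<mu>)"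
proof -
  have "emeasure M G = (\<integral>\<^sup>+z. emeasure M {\<omega> \<in> G. f \<omega> = z} \<partial>count_space UNIV)"
    using G C g by (intro emeasure_partition[of _ _ C]) auto
  also have "\<dots> = (\<integral>\<^sup>+z. c * (ennreal (pmf \<mu> z) * \<kappa> z) \<partial>count_space UNIV)"
    by (simp add: g f mult.assoc)
  also have "\<dots> = c * (\<integral>\<^sup>+z. \<kappa> z \<partial>measure_pmf \<mu>)"
    by (simp add: nn_integral_cmult nn_integral_measure_pmf)
  finally show ?thesis .
qed

lemma nn_integral_countable_range:
  assumes "countable C" "\<And>\<omega>. \<omega> \<in> space M \<Longrightarrow> f \<omega> \<in> C"
    and "\<And>z. {\<omega> \<in> space M. f \<omega> = z} \<in> sets M"
  shows "(\<integral>\<^sup>+\<omega>. h (f \<omega>) \<partial>M) = (\<integral>\<^sup>+z. h z * emeasure M {\<omega> \<in> space M. f \<omega> = z} \<partial>count_space UNIV)"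
proof -
  have "(\<integral>\<^sup>+\<omega>. h (f \<omega>) \<partial>M)
      = (\<integral>\<^sup>+\<omega>. (\<integral>\<^sup>+z. h z * indicator {\<omega> \<in> space M. f \<omega> = z} \<omega> \<partial>count_space C) \<partial>M)"
  proof (rule nn_integral_cong)
    fix \<omega> assume w: "\<omega> \<in> space M"
    have "(\<integral>\<^sup>+z. h z * indicator {\<omega> \<in> space M. f \<omega> = z} \<omega> \<partial>count_space C)
        = (\<integral>\<^sup>+z. h (f \<omega>) * indicator {f \<omega>} z \<partial>count_space C)"
      using w by (intro nn_integral_cong) (auto simp: indicator_def)
    also have "\<dots> = h (f \<omega>)" using assms(2)[OF w] by (subst nn_integral_cmult_indicator) auto
    finally show "h (f \<omega>) = (\<integral>\<^sup>+z. h z * indicator {\<omega> \<in> space M. f \<omega> = z} \<omega> \<partial>count_space C)" ..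
  qed
  also have "\<dots> = (\<integral>\<^sup>+z. (\<integral>\<^sup>+\<omega>. h z * indicator {\<omega> \<in> space M. f \<omega> = z} \<omega> \<partial>M) \<partial>count_space C)"
    using assms by (intro nn_integral_count_space_nn_integral) auto
  also have "\<dots> = (\<integral>\<^sup>+z. h z * emeasure M {\<omega> \<in> space M. f \<omega> = z} \<partial>count_space C)"
    using assms(3) by (simp add: nn_integral_cmult_indicator)
  also have "\<dots> = (\<integral>\<^sup>+z. h z * emeasure M {\<omega> \<in> space M. f \<omega> = z} \<partial>count_space UNIV)"
  proof (rule nn_integral_count_space_eq)
    fix z assume "z \<in> UNIV - C"
    then have "{\<omega> \<in> space M. f \<omega> = z} = {}" using assms(2) by auto
    then show "h z * emeasure M {\<omega> \<in> space M. f \<omega> = z} = 0" by (simp only: emeasure_empty mult_zero_right)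
  qed auto
  finally show ?thesis .
qed

text \<open>Both random elements have countable range, so one identity for each pair of values
  determines the whole conditional expectation.\<close>

lemma nn_integral_kernel:
  fixes \<kappa> :: "'b \<Rightarrow> 'c pmf"
  assumes f: "countable C" "\<And>\<omega>. \<omega> \<in> space M \<Longrightarrow> f \<omega> \<in> C" "\<And>z. {\<omega> \<in> space M. f \<omega> = z} \<in> sets M"
    and g: "countable C'" "\<And>\<omega>. \<omega> \<in> space M \<Longrightarrow> g \<omega> \<in> C'" "\<And>z. {\<omega> \<in> space M. g \<omega> = z} \<in> sets M"
    and fg: "\<And>z y. emeasure M {\<omega> \<in> space M. f \<omega> = z \<and> g \<omega> = y}
      = emeasure M {\<omega> \<in> space M. f \<omega> = z} * ennreal (pmf (\<kappa> z) y)"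
  shows "(\<integral>\<^sup>+\<omega>. h (g \<omega>) \<partial>M) = (\<integral>\<^sup>+\<omega>. \<integral>\<^sup>+y. h y \<partial>\<kappa> (f \<omega>) \<partial>M)"
proof -
  let ?e = "\<lambda>z. emeasure M {\<omega> \<in> space M. f \<omega> = z}"
  have 1: "emeasure M {\<omega> \<in> space M. g \<omega> = y} = (\<integral>\<^sup>+z. ?e z * ennreal (pmf (\<kappa> z) y) \<partial>count_space UNIV)" for y
  proof -
    have "emeasure M {\<omega> \<in> space M. g \<omega> = y}
        = (\<integral>\<^sup>+z. emeasure M {\<omega> \<in> {\<omega> \<in> space M. g \<omega> = y}. f \<omega> = z} \<partial>count_space UNIV)"
    proof (rule emeasure_partition[OF g(3) f(1)])
      show "{\<omega> \<in> {\<omega> \<in> space M. g \<omega> = y}. f \<omega> = z} \<in> sets M" for z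
      proof -
        have "{\<omega> \<in> {\<omega> \<in> space M. g \<omega> = y}. f \<omega> = z} = {\<omega> \<in> space M. g \<omega> = y} \<inter> {\<omega> \<in> space M. f \<omega> = z}"
          by auto
        then show ?thesis using sets.Int[OF g(3)[of y] f(3)[of z]] by (simp only:)
      qed
    qed (use f(2) in auto)
    also have "\<dots> = (\<integral>\<^sup>+z. ?e z * ennreal (pmf (\<kappa> z) y) \<partial>count_space UNIV)"
    proof (rule nn_integral_cong)
      fix z
      have "{\<omega> \<in> {\<omega> \<in> space M. g \<omega> = y}. f \<omega> = z} = {\<omega> \<in> space M. f \<omega> = z \<and> g \<omega> = y}" by auto
      then show "emeasure M {\<omega> \<in> {\<omega> \<in> space M. g \<omega> = y}. f \<omega> = z} = ?e z * ennreal (pmf (\<kappa> z) y)"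
        by (simp only: fg)
    qed
    finally show ?thesis .
  qed
  have "(\<integral>\<^sup>+\<omega>. h (g \<omega>) \<partial>M) = (\<integral>\<^sup>+y. (\<integral>\<^sup>+z. h y * (?e z * ennreal (pmf (\<kappa> z) y)) \<partial>count_space UNIV) \<partial>count_space UNIV)"
    by (subst nn_integral_countable_range[OF g]) (simp_all add: 1 nn_integral_cmult)
  also have "\<dots> = (\<integral>\<^sup>+z. (\<integral>\<^sup>+y. h y * (?e z * ennreal (pmf (\<kappa> z) y)) \<partial>count_space UNIV) \<partial>count_space UNIV)"
    using nn_integral_fst_count_space[of "\<lambda>(y, z). h y * (?e z * ennreal (pmf (\<kappa> z) y))"]
      nn_integral_snd_count_space[of "\<lambda>(y, z). h y * (?e z * ennreal (pmf (\<kappa> z) y))"] by simp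
  also have "\<dots> = (\<integral>\<^sup>+z. (\<integral>\<^sup>+y. h y \<partial>\<kappa> z) * ?e z \<partial>count_space UNIV)"
  proof (rule nn_integral_cong)
    fix z
    have "(\<integral>\<^sup>+y. h y * (?e z * ennreal (pmf (\<kappa> z) y)) \<partial>count_space UNIV)
        = (\<integral>\<^sup>+y. ?e z * (ennreal (pmf (\<kappa> z) y) * h y) \<partial>count_space UNIV)"
      by (simp add: mult_ac)
    also have "\<dots> = ?e z * (\<integral>\<^sup>+y. h y \<partial>\<kappa> z)"
      by (simp add: nn_integral_cmult nn_integral_measure_pmf)
    finally show "(\<integral>\<^sup>+y. h y * (?e z * ennreal (pmf (\<kappa> z) y)) \<partial>count_space UNIV) = (\<integral>\<^sup>+y. h y \<partial>\<kappa> z) * ?e z"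
      by (simp only: mult.commute)
  qed
  also have "\<dots> = (\<integral>\<^sup>+\<omega>. \<integral>\<^sup>+y. h y \<partial>\<kappa> (f \<omega>) \<partial>M)"
    by (rule nn_integral_countable_range[OF f, symmetric])
  finally show ?thesis .
qed

context bep_model
begin

declare One_nat_def [simp del] source_events.simps [simp del]

lemma service_source: "k \<in> {1..K} \<Longrightarrow> Service k l \<in> other_sources"
  and switch_source: "i \<in> {1..I} \<Longrightarrow> Switchover c i \<in> other_sources"
  and draw_source: "i \<in> {1..I} \<Longrightarrow> Draw c i N \<in> other_sources"
  and initial_source: "Initial \<in> other_sources"
  by (auto simp: other_sources_def sources_def)

lemma service_event: "B \<in> sets borel \<Longrightarrow> service_time X k l -` B \<inter> \<Omega> \<in> source_events K X (Service k l)"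
  unfolding source_events.simps by (rule in_vimage_algebra)

lemma switch_event: "B \<in> sets borel \<Longrightarrow> switchover_time X c i -` B \<inter> \<Omega> \<in> source_events K X (Switchover c i)"
  unfolding source_events.simps by (rule in_vimage_algebra)

lemma draw_event: "{\<omega> \<in> \<Omega>. binomial_draw X c i N \<omega> = y} \<in> source_events K X (Draw c i N)"
proof -
  have "binomial_draw X c i N -` {y} \<inter> \<Omega> \<in> source_events K X (Draw c i N)"
    unfolding source_events.simps by (rule in_vimage_algebra) simp
  then show ?thesis by (simp add: vimage_def Int_def conj_commute)
qed

lemma initial_event:
  assumes "k \<in> {1..K}"
  shows "{\<omega> \<in> \<Omega>. initial_queue X k \<omega> = n} \<in> source_events K X Initial"
proof -
  let ?V = "vimage_algebra \<Omega> (\<lambda>\<omega>. \<lambda>k\<in>{1..K}. initial_queue X k \<omega>) (Pi\<^sub>M {1..K} (\<lambda>_. count_space UNIV))"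
  have "(\<lambda>\<omega>. (\<lambda>k\<in>{1..K}. initial_queue X k \<omega>) k) \<in> measurable ?V (count_space UNIV)"
    using assms by (intro measurable_compose[OF measurable_vimage_algebra1 measurable_component_singleton])
      (auto simp: space_PiM split: if_splits)
  then have "initial_queue X k \<in> measurable ?V (count_space UNIV)" using assms by simp
  then have "initial_queue X k -` {n} \<inter> space ?V \<in> sets ?V" by (rule measurable_sets) simp
  then show ?thesis by (simp add: vimage_def Int_def conj_commute source_events.simps)
qed

lemma hist_Int: "hist J T A \<Longrightarrow> hist J T B \<Longrightarrow> hist J T (A \<inter> B)"
  using hist_Diff[of J T A "A - B"] hist_Diff[of J T A B] by (simp add: Diff_Diff_Int)

lemma hist_Collect_ball:
  assumes "hist J T A" "finite F" "\<And>k. k \<in> F \<Longrightarrow> hist J T {\<omega> \<in> A. P k \<omega>}"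
  shows "hist J T {\<omega> \<in> A. \<forall>k\<in>F. P k \<omega>}"
  using assms(2,3)
proof (induction F)
  case empty
  then show ?case using assms(1) by simp
next
  case (insert x F)
  have "{\<omega> \<in> A. \<forall>k\<in>insert x F. P k \<omega>} = {\<omega> \<in> A. P x \<omega>} \<inter> {\<omega> \<in> A. \<forall>k\<in>F. P k \<omega>}" by auto
  then show ?case using hist_Int[of J T "{\<omega> \<in> A. P x \<omega>}" "{\<omega> \<in> A. \<forall>k\<in>F. P k \<omega>}"] insert by simp
qed

lemma hist_indep:
  assumes H: "hist J T A" and a: "a \<in> other_sources" "a \<notin> J" and F: "F \<in> source_events K X a"
  shows "P.prob (A \<inter> F) = P.prob A * P.prob F"
proof -
  note J = histD(1)[OF H]
  let ?A = "\<lambda>n. {\<omega> \<in> A. T \<omega> \<le> real n}"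
  have F_ev: "F \<in> P.events"
    using F a source_events[of a] by (auto simp: sources_split)
  have A_ev: "?A n \<in> P.events" for n
    by (rule subsetD[OF past_subset[OF J] histD(4)[OF H]])
  have eq: "P.prob (?A n \<inter> F) = P.prob (?A n) * P.prob F" for n
  proof -
    \<comment> \<open>With a time increment of length 0 nothing arrives, so the third factor of
      \<open>past_indep\<close> becomes 1.\<close>
    have "pmf (vec_pois {1..K} lam 0) (\<lambda>_. 0) = 1"
      by (simp add: pmf_vec_pois vecs_def pois_def)
    moreover have "?A n \<inter> F \<inter> {\<omega> \<in> \<Omega>. arrived (real n) (real n + 0) \<omega> = (\<lambda>_. 0)} = ?A n \<inter> F"
      using histD(2)[OF H] by (auto simp: arrived_def)
    ultimately show ?thesis
      using past_indep[OF J a _ _ histD(4)[OF H] F, of n 0 "\<lambda>_. 0"] by (simp only: mult_1_right of_nat_0_le_iff order_refl simp_thms)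
  qed
  have U: "(\<Union>n. ?A n) = A" using real_arch_simple by auto
  have U': "(\<Union>n. ?A n \<inter> F) = A \<inter> F" using U by auto
  have "(\<lambda>n. P.prob (?A n \<inter> F)) \<longlonglongrightarrow> P.prob (\<Union>n. ?A n \<inter> F)"
    using A_ev F_ev by (intro P.finite_Lim_measure_incseq) (auto simp: incseq_def intro: order_trans)
  moreover have "(\<lambda>n. P.prob (?A n) * P.prob F) \<longlonglongrightarrow> P.prob (\<Union>n. ?A n) * P.prob F"
    using A_ev by (intro tendsto_mult_right P.finite_Lim_measure_incseq) (auto simp: incseq_def intro: order_trans)
  ultimately show ?thesis unfolding eq U U' by (rule LIMSEQ_unique)
qed

definition queue_vec :: "real \<times> (nat \<Rightarrow> nat) \<Rightarrow> 'w \<Rightarrow> nat \<Rightarrow> nat" where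
  "queue_vec \<sigma> \<omega> = (\<lambda>k. if k \<in> {1..K} then queue_length X \<omega> \<sigma> k else 0)"

lemma queue_vec_in_vecs: "queue_vec \<sigma> \<omega> \<in> vecs {1..K}"
  by (auto simp: queue_vec_def vecs_def)

lemma hist_queue_length:
  assumes H: "hist J T A" and J: "Initial \<in> J" and k: "k \<in> {1..K}"
  shows "hist J T {\<omega> \<in> A. queue_length X \<omega> (T \<omega>, d) k \<in> B}"
proof -
  let ?A = "\<lambda>(i, n). if i + n - d k \<in> B then {\<omega> \<in> A. arrivals X k (T \<omega>) \<omega> = n} \<inter> {\<omega> \<in> \<Omega>. initial_queue X k \<omega> = i} else {}"
  have "{\<omega> \<in> A. queue_length X \<omega> (T \<omega>, d) k \<in> B} = (\<Union>x\<in>UNIV. ?A x)"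
  proof (intro equalityI subsetI)
    fix \<omega> assume w: "\<omega> \<in> {\<omega> \<in> A. queue_length X \<omega> (T \<omega>, d) k \<in> B}"
    then have "\<omega> \<in> ?A (initial_queue X k \<omega>, arrivals X k (T \<omega>) \<omega>)"
      using histD(2)[OF H] by (auto simp: queue_length_def)
    then show "\<omega> \<in> (\<Union>x\<in>UNIV. ?A x)" by (rule UN_I[OF UNIV_I])
  next
    fix \<omega> assume "\<omega> \<in> (\<Union>x\<in>UNIV. ?A x)"
    then obtain x where "\<omega> \<in> ?A x" by (rule UN_E)
    then show "\<omega> \<in> {\<omega> \<in> A. queue_length X \<omega> (T \<omega>, d) k \<in> B}"
      by (cases x) (auto simp: queue_length_def split: if_splits)
  qed
  moreover have "hist J T (\<Union>x\<in>UNIV. ?A x)"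
  proof (rule hist_UN)
    show "hist J T (?A x)" for x
      using hist_source[OF hist_arrivals[OF H k] J initial_event[OF k]] hist_empty[OF histD(1)[OF H]]
      by (cases x) simp
  qed auto
  ultimately show ?thesis by simp
qed

lemma hist_queue_vec:
  assumes H: "hist J T A" and J: "Initial \<in> J"
  shows "hist J T {\<omega> \<in> A. queue_vec (T \<omega>, d) \<omega> = x}"
proof (cases "x \<in> vecs {1..K}")
  case True
  have "{\<omega> \<in> A. queue_vec (T \<omega>, d) \<omega> = x} = {\<omega> \<in> A. \<forall>k\<in>{1..K}. queue_length X \<omega> (T \<omega>, d) k \<in> {x k}}"
    using True by (auto simp: queue_vec_def vecs_def fun_eq_iff)
  moreover have "hist J T \<dots>"
    by (intro hist_Collect_ball[OF H] hist_queue_length[OF H J]) auto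
  ultimately show ?thesis by (simp only:)
next
  case False
  then have "{\<omega> \<in> A. queue_vec (T \<omega>, d) \<omega> = x} = {}" using queue_vec_in_vecs by auto
  then show ?thesis by (simp only: hist_empty[OF histD(1)[OF H]])
qed

end

lemma measurable_count_space_range:
  assumes "countable C" "\<And>x. x \<in> space M \<Longrightarrow> f x \<in> C" "\<And>c. {x \<in> space M. f x = c} \<in> sets M"
  shows "f \<in> measurable M (count_space UNIV)"
proof (rule measurableI)
  fix B
  have "f -` B \<inter> space M = (\<Union>c\<in>B \<inter> C. {x \<in> space M. f x = c})" using assms(2) by auto
  also have "\<dots> \<in> sets M" using assms by (intro sets.countable_UN'') auto
  finally show "f -` B \<inter> space M \<in> sets M" .
qed simp

lemma measurable_vecs:
  assumes "finite A" "\<And>x. x \<in> space M \<Longrightarrow> f x \<in> vecs A"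
    and "\<And>k. k \<in> A \<Longrightarrow> (\<lambda>x. f x k) \<in> measurable M (count_space UNIV)"
  shows "f \<in> measurable M (count_space UNIV)"
proof (rule measurable_count_space_range[OF countable_vecs[OF assms(1)] assms(2)])
  fix c
  have 1: "{x \<in> space M. f x k = n} \<in> sets M" if "k \<in> A" for k n
    using measurable_sets[OF assms(3)[OF that], of "{n}"] by (simp add: vimage_def Int_def conj_commute)
  have "f x = c \<longleftrightarrow> c \<in> vecs A \<and> (\<forall>k\<in>A. f x k = c k)" if "x \<in> space M" for x
    using assms(2)[OF that] unfolding vecs_def fun_eq_iff by auto
  then have "{x \<in> space M. f x = c} = (if c \<in> vecs A then {x \<in> space M. \<forall>k\<in>A. f x k = c k} else {})"
    by auto
  also have "\<dots> \<in> sets M" using assms(1) 1 by (auto intro!: sets.sets_Collect_finite_All)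
  finally show "{x \<in> space M. f x = c} \<in> sets M" .
qed

lemma measurable_countable_op:
  fixes f :: "'a \<Rightarrow> 'b :: countable" and g :: "'a \<Rightarrow> 'c"
  assumes "f \<in> measurable M (count_space UNIV)" "g \<in> measurable M (count_space UNIV)"
  shows "(\<lambda>x. h (f x) (g x)) \<in> measurable M (count_space UNIV)"
  by (rule measurable_compose_countable[OF measurable_compose[OF assms(2)] assms(1)]) simp

section \<open>Polling epochs, stages and the state of the server\<close>

context polling_model
begin

declare One_nat_def [simp del]

lemma I_pos: "0 < I"
  using switch_total by (cases "I = 0") auto

definition stage :: "nat \<Rightarrow> nat" where "stage m = m mod I + 1"
definition cycle :: "nat \<Rightarrow> nat" where "cycle m = m div I"
definition que :: "nat \<Rightarrow> nat" where "que m = p (stage m)"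

lemma stage_range: "stage m \<in> {1..I}"
  using mod_less_divisor[OF I_pos, of m] by (simp add: stage_def)

lemma que_range: "que m \<in> {1..K}"
  unfolding que_def by (rule polling_table[OF stage_range])

lemma stage_cycle_inj: "cycle m = cycle m' \<Longrightarrow> stage m = stage m' \<Longrightarrow> m = m'"
  unfolding stage_def cycle_def by (metis add_right_imp_eq div_mod_decomp)

end

context bep_model
begin

declare One_nat_def [simp del] source_events.simps [simp del] epoch_state.simps(2) [simp del]

abbreviation st :: "nat \<Rightarrow> 'w \<Rightarrow> real \<times> (nat \<Rightarrow> nat)" where
  "st m \<omega> \<equiv> epoch_state I p X \<omega> m"

definition Qv :: "nat \<Rightarrow> 'w \<Rightarrow> nat \<Rightarrow> nat" where
  "Qv m \<omega> = queue_vec (st m \<omega>) \<omega>"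
definition draw :: "nat \<Rightarrow> 'w \<Rightarrow> nat" where
  "draw m \<omega> = binomial_draw X (cycle m) (stage m) (Qv m \<omega> (que m)) \<omega>"
definition target :: "nat \<Rightarrow> 'w \<Rightarrow> nat" where
  "target m \<omega> = Qv m \<omega> (que m) - draw m \<omega>"
definition served :: "nat \<Rightarrow> nat \<Rightarrow> 'w \<Rightarrow> real \<times> (nat \<Rightarrow> nat)" where
  "served m j \<omega> = after_services X \<omega> (que m) j (st m \<omega>)"
definition vq :: "nat \<Rightarrow> nat \<Rightarrow> 'w \<Rightarrow> nat \<Rightarrow> nat" where
  "vq m j \<omega> = queue_vec (served m j \<omega>) \<omega>"
definition hits :: "nat \<Rightarrow> nat \<Rightarrow> 'w \<Rightarrow> bool" where
  "hits m j \<omega> \<longleftrightarrow> vq m j \<omega> (que m) = target m \<omega>"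
definition Lv :: "nat \<Rightarrow> 'w \<Rightarrow> nat" where
  "Lv m \<omega> = (LEAST j. hits m j \<omega>)"
definition Ev :: "nat \<Rightarrow> 'w \<Rightarrow> nat \<Rightarrow> nat" where
  "Ev m \<omega> = vq m (Lv m \<omega>) \<omega>"
text \<open>If a visit never reaches its target, \<open>Lv\<close> is an unspecified number and the
  path is meaningless from then on. Path properties are proved on \<open>good\<close> paths, which
  have probability one by \<open>AE_good\<close>.\<close>

definition good :: "nat \<Rightarrow> 'w \<Rightarrow> bool" where
  "good m \<omega> \<longleftrightarrow> (\<forall>m'<m. \<exists>j. hits m' j \<omega>)"
definition eta :: "nat \<Rightarrow> 'w \<Rightarrow> nat \<Rightarrow> nat" where
  "eta m \<omega> = arrived (fst (served m (Lv m \<omega>) \<omega>)) (fst (st (Suc m) \<omega>)) \<omega>"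

lemma in_vecs: "Qv m \<omega> \<in> vecs {1..K}" "vq m j \<omega> \<in> vecs {1..K}" "Ev m \<omega> \<in> vecs {1..K}"
  "eta m \<omega> \<in> vecs {1..K}" "arrived t t' \<omega> \<in> vecs {1..K}"
  by (simp_all add: Qv_def vq_def Ev_def queue_vec_in_vecs) (simp_all add: eta_def arrived_def vecs_def)

lemma queue_vec_que: "queue_vec \<sigma> \<omega> (que m) = queue_length X \<omega> \<sigma> (que m)"
  using que_range by (simp add: queue_vec_def)

lemma epoch_Suc:
  "st (Suc m) \<omega> = (fst (served m (Lv m \<omega>) \<omega>) + switchover_time X (cycle m) (stage m) \<omega>,
    snd (served m (Lv m \<omega>) \<omega>))"
proof -
  have "services_in_visit X \<omega> (que m) (draw m \<omega>) (st m \<omega>) = Lv m \<omega>"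
    unfolding services_in_visit_def Lv_def hits_def vq_def target_def Qv_def served_def queue_vec_que ..
  moreover have "draw m \<omega> = binomial_draw X (cycle m) (stage m) (queue_length X \<omega> (st m \<omega>) (que m)) \<omega>"
    unfolding draw_def Qv_def queue_vec_que ..
  ultimately show ?thesis
    unfolding epoch_state.simps visit_and_switch_def Let_def served_def
    by (simp add: que_def[symmetric] stage_def[symmetric] cycle_def[symmetric] case_prod_beta)
qed

lemma served_eq:
  "served m j \<omega> = (fst (st m \<omega>) + (\<Sum>l<j. service_time X (que m) (snd (st m \<omega>) (que m) + l) \<omega>),
    (snd (st m \<omega>))(que m := snd (st m \<omega>) (que m) + j))"
  by (simp add: served_def after_services_def case_prod_beta)

lemma served_0: "served m 0 \<omega> = st m \<omega>"
  by (simp add: served_eq)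

lemma served_Suc:
  "served m (Suc j) \<omega> = (fst (served m j \<omega>) + service_time X (que m) (snd (st m \<omega>) (que m) + j) \<omega>,
    (snd (served m j \<omega>))(que m := snd (served m j \<omega>) (que m) + 1))"
  by (simp add: served_eq add.assoc One_nat_def)

lemma vq_0: "vq m 0 \<omega> = Qv m \<omega>"
  by (simp add: vq_def served_0 Qv_def)

lemma departures_in_vecs: "snd (st m \<omega>) \<in> vecs {1..K}"
proof (induction m)
  case (Suc m)
  then show ?case using que_range[of m] by (auto simp: epoch_Suc served_eq vecs_def)
qed (simp add: vecs_def)

subsection \<open>Sample paths\<close>

text \<open>The condition under which the natural subtraction in \<open>queue_length\<close> is
  exact, so that queue lengths obey the expected balance equations.\<close>

definition valid :: "real \<times> (nat \<Rightarrow> nat) \<Rightarrow> 'w \<Rightarrow> bool" where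
  "valid \<sigma> \<omega> \<longleftrightarrow> 0 \<le> fst \<sigma> \<and>
    (\<forall>k\<in>{1..K}. snd \<sigma> k \<le> initial_queue X k \<omega> + arrivals X k (fst \<sigma>) \<omega>)"

lemma valid_time:
  assumes "\<omega> \<in> \<Omega>" "valid (t, d) \<omega>" "0 \<le> u"
  shows "valid (t + u, d) \<omega>"
    and "queue_vec (t + u, d) \<omega> = (\<lambda>k. queue_vec (t, d) \<omega> k + arrived t (t + u) \<omega> k)"
proof -
  have le: "arrivals X k t \<omega> \<le> arrivals X k (t + u) \<omega>" if "k \<in> {1..K}" for k
    using assms by (intro arr_mono[OF that]) (auto simp: valid_def)
  show "valid (t + u, d) \<omega>"
    using assms le unfolding valid_def by (auto intro: order_trans)
  show "queue_vec (t + u, d) \<omega> = (\<lambda>k. queue_vec (t, d) \<omega> k + arrived t (t + u) \<omega> k)"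
  proof
    fix k
    show "queue_vec (t + u, d) \<omega> k = queue_vec (t, d) \<omega> k + arrived t (t + u) \<omega> k"
    proof (cases "k \<in> {1..K}")
      case True
      have "d k \<le> initial_queue X k \<omega> + arrivals X k t \<omega>" using assms True by (simp add: valid_def)
      then show ?thesis using True le[OF True]
        by (simp add: queue_vec_def queue_length_def arrived_def)
    qed (simp only: queue_vec_def arrived_def if_False add_0_left)
  qed
qed

lemma valid_service:
  assumes w: "\<omega> \<in> \<Omega>" and v: "valid (t, d) \<omega>" and k: "k \<in> {1..K}" and pos: "0 < queue_vec (t, d) \<omega> k" and u: "0 \<le> u"
  shows "valid (t + u, d(k := d k + 1)) \<omega>"
    and "queue_vec (t + u, d(k := d k + 1)) \<omega> = serve k (queue_vec (t, d) \<omega>) (arrived t (t + u) \<omega>)"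
proof -
  have d: "d k + 1 \<le> initial_queue X k \<omega> + arrivals X k t \<omega>"
    using pos k by (simp add: queue_vec_def queue_length_def)
  then have v': "valid (t, d(k := d k + 1)) \<omega>" using v by (auto simp: valid_def)
  show "valid (t + u, d(k := d k + 1)) \<omega>" by (rule valid_time(1)[OF w v' u])
  have "queue_vec (t, d(k := d k + 1)) \<omega> = (\<lambda>j. if j = k then queue_vec (t, d) \<omega> k - 1 else queue_vec (t, d) \<omega> j)"
    by (auto simp: queue_vec_def queue_length_def fun_eq_iff)
  then show "queue_vec (t + u, d(k := d k + 1)) \<omega> = serve k (queue_vec (t, d) \<omega>) (arrived t (t + u) \<omega>)"
    using pos by (auto simp: valid_time(2)[OF w v' u] serve_def fun_eq_iff)
qed

lemma vq_Suc:
  assumes w: "\<omega> \<in> \<Omega>" and v: "valid (served m j \<omega>) \<omega>" and pos: "0 < vq m j \<omega> (que m)"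
  shows "valid (served m (Suc j) \<omega>) \<omega>"
    and "vq m (Suc j) \<omega> = serve (que m) (vq m j \<omega>)
      (arrived (fst (served m j \<omega>)) (fst (served m (Suc j) \<omega>)) \<omega>)"
proof -
  obtain t d where td: "served m j \<omega> = (t, d)" by (cases "served m j \<omega>")
  let ?u = "service_time X (que m) (snd (st m \<omega>) (que m) + j) \<omega>"
  have S: "served m (Suc j) \<omega> = (t + ?u, d(que m := d (que m) + 1))"
    by (simp add: served_Suc td)
  have u: "0 \<le> ?u" by (rule service_nonneg[OF que_range w])
  have v: "valid (t, d) \<omega>" using v by (simp add: td)
  have pos: "0 < queue_vec (t, d) \<omega> (que m)" using pos by (simp add: vq_def td)
  note * = valid_service[OF w v que_range pos u]
  show "valid (served m (Suc j) \<omega>) \<omega>" unfolding S by (rule *)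
  show "vq m (Suc j) \<omega> = serve (que m) (vq m j \<omega>)
      (arrived (fst (served m j \<omega>)) (fst (served m (Suc j) \<omega>)) \<omega>)"
    unfolding vq_def S td fst_conv by (rule *)
qed

text \<open>A service lowers the queue by at most one, so the target cannot be jumped over. Strictly
  above the target the queue is nonempty, and hence the next departure is a real one.\<close>

lemma before_hit:
  assumes w: "\<omega> \<in> \<Omega>" and v: "valid (st m \<omega>) \<omega>" and nh: "\<And>j'. j' < j \<Longrightarrow> \<not> hits m j' \<omega>"
  shows "valid (served m j \<omega>) \<omega> \<and> target m \<omega> \<le> vq m j \<omega> (que m)"
  using nh
proof (induction j)
  case 0
  then show ?case using v by (simp add: served_0 vq_0 target_def)
next
  case (Suc j)
  then have IH: "valid (served m j \<omega>) \<omega>" "target m \<omega> \<le> vq m j \<omega> (que m)" by auto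
  have "\<not> hits m j \<omega>" using Suc.prems by simp
  then have less: "target m \<omega> < vq m j \<omega> (que m)" using IH(2) by (simp add: hits_def)
  then have "0 < vq m j \<omega> (que m)" by simp
  note * = vq_Suc[OF w IH(1) this]
  have "target m \<omega> \<le> vq m (Suc j) \<omega> (que m)" unfolding *(2) using less by (simp add: serve_def)
  then show ?case using *(1) by simp
qed

lemma hits_Lv: "hits m j \<omega> \<Longrightarrow> hits m (Lv m \<omega>) \<omega>" and Lv_le: "hits m j \<omega> \<Longrightarrow> Lv m \<omega> \<le> j"
  and before_Lv: "j < Lv m \<omega> \<Longrightarrow> \<not> hits m j \<omega>"
  unfolding Lv_def by (rule LeastI, assumption) (rule Least_le, assumption, rule not_less_Least)

lemma Ev_target: "hits m j \<omega> \<Longrightarrow> Ev m \<omega> (que m) = target m \<omega>"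
  using hits_Lv[of m j \<omega>] by (simp add: hits_def Ev_def)

lemma Lv_eqI: "hits m j \<omega> \<Longrightarrow> (\<And>j'. j' < j \<Longrightarrow> \<not> hits m j' \<omega>) \<Longrightarrow> Lv m \<omega> = j"
  using Lv_le[of m j \<omega>] hits_Lv[of m j \<omega>] by (metis le_less)

lemma good_Suc: "good (Suc m) \<omega> \<longleftrightarrow> good m \<omega> \<and> (\<exists>j. hits m j \<omega>)"
  by (auto simp: good_def less_Suc_eq)

lemma good_valid: "\<omega> \<in> \<Omega> \<Longrightarrow> good m \<omega> \<Longrightarrow> valid (st m \<omega>) \<omega>"
proof (induction m)
  case (Suc m)
  then have v: "valid (st m \<omega>) \<omega>" and "\<exists>j. hits m j \<omega>" by (auto simp: good_Suc)
  have "valid (served m (Lv m \<omega>) \<omega>) \<omega>" using before_hit[OF Suc.prems(1) v] before_Lv by blast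
  then show ?case unfolding epoch_Suc
    using valid_time(1)[OF Suc.prems(1) _ switchover_nonneg[OF stage_range Suc.prems(1)]] by (metis prod.collapse)
qed (simp add: valid_def)

lemma Qv_Suc:
  assumes "\<omega> \<in> \<Omega>" "good (Suc m) \<omega>"
  shows "Qv (Suc m) \<omega> = (\<lambda>k. Ev m \<omega> k + eta m \<omega> k)"
proof -
  have v: "valid (st m \<omega>) \<omega>" using assms good_valid by (simp add: good_Suc)
  obtain t d where td: "served m (Lv m \<omega>) \<omega> = (t, d)" by (cases "served m (Lv m \<omega>) \<omega>")
  have "valid (t, d) \<omega>" using before_hit[OF assms(1) v before_Lv] td by metis
  then show ?thesis
    using valid_time(2)[OF assms(1) _ switchover_nonneg[OF stage_range assms(1)]]
    by (simp add: Qv_def Ev_def vq_def eta_def epoch_Suc td)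
qed

lemma queue_at_epoch_Qv:
  "k \<in> {1..K} \<Longrightarrow> queue_at_epoch I p X c i k \<omega> = Qv (c * I + (i - 1)) \<omega> k"
  by (simp add: queue_at_epoch_def Qv_def queue_vec_def)

subsection \<open>Measurability\<close>

lemma measurable_arrivals_at:
  assumes k: "k \<in> {1..K}" and T [measurable]: "T \<in> borel_measurable (sample_space X)"
    and nonneg: "\<And>\<omega>. \<omega> \<in> \<Omega> \<Longrightarrow> 0 \<le> T \<omega>"
  shows "(\<lambda>\<omega>. arrivals X k (T \<omega>) \<omega>) \<in> measurable (sample_space X) (count_space UNIV)"
proof -
  have le: "{\<omega> \<in> \<Omega>. arrivals X k (T \<omega>) \<omega> \<le> n} \<in> P.events" for n
  proof -
    \<comment> \<open>By right-continuity a rational time just after \<open>T\<close> sees the same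
      arrivals; any later time sees at least as many.\<close>
    have "{\<omega> \<in> \<Omega>. arrivals X k (T \<omega>) \<omega> \<le> n}
        = (\<Union>q\<in>{q\<in>\<rat>. 0 \<le> q}. {\<omega> \<in> \<Omega>. T \<omega> < q} \<inter> {\<omega> \<in> \<Omega>. arrivals X k q \<omega> \<le> n})" (is "?L = ?R")
    proof (intro equalityI subsetI)
      fix \<omega> assume w: "\<omega> \<in> ?L"
      then have w': "\<omega> \<in> \<Omega>" by simp
      obtain b where b: "b > T \<omega>" "\<And>u. T \<omega> \<le> u \<Longrightarrow> u < b \<Longrightarrow> arrivals X k u \<omega> = arrivals X k (T \<omega>) \<omega>"
        using P.poisson_right_constant[OF poisson_arrivals[OF k] arrival_rate[OF k] w' nonneg[OF w']] by blast
      obtain q where q: "q \<in> \<rat>" "T \<omega> < q" "q < b" using Rats_dense_in_real[OF b(1)] by blast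
      then have "arrivals X k q \<omega> \<le> n" "0 \<le> q" using b(2)[of q] w nonneg[OF w'] by auto
      then show "\<omega> \<in> ?R" using q w' by (intro UN_I[of q]) auto
    next
      fix \<omega> assume "\<omega> \<in> ?R"
      then obtain q where q: "\<omega> \<in> \<Omega>" "T \<omega> < q" "arrivals X k q \<omega> \<le> n" by auto
      then have "arrivals X k (T \<omega>) \<omega> \<le> arrivals X k q \<omega>" using nonneg by (intro arr_mono[OF k]) auto
      then show "\<omega> \<in> ?L" using q by simp
    qed
    also have "\<dots> \<in> P.events"
    proof (intro sets.countable_UN'' sets.Int)
      show "countable {q\<in>\<rat>. 0 \<le> q}" using countable_rat by (rule countable_subset[rotated]) auto
      fix q :: real assume "q \<in> {q\<in>\<rat>. 0 \<le> q}"
      then have [measurable]: "arrivals X k q \<in> measurable (sample_space X) (count_space UNIV)"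
        using arr_measurable[OF k] by simp
      show "{\<omega> \<in> \<Omega>. T \<omega> < q} \<in> P.events" by measurable
      show "{\<omega> \<in> \<Omega>. arrivals X k q \<omega> \<le> n} \<in> P.events" by measurable
    qed
    finally show ?thesis .
  qed
  show ?thesis
  proof (rule measurable_count_space_range[of UNIV])
    fix n
    have "{\<omega> \<in> \<Omega>. arrivals X k (T \<omega>) \<omega> = n} = {\<omega> \<in> \<Omega>. arrivals X k (T \<omega>) \<omega> \<le> n}
        - (case n of 0 \<Rightarrow> {} | Suc n' \<Rightarrow> {\<omega> \<in> \<Omega>. arrivals X k (T \<omega>) \<omega> \<le> n'})"
      by (auto split: nat.splits)
    also have "\<dots> \<in> P.events" using le by (intro sets.Diff) (auto split: nat.splits)
    finally show "{\<omega> \<in> \<Omega>. arrivals X k (T \<omega>) \<omega> = n} \<in> P.events" .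
  qed auto
qed

lemma measurable_queue_vec:
  assumes T: "T \<in> borel_measurable (sample_space X)" "\<And>\<omega>. \<omega> \<in> \<Omega> \<Longrightarrow> 0 \<le> T \<omega>"
    and D: "D \<in> measurable (sample_space X) (count_space UNIV)"
  shows "(\<lambda>\<omega>. queue_vec (T \<omega>, D \<omega>) \<omega>) \<in> measurable (sample_space X) (count_space UNIV)"
proof (rule measurable_vecs)
  fix k assume k: "k \<in> {1..K}"
  have "(\<lambda>\<omega>. initial_queue X k \<omega> + arrivals X k (T \<omega>) \<omega> - D \<omega> k) \<in> measurable (sample_space X) (count_space UNIV)"
    by (intro measurable_countable_op[of _ _ _ "(-)"] measurable_countable_op[of _ _ _ "(+)"]
        initial_measurable[OF k] measurable_arrivals_at[OF k T] measurable_compose[OF D]) auto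
  then show "(\<lambda>\<omega>. queue_vec (T \<omega>, D \<omega>) \<omega> k) \<in> measurable (sample_space X) (count_space UNIV)"
    using k by (simp add: queue_vec_def queue_length_def)
qed (auto simp: queue_vec_in_vecs)

definition measurable_state :: "('w \<Rightarrow> real \<times> (nat \<Rightarrow> nat)) \<Rightarrow> bool" where
  "measurable_state S \<longleftrightarrow> (\<lambda>\<omega>. fst (S \<omega>)) \<in> borel_measurable (sample_space X) \<and>
    (\<lambda>\<omega>. snd (S \<omega>)) \<in> measurable (sample_space X) (count_space UNIV) \<and> (\<forall>\<omega>\<in>\<Omega>. 0 \<le> fst (S \<omega>))"

lemma measurable_state_queue_vec:
  "measurable_state S \<Longrightarrow> (\<lambda>\<omega>. queue_vec (S \<omega>) \<omega>) \<in> measurable (sample_space X) (count_space UNIV)"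
  using measurable_queue_vec[of "\<lambda>\<omega>. fst (S \<omega>)" "\<lambda>\<omega>. snd (S \<omega>)"] by (simp add: measurable_state_def)

lemma measurable_served:
  assumes S: "measurable_state (st m)"
  shows "measurable_state (served m j)"
proof -
  have D: "(\<lambda>\<omega>. snd (st m \<omega>)) \<in> measurable (sample_space X) (count_space UNIV)"
    using S by (simp add: measurable_state_def)
  have k: "(\<lambda>\<omega>. snd (st m \<omega>) (que m) + l) \<in> measurable (sample_space X) (count_space UNIV)" for l
    by (rule measurable_compose[OF D]) simp
  have "(\<lambda>\<omega>. service_time X (que m) (snd (st m \<omega>) (que m) + l) \<omega>) \<in> borel_measurable (sample_space X)" for l
    by (rule measurable_compose_countable[OF service_measurable[OF que_range] k])
  then have "(\<lambda>\<omega>. fst (served m j \<omega>)) \<in> borel_measurable (sample_space X)"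
    using S unfolding served_eq fst_conv by (intro borel_measurable_add borel_measurable_sum) (simp_all add: measurable_state_def)
  moreover have "(\<lambda>\<omega>. snd (served m j \<omega>)) \<in> measurable (sample_space X) (count_space UNIV)"
    unfolding served_eq snd_conv by (rule measurable_compose[OF D]) simp
  moreover have "0 \<le> fst (served m j \<omega>)" if "\<omega> \<in> \<Omega>" for \<omega>
    unfolding served_eq fst_conv using S that
    by (intro add_nonneg_nonneg sum_nonneg service_nonneg[OF que_range]) (auto simp: measurable_state_def)
  ultimately show ?thesis by (simp add: measurable_state_def)
qed

text \<open>The auxiliary claims assume measurability of the state at epoch \<open>m\<close>,
  because the induction step from \<open>m\<close> to \<open>Suc m\<close> uses them while that
  measurability is only its hypothesis.\<close>

lemma measurable_epoch: "measurable_state (st m)"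
  and measurable_draw': "measurable_state (st m) \<Longrightarrow> draw m \<in> measurable (sample_space X) (count_space UNIV)"
  and measurable_hits': "measurable_state (st m) \<Longrightarrow> Measurable.pred (sample_space X) (hits m j)"
  and measurable_Lv': "measurable_state (st m) \<Longrightarrow> Lv m \<in> measurable (sample_space X) (count_space UNIV)"
proof -
  show draw: "draw m \<in> measurable (sample_space X) (count_space UNIV)" if S: "measurable_state (st m)" for m
  proof -
    have "(\<lambda>\<omega>. Qv m \<omega> (que m)) \<in> measurable (sample_space X) (count_space UNIV)"
      unfolding Qv_def by (rule measurable_compose[OF measurable_state_queue_vec[OF S]]) simp
    then show ?thesis unfolding draw_def
      by (rule measurable_compose_countable[OF draw_measurable[OF stage_range]])
  qed
  show hits: "Measurable.pred (sample_space X) (hits m j)" if S: "measurable_state (st m)" for m j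
  proof -
    have 1: "(\<lambda>\<omega>. vq m j \<omega> (que m)) \<in> measurable (sample_space X) (count_space UNIV)"
      unfolding vq_def by (rule measurable_compose[OF measurable_state_queue_vec[OF measurable_served[OF S]]]) simp
    have 2: "(\<lambda>\<omega>. Qv m \<omega> (que m)) \<in> measurable (sample_space X) (count_space UNIV)"
      unfolding Qv_def by (rule measurable_compose[OF measurable_state_queue_vec[OF S]]) simp
    show ?thesis unfolding hits_def target_def
      by (intro measurable_countable_op[of _ _ _ "(=)"] measurable_countable_op[of _ _ _ "(-)"] 1 2 draw[OF S])
  qed
  show Lv: "Lv m \<in> measurable (sample_space X) (count_space UNIV)" if S: "measurable_state (st m)" for m
    unfolding Lv_def[abs_def] by (rule measurable_Least) (rule hits[OF S])
  show "measurable_state (st m)"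
  proof (induction m)
    case 0
    then show ?case by (simp add: measurable_state_def)
  next
    case (Suc m)
    note V = measurable_served[OF Suc]
    have V1: "(\<lambda>\<omega>. fst (served m j \<omega>)) \<in> borel_measurable (sample_space X)"
      and V2: "(\<lambda>\<omega>. snd (served m j \<omega>)) \<in> measurable (sample_space X) (count_space UNIV)"
      and V3: "\<omega> \<in> \<Omega> \<Longrightarrow> 0 \<le> fst (served m j \<omega>)" for j \<omega>
      using V[of j] by (simp_all add: measurable_state_def)
    have "(\<lambda>\<omega>. fst (served m (Lv m \<omega>) \<omega>)) \<in> borel_measurable (sample_space X)"
      by (rule measurable_compose_countable[where f = "\<lambda>j \<omega>. fst (served m j \<omega>)", OF V1 Lv[OF Suc]])
    then have "(\<lambda>\<omega>. fst (st (Suc m) \<omega>)) \<in> borel_measurable (sample_space X)"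
      unfolding epoch_Suc fst_conv by (intro borel_measurable_add switchover_measurable[OF stage_range])
    moreover have "(\<lambda>\<omega>. snd (st (Suc m) \<omega>)) \<in> measurable (sample_space X) (count_space UNIV)"
      unfolding epoch_Suc snd_conv
      by (rule measurable_compose_countable[where f = "\<lambda>j \<omega>. snd (served m j \<omega>)", OF V2 Lv[OF Suc]])
    moreover have "0 \<le> fst (st (Suc m) \<omega>)" if "\<omega> \<in> \<Omega>" for \<omega>
      unfolding epoch_Suc fst_conv by (intro add_nonneg_nonneg switchover_nonneg[OF stage_range] V3 that)
    ultimately show ?case by (simp add: measurable_state_def)
  qed
qed

lemma measurable_departures [measurable]: "(\<lambda>\<omega>. snd (st m \<omega>)) \<in> measurable (sample_space X) (count_space UNIV)"
  and measurable_Qv [measurable]: "Qv m \<in> measurable (sample_space X) (count_space UNIV)"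
  and measurable_draw [measurable]: "draw m \<in> measurable (sample_space X) (count_space UNIV)"
  and measurable_vq [measurable]: "vq m j \<in> measurable (sample_space X) (count_space UNIV)"
  and measurable_hits [measurable]: "Measurable.pred (sample_space X) (hits m j)"
  and measurable_Lv [measurable]: "Lv m \<in> measurable (sample_space X) (count_space UNIV)"
proof -
  note S = measurable_epoch[of m]
  show "(\<lambda>\<omega>. snd (st m \<omega>)) \<in> measurable (sample_space X) (count_space UNIV)"
    using S by (simp add: measurable_state_def)
  show "Qv m \<in> measurable (sample_space X) (count_space UNIV)"
    unfolding Qv_def[abs_def] by (rule measurable_state_queue_vec[OF S])
  show "vq m j \<in> measurable (sample_space X) (count_space UNIV)"
    unfolding vq_def[abs_def] by (rule measurable_state_queue_vec[OF measurable_served[OF S]])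
qed (rule measurable_draw' measurable_hits' measurable_Lv', rule measurable_epoch)+

lemma measurable_Ev [measurable]: "Ev m \<in> measurable (sample_space X) (count_space UNIV)"
  unfolding Ev_def[abs_def] by (rule measurable_compose_countable[OF measurable_vq measurable_Lv])

lemma measurable_good [measurable]: "Measurable.pred (sample_space X) (good m)"
  unfolding good_def[abs_def] by measurable

lemma measurable_eta [measurable]: "eta m \<in> measurable (sample_space X) (count_space UNIV)"
proof (rule measurable_vecs)
  fix k assume k: "k \<in> {1..K}"
  have V1: "(\<lambda>\<omega>. fst (served m j \<omega>)) \<in> borel_measurable (sample_space X)"
    and V3: "\<omega> \<in> \<Omega> \<Longrightarrow> 0 \<le> fst (served m j \<omega>)" for j \<omega>
    using measurable_served[OF measurable_epoch, of m j] by (simp_all add: measurable_state_def)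
  have V: "(\<lambda>\<omega>. fst (served m (Lv m \<omega>) \<omega>)) \<in> borel_measurable (sample_space X)"
    by (rule measurable_compose_countable[where f = "\<lambda>j \<omega>. fst (served m j \<omega>)", OF V1 measurable_Lv])
  have T: "(\<lambda>\<omega>. fst (st (Suc m) \<omega>)) \<in> borel_measurable (sample_space X)"
    and T3: "\<omega> \<in> \<Omega> \<Longrightarrow> 0 \<le> fst (st (Suc m) \<omega>)" for \<omega>
    using measurable_epoch[of "Suc m"] by (simp_all add: measurable_state_def)
  have "(\<lambda>\<omega>. arrivals X k (fst (st (Suc m) \<omega>)) \<omega> - arrivals X k (fst (served m (Lv m \<omega>) \<omega>)) \<omega>)
      \<in> measurable (sample_space X) (count_space UNIV)"
    by (intro measurable_countable_op[of _ _ _ "(-)"] measurable_arrivals_at[OF k] T V T3 V3)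
  then show "(\<lambda>\<omega>. eta m \<omega> k) \<in> measurable (sample_space X) (count_space UNIV)"
    using k by (simp add: eta_def arrived_def)
qed (auto simp: in_vecs)

end

section \<open>Conditional law of a single visit\<close>

lemma sets_Collect_restrict:
  assumes "A \<in> sets M" "Measurable.pred M P"
  shows "{x \<in> A. P x} \<in> sets M"
proof -
  have "{x \<in> A. P x} = A \<inter> {x \<in> space M. P x}" using sets.sets_into_space[OF assms(1)] by auto
  then show ?thesis using assms by (simp add: pred_def)
qed

lemma nn_integral_indicator_map:
  "(\<integral>\<^sup>+a. indicator {a. f a = z} a \<partial>measure_pmf \<pi>) = ennreal (pmf (map_pmf f \<pi>) z)"
proof -
  have "f -` {z} = {a. f a = z}" by auto
  then show ?thesis by (simp add: pmf_map measure_pmf.emeasure_eq_measure)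
qed

lemma emeasure_scale:
  assumes H: "H \<in> sets M" and G: "G \<in> sets M" "G \<subseteq> H" and C: "countable C" "\<And>\<omega>. \<omega> \<in> H \<Longrightarrow> f \<omega> \<in> C"
    and f: "\<And>c. c \<in> C \<Longrightarrow> Measurable.pred M (\<lambda>\<omega>. f \<omega> = c)"
    and eq: "\<And>c. c \<in> C \<Longrightarrow> emeasure M {\<omega> \<in> G. f \<omega> = c} = emeasure M {\<omega> \<in> H. f \<omega> = c} * \<kappa>"
  shows "emeasure M G = emeasure M H * \<kappa>"
proof -
  have "emeasure M G = (\<integral>\<^sup>+c. emeasure M {\<omega> \<in> G. f \<omega> = c} \<partial>count_space UNIV)"
    using G C by (intro emeasure_partition[of _ _ C] sets_Collect_restrict f) auto
  also have "\<dots> = (\<integral>\<^sup>+c. emeasure M {\<omega> \<in> H. f \<omega> = c} * \<kappa> \<partial>count_space UNIV)"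
  proof (rule nn_integral_cong)
    fix c
    show "emeasure M {\<omega> \<in> G. f \<omega> = c} = emeasure M {\<omega> \<in> H. f \<omega> = c} * \<kappa>"
    proof (cases "c \<in> C")
      case False
      then have "{\<omega> \<in> G. f \<omega> = c} = {}" "{\<omega> \<in> H. f \<omega> = c} = {}" using C G by auto
      then show ?thesis by (simp only: emeasure_empty mult_zero_left)
    qed (rule eq)
  qed
  also have "\<dots> = (\<integral>\<^sup>+c. emeasure M {\<omega> \<in> H. f \<omega> = c} \<partial>count_space UNIV) * \<kappa>"
    by (rule nn_integral_multc) simp
  also have "(\<integral>\<^sup>+c. emeasure M {\<omega> \<in> H. f \<omega> = c} \<partial>count_space UNIV) = emeasure M H"
    using H C by (intro emeasure_partition[symmetric, of _ _ C] sets_Collect_restrict f) auto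
  finally show ?thesis .
qed

context polling_model
begin

declare One_nat_def [simp del]

abbreviation service_arrivals :: "nat \<Rightarrow> (nat \<Rightarrow> nat) pmf" where
  "service_arrivals k \<equiv> arrival_law {1..K} lam (SD k)"

lemma service_nn_mean:
  assumes k: "k \<in> {1..K}"
  shows "(\<integral>\<^sup>+s. ennreal s \<partial>SD k) = ennreal (1 / mu k)"
  using service_mean[OF k] service_law(3)[OF k]
  by (subst nn_integral_eq_integral) (auto simp: has_bochner_integral_iff)

lemma load_lt_1: "k \<in> {1..K} \<Longrightarrow> lam k / mu k < 1"
proof -
  assume k: "k \<in> {1..K}"
  have "lam k / mu k \<le> (\<Sum>k\<in>{1..K}. lam k / mu k)"
    using k arrival_rate service_rate by (intro member_le_sum) (auto intro!: divide_nonneg_nonneg less_imp_le)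
  then show ?thesis using stability by simp
qed

lemma service_arrivals_mean:
  assumes k: "k \<in> {1..K}" and j: "j \<in> {1..K}"
  shows "(\<integral>\<^sup>+a. of_nat (a j) \<partial>service_arrivals k) = ennreal (lam j / mu k)"
  using arrival_law_mean[OF finite_atLeastAtMost service_law(1,2)[OF k] j _ service_law(3)[OF k]] arrival_rate[OF j] service_rate[OF k]
  by (simp add: service_nn_mean[OF k] ennreal_mult'[symmetric])

lemma stopped_walk_service: "k \<in> {1..K} \<Longrightarrow> stopped_walk (service_arrivals k) k (lam k / mu k)"
  using service_arrivals_mean load_lt_1 arrival_rate service_rate
  by unfold_locales (auto intro!: divide_nonneg_nonneg less_imp_le)

end

context bep_model
begin

declare One_nat_def [simp del] source_events.simps [simp del] epoch_state.simps(2) [simp del]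

definition visit_time :: "nat \<Rightarrow> (nat \<Rightarrow> nat) \<Rightarrow> nat \<Rightarrow> 'w \<Rightarrow> real" where
  "visit_time m d j \<omega> = fst (st m \<omega>) + (\<Sum>l<j. service_time X (que m) (d (que m) + l) \<omega>)"

text \<open>The next service at queue \<open>que m\<close> has number \<open>d (que m)\<close> when
  \<open>d\<close> counts the departures. Only with \<open>d\<close> fixed is the source to be
  consulted next a fixed \<open>randomness_source\<close>.\<close>

definition A0 :: "nat \<Rightarrow> (nat \<Rightarrow> nat) \<Rightarrow> 'w set" where
  "A0 m d = {\<omega> \<in> \<Omega>. good m \<omega> \<and> snd (st m \<omega>) = d}"
definition H0 :: "nat \<Rightarrow> (nat \<Rightarrow> nat) \<Rightarrow> (nat \<Rightarrow> nat) \<Rightarrow> nat \<Rightarrow> 'w set" where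
  "H0 m d x y = {\<omega> \<in> A0 m d. Qv m \<omega> = x \<and> draw m \<omega> = y}"
definition Bv :: "nat \<Rightarrow> (nat \<Rightarrow> nat) \<Rightarrow> (nat \<Rightarrow> nat) \<Rightarrow> nat \<Rightarrow> nat \<Rightarrow> 'w set" where
  "Bv m d x y j = {\<omega> \<in> H0 m d x y. \<forall>j'<j. \<not> hits m j' \<omega>}"

text \<open>The sources consulted before epoch \<open>m\<close>, respectively before service \<open>j\<close> of the visit that
  starts there, when \<open>d\<close> counts the departures up to epoch \<open>m\<close>.\<close>

definition Jm :: "nat \<Rightarrow> (nat \<Rightarrow> nat) \<Rightarrow> randomness_source set" where
  "Jm m d = insert Initial ({Service k l | k l. k \<in> {1..K} \<and> l < d k}
    \<union> {Switchover (cycle m') (stage m') | m'. m' < m} \<union> {Draw (cycle m') (stage m') N | m' N. m' < m})"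
definition Jv :: "nat \<Rightarrow> (nat \<Rightarrow> nat) \<Rightarrow> nat \<Rightarrow> nat \<Rightarrow> randomness_source set" where
  "Jv m d N j = insert (Draw (cycle m) (stage m) N) (Jm m d \<union> {Service (que m) (d (que m) + l) | l. l < j})"

lemma Jm_sources: "Jm m d \<subseteq> other_sources"
  unfolding Jm_def using service_source switch_source[OF stage_range] draw_source[OF stage_range] initial_source
  by blast

lemma Jv_sources: "Jv m d N j \<subseteq> other_sources"
  unfolding Jv_def using Jm_sources[of m d] service_source[OF que_range] draw_source[OF stage_range]
  by blast

lemma Draw_notin: "Draw (cycle m) (stage m) N \<notin> Jm m d"
  by (auto simp: Jm_def dest: stage_cycle_inj)

lemma Service_notin: "Service (que m) (d (que m) + j) \<notin> Jv m d N j"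
  by (auto simp: Jv_def Jm_def)

lemma Switchover_notin: "Switchover (cycle m) (stage m) \<notin> Jv m d N j"
  by (auto simp: Jv_def Jm_def dest: stage_cycle_inj)

lemma visit_time_Suc:
  "visit_time m d (Suc j) \<omega> = visit_time m d j \<omega> + service_time X (que m) (d (que m) + j) \<omega>"
  by (simp add: visit_time_def add.assoc)

lemma A0_served:
  "\<omega> \<in> A0 m d \<Longrightarrow> served m j \<omega> = (visit_time m d j \<omega>, d(que m := d (que m) + j))"
  by (simp add: A0_def served_eq visit_time_def)

lemma A0_Qv: "\<omega> \<in> A0 m d \<Longrightarrow> Qv m \<omega> = queue_vec (visit_time m d 0 \<omega>, d) \<omega>"
  using A0_served[of \<omega> m d 0] by (simp add: Qv_def served_0)

lemma A0_events: "A0 m d \<in> P.events"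
  unfolding A0_def by measurable

lemma H0_events: "H0 m d x y \<in> P.events"
  unfolding H0_def by (intro sets_Collect_restrict A0_events) measurable

lemma H0_facts:
  assumes "\<omega> \<in> H0 m d x y"
  shows "\<omega> \<in> \<Omega>" "good m \<omega>" "\<omega> \<in> A0 m d" "Qv m \<omega> = x" "draw m \<omega> = y"
    "target m \<omega> = x (que m) - y" "valid (st m \<omega>) \<omega>"
  using assms good_valid by (auto simp: H0_def A0_def target_def)

text \<open>The assumption is the induction hypothesis of \<open>hist_A0_all\<close>: that lemma
  needs the analysis of visit \<open>m\<close> in order to reach epoch \<open>m + 1\<close>.\<close>

context
  fixes m d
  assumes HA: "hist (Jm m d) (\<lambda>\<omega>. fst (st m \<omega>)) (A0 m d)"
begin

lemma hist_A0: "hist (Jm m d) (visit_time m d 0) (A0 m d)"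
  using HA by (rule hist_cong) (simp add: visit_time_def)

lemma hist_A0_Qv: "hist (Jm m d) (visit_time m d 0) {\<omega> \<in> A0 m d. Qv m \<omega> = x}"
proof -
  have "{\<omega> \<in> A0 m d. Qv m \<omega> = x} = {\<omega> \<in> A0 m d. queue_vec (visit_time m d 0 \<omega>, d) \<omega> = x}"
    using A0_Qv by auto
  also have "hist (Jm m d) (visit_time m d 0) \<dots>"
    by (rule hist_queue_vec[OF hist_A0]) (simp add: Jm_def)
  finally show ?thesis .
qed

lemma H0_eq: "H0 m d x y = {\<omega> \<in> A0 m d. Qv m \<omega> = x} \<inter> {\<omega> \<in> \<Omega>. binomial_draw X (cycle m) (stage m) (x (que m)) \<omega> = y}"
  by (auto simp: H0_def A0_def draw_def)

lemma hist_H0: "hist (Jv m d (x (que m)) 0) (visit_time m d 0) (H0 m d x y)"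
  unfolding H0_eq
proof (rule hist_source[OF hist_mono[OF hist_A0_Qv _ Jv_sources] _ draw_event])
  show "Jm m d \<subseteq> Jv m d (x (que m)) 0" "Draw (cycle m) (stage m) (x (que m)) \<in> Jv m d (x (que m)) 0"
    by (auto simp: Jv_def)
qed

lemma draw_law:
  "emeasure (sample_space X) (H0 m d x y)
    = emeasure (sample_space X) {\<omega> \<in> A0 m d. Qv m \<omega> = x} * ennreal (pmf (binomial_pmf (x (que m)) (r (stage m))) y)"
proof -
  let ?F = "{\<omega> \<in> \<Omega>. binomial_draw X (cycle m) (stage m) (x (que m)) \<omega> = y}"
  have "P.prob ?F = measure (distr (sample_space X) (count_space UNIV) (binomial_draw X (cycle m) (stage m) (x (que m)))) {y}"
    using draw_measurable[OF stage_range] by (subst measure_distr) (auto simp: vimage_def Int_def conj_commute)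
  also have "\<dots> = pmf (binomial_pmf (x (que m)) (r (stage m))) y"
    by (simp add: draw_distr[OF stage_range] pmf.rep_eq)
  finally have "P.prob ?F = pmf (binomial_pmf (x (que m)) (r (stage m))) y" .
  moreover have "P.prob (H0 m d x y) = P.prob {\<omega> \<in> A0 m d. Qv m \<omega> = x} * P.prob ?F"
    unfolding H0_eq by (rule hist_indep[OF hist_A0_Qv draw_source[OF stage_range] Draw_notin draw_event])
  ultimately show ?thesis by (simp add: P.emeasure_eq_measure ennreal_mult'[symmetric])
qed

lemma Bv_served:
  "\<omega> \<in> Bv m d x y j \<Longrightarrow> vq m j' \<omega> = queue_vec (visit_time m d j' \<omega>, d(que m := d (que m) + j')) \<omega>"
  using A0_served[of \<omega> m d j'] by (simp add: Bv_def H0_def vq_def)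

text \<open>Whether the visit ends after \<open>j\<close> services is decided by a queue length seen
  at that moment. Only afterwards does service number \<open>j\<close> join the known sources and
  its duration the elapsed time.\<close>

lemma hist_Bv: "hist (Jv m d (x (que m)) j) (visit_time m d j) (Bv m d x y j)"
proof (induction j)
  case 0
  then show ?case using hist_H0 by (simp add: Bv_def)
next
  case (Suc j)
  have "Bv m d x y (Suc j) = {\<omega> \<in> Bv m d x y j. queue_length X \<omega> (visit_time m d j \<omega>, d(que m := d (que m) + j)) (que m) \<in> - {x (que m) - y}}"
  proof -
    have "hits m j \<omega> \<longleftrightarrow> queue_length X \<omega> (visit_time m d j \<omega>, d(que m := d (que m) + j)) (que m) = x (que m) - y"
      if "\<omega> \<in> Bv m d x y j" for \<omega>
      using that H0_facts(6)[of \<omega> m d x y] by (simp add: hits_def Bv_served[OF that] queue_vec_que Bv_def)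
    then show ?thesis by (auto simp: Bv_def less_Suc_eq)
  qed
  also have "hist (Jv m d (x (que m)) j) (visit_time m d j) \<dots>"
    by (rule hist_queue_length[OF Suc _ que_range]) (simp add: Jv_def Jm_def)
  finally have "hist (Jv m d (x (que m)) (Suc j)) (visit_time m d j) (Bv m d x y (Suc j))"
    by (rule hist_mono[OF _ _ Jv_sources]) (auto simp: Jv_def)
  then have "hist (Jv m d (x (que m)) (Suc j))
      (\<lambda>\<omega>. visit_time m d j \<omega> + service_time X (que m) (d (que m) + j) \<omega>) (Bv m d x y (Suc j))"
    by (rule hist_add[OF _ _ service_event service_nonneg[OF que_range]]) (auto simp: Jv_def)
  then show ?case by (rule hist_cong) (simp add: visit_time_Suc)
qed

lemma hist_Bv_vq: "hist (Jv m d (x (que m)) j) (visit_time m d j) {\<omega> \<in> Bv m d x y j. vq m j \<omega> = z}"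
proof -
  have "{\<omega> \<in> Bv m d x y j. vq m j \<omega> = z}
      = {\<omega> \<in> Bv m d x y j. queue_vec (visit_time m d j \<omega>, d(que m := d (que m) + j)) \<omega> = z}"
    using Bv_served by auto
  also have "hist (Jv m d (x (que m)) j) (visit_time m d j) \<dots>"
    by (rule hist_queue_vec[OF hist_Bv]) (simp add: Jv_def Jm_def)
  finally show ?thesis .
qed

lemma service_law_step:
  "P.prob {\<omega> \<in> {\<omega> \<in> Bv m d x y j. vq m j \<omega> = z}. arrived (visit_time m d j \<omega>) (visit_time m d (Suc j) \<omega>) \<omega> = a}
    = P.prob {\<omega> \<in> Bv m d x y j. vq m j \<omega> = z} * pmf (service_arrivals (que m)) a"
  unfolding visit_time_Suc service_distr[OF que_range, symmetric, of m "d (que m) + j"]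
  by (rule strong_markov[OF hist_Bv_vq service_source[OF que_range] Service_notin
      service_measurable[OF que_range] service_event service_nonneg[OF que_range]])

text \<open>The queue vector after \<open>j\<close> services, frozen once the target is hit: the
  sample-path counterpart of \<open>walk\<close>.\<close>

definition Zv :: "nat \<Rightarrow> 'w \<Rightarrow> nat \<Rightarrow> nat" where
  "Zv j \<omega> = (if \<exists>j'\<le>j. hits m j' \<omega> then Ev m \<omega> else vq m j \<omega>)"

lemma Zv_hit: "hits m j' \<omega> \<Longrightarrow> j' \<le> j \<Longrightarrow> Zv j \<omega> = Ev m \<omega>"
  and Zv_no_hit: "(\<And>j'. j' \<le> j \<Longrightarrow> \<not> hits m j' \<omega>) \<Longrightarrow> Zv j \<omega> = vq m j \<omega>"
  unfolding Zv_def by (auto intro: if_P if_not_P)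

lemma measurable_Zv [measurable]: "Zv j \<in> measurable (sample_space X) (count_space UNIV)"
  unfolding Zv_def[abs_def] by measurable

lemma Zv_stopped:
  assumes "\<omega> \<in> H0 m d x y"
  shows "Zv j \<omega> (que m) \<le> x (que m) - y \<longleftrightarrow> (\<exists>j'\<le>j. hits m j' \<omega>)"
proof
  assume le: "Zv j \<omega> (que m) \<le> x (que m) - y"
  show "\<exists>j'\<le>j. hits m j' \<omega>"
  proof (rule ccontr)
    assume *: "\<not> (\<exists>j'\<le>j. hits m j' \<omega>)"
    then have "target m \<omega> \<le> vq m j \<omega> (que m)" "\<not> hits m j \<omega>"
      using before_hit[OF H0_facts(1,7)[OF assms], of j] by auto
    moreover have "Zv j \<omega> = vq m j \<omega>" using * by (intro Zv_no_hit) auto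
    ultimately show False using le by (simp add: hits_def H0_facts(6)[OF assms])
  qed
next
  assume "\<exists>j'\<le>j. hits m j' \<omega>"
  then show "Zv j \<omega> (que m) \<le> x (que m) - y"
    using Ev_target[of m _ \<omega>] Zv_hit by (metis H0_facts(6)[OF assms] order_refl)
qed

lemma Zv_active:
  assumes "x (que m) - y < z (que m)"
  shows "{\<omega> \<in> H0 m d x y. Zv j \<omega> = z} = {\<omega> \<in> Bv m d x y j. vq m j \<omega> = z}"
proof (intro equalityI subsetI)
  fix \<omega> assume w: "\<omega> \<in> {\<omega> \<in> H0 m d x y. Zv j \<omega> = z}"
  then have "\<not> (\<exists>j'\<le>j. hits m j' \<omega>)" using Zv_stopped[of \<omega> x y j] assms by auto
  then show "\<omega> \<in> {\<omega> \<in> Bv m d x y j. vq m j \<omega> = z}" using w Zv_no_hit[of j \<omega>] by (auto simp: Bv_def)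
next
  fix \<omega> assume w: "\<omega> \<in> {\<omega> \<in> Bv m d x y j. vq m j \<omega> = z}"
  then have h: "\<omega> \<in> H0 m d x y" by (simp add: Bv_def)
  have "\<not> hits m j \<omega>" using w assms H0_facts(6)[OF h] by (auto simp: hits_def)
  then have "\<not> (\<exists>j'\<le>j. hits m j' \<omega>)" using w by (auto simp: Bv_def le_less)
  then show "\<omega> \<in> {\<omega> \<in> H0 m d x y. Zv j \<omega> = z}" using w h Zv_no_hit[of j \<omega>] by auto
qed

lemma Zv_serve:
  assumes z: "x (que m) - y < z (que m)" and w: "\<omega> \<in> Bv m d x y j" "vq m j \<omega> = z"
  shows "Zv (Suc j) \<omega> = serve (que m) z (arrived (visit_time m d j \<omega>) (visit_time m d (Suc j) \<omega>) \<omega>)"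
proof -
  have h: "\<omega> \<in> H0 m d x y" using w by (simp add: Bv_def)
  have nh: "\<not> hits m j' \<omega>" if "j' \<le> j" for j'
    using w z H0_facts(6)[OF h] that by (cases "j' = j") (auto simp: Bv_def hits_def)
  then have v: "valid (served m j \<omega>) \<omega>" using before_hit[OF H0_facts(1,7)[OF h], of j] by simp
  have "Zv (Suc j) \<omega> = vq m (Suc j) \<omega>"
  proof (cases "hits m (Suc j) \<omega>")
    case True
    then have "Lv m \<omega> = Suc j" using nh by (intro Lv_eqI) auto
    then show ?thesis using Zv_hit[OF True order_refl] by (simp add: Ev_def)
  next
    case False
    then show ?thesis using nh by (intro Zv_no_hit) (auto simp: le_Suc_eq)
  qed
  also have "\<dots> = serve (que m) z (arrived (fst (served m j \<omega>)) (fst (served m (Suc j) \<omega>)) \<omega>)"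
    using vq_Suc(2)[OF H0_facts(1)[OF h] v] w z by simp
  finally show ?thesis by (simp add: A0_served[OF H0_facts(3)[OF h]])
qed

text \<open>Induction on \<open>j\<close> with the last step split off. An absorbed path stays put.
  On an active one the next service is a fresh source, so by the strong Markov property its arrivals
  are drawn from \<open>service_arrivals\<close> independently of the path so far.\<close>

lemma walk_law:
  "emeasure (sample_space X) {\<omega> \<in> H0 m d x y. Zv j \<omega> = z}
    = emeasure (sample_space X) (H0 m d x y) * ennreal (pmf (walk (service_arrivals (que m)) (que m) (x (que m) - y) j x) z)"
proof (induction j arbitrary: z)
  case 0
  have "Zv 0 \<omega> = x" if "\<omega> \<in> H0 m d x y" for \<omega>
  proof (cases "hits m 0 \<omega>")
    case True
    then have "Lv m \<omega> = 0" by (intro Lv_eqI) auto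
    then show ?thesis using H0_facts(4)[OF that] Zv_hit[OF True order_refl] by (simp add: Ev_def vq_0)
  qed (use H0_facts(4)[OF that] Zv_no_hit[of 0 \<omega>] in \<open>simp add: vq_0\<close>)
  then have "{\<omega> \<in> H0 m d x y. Zv 0 \<omega> = z} = (if z = x then H0 m d x y else {})" by auto
  then show ?case by (simp add: indicator_def)
next
  case (Suc j)
  let ?k = "que m" and ?\<tau> = "x (que m) - y" and ?M = "sample_space X"
  let ?\<pi> = "service_arrivals ?k"
  let ?step = "\<lambda>z'. if z' ?k \<le> ?\<tau> then return_pmf z' else map_pmf (serve ?k z') ?\<pi>"
  have "emeasure ?M {\<omega> \<in> H0 m d x y. Zv (Suc j) \<omega> = z}
      = emeasure ?M (H0 m d x y) * (\<integral>\<^sup>+z'. ennreal (pmf (?step z') z) \<partial>walk ?\<pi> ?k ?\<tau> j x)"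
  proof (rule emeasure_bind_law[where f = "Zv j" and H = "H0 m d x y"])
    show "countable (vecs {1..K})" by (simp add: countable_vecs)
    show "{\<omega> \<in> H0 m d x y. Zv (Suc j) \<omega> = z} \<in> sets ?M"
      by (intro sets_Collect_restrict H0_events) measurable
    show "{\<omega> \<in> {\<omega> \<in> H0 m d x y. Zv (Suc j) \<omega> = z}. Zv j \<omega> = z'} \<in> sets ?M" for z'
      by (intro sets_Collect_restrict H0_events) measurable
    show "Zv j \<omega> \<in> vecs {1..K}" for \<omega> using in_vecs by (simp add: Zv_def)
    fix z'
    show "emeasure ?M {\<omega> \<in> {\<omega> \<in> H0 m d x y. Zv (Suc j) \<omega> = z}. Zv j \<omega> = z'}
        = emeasure ?M {\<omega> \<in> H0 m d x y. Zv j \<omega> = z'} * ennreal (pmf (?step z') z)"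
    proof (cases "z' ?k \<le> ?\<tau>")
      case True
      have "Zv (Suc j) \<omega> = z'" if h: "\<omega> \<in> H0 m d x y" "Zv j \<omega> = z'" for \<omega>
      proof -
        obtain j' where "j' \<le> j" "hits m j' \<omega>" using Zv_stopped[OF h(1), of j] h(2) True by auto
        then show ?thesis using h(2) Zv_hit[of j' \<omega> j] Zv_hit[of j' \<omega> "Suc j"] by simp
      qed
      then have "{\<omega> \<in> {\<omega> \<in> H0 m d x y. Zv (Suc j) \<omega> = z}. Zv j \<omega> = z'}
          = (if z = z' then {\<omega> \<in> H0 m d x y. Zv j \<omega> = z'} else {})" by auto
      then show ?thesis using True by (simp add: indicator_def)
    next
      case False
      let ?Act = "{\<omega> \<in> Bv m d x y j. vq m j \<omega> = z'}"
      let ?arr = "\<lambda>\<omega>. arrived (visit_time m d j \<omega>) (visit_time m d (Suc j) \<omega>) \<omega>"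
      from False have z': "?\<tau> < z' ?k" by simp
      have Act: "{\<omega> \<in> H0 m d x y. Zv j \<omega> = z'} = ?Act" by (rule Zv_active[of x y z', OF z'])
      have "{\<omega> \<in> {\<omega> \<in> H0 m d x y. Zv (Suc j) \<omega> = z}. Zv j \<omega> = z'}
          = {\<omega> \<in> {\<omega> \<in> H0 m d x y. Zv j \<omega> = z'}. Zv (Suc j) \<omega> = z}" by auto
      also have "\<dots> = {\<omega> \<in> ?Act. serve ?k z' (?arr \<omega>) = z}"
        unfolding Act using Zv_serve[of x y z', OF z'] by auto
      finally have set_eq: "{\<omega> \<in> {\<omega> \<in> H0 m d x y. Zv (Suc j) \<omega> = z}. Zv j \<omega> = z'}
          = {\<omega> \<in> ?Act. serve ?k z' (?arr \<omega>) = z}" .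
      have "emeasure ?M {\<omega> \<in> ?Act. serve ?k z' (?arr \<omega>) = z} = emeasure ?M ?Act * (\<integral>\<^sup>+a. indicator {a. serve ?k z' a = z} a \<partial>?\<pi>)"
      proof (rule emeasure_bind_law[where f = ?arr and H = ?Act])
        have eq: "{\<omega> \<in> ?Act. serve ?k z' (?arr \<omega>) = z} = {\<omega> \<in> {\<omega> \<in> H0 m d x y. Zv j \<omega> = z'}. Zv (Suc j) \<omega> = z}"
          unfolding Act using Zv_serve[of x y z', OF z'] by auto
        show ev: "{\<omega> \<in> ?Act. serve ?k z' (?arr \<omega>) = z} \<in> sets ?M"
          unfolding eq by (intro sets_Collect_restrict H0_events) measurable
        show "countable (vecs {1..K})" by (simp add: countable_vecs)
        show "?arr \<omega> \<in> vecs {1..K}" for \<omega> by (rule in_vecs)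
        show law: "emeasure ?M {\<omega> \<in> ?Act. ?arr \<omega> = a} = emeasure ?M ?Act * ennreal (pmf ?\<pi> a)" for a
          using service_law_step[of x y j z' a] by (simp add: P.emeasure_eq_measure ennreal_mult'[symmetric])
        fix a
        have "hist (Jv m d (x (que m)) (Suc j)) (\<lambda>\<omega>. visit_time m d j \<omega> + service_time X (que m) (d (que m) + j) \<omega>)
            {\<omega> \<in> ?Act. arrived (visit_time m d j \<omega>) (visit_time m d j \<omega> + service_time X (que m) (d (que m) + j) \<omega>) \<omega> = a}"
          by (rule hist_arrived[OF hist_mono[OF hist_Bv_vq _ Jv_sources] _ service_event service_nonneg[OF que_range]])
            (auto simp: Jv_def)
        then have "{\<omega> \<in> ?Act. ?arr \<omega> = a} \<in> sets ?M" unfolding visit_time_Suc by (rule hist_events)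
        moreover have sub: "{\<omega> \<in> {\<omega> \<in> ?Act. serve ?k z' (?arr \<omega>) = z}. ?arr \<omega> = a}
            = (if serve ?k z' a = z then {\<omega> \<in> ?Act. ?arr \<omega> = a} else {})" by auto
        ultimately show "{\<omega> \<in> {\<omega> \<in> ?Act. serve ?k z' (?arr \<omega>) = z}. ?arr \<omega> = a} \<in> sets ?M" by simp
        show "emeasure ?M {\<omega> \<in> {\<omega> \<in> ?Act. serve ?k z' (?arr \<omega>) = z}. ?arr \<omega> = a}
            = emeasure ?M {\<omega> \<in> ?Act. ?arr \<omega> = a} * indicator {a. serve ?k z' a = z} a"
          unfolding sub by simp
      qed auto
      then show ?thesis unfolding set_eq Act nn_integral_indicator_map using False by (simp only: if_False)
    qed
  qed (use Suc in auto)
  then show ?case unfolding walk_Suc by (simp add: ennreal_pmf_bind)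
qed

end

end

section \<open>Transition kernels between polling epochs\<close>

context polling_model
begin

definition visit_kernel :: "nat \<Rightarrow> (nat \<Rightarrow> nat) \<Rightarrow> (nat \<Rightarrow> nat) pmf" where
  "visit_kernel m x = bind_pmf (binomial_pmf (x (que m)) (r (stage m)))
    (\<lambda>y. visit_law (service_arrivals (que m)) (que m) (x (que m) - y) x)"

end

context bep_model
begin

declare One_nat_def [simp del] source_events.simps [simp del] epoch_state.simps(2) [simp del]

definition switch_arrivals :: "nat \<Rightarrow> (nat \<Rightarrow> nat) pmf" where
  "switch_arrivals m = arrival_law {1..K} lam (VD (stage m))"

context
  fixes m d
  assumes HA: "hist (Jm m d) (\<lambda>\<omega>. fst (st m \<omega>)) (A0 m d)"
begin

text \<open>For \<open>z\<close> at the target level, \<open>Zv j = z\<close> forces a hit within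
  \<open>j\<close> services, so these events increase to the event that the visit ends in
  \<open>z\<close>; \<open>visit_law\<close> is the matching monotone limit. Away from the target
  level both sides vanish.\<close>

lemma visit_event_law:
  "emeasure (sample_space X) {\<omega> \<in> H0 m d x y. (\<exists>j. hits m j \<omega>) \<and> Ev m \<omega> = z}
    = emeasure (sample_space X) (H0 m d x y)
      * ennreal (pmf (visit_law (service_arrivals (que m)) (que m) (x (que m) - y) x) z)"
proof -
  interpret W: stopped_walk "service_arrivals (que m)" "que m" "lam (que m) / mu (que m)"
    by (rule stopped_walk_service[OF que_range])
  let ?k = "que m" and ?\<tau> = "x (que m) - y" and ?M = "sample_space X"
  show ?thesis
  proof (cases "z ?k = ?\<tau>")
    case False
    have "{\<omega> \<in> H0 m d x y. (\<exists>j. hits m j \<omega>) \<and> Ev m \<omega> = z} = {}"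
      using False Ev_target H0_facts(6) by fastforce
    moreover have "z \<notin> set_pmf (visit_law (service_arrivals ?k) ?k ?\<tau> x)"
      using W.set_visit_law(1)[of z ?\<tau> x] False by auto
    then have "pmf (visit_law (service_arrivals ?k) ?k ?\<tau> x) z = 0" by (simp add: set_pmf_iff)
    ultimately show ?thesis by (simp only: emeasure_empty ennreal_0 mult_zero_right)
  next
    case True
    let ?Z = "\<lambda>j. {\<omega> \<in> H0 m d x y. Zv m j \<omega> = z}"
    have hit: "\<exists>j'\<le>j. hits m j' \<omega>" if "\<omega> \<in> ?Z j" for j \<omega>
      using Zv_stopped[OF HA, of \<omega> x y j] that True by auto
    have "{\<omega> \<in> H0 m d x y. (\<exists>j. hits m j \<omega>) \<and> Ev m \<omega> = z} = (\<Union>j. ?Z j)"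
    proof (intro equalityI subsetI)
      fix \<omega> assume w: "\<omega> \<in> {\<omega> \<in> H0 m d x y. (\<exists>j. hits m j \<omega>) \<and> Ev m \<omega> = z}"
      then obtain j where "hits m j \<omega>" by auto
      then have "\<omega> \<in> ?Z j" using w Zv_hit[OF HA, of j \<omega> j] by auto
      then show "\<omega> \<in> (\<Union>j. ?Z j)" by (rule UN_I[OF UNIV_I])
    next
      fix \<omega> assume "\<omega> \<in> (\<Union>j. ?Z j)"
      then obtain j where j: "\<omega> \<in> ?Z j" by auto
      with hit obtain j' where "j' \<le> j" "hits m j' \<omega>" by blast
      then show "\<omega> \<in> {\<omega> \<in> H0 m d x y. (\<exists>j. hits m j \<omega>) \<and> Ev m \<omega> = z}"
        using j Zv_hit[OF HA, of j' \<omega> j] by auto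
    qed
    moreover have "emeasure ?M (\<Union>j. ?Z j) = (SUP j. emeasure ?M (?Z j))"
    proof (rule SUP_emeasure_incseq[symmetric])
      show "range ?Z \<subseteq> sets ?M"
        using measurable_Zv[OF HA] by (auto intro!: sets_Collect_restrict H0_events)
      show "incseq ?Z"
      proof (rule monoI, rule subsetI)
        fix i j :: nat and \<omega> assume ij: "i \<le> j" and w: "\<omega> \<in> ?Z i"
        obtain j' where "j' \<le> i" "hits m j' \<omega>" using hit[OF w] by blast
        then show "\<omega> \<in> ?Z j" using w ij Zv_hit[OF HA, of j' \<omega> i] Zv_hit[OF HA, of j' \<omega> j] by auto
      qed
    qed
    moreover have "(SUP j. emeasure ?M (?Z j)) = emeasure ?M (H0 m d x y)
        * ennreal (pmf (visit_law (service_arrivals ?k) ?k ?\<tau> x) z)"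
      using True by (simp add: walk_law[OF HA] W.ennreal_pmf_visit_law stopped_integral_pmf SUP_mult_left_ennreal)
    ultimately show ?thesis by (simp only:)
  qed
qed

lemma visit_kernel_law_fixed:
  "emeasure (sample_space X) {\<omega> \<in> {\<omega> \<in> A0 m d. Qv m \<omega> = x}. (\<exists>j. hits m j \<omega>) \<and> Ev m \<omega> = z}
    = emeasure (sample_space X) {\<omega> \<in> A0 m d. Qv m \<omega> = x} * ennreal (pmf (visit_kernel m x) z)"
proof -
  let ?M = "sample_space X"
  have "emeasure ?M {\<omega> \<in> {\<omega> \<in> A0 m d. Qv m \<omega> = x}. (\<exists>j. hits m j \<omega>) \<and> Ev m \<omega> = z}
    = emeasure ?M {\<omega> \<in> A0 m d. Qv m \<omega> = x}
      * (\<integral>\<^sup>+y. ennreal (pmf (visit_law (service_arrivals (que m)) (que m) (x (que m) - y) x) z)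
          \<partial>binomial_pmf (x (que m)) (r (stage m)))"
  proof (rule emeasure_bind_law[where f = "draw m" and C = UNIV and H = "{\<omega> \<in> A0 m d. Qv m \<omega> = x}"])
    have H: "{\<omega> \<in> {\<omega> \<in> A0 m d. Qv m \<omega> = x}. draw m \<omega> = y} = H0 m d x y" for y
      by (auto simp: H0_def)
    show "emeasure ?M {\<omega> \<in> {\<omega> \<in> A0 m d. Qv m \<omega> = x}. draw m \<omega> = y}
        = emeasure ?M {\<omega> \<in> A0 m d. Qv m \<omega> = x} * ennreal (pmf (binomial_pmf (x (que m)) (r (stage m))) y)" for y
      unfolding H by (rule draw_law[OF HA])
    show "{\<omega> \<in> {\<omega> \<in> A0 m d. Qv m \<omega> = x}. (\<exists>j. hits m j \<omega>) \<and> Ev m \<omega> = z} \<in> sets ?M"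
      by (intro sets_Collect_restrict A0_events) measurable
    fix y
    show "{\<omega> \<in> {\<omega> \<in> {\<omega> \<in> A0 m d. Qv m \<omega> = x}. (\<exists>j. hits m j \<omega>) \<and> Ev m \<omega> = z}. draw m \<omega> = y} \<in> sets ?M"
      by (intro sets_Collect_restrict A0_events) measurable
    have "{\<omega> \<in> {\<omega> \<in> {\<omega> \<in> A0 m d. Qv m \<omega> = x}. (\<exists>j. hits m j \<omega>) \<and> Ev m \<omega> = z}. draw m \<omega> = y}
        = {\<omega> \<in> H0 m d x y. (\<exists>j. hits m j \<omega>) \<and> Ev m \<omega> = z}" by (auto simp: H0_def)
    then show "emeasure ?M {\<omega> \<in> {\<omega> \<in> {\<omega> \<in> A0 m d. Qv m \<omega> = x}. (\<exists>j. hits m j \<omega>) \<and> Ev m \<omega> = z}. draw m \<omega> = y}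
        = emeasure ?M {\<omega> \<in> {\<omega> \<in> A0 m d. Qv m \<omega> = x}. draw m \<omega> = y}
          * ennreal (pmf (visit_law (service_arrivals (que m)) (que m) (x (que m) - y) x) z)"
      unfolding H by (simp only: visit_event_law)
  qed auto
  then show ?thesis by (simp add: visit_kernel_def ennreal_pmf_bind)
qed

end

text \<open>On a piece with fixed index the sources consulted up to the end of the visit, and the
  departures after it, are all known constants. This is what the strong Markov property at the
  switchover requires.\<close>

definition index :: "nat \<Rightarrow> 'w \<Rightarrow> (nat \<Rightarrow> nat) \<times> (nat \<Rightarrow> nat) \<times> nat \<times> nat \<times> (nat \<Rightarrow> nat)" where
  "index m \<omega> = (snd (st m \<omega>), Qv m \<omega>, draw m \<omega>, Lv m \<omega>, Ev m \<omega>)"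

text \<open>The relation between \<open>z\<close>, \<open>x\<close> and \<open>y\<close> says that
  the final state is at the target; it lets \<open>index_event\<close> recover from the recorded
  values that the visit did end.\<close>

definition indices :: "nat \<Rightarrow> ((nat \<Rightarrow> nat) \<times> (nat \<Rightarrow> nat) \<times> nat \<times> nat \<times> (nat \<Rightarrow> nat)) set" where
  "indices m = {(d, x, y, j, z). d \<in> vecs {1..K} \<and> x \<in> vecs {1..K} \<and> z \<in> vecs {1..K} \<and> z (que m) = x (que m) - y}"

lemma countable_indices: "countable (indices m)"
proof (rule countable_subset)
  show "indices m \<subseteq> vecs {1..K} \<times> vecs {1..K} \<times> UNIV \<times> UNIV \<times> vecs {1..K}" by (auto simp: indices_def)
  show "countable (vecs {1..K} \<times> vecs {1..K} \<times> (UNIV :: nat set) \<times> (UNIV :: nat set) \<times> vecs {1..K})"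
    by (intro countable_SIGMA countable_vecs) auto
qed

lemma index_in_indices: "good (Suc m) \<omega> \<Longrightarrow> index m \<omega> \<in> indices m"
  using Ev_target by (auto simp: index_def indices_def departures_in_vecs in_vecs good_Suc target_def)

lemma pred_index: "Measurable.pred (sample_space X) (\<lambda>\<omega>. index m \<omega> = c)"
  by (cases c) (simp add: index_def)

lemma index_event:
  assumes "(d, x, y, j, z) \<in> indices m"
  shows "{\<omega> \<in> \<Omega>. good (Suc m) \<omega> \<and> index m \<omega> = (d, x, y, j, z)} = {\<omega> \<in> Bv m d x y j. vq m j \<omega> = z}"
proof (intro equalityI subsetI)
  fix \<omega> assume w: "\<omega> \<in> {\<omega> \<in> \<Omega>. good (Suc m) \<omega> \<and> index m \<omega> = (d, x, y, j, z)}"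
  then show "\<omega> \<in> {\<omega> \<in> Bv m d x y j. vq m j \<omega> = z}"
    using before_Lv by (auto simp: Bv_def H0_def A0_def good_Suc index_def Ev_def)
next
  fix \<omega> assume w: "\<omega> \<in> {\<omega> \<in> Bv m d x y j. vq m j \<omega> = z}"
  then have h: "\<omega> \<in> H0 m d x y" by (simp add: Bv_def)
  have hit: "hits m j \<omega>" using w assms H0_facts(6)[OF h] by (auto simp: hits_def indices_def)
  moreover have "Lv m \<omega> = j" using w by (intro Lv_eqI hit) (auto simp: Bv_def)
  ultimately show "\<omega> \<in> {\<omega> \<in> \<Omega>. good (Suc m) \<omega> \<and> index m \<omega> = (d, x, y, j, z)}"
    using w h by (auto simp: good_Suc index_def Ev_def H0_def A0_def)
qed

lemma index_event_next:
  assumes "(d, x, y, j, z) \<in> indices m" "\<omega> \<in> Bv m d x y j" "vq m j \<omega> = z"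
  shows "st (Suc m) \<omega> = (visit_time m d j \<omega> + switchover_time X (cycle m) (stage m) \<omega>, d(que m := d (que m) + j))"
    and "eta m \<omega> = arrived (visit_time m d j \<omega>) (visit_time m d j \<omega> + switchover_time X (cycle m) (stage m) \<omega>) \<omega>"
proof -
  have "\<omega> \<in> {\<omega> \<in> \<Omega>. good (Suc m) \<omega> \<and> index m \<omega> = (d, x, y, j, z)}"
    unfolding index_event[OF assms(1)] using assms by simp
  then have L: "Lv m \<omega> = j" by (simp add: index_def)
  have S: "served m j \<omega> = (visit_time m d j \<omega>, d(que m := d (que m) + j))"
    using assms(2) by (intro A0_served) (simp add: Bv_def H0_def)
  show 1: "st (Suc m) \<omega> = (visit_time m d j \<omega> + switchover_time X (cycle m) (stage m) \<omega>, d(que m := d (que m) + j))"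
    unfolding epoch_Suc L S by simp
  show "eta m \<omega> = arrived (visit_time m d j \<omega>) (visit_time m d j \<omega> + switchover_time X (cycle m) (stage m) \<omega>) \<omega>"
    unfolding eta_def 1 L S by simp
qed

lemma A0_Suc:
  "A0 (Suc m) d' = (\<Union>c\<in>indices m. case c of (d, x, y, j, z) \<Rightarrow>
    if d' = d(que m := d (que m) + j) then {\<omega> \<in> Bv m d x y j. vq m j \<omega> = z} else {})"
proof (intro equalityI subsetI)
  fix \<omega> assume w: "\<omega> \<in> A0 (Suc m) d'"
  then have g: "\<omega> \<in> \<Omega>" "good (Suc m) \<omega>" by (auto simp: A0_def)
  obtain d x y j z where c: "index m \<omega> = (d, x, y, j, z)" by (metis prod.exhaust)
  have i: "(d, x, y, j, z) \<in> indices m" using index_in_indices[OF g(2)] c by simp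
  have "\<omega> \<in> {\<omega> \<in> \<Omega>. good (Suc m) \<omega> \<and> index m \<omega> = (d, x, y, j, z)}" using g c by simp
  then have b: "\<omega> \<in> {\<omega> \<in> Bv m d x y j. vq m j \<omega> = z}" unfolding index_event[OF i] .
  then have "snd (st (Suc m) \<omega>) = d(que m := d (que m) + j)" using index_event_next(1)[OF i] by simp
  then have "d' = d(que m := d (que m) + j)" using w by (simp add: A0_def)
  with i b show "\<omega> \<in> (\<Union>c\<in>indices m. case c of (d, x, y, j, z) \<Rightarrow>
    if d' = d(que m := d (que m) + j) then {\<omega> \<in> Bv m d x y j. vq m j \<omega> = z} else {})"
    by (intro UN_I[OF i]) simp
next
  fix \<omega> assume "\<omega> \<in> (\<Union>c\<in>indices m. case c of (d, x, y, j, z) \<Rightarrow>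
    if d' = d(que m := d (que m) + j) then {\<omega> \<in> Bv m d x y j. vq m j \<omega> = z} else {})"
  then obtain d x y j z where i: "(d, x, y, j, z) \<in> indices m" and d': "d' = d(que m := d (que m) + j)"
    and b: "\<omega> \<in> {\<omega> \<in> Bv m d x y j. vq m j \<omega> = z}"
    by (auto split: if_splits)
  have "\<omega> \<in> {\<omega> \<in> \<Omega>. good (Suc m) \<omega> \<and> index m \<omega> = (d, x, y, j, z)}"
    unfolding index_event[OF i] by (rule b)
  then show "\<omega> \<in> A0 (Suc m) d'"
    using index_event_next(1)[OF i, of \<omega>] b by (simp add: A0_def d')
qed

text \<open>By \<open>A0_Suc\<close> the event at the next epoch is a countable union of pieces, one
  for each index. On each of them the next epoch is the end of the visit plus a switchover time, so
  \<open>hist_add\<close> applies.\<close>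

lemma hist_A0_all: "hist (Jm m d) (\<lambda>\<omega>. fst (st m \<omega>)) (A0 m d)"
proof (induction m arbitrary: d)
  case 0
  show ?case
  proof (cases "d = (\<lambda>_. 0)")
    case True
    then have A: "A0 0 d = \<Omega>" by (auto simp: A0_def good_def)
    have "{\<omega> \<in> \<Omega>. (0 :: real) \<le> t} \<in> sets (past (Jm 0 d) t)" for t
    proof (cases "0 \<le> t")
      case True
      then have "{\<omega> \<in> \<Omega>. (0 :: real) \<le> t} = space (past (Jm 0 d) t)" by (simp add: space_past[OF Jm_sources])
      then show ?thesis by (simp only: sets.top)
    qed simp
    then show ?thesis unfolding A hist_def epoch_state.simps(1) fst_conv
      by (intro conjI Jm_sources ballI allI order_refl)
  next
    case False
    then have "A0 0 d = {}" by (auto simp: A0_def)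
    then show ?thesis using hist_empty[OF Jm_sources] by simp
  qed
next
  case (Suc m)
  note HA = Suc
  show ?case unfolding A0_Suc
  proof (rule hist_UN[OF countable_indices])
    have "((\<lambda>_. 0), (\<lambda>_. 0), 0, 0, (\<lambda>_. 0)) \<in> indices m" by (simp add: indices_def vecs_def)
    then show "indices m \<noteq> {}" by blast
    fix c assume c: "c \<in> indices m"
    obtain d' x y j z where c_eq: "c = (d', x, y, j, z)" by (metis prod.exhaust)
    show "hist (Jm (Suc m) d) (\<lambda>\<omega>. fst (st (Suc m) \<omega>))
       (case c of (d', x, y, j, z) \<Rightarrow> if d = d'(que m := d' (que m) + j)
          then {\<omega> \<in> Bv m d' x y j. vq m j \<omega> = z} else {})"
    proof (cases "d = d'(que m := d' (que m) + j)")
      case False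
      then show ?thesis using hist_empty[OF Jm_sources] by (simp add: c_eq)
    next
      case True
      \<comment> \<open>The services given in the visit have numbers from \<open>d' (que m)\<close>
        up to, but excluding, \<open>d' (que m) + j\<close>, and the latter is the new number of
        departures.\<close>
      have sub: "Jv m d' (x (que m)) j \<subseteq> Jm (Suc m) d"
      proof
        have S: "Service k l \<in> Jm (Suc m) d" if "k \<in> {1..K}" "l < d k" for k l
          using that unfolding Jm_def by blast
        fix a assume "a \<in> Jv m d' (x (que m)) j"
        then consider "a = Draw (cycle m) (stage m) (x (que m))" | "a = Initial"
          | k l where "a = Service k l" "k \<in> {1..K}" "l < d' k"
          | m' where "a = Switchover (cycle m') (stage m')" "m' < m"
          | m' N where "a = Draw (cycle m') (stage m') N" "m' < m"
          | l where "a = Service (que m) (d' (que m) + l)" "l < j"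
          unfolding Jv_def Jm_def by blast
        then show "a \<in> Jm (Suc m) d"
        proof cases
          case (3 k l)
          then have "l < d k" unfolding True by auto
          then show ?thesis unfolding 3(1) by (rule S[OF 3(2)])
        next
          case (6 l)
          then have "d' (que m) + l < d (que m)" unfolding True by simp
          then show ?thesis unfolding 6(1) by (rule S[OF que_range])
        qed (auto simp: Jm_def less_Suc_eq)
      qed
      have sw: "Switchover (cycle m) (stage m) \<in> Jm (Suc m) d" by (auto simp: Jm_def)
      have "hist (Jm (Suc m) d) (\<lambda>\<omega>. visit_time m d' j \<omega> + switchover_time X (cycle m) (stage m) \<omega>)
          {\<omega> \<in> Bv m d' x y j. vq m j \<omega> = z}"
        by (rule hist_add[OF hist_mono[OF hist_Bv_vq[OF HA[of d'], where x = x and y = y and j = j and z = z] sub Jm_sources] sw switch_event switchover_nonneg[OF stage_range]])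
      then have "hist (Jm (Suc m) d) (\<lambda>\<omega>. fst (st (Suc m) \<omega>)) {\<omega> \<in> Bv m d' x y j. vq m j \<omega> = z}"
        by (rule hist_cong) (use index_event_next(1)[OF c[unfolded c_eq]] in auto)
      then show ?thesis using True by (simp add: c_eq)
    qed
  qed
qed

text \<open>The conditional law found for fixed departures depends on the queue vector only. Summing
  over the departures shows that the queue vectors alone are Markov.\<close>

lemma visit_kernel_law_good:
  "emeasure (sample_space X) {\<omega> \<in> {\<omega> \<in> \<Omega>. good m \<omega> \<and> Qv m \<omega> = x}. (\<exists>j. hits m j \<omega>) \<and> Ev m \<omega> = z}
    = emeasure (sample_space X) {\<omega> \<in> \<Omega>. good m \<omega> \<and> Qv m \<omega> = x} * ennreal (pmf (visit_kernel m x) z)"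
proof (rule emeasure_scale[where f = "\<lambda>\<omega>. snd (st m \<omega>)" and C = "vecs {1..K}"])
  fix d
  have "{\<omega> \<in> {\<omega> \<in> {\<omega> \<in> \<Omega>. good m \<omega> \<and> Qv m \<omega> = x}. (\<exists>j. hits m j \<omega>) \<and> Ev m \<omega> = z}. snd (st m \<omega>) = d}
      = {\<omega> \<in> {\<omega> \<in> A0 m d. Qv m \<omega> = x}. (\<exists>j. hits m j \<omega>) \<and> Ev m \<omega> = z}"
    "{\<omega> \<in> {\<omega> \<in> \<Omega>. good m \<omega> \<and> Qv m \<omega> = x}. snd (st m \<omega>) = d} = {\<omega> \<in> A0 m d. Qv m \<omega> = x}"
    by (auto simp: A0_def)
  then show "emeasure (sample_space X) {\<omega> \<in> {\<omega> \<in> {\<omega> \<in> \<Omega>. good m \<omega> \<and> Qv m \<omega> = x}. (\<exists>j. hits m j \<omega>) \<and> Ev m \<omega> = z}. snd (st m \<omega>) = d}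
      = emeasure (sample_space X) {\<omega> \<in> {\<omega> \<in> \<Omega>. good m \<omega> \<and> Qv m \<omega> = x}. snd (st m \<omega>) = d} * ennreal (pmf (visit_kernel m x) z)"
    by (simp only: visit_kernel_law_fixed[OF hist_A0_all])
  show "Measurable.pred (sample_space X) (\<lambda>\<omega>. snd (st m \<omega>) = d)" by measurable
next
  show "{\<omega> \<in> \<Omega>. good m \<omega> \<and> Qv m \<omega> = x} \<in> P.events" by measurable
  then show "{\<omega> \<in> {\<omega> \<in> \<Omega>. good m \<omega> \<and> Qv m \<omega> = x}. (\<exists>j. hits m j \<omega>) \<and> Ev m \<omega> = z} \<in> P.events"
    by (intro sets_Collect_restrict) measurable
  show "countable (vecs {1..K})" by (simp add: countable_vecs)
qed (auto simp: departures_in_vecs)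

text \<open>The visit kernel has total mass 1, so given the past the next visit ends with
  probability one; recurrence of the walk has entered through \<open>visit_law\<close>.\<close>

lemma AE_good: "AE \<omega> in sample_space X. good m \<omega>"
proof (induction m)
  case 0
  then show ?case by (simp add: good_def)
next
  case (Suc m)
  let ?M = "sample_space X"
  have x: "emeasure ?M {\<omega> \<in> {\<omega> \<in> \<Omega>. good m \<omega> \<and> Qv m \<omega> = x}. \<exists>j. hits m j \<omega>}
      = emeasure ?M {\<omega> \<in> \<Omega>. good m \<omega> \<and> Qv m \<omega> = x}" for x
  proof -
    let ?G = "{\<omega> \<in> {\<omega> \<in> \<Omega>. good m \<omega> \<and> Qv m \<omega> = x}. \<exists>j. hits m j \<omega>}"
    have ev: "?G \<in> sets ?M" by (intro sets_Collect_restrict) measurable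
    have "emeasure ?M ?G = (\<integral>\<^sup>+z. emeasure ?M {\<omega> \<in> ?G. Ev m \<omega> = z} \<partial>count_space UNIV)"
      by (rule emeasure_partition[OF ev countable_vecs, of "{1..K}"])
        (simp_all add: in_vecs sets_Collect_restrict[OF ev])
    also have "\<dots> = (\<integral>\<^sup>+z. emeasure ?M {\<omega> \<in> \<Omega>. good m \<omega> \<and> Qv m \<omega> = x} * ennreal (pmf (visit_kernel m x) z) \<partial>count_space UNIV)"
    proof (rule nn_integral_cong)
      fix z
      have "{\<omega> \<in> ?G. Ev m \<omega> = z} = {\<omega> \<in> {\<omega> \<in> \<Omega>. good m \<omega> \<and> Qv m \<omega> = x}. (\<exists>j. hits m j \<omega>) \<and> Ev m \<omega> = z}" by auto
      then show "emeasure ?M {\<omega> \<in> ?G. Ev m \<omega> = z}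
          = emeasure ?M {\<omega> \<in> \<Omega>. good m \<omega> \<and> Qv m \<omega> = x} * ennreal (pmf (visit_kernel m x) z)"
        by (simp only: visit_kernel_law_good)
    qed
    also have "\<dots> = emeasure ?M {\<omega> \<in> \<Omega>. good m \<omega> \<and> Qv m \<omega> = x}"
      by (simp add: nn_integral_cmult nn_integral_pmf emeasure_pmf)
    finally show ?thesis .
  qed
  have "emeasure ?M {\<omega> \<in> \<Omega>. good (Suc m) \<omega>} = emeasure ?M {\<omega> \<in> \<Omega>. good m \<omega>} * 1"
  proof (rule emeasure_scale[where f = "Qv m" and C = "vecs {1..K}"])
    fix x
    have "{\<omega> \<in> {\<omega> \<in> \<Omega>. good (Suc m) \<omega>}. Qv m \<omega> = x} = {\<omega> \<in> {\<omega> \<in> \<Omega>. good m \<omega> \<and> Qv m \<omega> = x}. \<exists>j. hits m j \<omega>}"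
      "{\<omega> \<in> {\<omega> \<in> \<Omega>. good m \<omega>}. Qv m \<omega> = x} = {\<omega> \<in> \<Omega>. good m \<omega> \<and> Qv m \<omega> = x}"
      by (auto simp: good_Suc)
    then show "emeasure ?M {\<omega> \<in> {\<omega> \<in> \<Omega>. good (Suc m) \<omega>}. Qv m \<omega> = x}
        = emeasure ?M {\<omega> \<in> {\<omega> \<in> \<Omega>. good m \<omega>}. Qv m \<omega> = x} * 1"
      by (simp only: x mult_1_right)
    show "Measurable.pred ?M (\<lambda>\<omega>. Qv m \<omega> = x)" by measurable
  next
    show "{\<omega> \<in> \<Omega>. good m \<omega>} \<in> sets ?M" "{\<omega> \<in> \<Omega>. good (Suc m) \<omega>} \<in> sets ?M" by measurable
    show "countable (vecs {1..K})" by (simp add: countable_vecs)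
  qed (auto simp: in_vecs good_Suc)
  also have "emeasure ?M {\<omega> \<in> \<Omega>. good m \<omega>} = 1"
    using Suc by (subst P.emeasure_eq_1_AE) auto
  finally show ?case by (subst (asm) P.emeasure_eq_measure) (simp add: P.AE_prob_1 P.prob_Collect_eq_1)
qed

lemma switch_law_good:
  "emeasure (sample_space X) {\<omega> \<in> {\<omega> \<in> \<Omega>. good (Suc m) \<omega> \<and> Ev m \<omega> = z}. eta m \<omega> = e}
    = emeasure (sample_space X) {\<omega> \<in> \<Omega>. good (Suc m) \<omega> \<and> Ev m \<omega> = z} * ennreal (pmf (switch_arrivals m) e)"
proof (rule emeasure_scale[where f = "index m" and C = "indices m"])
  fix c assume c: "c \<in> indices m"
  show "Measurable.pred (sample_space X) (\<lambda>\<omega>. index m \<omega> = c)" by (rule pred_index)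
  obtain d x y j z' where c_eq: "c = (d, x, y, j, z')" by (metis prod.exhaust)
  note i = c[unfolded c_eq]
  let ?R = "{\<omega> \<in> Bv m d x y j. vq m j \<omega> = z'}"
  show "emeasure (sample_space X) {\<omega> \<in> {\<omega> \<in> {\<omega> \<in> \<Omega>. good (Suc m) \<omega> \<and> Ev m \<omega> = z}. eta m \<omega> = e}. index m \<omega> = c}
      = emeasure (sample_space X) {\<omega> \<in> {\<omega> \<in> \<Omega>. good (Suc m) \<omega> \<and> Ev m \<omega> = z}. index m \<omega> = c} * ennreal (pmf (switch_arrivals m) e)"
  proof (cases "z' = z")
    case False
    then have e: "{\<omega> \<in> {\<omega> \<in> {\<omega> \<in> \<Omega>. good (Suc m) \<omega> \<and> Ev m \<omega> = z}. eta m \<omega> = e}. index m \<omega> = c} = {}"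
      "{\<omega> \<in> {\<omega> \<in> \<Omega>. good (Suc m) \<omega> \<and> Ev m \<omega> = z}. index m \<omega> = c} = {}"
      by (auto simp: c_eq index_def)
    show ?thesis unfolding e by simp
  next
    case True
    let ?S = "switchover_time X (cycle m) (stage m)"
    have 1: "{\<omega> \<in> {\<omega> \<in> \<Omega>. good (Suc m) \<omega> \<and> Ev m \<omega> = z}. index m \<omega> = c} = ?R"
      unfolding index_event[OF i, symmetric] using True by (auto simp: c_eq index_def)
    have "{\<omega> \<in> {\<omega> \<in> {\<omega> \<in> \<Omega>. good (Suc m) \<omega> \<and> Ev m \<omega> = z}. eta m \<omega> = e}. index m \<omega> = c}
        = {\<omega> \<in> {\<omega> \<in> {\<omega> \<in> \<Omega>. good (Suc m) \<omega> \<and> Ev m \<omega> = z}. index m \<omega> = c}. eta m \<omega> = e}" by auto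
    also have "\<dots> = {\<omega> \<in> ?R. arrived (visit_time m d j \<omega>) (visit_time m d j \<omega> + ?S \<omega>) \<omega> = e}"
      unfolding 1 using index_event_next(2)[OF i] by auto
    finally have 2: "{\<omega> \<in> {\<omega> \<in> {\<omega> \<in> \<Omega>. good (Suc m) \<omega> \<and> Ev m \<omega> = z}. eta m \<omega> = e}. index m \<omega> = c}
        = {\<omega> \<in> ?R. arrived (visit_time m d j \<omega>) (visit_time m d j \<omega> + ?S \<omega>) \<omega> = e}" .
    have "emeasure (sample_space X) {\<omega> \<in> ?R. arrived (visit_time m d j \<omega>) (visit_time m d j \<omega> + ?S \<omega>) \<omega> = e} = emeasure (sample_space X) ?R * ennreal (pmf (switch_arrivals m) e)"
      using strong_markov[OF hist_Bv_vq[OF hist_A0_all[of m d], where x = x and y = y and j = j and z = z'] switch_source[OF stage_range] Switchover_notin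
          switchover_measurable[OF stage_range] switch_event switchover_nonneg[OF stage_range], where x = e]
      by (simp add: switch_arrivals_def switchover_distr[OF stage_range] P.emeasure_eq_measure ennreal_mult'[symmetric])
    then show ?thesis unfolding 1 2 .
  qed
next
  show "{\<omega> \<in> \<Omega>. good (Suc m) \<omega> \<and> Ev m \<omega> = z} \<in> P.events" by measurable
  then show "{\<omega> \<in> {\<omega> \<in> \<Omega>. good (Suc m) \<omega> \<and> Ev m \<omega> = z}. eta m \<omega> = e} \<in> P.events"
    by (intro sets_Collect_restrict) measurable
qed (auto simp: index_in_indices countable_indices)

lemma nn_integral_visit:
  "(\<integral>\<^sup>+\<omega>. F (Ev m \<omega>) \<partial>sample_space X) = (\<integral>\<^sup>+\<omega>. \<integral>\<^sup>+z. F z \<partial>visit_kernel m (Qv m \<omega>) \<partial>sample_space X)"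
proof (rule nn_integral_kernel[where f = "Qv m" and g = "Ev m" and \<kappa> = "visit_kernel m"
      and C = "vecs {1..K}" and C' = "vecs {1..K}"])
  let ?M = "sample_space X"
  fix x z
  have "emeasure ?M {\<omega> \<in> \<Omega>. Qv m \<omega> = x \<and> Ev m \<omega> = z}
      = emeasure ?M {\<omega> \<in> {\<omega> \<in> \<Omega>. good m \<omega> \<and> Qv m \<omega> = x}. (\<exists>j. hits m j \<omega>) \<and> Ev m \<omega> = z}"
  proof (rule emeasure_eq_AE)
    show "AE \<omega> in ?M. (\<omega> \<in> {\<omega> \<in> \<Omega>. Qv m \<omega> = x \<and> Ev m \<omega> = z})
        = (\<omega> \<in> {\<omega> \<in> {\<omega> \<in> \<Omega>. good m \<omega> \<and> Qv m \<omega> = x}. (\<exists>j. hits m j \<omega>) \<and> Ev m \<omega> = z})"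
      using AE_good[of "Suc m"] by eventually_elim (auto simp: good_Suc)
    show "{\<omega> \<in> {\<omega> \<in> \<Omega>. good m \<omega> \<and> Qv m \<omega> = x}. (\<exists>j. hits m j \<omega>) \<and> Ev m \<omega> = z} \<in> sets ?M"
      by (intro sets_Collect_restrict) measurable
  qed measurable
  also have "\<dots> = emeasure ?M {\<omega> \<in> \<Omega>. good m \<omega> \<and> Qv m \<omega> = x} * ennreal (pmf (visit_kernel m x) z)"
    by (rule visit_kernel_law_good)
  finally have 1: "emeasure ?M {\<omega> \<in> \<Omega>. Qv m \<omega> = x \<and> Ev m \<omega> = z}
      = emeasure ?M {\<omega> \<in> \<Omega>. good m \<omega> \<and> Qv m \<omega> = x} * ennreal (pmf (visit_kernel m x) z)" .
  have "emeasure ?M {\<omega> \<in> \<Omega>. good m \<omega> \<and> Qv m \<omega> = x} = emeasure ?M {\<omega> \<in> \<Omega>. Qv m \<omega> = x}"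
    using AE_good[of m] by (intro emeasure_eq_AE) (auto elim: eventually_mono)
  with 1 show "emeasure ?M {\<omega> \<in> \<Omega>. Qv m \<omega> = x \<and> Ev m \<omega> = z}
      = emeasure ?M {\<omega> \<in> \<Omega>. Qv m \<omega> = x} * ennreal (pmf (visit_kernel m x) z)" by (simp only:)
next
  show "countable (vecs {1..K})" "countable (vecs {1..K})" by (simp_all add: countable_vecs)
qed (simp_all add: in_vecs)

lemma nn_integral_switch:
  "(\<integral>\<^sup>+\<omega>. F (Qv (Suc m) \<omega>) \<partial>sample_space X)
    = (\<integral>\<^sup>+\<omega>. \<integral>\<^sup>+e. F (\<lambda>k. Ev m \<omega> k + e k) \<partial>switch_arrivals m \<partial>sample_space X)"
proof -
  let ?M = "sample_space X"
  let ?add = "\<lambda>z e k. z k + e k :: nat"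
  have "(\<integral>\<^sup>+\<omega>. F (Qv (Suc m) \<omega>) \<partial>?M)
      = (\<integral>\<^sup>+\<omega>. \<integral>\<^sup>+y. F y \<partial>map_pmf (?add (Ev m \<omega>)) (switch_arrivals m) \<partial>?M)"
  proof (rule nn_integral_kernel[where f = "Ev m" and g = "Qv (Suc m)"
        and \<kappa> = "\<lambda>z. map_pmf (?add z) (switch_arrivals m)" and C = "vecs {1..K}" and C' = "vecs {1..K}"])
    fix z y
    let ?H = "{\<omega> \<in> \<Omega>. good (Suc m) \<omega> \<and> Ev m \<omega> = z}"
    have "emeasure ?M {\<omega> \<in> \<Omega>. Ev m \<omega> = z \<and> Qv (Suc m) \<omega> = y}
        = emeasure ?M {\<omega> \<in> ?H. ?add z (eta m \<omega>) = y}"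
    proof (rule emeasure_eq_AE)
      show "AE \<omega> in ?M. (\<omega> \<in> {\<omega> \<in> \<Omega>. Ev m \<omega> = z \<and> Qv (Suc m) \<omega> = y})
          = (\<omega> \<in> {\<omega> \<in> ?H. ?add z (eta m \<omega>) = y})"
        using AE_good[of "Suc m"] AE_space by eventually_elim (auto simp: Qv_Suc)
      have "(\<lambda>\<omega>. ?add z (eta m \<omega>)) \<in> measurable ?M (count_space UNIV)"
        by (rule measurable_compose[OF measurable_eta]) simp
      then show "{\<omega> \<in> ?H. ?add z (eta m \<omega>) = y} \<in> sets ?M"
        by (intro sets_Collect_restrict pred_count_space_const1) measurable
    qed measurable
    also have "\<dots> = emeasure ?M ?H * (\<integral>\<^sup>+e. indicator {e. ?add z e = y} e \<partial>switch_arrivals m)"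
    proof (rule emeasure_bind_law[where f = "eta m" and H = ?H and C = "vecs {1..K}"])
      have "(\<lambda>\<omega>. ?add z (eta m \<omega>)) \<in> measurable ?M (count_space UNIV)"
        by (rule measurable_compose[OF measurable_eta]) simp
      then show G: "{\<omega> \<in> ?H. ?add z (eta m \<omega>) = y} \<in> sets ?M"
        by (intro sets_Collect_restrict pred_count_space_const1) measurable
      fix e
      show "emeasure ?M {\<omega> \<in> ?H. eta m \<omega> = e} = emeasure ?M ?H * ennreal (pmf (switch_arrivals m) e)"
        by (rule switch_law_good)
      show "{\<omega> \<in> {\<omega> \<in> ?H. ?add z (eta m \<omega>) = y}. eta m \<omega> = e} \<in> sets ?M"
        by (rule sets_Collect_restrict[OF G]) measurable
      have "{\<omega> \<in> {\<omega> \<in> ?H. ?add z (eta m \<omega>) = y}. eta m \<omega> = e}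
          = (if ?add z e = y then {\<omega> \<in> ?H. eta m \<omega> = e} else {})" by auto
      then show "emeasure ?M {\<omega> \<in> {\<omega> \<in> ?H. ?add z (eta m \<omega>) = y}. eta m \<omega> = e}
          = emeasure ?M {\<omega> \<in> ?H. eta m \<omega> = e} * indicator {e. ?add z e = y} e" by simp
    qed (auto simp: in_vecs countable_vecs)
    finally have 1: "emeasure ?M {\<omega> \<in> \<Omega>. Ev m \<omega> = z \<and> Qv (Suc m) \<omega> = y}
        = emeasure ?M ?H * ennreal (pmf (map_pmf (?add z) (switch_arrivals m)) y)"
      unfolding nn_integral_indicator_map .
    have "emeasure ?M ?H = emeasure ?M {\<omega> \<in> \<Omega>. Ev m \<omega> = z}"
      using AE_good[of "Suc m"] by (intro emeasure_eq_AE) (auto elim: eventually_mono)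
    with 1 show "emeasure ?M {\<omega> \<in> \<Omega>. Ev m \<omega> = z \<and> Qv (Suc m) \<omega> = y}
        = emeasure ?M {\<omega> \<in> \<Omega>. Ev m \<omega> = z} * ennreal (pmf (map_pmf (?add z) (switch_arrivals m)) y)"
      by (simp only:)
  next
    show "countable (vecs {1..K})" "countable (vecs {1..K})" by (simp_all add: countable_vecs)
  qed (simp_all add: in_vecs)
  then show ?thesis by simp
qed

end

subsection \<open>Polynomial supermartingales\<close>

text \<open>Choose \<delta> with \<open>(1 + \<delta>) ^ l \<le> 1 + \<epsilon>\<close>. If
  \<open>b \<le> \<delta> * a\<close>, the sum is at most \<open>(1 + \<delta>) * a\<close>;
  otherwise \<open>a\<close> is bounded by a multiple of \<open>b\<close>.\<close>

lemma power_add_le_eps: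
  fixes \<epsilon> :: real
  assumes "0 < \<epsilon>"
  shows "\<exists>C\<ge>0. \<forall>a b. 0 \<le> a \<longrightarrow> 0 \<le> b \<longrightarrow> (a + b) ^ l \<le> (1 + \<epsilon>) * a ^ l + C * b ^ l"
proof -
  have "(\<lambda>n. (1 + 1 / real (Suc n)) ^ l) \<longlonglongrightarrow> (1 + 0) ^ l"
    by (intro tendsto_power tendsto_add tendsto_const LIMSEQ_Suc[OF lim_1_over_n])
  then have "\<forall>\<^sub>F n in sequentially. (1 + 1 / real (Suc n)) ^ l < 1 + \<epsilon>"
    by (rule order_tendstoD(2)) (use assms in simp)
  then obtain n where n: "(1 + 1 / real (Suc n)) ^ l < 1 + \<epsilon>"
    unfolding eventually_sequentially by blast
  define \<delta> where "\<delta> = 1 / real (Suc n)"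
  have \<delta>: "0 < \<delta>" "(1 + \<delta>) ^ l \<le> 1 + \<epsilon>" using n by (simp_all add: \<delta>_def)
  show ?thesis
  proof (intro exI[of _ "(1 / \<delta> + 1) ^ l"] conjI allI impI)
    fix a b :: real assume a: "0 \<le> a" and b: "0 \<le> b"
    show "(a + b) ^ l \<le> (1 + \<epsilon>) * a ^ l + (1 / \<delta> + 1) ^ l * b ^ l"
    proof (cases "b \<le> \<delta> * a")
      case True
      have "(a + b) ^ l \<le> ((1 + \<delta>) * a) ^ l"
        using a b True by (intro power_mono) (auto simp: algebra_simps)
      also have "\<dots> \<le> (1 + \<epsilon>) * a ^ l"
        unfolding power_mult_distrib using \<delta> a by (intro mult_right_mono) auto
      also have "\<dots> \<le> (1 + \<epsilon>) * a ^ l + (1 / \<delta> + 1) ^ l * b ^ l" using b \<delta> by simp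
      finally show ?thesis .
    next
      case False
      then have "a \<le> b / \<delta>" using \<delta> by (simp add: field_simps)
      then have "(a + b) ^ l \<le> ((1 / \<delta> + 1) * b) ^ l"
        using a b by (intro power_mono) (auto simp: algebra_simps)
      also have "\<dots> \<le> (1 + \<epsilon>) * a ^ l + (1 / \<delta> + 1) ^ l * b ^ l"
        using a assms by (simp add: power_mult_distrib)
      finally show ?thesis .
    qed
  qed (use \<delta> in simp)
qed

lemma sum_power_le:
  fixes x :: "'b \<Rightarrow> real"
  assumes A: "finite A" "A \<noteq> {}" and x: "\<And>i. i \<in> A \<Longrightarrow> 0 \<le> x i"
  shows "(\<Sum>i\<in>A. x i) ^ l \<le> real (card A) ^ l * (\<Sum>i\<in>A. x i ^ l)"
proof -
  have "Max (x ` A) \<in> x ` A" using A by (intro Max_in) auto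
  then obtain i where i: "i \<in> A" "x i = Max (x ` A)" by (metis imageE)
  have "(\<Sum>j\<in>A. x j) \<le> (\<Sum>j\<in>A. x i)"
    using A i by (intro sum_mono) auto
  then have "(\<Sum>j\<in>A. x j) ^ l \<le> (real (card A) * x i) ^ l"
    using x by (intro power_mono sum_nonneg) auto
  also have "\<dots> = real (card A) ^ l * x i ^ l" by (rule power_mult_distrib)
  also have "\<dots> \<le> real (card A) ^ l * (\<Sum>i\<in>A. x i ^ l)"
    using A i x by (intro mult_left_mono member_le_sum[of i A "\<lambda>i. x i ^ l"]) auto
  finally show ?thesis .
qed

text \<open>The terms of degree at least two in \<open>u\<close> carry at most the power l - 2 of
  \<kappa>, here written as a quotient, and their binomial coefficients sum to at most 2 ^
  l.\<close>

lemma power_taylor_bound: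
  fixes \<kappa> u :: real
  assumes \<kappa>: "1 \<le> \<kappa>"
  shows "(\<kappa> + u) ^ l \<le> \<kappa> ^ l + real l * \<kappa> ^ (l - 1) * u + \<kappa> ^ (l - 1) / \<kappa> * (2 ^ l * (1 + \<bar>u\<bar> ^ l))"
proof -
  have "l = 0 \<or> l = 1 \<or> (\<exists>n. l = n + 2)" by presburger
  then consider "l = 0" | "l = 1" | n where "l = n + 2" by blast
  then show ?thesis
  proof cases
    case 3
    have "(\<kappa> + u) ^ l = (\<Sum>i\<le>l. real (l choose i) * u ^ i * \<kappa> ^ (l - i))"
      using binomial_ring[of u \<kappa> l] by (simp add: add.commute)
    also have "\<dots> = \<kappa> ^ l + real l * u * \<kappa> ^ (l - 1)
        + (\<Sum>i\<le>n. real (l choose (i + 2)) * u ^ (i + 2) * \<kappa> ^ (l - (i + 2)))"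
      unfolding 3 by (simp add: sum.atMost_Suc_shift del: sum.atMost_Suc)
    also have "(\<Sum>i\<le>n. real (l choose (i + 2)) * u ^ (i + 2) * \<kappa> ^ (l - (i + 2)))
        \<le> (\<Sum>i\<le>n. real (l choose (i + 2)) * ((1 + \<bar>u\<bar> ^ l) * \<kappa> ^ n))"
    proof (rule sum_mono)
      fix i assume "i \<in> {..n}"
      then have i: "i + 2 \<le> l" "l - (i + 2) \<le> n" using 3 by auto
      have "u ^ (i + 2) * \<kappa> ^ (l - (i + 2)) \<le> \<bar>u\<bar> ^ (i + 2) * \<kappa> ^ (l - (i + 2))"
        using \<kappa> abs_ge_self[of "u ^ (i + 2)"] unfolding power_abs[symmetric] by (intro mult_right_mono) auto
      also have "\<dots> \<le> (1 + \<bar>u\<bar> ^ l) * \<kappa> ^ n"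
      proof (intro mult_mono power_increasing i(2) \<kappa>)
        show "\<bar>u\<bar> ^ (i + 2) \<le> 1 + \<bar>u\<bar> ^ l"
        proof (cases "\<bar>u\<bar> \<le> 1")
          case True
          then have "\<bar>u\<bar> ^ (i + 2) \<le> 1" by (intro power_le_one) auto
          then show ?thesis by (simp add: add_increasing2)
        next
          case False
          then have "\<bar>u\<bar> ^ (i + 2) \<le> \<bar>u\<bar> ^ l" using i by (intro power_increasing) auto
          then show ?thesis by simp
        qed
      qed (use \<kappa> in auto)
      finally show "real (l choose (i + 2)) * u ^ (i + 2) * \<kappa> ^ (l - (i + 2))
          \<le> real (l choose (i + 2)) * ((1 + \<bar>u\<bar> ^ l) * \<kappa> ^ n)"
        unfolding mult.assoc by (rule mult_left_mono) simp
    qed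
    also have "\<dots> = (\<Sum>i\<le>n. real (l choose (i + 2))) * ((1 + \<bar>u\<bar> ^ l) * \<kappa> ^ n)"
      by (simp add: sum_distrib_right)
    also have "\<dots> \<le> 2 ^ l * ((1 + \<bar>u\<bar> ^ l) * \<kappa> ^ n)"
    proof (intro mult_right_mono)
      have "(\<Sum>i\<le>l. real (l choose i)) = 2 ^ l"
        using choose_row_sum[of l] by (metis of_nat_numeral of_nat_power of_nat_sum)
      moreover have "(\<Sum>i\<le>l. real (l choose i)) = 1 + real l + (\<Sum>i\<le>n. real (l choose (i + 2)))"
        unfolding 3 by (simp add: sum.atMost_Suc_shift del: sum.atMost_Suc)
      ultimately show "(\<Sum>i\<le>n. real (l choose (i + 2))) \<le> 2 ^ l" by linarith
    qed (use \<kappa> in auto)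
    also have "\<kappa> ^ n = \<kappa> ^ (l - 1) / \<kappa>" using \<kappa> by (simp add: 3)
    finally show ?thesis by (simp add: mult_ac)
  qed (use \<kappa> in auto)
qed

text \<open>The first-order term of \<open>(\<kappa> + U) ^ l\<close> is negative and of order l - 1
  in \<kappa>, the remainder only of order l - 2. Beyond a threshold the former wins; the shift
  \<kappa> in the drift inequalities below serves to stay beyond it.\<close>

lemma poly_supermartingale:
  fixes U :: "'b \<Rightarrow> real"
  assumes int: "integrable (measure_pmf p) U" "integrable (measure_pmf p) (\<lambda>a. \<bar>U a\<bar> ^ l)"
    and neg: "measure_pmf.expectation p U < 0"
  shows "\<exists>K0\<ge>1. \<forall>\<kappa>\<ge>K0. (\<forall>a\<in>set_pmf p. 0 \<le> \<kappa> + U a) \<longrightarrow>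
    (\<integral>\<^sup>+a. ennreal ((\<kappa> + U a) ^ l) \<partial>p) \<le> ennreal (\<kappa> ^ l)"
proof (cases "l = 0")
  case True
  then show ?thesis by (intro exI[of _ 1]) (simp add: emeasure_pmf)
next
  case False
  define E where "E = measure_pmf.expectation p U"
  define B where "B = 2 ^ l * (1 + measure_pmf.expectation p (\<lambda>a. \<bar>U a\<bar> ^ l))"
  have B: "0 \<le> B" unfolding B_def by (intro mult_nonneg_nonneg add_nonneg_nonneg integral_nonneg_AE) auto
  show ?thesis
  proof (intro exI[of _ "max 1 (B / (- (real l * E)))"] conjI allI impI)
    fix \<kappa> assume K: "max 1 (B / (- (real l * E))) \<le> \<kappa>" and nonneg: "\<forall>a\<in>set_pmf p. 0 \<le> \<kappa> + U a"
    then have \<kappa>: "1 \<le> \<kappa>" "B / (- (real l * E)) \<le> \<kappa>" by auto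
    have lE: "real l * E < 0" using neg False by (simp add: E_def mult_pos_neg)
    let ?T = "\<lambda>a. \<kappa> ^ l + real l * \<kappa> ^ (l - 1) * U a + \<kappa> ^ (l - 1) / \<kappa> * (2 ^ l * (1 + \<bar>U a\<bar> ^ l))"
    have intT: "integrable (measure_pmf p) ?T"
      using int by (intro Bochner_Integration.integrable_add integrable_mult_right) auto
    have T0: "0 \<le> ?T a" if "a \<in> set_pmf p" for a
      using nonneg that by (intro order_trans[OF zero_le_power power_taylor_bound[OF \<kappa>(1), of "U a" l]]) auto
    have "(\<integral>\<^sup>+a. ennreal ((\<kappa> + U a) ^ l) \<partial>p) \<le> (\<integral>\<^sup>+a. ennreal (?T a) \<partial>p)"
      by (intro nn_integral_mono ennreal_leI power_taylor_bound \<kappa>)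
    also have "\<dots> = ennreal (measure_pmf.expectation p ?T)"
      using intT T0 by (intro nn_integral_eq_integral) (auto simp: AE_measure_pmf_iff)
    also have "measure_pmf.expectation p ?T = \<kappa> ^ l + \<kappa> ^ (l - 1) * (real l * E + B / \<kappa>)"
      using int by (simp add: E_def B_def algebra_simps add_divide_distrib)
    also have "\<dots> \<le> \<kappa> ^ l"
    proof -
      have "B / \<kappa> \<le> - (real l * E)" using \<kappa> lE B by (simp add: field_simps)
      then have "\<kappa> ^ (l - 1) * (real l * E + B / \<kappa>) \<le> 0"
        using \<kappa> by (intro mult_nonneg_nonpos) auto
      then show ?thesis by simp
    qed
    finally show "(\<integral>\<^sup>+a. ennreal ((\<kappa> + U a) ^ l) \<partial>p) \<le> ennreal (\<kappa> ^ l)"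
      by (simp add: ennreal_leI)
  qed simp
qed

lemma arrival_law_moment:
  assumes A: "finite A" and lam: "\<And>k. k \<in> A \<Longrightarrow> 0 \<le> lam k"
  shows "\<exists>C\<ge>0. \<forall>(\<nu> :: real measure) k. prob_space \<nu> \<longrightarrow> sets \<nu> = sets borel \<longrightarrow> (AE s in \<nu>. 0 \<le> s) \<longrightarrow> k \<in> A \<longrightarrow>
    (\<integral>\<^sup>+a. ennreal (real (a k) ^ l) \<partial>arrival_law A lam \<nu>) \<le> ennreal C * (1 + (\<integral>\<^sup>+s. ennreal (s ^ l) \<partial>\<nu>))"
proof -
  obtain C where C: "0 \<le> C" "\<And>s. 0 \<le> s \<Longrightarrow> (\<integral>\<^sup>+n. ennreal (real n ^ l) \<partial>pois s) \<le> ennreal (C * (1 + s ^ l))"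
    using pois_moment[of l] by blast
  define L where "L = 1 + (\<Sum>k\<in>A. lam k)"
  have L: "1 \<le> L" "\<And>k. k \<in> A \<Longrightarrow> lam k \<le> L"
    using lam A by (auto simp: L_def sum_nonneg intro!: member_le_sum add_increasing)
  show ?thesis
  proof (intro exI[of _ "C * L ^ l"] conjI allI impI)
    fix \<nu> :: "real measure" and k assume \<nu>: "prob_space \<nu>" "sets \<nu> = sets borel" "AE s in \<nu>. 0 \<le> s" and k: "k \<in> A"
    interpret \<nu>: prob_space \<nu> by fact
    have "(\<integral>\<^sup>+a. ennreal (real (a k) ^ l) \<partial>arrival_law A lam \<nu>)
        = (\<integral>\<^sup>+s. \<integral>\<^sup>+n. ennreal (real n ^ l) \<partial>pois (lam k * s) \<partial>\<nu>)"
      by (rule nn_integral_arrival_law_component[OF A \<nu>(1,2) k])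
    also have "\<dots> \<le> (\<integral>\<^sup>+s. ennreal (C * L ^ l) * (1 + ennreal (s ^ l)) \<partial>\<nu>)"
    proof (rule nn_integral_mono_AE, use \<nu>(3) in eventually_elim)
      fix s :: real assume s: "0 \<le> s"
      have "(\<integral>\<^sup>+n. ennreal (real n ^ l) \<partial>pois (lam k * s)) \<le> ennreal (C * (1 + (lam k * s) ^ l))"
        using s lam[OF k] by (intro C) simp
      also have "\<dots> \<le> ennreal (C * L ^ l * (1 + s ^ l))"
      proof (intro ennreal_leI)
        have "(lam k * s) ^ l \<le> L ^ l * s ^ l"
          unfolding power_mult_distrib using L(2)[OF k] s lam[OF k] by (intro mult_right_mono power_mono) auto
        moreover have "1 \<le> L ^ l" using L by simp
        ultimately have "1 + (lam k * s) ^ l \<le> L ^ l * (1 + s ^ l)" by (simp add: algebra_simps)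
        then show "C * (1 + (lam k * s) ^ l) \<le> C * L ^ l * (1 + s ^ l)"
          unfolding mult.assoc using C(1) by (rule mult_left_mono)
      qed
      also have "\<dots> = ennreal (C * L ^ l) * (1 + ennreal (s ^ l))"
        using C(1) L s ennreal_plus[of 1 "s ^ l"] by (subst ennreal_mult) simp_all
      finally show "(\<integral>\<^sup>+n. ennreal (real n ^ l) \<partial>pois (lam k * s)) \<le> ennreal (C * L ^ l) * (1 + ennreal (s ^ l))" .
    qed
    also have "\<dots> = ennreal (C * L ^ l) * (1 + (\<integral>\<^sup>+s. ennreal (s ^ l) \<partial>\<nu>))"
    proof -
      have "(\<lambda>s. ennreal (s ^ l)) \<in> borel_measurable borel" by measurable
      then have "(\<lambda>s. ennreal (s ^ l)) \<in> borel_measurable \<nu>"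
        using measurable_cong_sets[OF \<nu>(2) refl] by blast
      then show ?thesis by (simp add: nn_integral_cmult nn_integral_add \<nu>.emeasure_space_1)
    qed
    finally show "(\<integral>\<^sup>+a. ennreal (real (a k) ^ l) \<partial>arrival_law A lam \<nu>)
        \<le> ennreal (C * L ^ l) * (1 + (\<integral>\<^sup>+s. ennreal (s ^ l) \<partial>\<nu>))" .
  qed (use C(1) L in auto)
qed

lemma nn_integral_binomial_Suc:
  assumes "0 \<le> p" "p \<le> 1"
  shows "(\<integral>\<^sup>+y. F y \<partial>binomial_pmf (Suc n) p)
    = (\<integral>\<^sup>+b. \<integral>\<^sup>+y. F (if b then Suc y else y) \<partial>binomial_pmf n p \<partial>bernoulli_pmf p)"
proof -
  have p: "p \<in> {0..1}" using assms by simp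
  show ?thesis
    by (auto simp: binomial_pmf_Suc[OF p] nn_integral_pair_pmf' intro!: nn_integral_cong)
qed

text \<open>The offset \<open>a\<close> carries the induction: conditioning on one trial shifts it
  by 1 - p or by - p.\<close>

lemma binomial_square:
  assumes p: "0 \<le> p" "p \<le> 1"
  shows "(\<integral>\<^sup>+y. ennreal ((a + real y - real n * p) ^ 2) \<partial>binomial_pmf n p) = ennreal (a ^ 2 + real n * p * (1 - p))"
proof (induction n arbitrary: a)
  case 0
  then show ?case using p by (simp add: binomial_pmf_0)
next
  case (Suc n)
  have "(\<integral>\<^sup>+y. ennreal ((a + real y - real (Suc n) * p) ^ 2) \<partial>binomial_pmf (Suc n) p)
      = (\<integral>\<^sup>+b. \<integral>\<^sup>+y. ennreal (((a + (if b then 1 else 0) - p) + real y - real n * p) ^ 2) \<partial>binomial_pmf n p \<partial>bernoulli_pmf p)"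
    unfolding nn_integral_binomial_Suc[OF p]
    by (intro nn_integral_cong) (auto simp: algebra_simps)
  also have "\<dots> = (\<integral>\<^sup>+b. ennreal ((a + (if b then 1 else 0) - p) ^ 2 + real n * p * (1 - p)) \<partial>bernoulli_pmf p)"
    by (simp only: Suc)
  also have "\<dots> = ennreal ((a + 1 - p) ^ 2 + real n * p * (1 - p)) * ennreal p + ennreal ((a - p) ^ 2 + real n * p * (1 - p)) * ennreal (1 - p)"
    using p by simp
  also have "\<dots> = ennreal (((a + 1 - p) ^ 2 + real n * p * (1 - p)) * p + ((a - p) ^ 2 + real n * p * (1 - p)) * (1 - p))"
    using p by (simp add: ennreal_mult'[symmetric] ennreal_plus[symmetric] del: ennreal_plus)
  also have "((a + 1 - p) ^ 2 + real n * p * (1 - p)) * p + ((a - p) ^ 2 + real n * p * (1 - p)) * (1 - p)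
      = a ^ 2 + real (Suc n) * p * (1 - p)"
    by (simp add: power2_eq_square algebra_simps)
  finally show ?case .
qed

lemma binomial_mean:
  assumes p: "0 \<le> p" "p \<le> 1"
  shows "(\<integral>\<^sup>+y. of_nat y \<partial>binomial_pmf n p) = ennreal (real n * p)"
proof (induction n)
  case 0
  then show ?case using p by (simp add: binomial_pmf_0)
next
  case (Suc n)
  have "(\<integral>\<^sup>+y. of_nat y \<partial>binomial_pmf (Suc n) p)
      = (\<integral>\<^sup>+b. \<integral>\<^sup>+y. (if b then 1 else 0) + of_nat y \<partial>binomial_pmf n p \<partial>bernoulli_pmf p)"
    unfolding nn_integral_binomial_Suc[OF p] by (intro nn_integral_cong) auto
  also have "\<dots> = ennreal p + ennreal (real n * p)"
    using p Suc by (simp add: nn_integral_add emeasure_pmf)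
  also have "\<dots> = ennreal (real (Suc n) * p)"
    using p by (simp add: ennreal_plus[symmetric] algebra_simps del: ennreal_plus)
  finally show ?case .
qed

lemma set_binomial_pmf_subset: "0 \<le> p \<Longrightarrow> p \<le> 1 \<Longrightarrow> set_pmf (binomial_pmf n p) \<subseteq> {..n}"
  by (subst set_pmf_binomial_eq) auto

text \<open>Customers are treated one at a time. Each contributes \<open>w\<close> if kept and
  \<open>u\<close> if selected, less than \<open>v\<close> in the mean, so
  \<open>poly_supermartingale\<close> applies to a single Bernoulli trial. The base value only grows
  along the induction, so one threshold suffices for all \<open>n\<close>.\<close>

lemma binomial_polynomial:
  assumes p: "0 \<le> p" "p \<le> 1" and w: "0 \<le> w" "0 \<le> u" "(1 - p) * w + p * u < v"
  shows "\<exists>K0\<ge>1. \<forall>\<kappa>\<ge>K0. \<forall>n. (\<integral>\<^sup>+y. ennreal ((\<kappa> + w * (real n - real y) + u * real y) ^ l) \<partial>binomial_pmf n p)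
    \<le> ennreal ((\<kappa> + v * real n) ^ l)"
proof -
  let ?U = "\<lambda>b. (if b then u else w) - v"
  have "0 \<le> (1 - p) * w + p * u" using p w by simp
  then have v: "0 \<le> v" using w by linarith
  have "measure_pmf.expectation (bernoulli_pmf p) ?U < 0"
    using p w by (subst integral_bernoulli_pmf) (auto simp: algebra_simps)
  then obtain K0 where K0: "1 \<le> K0" "\<And>\<kappa>. K0 \<le> \<kappa> \<Longrightarrow> (\<forall>a\<in>set_pmf (bernoulli_pmf p). 0 \<le> \<kappa> + ?U a) \<Longrightarrow>
      (\<integral>\<^sup>+b. ennreal ((\<kappa> + ?U b) ^ l) \<partial>bernoulli_pmf p) \<le> ennreal (\<kappa> ^ l)"
    using poly_supermartingale[of "bernoulli_pmf p" ?U l] by (auto simp: integrable_measure_pmf_finite)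
  have "(\<integral>\<^sup>+y. ennreal ((\<kappa> + w * (real n - real y) + u * real y) ^ l) \<partial>binomial_pmf n p)
    \<le> ennreal ((\<kappa> + v * real n) ^ l)" if "K0 \<le> \<kappa>" for \<kappa> n
    using that
  proof (induction n arbitrary: \<kappa>)
    case 0
    then show ?case using p by (simp add: binomial_pmf_0)
  next
    case (Suc n)
      have "(\<integral>\<^sup>+y. ennreal ((\<kappa> + w * (real (Suc n) - real y) + u * real y) ^ l) \<partial>binomial_pmf (Suc n) p)
        = (\<integral>\<^sup>+b. \<integral>\<^sup>+y. ennreal (((\<kappa> + (if b then u else w)) + w * (real n - real y) + u * real y) ^ l) \<partial>binomial_pmf n p \<partial>bernoulli_pmf p)"
      unfolding nn_integral_binomial_Suc[OF p] by (intro nn_integral_cong) (auto simp: algebra_simps)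
    also have "\<dots> \<le> (\<integral>\<^sup>+b. ennreal (((\<kappa> + v * real (Suc n)) + ?U b) ^ l) \<partial>bernoulli_pmf p)"
    proof (intro nn_integral_mono)
      fix b
      have "K0 \<le> \<kappa> + (if b then u else w)" using Suc.prems w by auto
      from Suc.IH[OF this] show "(\<integral>\<^sup>+y. ennreal (((\<kappa> + (if b then u else w)) + w * (real n - real y) + u * real y) ^ l) \<partial>binomial_pmf n p)
          \<le> ennreal (((\<kappa> + v * real (Suc n)) + ?U b) ^ l)"
        by (simp add: algebra_simps)
    qed
    also have "\<dots> \<le> ennreal ((\<kappa> + v * real (Suc n)) ^ l)"
    proof (rule K0(2))
      show "K0 \<le> \<kappa> + v * real (Suc n)" using Suc.prems v by (simp add: add_increasing2)
      show "\<forall>a\<in>set_pmf (bernoulli_pmf p). 0 \<le> \<kappa> + v * real (Suc n) + ?U a"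
        using Suc.prems K0(1) w v by (auto simp: algebra_simps)
    qed
    finally show ?case .
  qed
  then show ?thesis using K0(1) by blast
qed

context polling_model
begin

declare One_nat_def [simp del]

text \<open>The mean number of arrivals to queue \<open>j\<close> during one busy period of queue
  \<open>k\<close>, whose mean length is \<open>1 / (mu k * (1 - lam k / mu k))\<close>.\<close>

definition gain :: "nat \<Rightarrow> nat \<Rightarrow> real" where
  "gain k j = lam j / (mu k * (1 - lam k / mu k))"

lemma gain_nonneg: "k \<in> {1..K} \<Longrightarrow> j \<in> {1..K} \<Longrightarrow> 0 \<le> gain k j"
  using load_lt_1[of k] arrival_rate[of j] service_rate[of k] unfolding gain_def
  by (intro divide_nonneg_nonneg mult_nonneg_nonneg) auto

lemma gain_eq: "k \<in> {1..K} \<Longrightarrow> gain k j = lam j / mu k / (1 - lam k / mu k)"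
  by (simp add: gain_def)

lemma policy: "0 \<le> r (stage m)" "r (stage m) \<le> 1"
  using policy_range[OF stage_range] by auto

subsection \<open>Moments of one visit\<close>

lemma service_arrivals_integrable:
  assumes k: "k \<in> {1..K}" and j: "j \<in> {1..K}" and S: "integrable (SD k) (\<lambda>x. x ^ l)"
  shows "integrable (service_arrivals k) (\<lambda>a. real (a j) ^ l)"
proof -
  have lam: "0 \<le> lam k" if "k \<in> {1..K}" for k using arrival_rate[OF that] by simp
  obtain C where C: "0 \<le> C" "\<And>(\<nu> :: real measure) j. prob_space \<nu> \<Longrightarrow> sets \<nu> = sets borel \<Longrightarrow> (AE s in \<nu>. 0 \<le> s) \<Longrightarrow> j \<in> {1..K} \<Longrightarrow>
    (\<integral>\<^sup>+a. ennreal (real (a j) ^ l) \<partial>arrival_law {1..K} lam \<nu>) \<le> ennreal C * (1 + (\<integral>\<^sup>+s. ennreal (s ^ l) \<partial>\<nu>))"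
    using arrival_law_moment[where A = "{1..K}" and lam = lam and l = l, OF finite_atLeastAtMost lam] by blast
  have "(\<integral>\<^sup>+s. ennreal (s ^ l) \<partial>SD k) < \<infinity>"
    using S service_law(3)[OF k] by (subst nn_integral_eq_integral) (auto elim: eventually_mono)
  then have "(\<integral>\<^sup>+a. ennreal (real (a j) ^ l) \<partial>service_arrivals k) < \<infinity>"
    using C(2)[OF service_law[OF k] j] by (auto intro: order.strict_trans1 simp: ennreal_mult_less_top)
  then show ?thesis by (intro integrableI_nonneg) auto
qed

lemma service_arrivals_expectation:
  assumes k: "k \<in> {1..K}" and j: "j \<in> {1..K}"
  shows "integrable (service_arrivals k) (\<lambda>a. real (a j))"
    and "measure_pmf.expectation (service_arrivals k) (\<lambda>a. real (a j)) = lam j / mu k"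
proof -
  have pos: "0 \<le> lam j / mu k" using arrival_rate[OF j] service_rate[OF k] by simp
  have nn: "(\<integral>\<^sup>+a. ennreal (real (a j)) \<partial>service_arrivals k) = ennreal (lam j / mu k)"
    using service_arrivals_mean[OF k j] by (simp add: ennreal_of_nat_eq_real_of_nat)
  show 1: "integrable (service_arrivals k) (\<lambda>a. real (a j))"
    by (rule integrableI_nn_integral_finite[OF _ _ nn]) (use pos in auto)
  show "measure_pmf.expectation (service_arrivals k) (\<lambda>a. real (a j)) = lam j / mu k"
    using nn pos by (subst (asm) nn_integral_eq_integral[OF 1]) auto
qed

text \<open>Two supermartingales are composed. During the walk each customer above the target is
  given a weight \<open>u\<close> slightly larger than the mean weight of the arrivals its busy
  period leaves in other queues; for the draw, a customer counts \<open>w (que m)\<close> if kept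
  and \<open>u\<close> if selected.\<close>

lemma visit_power:
  assumes w: "\<And>j. j \<in> {1..K} \<Longrightarrow> 0 \<le> w j"
    and v: "(1 - r (stage m)) * w (que m) + r (stage m) * (\<Sum>j\<in>{1..K} - {que m}. w j * gain (que m) j) < v"
    and S: "integrable (SD (que m)) (\<lambda>x. x ^ l)"
  shows "\<exists>K0\<ge>1. \<forall>\<kappa>\<ge>K0. \<forall>x.
    (\<integral>\<^sup>+z. ennreal ((\<kappa> + (\<Sum>j\<in>{1..K}. w j * real (z j))) ^ l) \<partial>visit_kernel m x)
    \<le> ennreal ((\<kappa> + v * real (x (que m)) + (\<Sum>j\<in>{1..K} - {que m}. w j * real (x j))) ^ l)"
proof -
  define k where "k = que m"
  define rr where "rr = r (stage m)"
  define Rs where "Rs = {1..K} - {k}"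
  have k: "k \<in> {1..K}" unfolding k_def by (rule que_range)
  have rr: "0 \<le> rr" "rr \<le> 1" using policy by (auto simp: rr_def)
  have Rs: "finite Rs" "j \<in> Rs \<Longrightarrow> j \<in> {1..K} \<and> j \<noteq> k" for j by (auto simp: Rs_def)
  let ?\<pi> = "service_arrivals k" and ?\<rho> = "lam k / mu k"
  interpret W: stopped_walk ?\<pi> k ?\<rho> by (rule stopped_walk_service[OF k])
  define c where "c = (\<Sum>j\<in>Rs. w j * gain k j)"
  have c: "0 \<le> c" unfolding c_def using Rs w gain_nonneg[OF k] by (intro sum_nonneg mult_nonneg_nonneg) auto
  have v: "(1 - rr) * w k + rr * c < v" using v by (simp add: k_def rr_def Rs_def c_def)
  \<comment> \<open>Half of the slack in the hypothesis goes to the walk, which needs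
    \<open>c < u\<close>; since \<open>rr\<close> is at most 1, the other half keeps the inequality
    for the binomial draw strict.\<close>
  define u where "u = c + (v - ((1 - rr) * w k + rr * c)) / 2"
  have u: "c < u" using v by (simp add: u_def)
  have uv: "(1 - rr) * w k + rr * u < v"
  proof -
    have "(1 - rr) * w k + rr * u = (1 - rr) * w k + rr * c + rr * ((v - ((1 - rr) * w k + rr * c)) / 2)"
      by (simp add: u_def algebra_simps)
    also have "\<dots> \<le> (1 - rr) * w k + rr * c + 1 * ((v - ((1 - rr) * w k + rr * c)) / 2)"
      using rr v by (intro add_left_mono mult_right_mono) auto
    also have "\<dots> < v" using v by (simp add: field_simps)
    finally show ?thesis .
  qed
  define U where "U = (\<lambda>a :: nat \<Rightarrow> nat. u * (real (a k) - 1) + (\<Sum>j\<in>Rs. w j * real (a j)))"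
  have intU: "integrable ?\<pi> U"
    unfolding U_def using Rs service_arrivals_expectation(1)[OF k] k
    by (intro Bochner_Integration.integrable_add integrable_mult_right Bochner_Integration.integrable_diff
        Bochner_Integration.integrable_sum) auto
  have "measure_pmf.expectation ?\<pi> U = u * (?\<rho> - 1) + (\<Sum>j\<in>Rs. w j * (lam j / mu k))"
    unfolding U_def using Rs k service_arrivals_expectation[OF k]
    by (simp add: Bochner_Integration.integral_add Bochner_Integration.integral_sum)
  also have "(\<Sum>j\<in>Rs. w j * (lam j / mu k)) = c * (1 - ?\<rho>)"
    unfolding c_def sum_distrib_right using W.load by (intro sum.cong) (auto simp: gain_eq[OF k])
  also have "u * (?\<rho> - 1) + c * (1 - ?\<rho>) = (c - u) * (1 - ?\<rho>)"
    by (simp only: left_diff_distrib right_diff_distrib mult_1_right)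
  finally have "measure_pmf.expectation ?\<pi> U = (c - u) * (1 - ?\<rho>)" .
  also have "\<dots> < 0" using u W.load by (intro mult_neg_pos) auto
  finally have negU: "measure_pmf.expectation ?\<pi> U < 0" .
  define B where "B = u + (\<Sum>j\<in>{1..K}. w j)"
  have B: "u \<le> B" "\<And>j. j \<in> {1..K} \<Longrightarrow> w j \<le> B"
  proof -
    show "u \<le> B" using sum_nonneg[of "{1..K}" w] w by (simp add: B_def)
    show "w j \<le> B" if "j \<in> {1..K}" for j
      using member_le_sum[of j "{1..K}" w] w that u c by (simp add: B_def)
  qed
  have absU: "\<bar>U a\<bar> \<le> B * (1 + (\<Sum>j\<in>{1..K}. real (a j)))" for a
  proof -
    have 1: "\<bar>u * (real (a k) - 1)\<bar> \<le> B * (1 + real (a k))"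
    proof -
      have "\<bar>u * (real (a k) - 1)\<bar> = u * \<bar>real (a k) - 1\<bar>" using u c by (simp add: abs_mult)
      also have "\<dots> \<le> B * (1 + real (a k))" using B u c by (intro mult_mono) auto
      finally show ?thesis .
    qed
    have 2: "(\<Sum>j\<in>Rs. w j * real (a j)) \<le> (\<Sum>j\<in>Rs. B * real (a j))"
      using Rs B by (intro sum_mono mult_right_mono) auto
    have "0 \<le> (\<Sum>j\<in>Rs. w j * real (a j))" using Rs w by (intro sum_nonneg mult_nonneg_nonneg) auto
    then have "\<bar>U a\<bar> \<le> B * (1 + real (a k)) + (\<Sum>j\<in>Rs. B * real (a j))"
      unfolding U_def using 1 2 by linarith
    also have "\<dots> = B * (1 + (\<Sum>j\<in>{1..K}. real (a j)))"
      using k by (simp add: Rs_def sum.remove[of "{1..K}" k] sum_distrib_left algebra_simps)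
    finally show ?thesis .
  qed
  have "integrable ?\<pi> (\<lambda>a. \<bar>U a\<bar> ^ l)"
  proof (rule Bochner_Integration.integrable_bound)
    show "integrable ?\<pi> (\<lambda>a. B ^ l * (2 ^ l * (1 + real K ^ l * (\<Sum>j\<in>{1..K}. real (a j) ^ l))))"
      using service_arrivals_integrable[OF k _ S[folded k_def]]
      by (intro integrable_mult_right Bochner_Integration.integrable_add Bochner_Integration.integrable_sum) auto
    show "AE a in ?\<pi>. norm (\<bar>U a\<bar> ^ l) \<le> norm (B ^ l * (2 ^ l * (1 + real K ^ l * (\<Sum>j\<in>{1..K}. real (a j) ^ l))))"
    proof (rule AE_I2)
      fix a :: "nat \<Rightarrow> nat"
      have B0: "0 \<le> B" using B(1) u c by linarith
      have "\<bar>U a\<bar> ^ l \<le> (B * (1 + (\<Sum>j\<in>{1..K}. real (a j)))) ^ l"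
        by (intro power_mono absU) auto
      also have "\<dots> \<le> B ^ l * (2 ^ l * (1 ^ l + (\<Sum>j\<in>{1..K}. real (a j)) ^ l))"
        unfolding power_mult_distrib using B0 by (intro mult_left_mono power_add_le sum_nonneg) auto
      also have "\<dots> \<le> B ^ l * (2 ^ l * (1 + real K ^ l * (\<Sum>j\<in>{1..K}. real (a j) ^ l)))"
        using B0 k sum_power_le[of "{1..K}" "\<lambda>j. real (a j)" l] by (intro mult_left_mono add_mono) auto
      finally show "norm (\<bar>U a\<bar> ^ l) \<le> norm (B ^ l * (2 ^ l * (1 + real K ^ l * (\<Sum>j\<in>{1..K}. real (a j) ^ l))))"
        by (simp add: abs_le_iff)
    qed
  qed simp
  from poly_supermartingale[OF intU this negU] obtain K1 where K1: "1 \<le> K1"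
    "\<And>\<kappa>. K1 \<le> \<kappa> \<Longrightarrow> (\<forall>a\<in>set_pmf ?\<pi>. 0 \<le> \<kappa> + U a) \<Longrightarrow> (\<integral>\<^sup>+a. ennreal ((\<kappa> + U a) ^ l) \<partial>?\<pi>) \<le> ennreal (\<kappa> ^ l)"
    by blast
  have wk: "0 \<le> w k" "0 \<le> u" using w[OF k] u c by auto
  obtain K2 where K2: "1 \<le> K2" "\<And>\<kappa> n. K2 \<le> \<kappa> \<Longrightarrow>
      (\<integral>\<^sup>+y. ennreal ((\<kappa> + w k * (real n - real y) + u * real y) ^ l) \<partial>binomial_pmf n rr) \<le> ennreal ((\<kappa> + v * real n) ^ l)"
    using binomial_polynomial[OF rr wk uv, of l] by blast
  have "(\<integral>\<^sup>+z. ennreal ((\<kappa> + (\<Sum>j\<in>{1..K}. w j * real (z j))) ^ l) \<partial>visit_kernel m x)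
    \<le> ennreal ((\<kappa> + v * real (x k) + (\<Sum>j\<in>Rs. w j * real (x j))) ^ l)"
    if \<kappa>: "max K1 K2 \<le> \<kappa>" for \<kappa> x
  proof -
    have pos: "0 \<le> (\<Sum>j\<in>Rs. w j * real (z j))" for z
      using Rs w by (intro sum_nonneg mult_nonneg_nonneg) auto
    have inner: "(\<integral>\<^sup>+z. ennreal ((\<kappa> + (\<Sum>j\<in>{1..K}. w j * real (z j))) ^ l) \<partial>visit_law ?\<pi> k (x k - y) x)
        \<le> ennreal ((\<kappa> + (\<Sum>j\<in>Rs. w j * real (x j)) + w k * (real (x k) - real y) + u * real y) ^ l)"
      if y: "y \<le> x k" for y
    proof -
      define \<tau> where "\<tau> = x k - y"
      have \<tau>: "real \<tau> = real (x k) - real y" using y by (simp add: \<tau>_def)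
      \<comment> \<open>Customers of queue \<open>k\<close> above the level weigh \<open>u\<close>
        instead of \<open>w k\<close>. The two weightings agree when the visit ends, because no
        customer is then above the level.\<close>
      define h where "h = (\<lambda>z. \<kappa> + w k * real \<tau> + u * (real (z k) - real \<tau>) + (\<Sum>j\<in>Rs. w j * real (z j)))"
      have step: "h (serve k z a) = h z + U a" if "\<tau> < z k" for z a
      proof -
        have 1: "real (serve k z a k) = real (z k) + real (a k) - 1"
          using that by (simp add: serve_def)
        have 2: "(\<Sum>j\<in>Rs. w j * real (serve k z a j)) = (\<Sum>j\<in>Rs. w j * real (z j)) + (\<Sum>j\<in>Rs. w j * real (a j))"
          unfolding sum.distrib[symmetric] using Rs by (intro sum.cong) (auto simp: serve_def algebra_simps)
        show ?thesis unfolding h_def U_def 1 2 by (simp add: algebra_simps)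
      qed
      have h_ge: "\<kappa> \<le> h z" if "\<tau> \<le> z k" for z
        using that wk pos[of z] by (simp add: h_def)
      have "(\<integral>\<^sup>+z. ennreal ((\<kappa> + (\<Sum>j\<in>{1..K}. w j * real (z j))) ^ l) \<partial>visit_law ?\<pi> k \<tau> x)
          = (\<integral>\<^sup>+z. ennreal (h z ^ l) \<partial>visit_law ?\<pi> k \<tau> x)"
      proof (intro nn_integral_cong_AE, subst AE_measure_pmf_iff, intro ballI)
        fix z assume "z \<in> set_pmf (visit_law ?\<pi> k \<tau> x)"
        then have "z k = \<tau>" by (rule W.set_visit_law) (simp add: \<tau>_def)
        then have "\<kappa> + (\<Sum>j\<in>{1..K}. w j * real (z j)) = h z"
          using k by (simp add: h_def Rs_def sum.remove[of "{1..K}" k])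
        then show "ennreal ((\<kappa> + (\<Sum>j\<in>{1..K}. w j * real (z j))) ^ l) = ennreal (h z ^ l)" by simp
      qed
      also have "\<dots> \<le> ennreal (h x ^ l)"
      proof (rule W.visit_supermartingale)
        fix z assume z: "\<tau> < z k"
        have nonneg: "0 \<le> h z + U a" for a
        proof -
          have "\<tau> \<le> serve k z a k" using z by (simp add: serve_def)
          then show ?thesis using h_ge[of "serve k z a"] step[of z, OF z] \<kappa> K1(1) by simp
        qed
        have "K1 \<le> h z" using h_ge[of z] z \<kappa> by simp
        from K1(2)[OF this] nonneg show "(\<integral>\<^sup>+a. ennreal (h (serve k z a) ^ l) \<partial>?\<pi>) \<le> ennreal (h z ^ l)"
          by (simp add: step[of z, OF z])
      qed
      also have "h x = \<kappa> + (\<Sum>j\<in>Rs. w j * real (x j)) + w k * (real (x k) - real y) + u * real y"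
        by (simp add: h_def \<tau>)
      finally show ?thesis by (simp add: \<tau>_def)
    qed
    have "(\<integral>\<^sup>+z. ennreal ((\<kappa> + (\<Sum>j\<in>{1..K}. w j * real (z j))) ^ l) \<partial>visit_kernel m x)
        = (\<integral>\<^sup>+y. \<integral>\<^sup>+z. ennreal ((\<kappa> + (\<Sum>j\<in>{1..K}. w j * real (z j))) ^ l) \<partial>visit_law ?\<pi> k (x k - y) x \<partial>binomial_pmf (x k) rr)"
      by (simp add: visit_kernel_def k_def rr_def)
    also have "\<dots> \<le> (\<integral>\<^sup>+y. ennreal ((\<kappa> + (\<Sum>j\<in>Rs. w j * real (x j)) + w k * (real (x k) - real y) + u * real y) ^ l) \<partial>binomial_pmf (x k) rr)"
      using inner set_binomial_pmf_subset[OF rr, of "x k"]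
      by (intro nn_integral_mono_AE) (auto simp: AE_measure_pmf_iff)
    also have "\<dots> \<le> ennreal ((\<kappa> + (\<Sum>j\<in>Rs. w j * real (x j)) + v * real (x k)) ^ l)"
      using \<kappa> pos[of x] by (intro K2(2)) simp
    finally show ?thesis by (simp add: add_ac)
  qed
  then show ?thesis using K1(1) unfolding k_def[symmetric] Rs_def[symmetric]
    by (intro exI[of _ "max K1 K2"]) auto
qed

definition visit_mean :: "nat \<Rightarrow> (nat \<Rightarrow> real) \<Rightarrow> nat \<Rightarrow> real" where
  "visit_mean m x j = (if j = que m then (1 - r (stage m)) * x j
    else x j + x (que m) * r (stage m) * gain (que m) j)"

lemma visit_kernel_mean:
  assumes j: "j \<in> {1..K}"
  shows "(\<integral>\<^sup>+z. ennreal (real (z j)) \<partial>visit_kernel m x) = ennreal (visit_mean m (\<lambda>j. real (x j)) j)"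
proof -
  define k where "k = que m"
  define rr where "rr = r (stage m)"
  have k: "k \<in> {1..K}" unfolding k_def by (rule que_range)
  have rr: "0 \<le> rr" "rr \<le> 1" using policy by (auto simp: rr_def)
  let ?\<pi> = "service_arrivals k"
  interpret W: stopped_walk ?\<pi> k "lam k / mu k" by (rule stopped_walk_service[OF k])
  have K: "visit_kernel m x = bind_pmf (binomial_pmf (x k) rr) (\<lambda>y. visit_law ?\<pi> k (x k - y) x)"
    by (simp add: visit_kernel_def k_def rr_def)
  have yle: "AE y in binomial_pmf (x k) rr. y \<le> x k"
    using set_binomial_pmf_subset[OF rr, of "x k"] by (auto simp: AE_measure_pmf_iff)
  show ?thesis
  proof (cases "j = k")
    case True
    have "(\<integral>\<^sup>+z. ennreal (real (z j)) \<partial>visit_law ?\<pi> k (x k - y) x) = ennreal (real (x k - y))" for y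
    proof -
      have "(\<integral>\<^sup>+z. ennreal (real (z j)) \<partial>visit_law ?\<pi> k (x k - y) x) = (\<integral>\<^sup>+z. ennreal (real (x k - y)) \<partial>visit_law ?\<pi> k (x k - y) x)"
        using W.set_visit_law(1)[of _ "x k - y" x] True
        by (intro nn_integral_cong_AE) (auto simp: AE_measure_pmf_iff)
      then show ?thesis by (simp add: emeasure_pmf)
    qed
    then have E: "(\<integral>\<^sup>+z. ennreal (real (z j)) \<partial>visit_kernel m x) = (\<integral>\<^sup>+y. ennreal (real (x k - y)) \<partial>binomial_pmf (x k) rr)"
      (is "_ = ?e") by (simp add: K)
    \<comment> \<open>The mean of the difference is found by adding the mean of the draw and
      cancelling, which avoids subtraction of extended reals.\<close>
    have "?e + ennreal (real (x k) * rr) = (\<integral>\<^sup>+y. ennreal (real (x k - y)) + of_nat y \<partial>binomial_pmf (x k) rr)"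
      using binomial_mean[OF rr] by (simp add: nn_integral_add)
    also have "\<dots> = (\<integral>\<^sup>+y. ennreal (real (x k)) \<partial>binomial_pmf (x k) rr)"
      using yle by (intro nn_integral_cong_AE) (auto simp: ennreal_of_nat_eq_real_of_nat ennreal_plus[symmetric] simp del: ennreal_plus)
    also have "\<dots> = ennreal (real (x k) * (1 - rr)) + ennreal (real (x k) * rr)"
    proof -
      have "real (x k) = real (x k) * (1 - rr) + real (x k) * rr" by (simp add: algebra_simps)
      then show ?thesis using rr by (simp add: emeasure_pmf flip: ennreal_plus)
    qed
    finally have "?e = ennreal (real (x k) * (1 - rr))" by (simp add: add.commute[of _ "ennreal (real (x k) * rr)"] ennreal_add_left_cancel)
    then show ?thesis unfolding E using True by (simp add: visit_mean_def k_def rr_def mult.commute)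
  next
    case False
    have g: "0 \<le> gain k j" by (rule gain_nonneg[OF k j])
    have "(\<integral>\<^sup>+z. ennreal (real (z j)) \<partial>visit_kernel m x)
        = (\<integral>\<^sup>+y. of_nat (x j) + ennreal (gain k j) * of_nat y \<partial>binomial_pmf (x k) rr)"
      unfolding K nn_integral_bind_pmf
    proof (rule nn_integral_cong_AE, use yle in eventually_elim)
      fix y assume y: "y \<le> x k"
      have "(\<integral>\<^sup>+z. of_nat (z j) \<partial>visit_law ?\<pi> k (x k - y) x)
          = of_nat (x j) + ennreal (lam j / mu k / (1 - lam k / mu k)) * of_nat (x k - (x k - y))"
        using arrival_rate[OF j] service_rate[OF k]
        by (intro W.visit_mean False service_arrivals_mean[OF k j]) auto
      then show "(\<integral>\<^sup>+z. ennreal (real (z j)) \<partial>visit_law ?\<pi> k (x k - y) x) = of_nat (x j) + ennreal (gain k j) * of_nat y"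
        using y by (simp add: gain_eq[OF k] ennreal_of_nat_eq_real_of_nat)
    qed
    also have "\<dots> = of_nat (x j) + ennreal (gain k j) * ennreal (real (x k) * rr)"
      using binomial_mean[OF rr] by (simp add: nn_integral_add nn_integral_cmult emeasure_pmf)
    also have "\<dots> = ennreal (visit_mean m (\<lambda>j. real (x j)) j)"
      using False rr g by (simp add: visit_mean_def k_def[symmetric] rr_def[symmetric]
          ennreal_of_nat_eq_real_of_nat ennreal_mult'[symmetric] ennreal_plus[symmetric] mult_ac del: ennreal_plus)
    finally show ?thesis .
  qed
qed

end

context polling_model
begin

declare One_nat_def [simp del]

lemma square_add_le: "(a + b) ^ 2 \<le> 2 * a ^ 2 + 2 * (b :: real) ^ 2"
  using sum_squares_bound[of a b] by (simp add: power2_sum)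

text \<open>The martingale behind \<open>visit_mean\<close> has increments \<zeta> of some variance
  \<open>s2\<close>. Its square gains \<open>s2\<close> per step, while the excess loses 1 - \<rho>;
  with \<open>B = s2 / (1 - \<rho>)\<close> the square plus \<open>B\<close> times the excess is a
  martingale. At the end the excess is 0, at the start the square is 0.\<close>

lemma visit_law_square:
  assumes k: "k \<in> {1..K}" and j: "j \<in> {1..K}" "j \<noteq> k" and S: "integrable (SD k) (\<lambda>x. x ^ 2)"
  shows "\<exists>B\<ge>0. \<forall>\<tau> x. \<tau> \<le> x k \<longrightarrow>
    (\<integral>\<^sup>+z. ennreal ((real (z j) - (real (x j) + gain k j * (real (x k) - real \<tau>))) ^ 2)
      \<partial>visit_law (service_arrivals k) k \<tau> x) \<le> ennreal (B * (real (x k) - real \<tau>))"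
proof -
  let ?\<pi> = "service_arrivals k"
  define \<rho> where "\<rho> = lam k / mu k"
  interpret W: stopped_walk ?\<pi> k \<rho> unfolding \<rho>_def by (rule stopped_walk_service[OF k])
  define c where "c = gain k j"
  define \<zeta> where "\<zeta> = (\<lambda>a :: nat \<Rightarrow> nat. real (a j) + c * (real (a k) - 1))"
  note ik = service_arrivals_expectation[OF k k] and ij = service_arrivals_expectation[OF k j(1)]
  have int: "integrable ?\<pi> \<zeta>"
    unfolding \<zeta>_def using ik(1) ij(1)
    by (intro Bochner_Integration.integrable_add integrable_mult_right Bochner_Integration.integrable_diff) auto
  have "measure_pmf.expectation ?\<pi> \<zeta> = lam j / mu k + c * (\<rho> - 1)"
    unfolding \<zeta>_def \<rho>_def using ik ij by simp
  also have "lam j / mu k = c * (1 - \<rho>)" using W.load by (simp add: c_def gain_eq[OF k] \<rho>_def[symmetric])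
  also have "c * (1 - \<rho>) + c * (\<rho> - 1) = 0" by (simp add: algebra_simps)
  finally have mean0: "measure_pmf.expectation ?\<pi> \<zeta> = 0" .
  have int2: "integrable ?\<pi> (\<lambda>a. \<zeta> a ^ 2)"
  proof (rule Bochner_Integration.integrable_bound)
    show "integrable ?\<pi> (\<lambda>a. 2 * real (a j) ^ 2 + 2 * (2 * (c * real (a k)) ^ 2 + 2 * c ^ 2))"
      using service_arrivals_integrable[OF k k S] service_arrivals_integrable[OF k j(1) S]
      by (intro Bochner_Integration.integrable_add integrable_mult_right)
        (auto simp: power_mult_distrib)
    show "AE a in ?\<pi>. norm (\<zeta> a ^ 2) \<le> norm (2 * real (a j) ^ 2 + 2 * (2 * (c * real (a k)) ^ 2 + 2 * c ^ 2))"
    proof (rule AE_I2)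
      fix a :: "nat \<Rightarrow> nat"
      have "\<zeta> a ^ 2 \<le> 2 * real (a j) ^ 2 + 2 * (c * (real (a k) - 1)) ^ 2"
        unfolding \<zeta>_def by (rule square_add_le)
      also have "(c * (real (a k) - 1)) ^ 2 \<le> 2 * (c * real (a k)) ^ 2 + 2 * c ^ 2"
        using square_add_le[of "c * real (a k)" "- c"] by (simp add: algebra_simps)
      finally show "norm (\<zeta> a ^ 2) \<le> norm (2 * real (a j) ^ 2 + 2 * (2 * (c * real (a k)) ^ 2 + 2 * c ^ 2))"
        by (simp add: abs_of_nonneg)
    qed
  qed simp
  define s2 where "s2 = measure_pmf.expectation ?\<pi> (\<lambda>a. \<zeta> a ^ 2)"
  define B where "B = s2 / (1 - \<rho>)"
  have "0 \<le> s2" unfolding s2_def by (intro integral_nonneg_AE) auto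
  then have B: "0 \<le> B" "B * (1 - \<rho>) = s2" using W.load by (auto simp: B_def)
  show ?thesis
  proof (intro exI[of _ B] conjI allI impI B(1))
    fix \<tau> and x :: "nat \<Rightarrow> nat" assume \<tau>: "\<tau> \<le> x k"
    define A where "A = real (x j) + c * (real (x k) - real \<tau>)"
    define h where "h = (\<lambda>z :: nat \<Rightarrow> nat. (real (z j) + c * (real (z k) - real \<tau>) - A) ^ 2 + B * (real (z k) - real \<tau>))"
    have "(\<integral>\<^sup>+z. ennreal ((real (z j) - A) ^ 2) \<partial>visit_law ?\<pi> k \<tau> x) = (\<integral>\<^sup>+z. ennreal (h z) \<partial>visit_law ?\<pi> k \<tau> x)"
    proof (intro nn_integral_cong_AE, subst AE_measure_pmf_iff, intro ballI)
      fix z assume "z \<in> set_pmf (visit_law ?\<pi> k \<tau> x)"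
      then have "z k = \<tau>" using \<tau> by (rule W.set_visit_law)
      then show "ennreal ((real (z j) - A) ^ 2) = ennreal (h z)" by (simp add: h_def)
    qed
    also have "\<dots> \<le> ennreal (h x)"
    proof (rule W.visit_supermartingale)
      fix z :: "nat \<Rightarrow> nat" assume z: "\<tau> < z k"
      define R where "R = real (z j) + c * (real (z k) - real \<tau>) - A"
      have step: "h (serve k z a) = R ^ 2 + 2 * R * \<zeta> a + \<zeta> a ^ 2 + B * (real (z k) - real \<tau> - 1) + B * real (a k)" for a
      proof -
        have 1: "real (serve k z a k) = real (z k) + real (a k) - 1" using z by (simp add: serve_def)
        have 2: "real (serve k z a j) = real (z j) + real (a j)" using j by (simp add: serve_def)
        have "h (serve k z a) = (R + \<zeta> a) ^ 2 + B * (real (z k) - real \<tau> - 1) + B * real (a k)"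
          unfolding h_def 1 2 R_def \<zeta>_def by (simp add: algebra_simps)
        then show ?thesis by (simp add: power2_sum)
      qed
      have inth: "integrable ?\<pi> (\<lambda>a. h (serve k z a))"
        unfolding step using int int2 ik(1)
        by (intro Bochner_Integration.integrable_add integrable_mult_right) auto
      have nonneg: "0 \<le> h (serve k z a)" for a
      proof -
        have "\<tau> \<le> serve k z a k" using z by (simp add: serve_def)
        then show ?thesis using B(1) by (simp add: h_def)
      qed
      have "(\<integral>\<^sup>+a. ennreal (h (serve k z a)) \<partial>?\<pi>) = ennreal (measure_pmf.expectation ?\<pi> (\<lambda>a. h (serve k z a)))"
        using inth nonneg by (intro nn_integral_eq_integral) auto
      also have "measure_pmf.expectation ?\<pi> (\<lambda>a. h (serve k z a)) = R ^ 2 + s2 + B * (real (z k) - real \<tau> - 1) + B * \<rho>"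
        unfolding step using int int2 ik by (simp add: mean0 s2_def \<rho>_def)
      also have "\<dots> = R ^ 2 + B * (real (z k) - real \<tau>)" unfolding B(2)[symmetric] by (simp add: algebra_simps)
      also have "\<dots> = h z" by (simp add: h_def R_def)
      finally show "(\<integral>\<^sup>+a. ennreal (h (serve k z a)) \<partial>?\<pi>) \<le> ennreal (h z)" by simp
    qed
    also have "h x = B * (real (x k) - real \<tau>)" by (simp add: h_def A_def)
    finally show "(\<integral>\<^sup>+z. ennreal ((real (z j) - (real (x j) + gain k j * (real (x k) - real \<tau>))) ^ 2) \<partial>visit_law ?\<pi> k \<tau> x)
        \<le> ennreal (B * (real (x k) - real \<tau>))"
      by (simp add: A_def c_def)
  qed
qed

text \<open>The deviation splits into the one of the walk given the draw and the one caused by the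
  draw. Both have second moments of the order of the visited queue, not of its square; the
  convergence in L2 rests on this linear growth.\<close>

lemma visit_kernel_square:
  assumes j: "j \<in> {1..K}" and S: "integrable (SD (que m)) (\<lambda>x. x ^ 2)"
  shows "\<exists>C\<ge>0. \<forall>x. (\<integral>\<^sup>+z. ennreal ((real (z j) - visit_mean m (\<lambda>j. real (x j)) j) ^ 2) \<partial>visit_kernel m x)
    \<le> ennreal (C * real (x (que m)))"
proof -
  define k where "k = que m"
  define rr where "rr = r (stage m)"
  have k: "k \<in> {1..K}" unfolding k_def by (rule que_range)
  have rr: "0 \<le> rr" "rr \<le> 1" using policy by (auto simp: rr_def)
  let ?\<pi> = "service_arrivals k"
  interpret W: stopped_walk ?\<pi> k "lam k / mu k" by (rule stopped_walk_service[OF k])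
  have K: "visit_kernel m x = bind_pmf (binomial_pmf (x k) rr) (\<lambda>y. visit_law ?\<pi> k (x k - y) x)" for x
    by (simp add: visit_kernel_def k_def rr_def)
  have yle: "AE y in binomial_pmf (x k) rr. y \<le> x k" for x
    using set_binomial_pmf_subset[OF rr, of "x k"] by (auto simp: AE_measure_pmf_iff)
  have bin: "(\<integral>\<^sup>+y. ennreal ((real y - real n * rr) ^ 2) \<partial>binomial_pmf n rr) \<le> ennreal (real n)" for n
  proof -
    have "real n * rr * (1 - rr) \<le> real n * 1 * 1" using rr by (intro mult_mono) auto
    then show ?thesis using binomial_square[OF rr, where a = 0 and n = n] by (simp add: ennreal_leI)
  qed
  show ?thesis
  proof (cases "j = k")
    case True
    have "(\<integral>\<^sup>+z. ennreal ((real (z j) - visit_mean m (\<lambda>j. real (x j)) j) ^ 2) \<partial>visit_kernel m x) \<le> ennreal (1 * real (x k))" for x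
    proof -
      have "(\<integral>\<^sup>+z. ennreal ((real (z j) - visit_mean m (\<lambda>j. real (x j)) j) ^ 2) \<partial>visit_kernel m x)
          = (\<integral>\<^sup>+y. \<integral>\<^sup>+z. ennreal ((real y - real (x k) * rr) ^ 2) \<partial>visit_law ?\<pi> k (x k - y) x \<partial>binomial_pmf (x k) rr)"
        unfolding K nn_integral_bind_pmf
      proof (rule nn_integral_cong_AE, use yle[of x] in eventually_elim)
        fix y assume y: "y \<le> x k"
        show "(\<integral>\<^sup>+z. ennreal ((real (z j) - visit_mean m (\<lambda>j. real (x j)) j) ^ 2) \<partial>visit_law ?\<pi> k (x k - y) x)
            = (\<integral>\<^sup>+z. ennreal ((real y - real (x k) * rr) ^ 2) \<partial>visit_law ?\<pi> k (x k - y) x)"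
        proof (intro nn_integral_cong_AE, subst AE_measure_pmf_iff, intro ballI)
          fix z assume "z \<in> set_pmf (visit_law ?\<pi> k (x k - y) x)"
          then have "z k = x k - y" by (rule W.set_visit_law) simp
          then have "real (z j) - visit_mean m (\<lambda>j. real (x j)) j = - (real y - real (x k) * rr)"
            using y True by (simp add: visit_mean_def k_def rr_def of_nat_diff algebra_simps)
          then show "ennreal ((real (z j) - visit_mean m (\<lambda>j. real (x j)) j) ^ 2) = ennreal ((real y - real (x k) * rr) ^ 2)"
            by (simp only: power2_minus)
        qed
      qed
      also have "\<dots> \<le> ennreal (real (x k))" using bin[of "x k"] by (simp add: emeasure_pmf)
      finally show ?thesis by simp
    qed
    then show ?thesis unfolding k_def by (intro exI[of _ 1]) auto
  next
    case False
    obtain B where B: "0 \<le> B" "\<And>\<tau> x. \<tau> \<le> x k \<Longrightarrow>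
      (\<integral>\<^sup>+z. ennreal ((real (z j) - (real (x j) + gain k j * (real (x k) - real \<tau>))) ^ 2) \<partial>visit_law ?\<pi> k \<tau> x)
        \<le> ennreal (B * (real (x k) - real \<tau>))"
      using visit_law_square[OF k j False S[folded k_def]] by blast
    define c where "c = gain k j"
    have "(\<integral>\<^sup>+z. ennreal ((real (z j) - visit_mean m (\<lambda>j. real (x j)) j) ^ 2) \<partial>visit_kernel m x)
        \<le> ennreal ((2 * B + 2 * c ^ 2) * real (x k))" for x
    proof -
      have inner: "(\<integral>\<^sup>+z. ennreal ((real (z j) - visit_mean m (\<lambda>j. real (x j)) j) ^ 2) \<partial>visit_law ?\<pi> k (x k - y) x)
          \<le> ennreal (2 * B * real (x k)) + ennreal (2 * c ^ 2) * ennreal ((real y - real (x k) * rr) ^ 2)"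
        if y: "y \<le> x k" for y
      proof -
        let ?A = "real (x j) + gain k j * (real (x k) - real (x k - y))"
        have "(\<integral>\<^sup>+z. ennreal ((real (z j) - visit_mean m (\<lambda>j. real (x j)) j) ^ 2) \<partial>visit_law ?\<pi> k (x k - y) x)
            \<le> (\<integral>\<^sup>+z. 2 * ennreal ((real (z j) - ?A) ^ 2) + ennreal (2 * c ^ 2 * (real y - real (x k) * rr) ^ 2) \<partial>visit_law ?\<pi> k (x k - y) x)"
        proof (intro nn_integral_mono)
          fix z :: "nat \<Rightarrow> nat"
          have eq: "real (z j) - visit_mean m (\<lambda>j. real (x j)) j = (real (z j) - ?A) + c * (real y - real (x k) * rr)"
            using y False by (simp add: visit_mean_def k_def[symmetric] rr_def[symmetric] c_def of_nat_diff algebra_simps)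
          have "(real (z j) - visit_mean m (\<lambda>j. real (x j)) j) ^ 2
              \<le> 2 * (real (z j) - ?A) ^ 2 + 2 * c ^ 2 * (real y - real (x k) * rr) ^ 2"
            unfolding eq using square_add_le[of "real (z j) - ?A" "c * (real y - real (x k) * rr)"]
            by (simp add: power_mult_distrib mult.assoc)
          then have "ennreal ((real (z j) - visit_mean m (\<lambda>j. real (x j)) j) ^ 2)
              \<le> ennreal (2 * (real (z j) - ?A) ^ 2 + 2 * c ^ 2 * (real y - real (x k) * rr) ^ 2)"
            by (rule ennreal_leI)
          then show "ennreal ((real (z j) - visit_mean m (\<lambda>j. real (x j)) j) ^ 2)
              \<le> 2 * ennreal ((real (z j) - ?A) ^ 2) + ennreal (2 * c ^ 2 * (real y - real (x k) * rr) ^ 2)"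
            by (simp add: ennreal_mult' ennreal_plus)
        qed
        also have "\<dots> = 2 * (\<integral>\<^sup>+z. ennreal ((real (z j) - ?A) ^ 2) \<partial>visit_law ?\<pi> k (x k - y) x)
            + ennreal (2 * c ^ 2 * (real y - real (x k) * rr) ^ 2)"
          by (simp add: nn_integral_add nn_integral_cmult emeasure_pmf)
        also have "(\<integral>\<^sup>+z. ennreal ((real (z j) - ?A) ^ 2) \<partial>visit_law ?\<pi> k (x k - y) x) \<le> ennreal (B * (real (x k) - real (x k - y)))"
          by (rule B(2)) simp
        also have "\<dots> \<le> ennreal (B * real (x k))"
          using B(1) by (intro ennreal_leI mult_left_mono) auto
        also have "2 * ennreal (B * real (x k)) = ennreal (2 * B * real (x k))"
          using B(1) by (simp add: ennreal_mult' mult.assoc)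
        finally show ?thesis by (simp add: ennreal_mult' mult_left_mono add_right_mono)
      qed
      have "(\<integral>\<^sup>+z. ennreal ((real (z j) - visit_mean m (\<lambda>j. real (x j)) j) ^ 2) \<partial>visit_kernel m x)
          \<le> (\<integral>\<^sup>+y. ennreal (2 * B * real (x k)) + ennreal (2 * c ^ 2) * ennreal ((real y - real (x k) * rr) ^ 2) \<partial>binomial_pmf (x k) rr)"
        unfolding K nn_integral_bind_pmf
        by (rule nn_integral_mono_AE, use yle[of x] in eventually_elim) (rule inner)
      also have "\<dots> = ennreal (2 * B * real (x k)) + ennreal (2 * c ^ 2) * (\<integral>\<^sup>+y. ennreal ((real y - real (x k) * rr) ^ 2) \<partial>binomial_pmf (x k) rr)"
        by (simp add: nn_integral_add nn_integral_cmult emeasure_pmf)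
      also have "\<dots> \<le> ennreal (2 * B * real (x k)) + ennreal (2 * c ^ 2) * ennreal (real (x k))"
        by (intro add_left_mono mult_left_mono bin) auto
      also have "\<dots> = ennreal ((2 * B + 2 * c ^ 2) * real (x k))"
        using B(1) by (simp add: ennreal_mult'[symmetric] ennreal_plus[symmetric] algebra_simps del: ennreal_plus)
      finally show ?thesis .
    qed
    then show ?thesis using B(1) unfolding k_def by (intro exI[of _ "2 * B + 2 * c ^ 2"]) auto
  qed
qed

subsection \<open>A weight that decreases at every stage\<close>

definition active_stage :: "nat \<Rightarrow> nat \<Rightarrow> bool" where
  "active_stage m k \<longleftrightarrow> que m = k \<and> 0 < r (stage m)"

definition wait :: "nat \<Rightarrow> nat \<Rightarrow> nat" where
  "wait m k = (LEAST t. active_stage (m + t) k)"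

lemma stage_add_I: "stage (m + I) = stage m" "que (m + I) = que m"
  by (simp_all add: stage_def que_def)

lemma active_stage_exists:
  assumes "k \<in> {1..K}"
  shows "\<exists>t<I. active_stage (m + t) k"
proof -
  have "\<exists>i\<in>{i. i \<in> {1..I} \<and> p i = k}. 0 < r i"
  proof (rule ccontr)
    assume "\<not> ?thesis"
    then have "(\<Sum>i | i \<in> {1..I} \<and> p i = k. r i) \<le> 0" by (intro sum_nonpos) (auto simp: not_less)
    then show False using policy_active[OF assms] by simp
  qed
  then obtain i where i: "1 \<le> i" "i \<le> I" "p i = k" "0 < r i" by auto
  \<comment> \<open>The number of epochs from \<open>m\<close> to the next visit of stage
    \<open>i\<close>; one period is added to keep the subtraction in the naturals.\<close>
  define t where "t = ((i - 1) + (I - m mod I)) mod I"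
  have "(m + t) mod I = (m mod I + ((i - 1) + (I - m mod I))) mod I"
    by (simp add: t_def mod_simps)
  also have "m mod I + ((i - 1) + (I - m mod I)) = (i - 1) + I"
    using mod_less_divisor[OF I_pos, of m] by simp
  also have "\<dots> mod I = (i - 1) mod I" by (rule mod_add_self2)
  also have "\<dots> = i - 1" using i I_pos by (intro mod_less) simp
  finally have "stage (m + t) = i" using i by (simp add: stage_def)
  then have "active_stage (m + t) k" using i by (simp add: active_stage_def que_def)
  moreover have "t < I" using I_pos by (simp add: t_def)
  ultimately show ?thesis by blast
qed

lemma wait_less: "k \<in> {1..K} \<Longrightarrow> wait m k < I"
  using active_stage_exists[of k m] unfolding wait_def by (metis (mono_tags, lifting) Least_le le_less_trans)

lemma wait_active: "active_stage m k \<Longrightarrow> wait m k = 0"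
  unfolding wait_def by (rule Least_eq_0) simp

lemma wait_Suc:
  assumes "k \<in> {1..K}" "\<not> active_stage m k"
  shows "wait m k = Suc (wait (Suc m) k)"
proof -
  obtain t where t: "active_stage (m + t) k" using active_stage_exists[OF assms(1)] by blast
  have "(LEAST t. active_stage (m + t) k) = Suc (LEAST t. active_stage (m + Suc t) k)"
    using t assms(2) by (intro Least_Suc) auto
  then show ?thesis by (simp add: wait_def)
qed

text \<open>A customer is weighed by the mean work it brings, \<open>1 / mu\<close>, discounted by
  powers of \<gamma>. With every inactive stage the waiting time drops by one and the discount grows
  by one factor. At an active stage the discount may be lost altogether; this is paid for because
  the work of the selected customers is replaced, in the mean, by at most the fraction \<rho> of it,
  left in other queues.\<close>

theorem weights_exist:
  obtains \<gamma> :: real and w :: "nat \<Rightarrow> nat \<Rightarrow> real" where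
    "0 < \<gamma>" "\<gamma> < 1"
    "\<And>m j. j \<in> {1..K} \<Longrightarrow> 0 < w m j"
    "\<And>m j. w (m + I) j = w m j"
    "\<And>m j. j \<in> {1..K} \<Longrightarrow> j \<noteq> que m \<Longrightarrow> w (Suc m) j \<le> \<gamma> * w m j"
    "\<And>m. (1 - r (stage m)) * w (Suc m) (que m)
      + r (stage m) * (\<Sum>j\<in>{1..K} - {que m}. w (Suc m) j * gain (que m) j) \<le> \<gamma> * w m (que m)"
proof -
  let ?\<rho> = "\<Sum>k\<in>{1..K}. lam k / mu k"
  define R where "R = {r i | i. i \<in> {1..I} \<and> 0 < r i}"
  have Rfin: "finite R" unfolding R_def by simp
  obtain t where "active_stage (0 + t) (que 0)" using active_stage_exists[OF que_range] by blast
  then have "r (stage t) \<in> R" using stage_range[of t] by (auto simp: R_def active_stage_def)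
  then have Rne: "R \<noteq> {}" by blast
  define \<delta> where "\<delta> = Min R * (1 - ?\<rho>)"
  have MinR: "0 < Min R" "Min R \<le> 1"
    using Min_in[OF Rfin Rne] policy_range by (auto simp: R_def)
  have \<rho>: "0 \<le> ?\<rho>" using arrival_rate service_rate by (intro sum_nonneg) (auto intro!: divide_nonneg_nonneg less_imp_le)
  have \<delta>: "0 < \<delta>" "\<delta> \<le> 1"
    using MinR stability \<rho> mult_mono[of "Min R" 1 "1 - ?\<rho>" 1] by (auto simp: \<delta>_def)
  \<comment> \<open>\<delta> bounds from below the relative loss of work of a served queue at an
    active stage. It must pay for up to \<open>I\<close> discount factors and for the contraction
    itself; Bernoulli's inequality shows that \<delta> / (I + 1) per factor is affordable.\<close>
  define \<gamma> where "\<gamma> = 1 - \<delta> / real (I + 1)"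
  have "\<delta> / real (I + 1) < 1" using \<delta> I_pos by (simp add: field_simps)
  then have \<gamma>: "0 < \<gamma>" "\<gamma> < 1" using \<delta> I_pos by (auto simp: \<gamma>_def)
  have \<gamma>_pow: "1 - \<delta> \<le> \<gamma> ^ (I + 1)"
    using Bernoulli_inequality[of "- (\<delta> / real (I + 1))" "I + 1"] \<open>\<delta> / real (I + 1) < 1\<close>
    by (simp add: \<gamma>_def)
  define w where "w = (\<lambda>m k. 1 / mu k * \<gamma> ^ (I - wait m k))"
  show thesis
  proof (rule that[OF \<gamma>])
    show pos: "0 < w m j" if "j \<in> {1..K}" for m j
      using \<gamma> service_rate[OF that] by (simp add: w_def)
    have "active_stage (m + I + t) j = active_stage (m + t) j" for m t j
      using stage_add_I[of "m + t"] by (simp add: active_stage_def add_ac)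
    then show "w (m + I) j = w m j" for m j by (simp add: w_def wait_def)
    have inactive: "w (Suc m) j = \<gamma> * w m j" if j: "j \<in> {1..K}" and "\<not> active_stage m j" for m j
    proof -
      have "I - wait (Suc m) j = Suc (I - wait m j)"
        using wait_Suc[OF that] wait_less[OF j, of m] by simp
      then show ?thesis by (simp add: w_def)
    qed
    then show "w (Suc m) j \<le> \<gamma> * w m j" if "j \<in> {1..K}" "j \<noteq> que m" for m j
      using that by (simp add: active_stage_def)
    fix m
    define k where "k = que m"
    have k: "k \<in> {1..K}" unfolding k_def by (rule que_range)
    define rr where "rr = r (stage m)"
    have rr: "0 \<le> rr" "rr \<le> 1" using policy by (auto simp: rr_def)
    have "(1 - rr) * w (Suc m) k + rr * (\<Sum>j\<in>{1..K} - {k}. w (Suc m) j * gain k j) \<le> \<gamma> * w m k"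
    proof (cases "rr = 0")
      case True
      then have "\<not> active_stage m k" by (simp add: active_stage_def rr_def)
      then show ?thesis using inactive[OF k, of m] True by simp
    next
      case False
      then have act: "active_stage m k" using rr by (simp add: active_stage_def k_def rr_def)
      then have wm: "w m k = 1 / mu k * \<gamma> ^ I" by (simp add: w_def wait_active)
      have w_le: "w (Suc m) j \<le> 1 / mu j" if "j \<in> {1..K}" for j
        using \<gamma> service_rate[OF that] power_le_one[of \<gamma>] by (simp add: w_def field_simps)
      define \<rho>k where "\<rho>k = lam k / mu k"
      have \<rho>k: "\<rho>k < 1" "0 \<le> \<rho>k" using load_lt_1[OF k] arrival_rate[OF k] service_rate[OF k] by (auto simp: \<rho>k_def)
      have "(\<Sum>j\<in>{1..K} - {k}. w (Suc m) j * gain k j) \<le> (\<Sum>j\<in>{1..K} - {k}. 1 / mu j * gain k j)"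
        using w_le gain_nonneg[OF k] by (intro sum_mono mult_right_mono) auto
      also have "\<dots> = (\<Sum>j\<in>{1..K} - {k}. lam j / mu j) * (1 / mu k / (1 - \<rho>k))"
        unfolding sum_distrib_right by (intro sum.cong) (simp_all add: gain_def \<rho>k_def)
      also have "(\<Sum>j\<in>{1..K} - {k}. lam j / mu j) = ?\<rho> - \<rho>k"
        using k by (subst sum_diff1) (auto simp: \<rho>k_def)
      finally have S: "(\<Sum>j\<in>{1..K} - {k}. w (Suc m) j * gain k j) \<le> 1 / mu k * ((?\<rho> - \<rho>k) / (1 - \<rho>k))"
        by (simp add: mult_ac)
      \<comment> \<open>Per unit of work cleared at queue \<open>k\<close> the left side is what its
        busy periods leave in the other queues. Stability gives the bound by the total load.\<close>
      have q: "(?\<rho> - \<rho>k) / (1 - \<rho>k) \<le> ?\<rho>"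
      proof -
        have "0 \<le> \<rho>k * (1 - ?\<rho>)" using \<rho>k stability by (intro mult_nonneg_nonneg) auto
        then have "?\<rho> - \<rho>k \<le> ?\<rho> * (1 - \<rho>k)" by (simp add: algebra_simps)
        then show ?thesis using \<rho>k by (simp add: pos_divide_le_eq)
      qed
      have muk: "0 < 1 / mu k" using service_rate[OF k] by simp
      have "(1 - rr) * w (Suc m) k + rr * (\<Sum>j\<in>{1..K} - {k}. w (Suc m) j * gain k j)
          \<le> (1 - rr) * (1 / mu k) + rr * (1 / mu k * ?\<rho>)"
        using rr w_le[OF k] S mult_left_mono[OF q less_imp_le[OF muk]]
        by (intro add_mono mult_left_mono) auto
      also have "\<dots> = 1 / mu k * (1 - rr * (1 - ?\<rho>))"
      proof -
        have "(1 - rr) * q + rr * (q * t) = q * (1 - rr * (1 - t))" for q t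
          by (simp add: algebra_simps)
        then show ?thesis .
      qed
      also have "\<dots> \<le> 1 / mu k * (1 - \<delta>)"
      proof -
        have "Min R \<le> rr" using False rr stage_range[of m] by (intro Min_le Rfin) (auto simp: R_def rr_def)
        then have "\<delta> \<le> rr * (1 - ?\<rho>)" unfolding \<delta>_def using stability by (intro mult_right_mono) auto
        then show ?thesis using muk by (intro mult_left_mono) auto
      qed
      also have "\<dots> \<le> 1 / mu k * \<gamma> ^ (I + 1)" using \<gamma>_pow muk by (intro mult_left_mono) auto
      also have "\<dots> = \<gamma> * w m k" by (simp add: wm power_add)
      finally show ?thesis .
    qed
    then show "(1 - r (stage m)) * w (Suc m) (que m)
      + r (stage m) * (\<Sum>j\<in>{1..K} - {que m}. w (Suc m) j * gain (que m) j) \<le> \<gamma> * w m (que m)"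
      by (simp only: k_def rr_def)
  qed
qed

end

section \<open>Drift of the weighted queue length\<close>

lemma periodic_mod:
  fixes g :: "nat \<Rightarrow> 'b"
  assumes "\<And>m. g (m + N) = g m"
  shows "g m = g (m mod N)"
proof -
  have "g (a + b * N) = g a" for a b
    using assms[of "a + b * N" for b] by (induction b) (simp_all add: add_ac)
  from this[of "m mod N" "m div N"] show ?thesis by simp
qed

lemma periodic_bounded:
  fixes g :: "nat \<Rightarrow> real"
  assumes "\<And>m. g (m + N) = g m" "0 < N"
  shows "\<exists>B\<ge>1. \<forall>m. g m \<le> B"
proof (intro exI[of _ "max 1 (Max (g ` {..<N}))"] conjI allI)
  fix m
  have "g (m mod N) \<le> Max (g ` {..<N})" using assms(2) by (intro Max_ge) auto
  then show "g m \<le> max 1 (Max (g ` {..<N}))" using periodic_mod[of g N m] assms(1) by simp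
qed simp

text \<open>Fixes one choice of weights. It depends on the polling model only, hence is common to
  all systems.\<close>

locale weighted_polling_model = polling_model +
  fixes \<gamma> :: real and w :: "nat \<Rightarrow> nat \<Rightarrow> real"
  assumes \<gamma>: "0 < \<gamma>" "\<gamma> < 1"
    and w_pos: "\<And>m j. j \<in> {1..K} \<Longrightarrow> 0 < w m j"
    and w_periodic: "\<And>m j. w (m + I) j = w m j"
    and w_other: "\<And>m j. j \<in> {1..K} \<Longrightarrow> j \<noteq> que m \<Longrightarrow> w (Suc m) j \<le> \<gamma> * w m j"
    and w_own: "\<And>m. (1 - r (stage m)) * w (Suc m) (que m)
      + r (stage m) * (\<Sum>j\<in>{1..K} - {que m}. w (Suc m) j * gain (que m) j) \<le> \<gamma> * w m (que m)"
begin

declare One_nat_def [simp del]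

definition weight :: "nat \<Rightarrow> (nat \<Rightarrow> nat) \<Rightarrow> real" where
  "weight m x = (\<Sum>j\<in>{1..K}. w m j * real (x j))"

lemma weight_nonneg: "0 \<le> weight m x"
  unfolding weight_def using w_pos by (intro sum_nonneg mult_nonneg_nonneg) (auto intro: less_imp_le)

lemma weight_add: "weight m (\<lambda>k. x k + y k) = weight m x + weight m y"
  by (simp add: weight_def algebra_simps sum.distrib)

lemma weight_bounds:
  obtains W \<omega> where "1 \<le> W" "0 < \<omega>" "\<And>m j. j \<in> {1..K} \<Longrightarrow> w m j \<le> W" "\<And>m j. j \<in> {1..K} \<Longrightarrow> \<omega> \<le> w m j"
proof -
  \<comment> \<open>Bounding the weights and their reciprocals at once gives the upper and the lower
    bound from a single periodic maximum.\<close>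
  have "\<exists>B\<ge>1. \<forall>m. (\<Sum>j\<in>{1..K}. w m j + 1 / w m j) \<le> B"
    by (rule periodic_bounded[of _ I]) (simp_all add: w_periodic I_pos)
  then obtain B where B: "1 \<le> B" "\<And>m. (\<Sum>j\<in>{1..K}. w m j + 1 / w m j) \<le> B" by blast
  have b: "w m j + 1 / w m j \<le> B" if "j \<in> {1..K}" for m j
  proof -
    have "w m j + 1 / w m j \<le> (\<Sum>j\<in>{1..K}. w m j + 1 / w m j)"
      using that w_pos[THEN less_imp_le]
      by (intro member_le_sum[of j "{1..K}" "\<lambda>j. w m j + 1 / w m j"]) (auto intro!: add_nonneg_nonneg)
    then show ?thesis using B(2)[of m] by linarith
  qed
  show thesis
  proof (rule that[of B "1 / B"])
    fix m j assume j: "j \<in> {1..K}"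
    have p: "0 < w m j" "0 < 1 / w m j" using w_pos[OF j] by auto
    show "w m j \<le> B" using b[OF j, of m] p by linarith
    have "1 / w m j \<le> B" using b[OF j, of m] p by linarith
    then show "1 / B \<le> w m j" using B(1) p by (simp add: field_simps)
  qed (use B in auto)
qed

lemma power_le_weight:
  "\<exists>C\<ge>0. \<forall>m x. \<forall>k\<in>{1..K}. real (x k) ^ l \<le> C * weight m x ^ l"
proof -
  obtain W \<omega> where \<omega>: "0 < \<omega>" "\<And>m j. j \<in> {1..K} \<Longrightarrow> \<omega> \<le> w m j" by (rule weight_bounds) blast
  have "real (x k) ^ l \<le> (1 / \<omega>) ^ l * weight m x ^ l" if k: "k \<in> {1..K}" for m x k
  proof -
    have "\<omega> * real (x k) \<le> w m k * real (x k)" using \<omega>(2)[OF k] by (intro mult_right_mono) auto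
    also have "\<dots> \<le> weight m x" unfolding weight_def using k w_pos[THEN less_imp_le]
      by (intro member_le_sum[of k "{1..K}" "\<lambda>k. w m k * real (x k)"]) auto
    finally have "real (x k) \<le> 1 / \<omega> * weight m x" using \<omega>(1) by (simp add: field_simps)
    then have "real (x k) ^ l \<le> (1 / \<omega> * weight m x) ^ l" by (intro power_mono) auto
    then show ?thesis unfolding power_mult_distrib .
  qed
  then show ?thesis using \<omega>(1) by (intro exI[of _ "(1 / \<omega>) ^ l"]) auto
qed

lemma visit_kernel_periodic: "visit_kernel (m + I) = visit_kernel m"
  by (simp add: visit_kernel_def fun_eq_iff stage_add_I)

text \<open>Enlarging \<gamma> to \<gamma>' produces the strict inequality that
  \<open>visit_power\<close> asks for. The threshold for the shift is a maximum over one period, so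
  a single \<kappa> works for all epochs.\<close>

lemma weight_visit_drift:
  assumes S: "\<And>k. k \<in> {1..K} \<Longrightarrow> integrable (SD k) (\<lambda>x. x ^ l)" and \<gamma>': "\<gamma> < \<gamma>'"
  shows "\<exists>\<kappa>\<ge>1. \<forall>m x. (\<integral>\<^sup>+z. ennreal ((\<kappa> + weight (Suc m) z) ^ l) \<partial>visit_kernel m x)
    \<le> ennreal ((\<kappa> + \<gamma>' * weight m x) ^ l)"
proof -
  have "\<exists>K0\<ge>1. \<forall>\<kappa>\<ge>K0. \<forall>x. (\<integral>\<^sup>+z. ennreal ((\<kappa> + weight (Suc m) z) ^ l) \<partial>visit_kernel m x)
    \<le> ennreal ((\<kappa> + \<gamma>' * weight m x) ^ l)" for m
  proof -
    have "\<gamma> * w m (que m) < \<gamma>' * w m (que m)" using \<gamma>' w_pos[OF que_range] by (intro mult_strict_right_mono) auto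
    then have "(1 - r (stage m)) * w (Suc m) (que m)
      + r (stage m) * (\<Sum>j\<in>{1..K} - {que m}. w (Suc m) j * gain (que m) j) < \<gamma>' * w m (que m)"
      using w_own[of m] by linarith
    from visit_power[OF less_imp_le[OF w_pos] this S[OF que_range]] obtain K0 where K0: "1 \<le> K0"
      "\<And>\<kappa> x. K0 \<le> \<kappa> \<Longrightarrow> (\<integral>\<^sup>+z. ennreal ((\<kappa> + weight (Suc m) z) ^ l) \<partial>visit_kernel m x)
        \<le> ennreal ((\<kappa> + \<gamma>' * w m (que m) * real (x (que m)) + (\<Sum>j\<in>{1..K} - {que m}. w (Suc m) j * real (x j))) ^ l)"
      unfolding weight_def by blast
    have "(\<kappa> + \<gamma>' * w m (que m) * real (x (que m)) + (\<Sum>j\<in>{1..K} - {que m}. w (Suc m) j * real (x j))) ^ l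
        \<le> (\<kappa> + \<gamma>' * weight m x) ^ l" if "1 \<le> \<kappa>" for \<kappa> x
    proof (rule power_mono)
      have "(\<Sum>j\<in>{1..K} - {que m}. w (Suc m) j * real (x j)) \<le> (\<Sum>j\<in>{1..K} - {que m}. \<gamma>' * (w m j * real (x j)))"
      proof (intro sum_mono)
        fix j assume j: "j \<in> {1..K} - {que m}"
        have "w (Suc m) j \<le> \<gamma> * w m j" using j by (intro w_other) auto
        also have "\<dots> \<le> \<gamma>' * w m j" using \<gamma>' w_pos[of j m] j by (intro mult_right_mono) auto
        finally show "w (Suc m) j * real (x j) \<le> \<gamma>' * (w m j * real (x j))"
          unfolding mult.assoc[symmetric] by (rule mult_right_mono) simp
      qed
      also have "\<dots> = \<gamma>' * (\<Sum>j\<in>{1..K} - {que m}. w m j * real (x j))" by (simp add: sum_distrib_left)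
      finally show "\<kappa> + \<gamma>' * w m (que m) * real (x (que m)) + (\<Sum>j\<in>{1..K} - {que m}. w (Suc m) j * real (x j))
          \<le> \<kappa> + \<gamma>' * weight m x"
        using que_range[of m] by (simp add: weight_def sum.remove[of "{1..K}" "que m"] algebra_simps)
      show "0 \<le> \<kappa> + \<gamma>' * w m (que m) * real (x (que m)) + (\<Sum>j\<in>{1..K} - {que m}. w (Suc m) j * real (x j))"
        using that \<gamma> \<gamma>' w_pos[THEN less_imp_le] que_range[of m]
        by (intro add_nonneg_nonneg sum_nonneg mult_nonneg_nonneg) auto
    qed
    note le = this
    show ?thesis
    proof (intro exI[of _ K0] conjI allI impI K0(1))
      fix \<kappa> x assume \<kappa>: "K0 \<le> \<kappa>"
      show "(\<integral>\<^sup>+z. ennreal ((\<kappa> + weight (Suc m) z) ^ l) \<partial>visit_kernel m x)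
          \<le> ennreal ((\<kappa> + \<gamma>' * weight m x) ^ l)"
        using \<kappa> K0(1) by (intro order_trans[OF K0(2)[OF \<kappa>]] ennreal_leI le) simp
    qed
  qed
  then obtain K0 where K0: "\<And>m. 1 \<le> K0 m" "\<And>m \<kappa> x. K0 m \<le> \<kappa> \<Longrightarrow>
      (\<integral>\<^sup>+z. ennreal ((\<kappa> + weight (Suc m) z) ^ l) \<partial>visit_kernel m x) \<le> ennreal ((\<kappa> + \<gamma>' * weight m x) ^ l)"
    by metis
  define \<kappa> where "\<kappa> = Max (K0 ` {..<I})"
  have \<kappa>: "K0 m \<le> \<kappa>" if "m < I" for m unfolding \<kappa>_def using that by (intro Max_ge) auto
  have "weight (m + I) = weight m" for m by (simp add: weight_def w_periodic fun_eq_iff)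
  moreover have "weight (Suc (m + I)) = weight (Suc m)" for m
    using w_periodic[of "Suc m"] by (simp add: weight_def fun_eq_iff)
  ultimately have "(weight m, weight (Suc m), visit_kernel m) = (weight (m mod I), weight (Suc (m mod I)), visit_kernel (m mod I))" for m
    using visit_kernel_periodic by (intro periodic_mod[of "\<lambda>m. (weight m, weight (Suc m), visit_kernel m)"]) simp
  then have mod: "weight m = weight (m mod I)" "weight (Suc m) = weight (Suc (m mod I))" "visit_kernel m = visit_kernel (m mod I)" for m
    by simp_all
  show ?thesis
  proof (intro exI[of _ \<kappa>] conjI allI)
    show "1 \<le> \<kappa>" using \<kappa>[OF I_pos] K0(1)[of 0] by linarith
    show "(\<integral>\<^sup>+z. ennreal ((\<kappa> + weight (Suc m) z) ^ l) \<partial>visit_kernel m x)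
        \<le> ennreal ((\<kappa> + \<gamma>' * weight m x) ^ l)" for m x
      unfolding mod[of m] using I_pos by (intro K0(2) \<kappa>) simp
  qed
qed

lemma weight_arrivals_moment:
  "\<exists>C\<ge>0. \<forall>m (\<nu> :: real measure). prob_space \<nu> \<longrightarrow> sets \<nu> = sets borel \<longrightarrow> (AE s in \<nu>. 0 \<le> s) \<longrightarrow>
    (\<integral>\<^sup>+e. ennreal (weight m e ^ l) \<partial>arrival_law {1..K} lam \<nu>) \<le> ennreal C * (1 + (\<integral>\<^sup>+s. ennreal (s ^ l) \<partial>\<nu>))"
proof -
  have lam: "0 \<le> lam k" if "k \<in> {1..K}" for k using arrival_rate[OF that] by simp
  obtain C where C: "0 \<le> C" "\<And>(\<nu> :: real measure) j. prob_space \<nu> \<Longrightarrow> sets \<nu> = sets borel \<Longrightarrow> (AE s in \<nu>. 0 \<le> s) \<Longrightarrow> j \<in> {1..K} \<Longrightarrow>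
    (\<integral>\<^sup>+a. ennreal (real (a j) ^ l) \<partial>arrival_law {1..K} lam \<nu>) \<le> ennreal C * (1 + (\<integral>\<^sup>+s. ennreal (s ^ l) \<partial>\<nu>))"
    using arrival_law_moment[where A = "{1..K}" and lam = lam and l = l, OF finite_atLeastAtMost lam] by blast
  obtain W \<omega> where W: "1 \<le> W" "\<And>m j. j \<in> {1..K} \<Longrightarrow> w m j \<le> W" by (rule weight_bounds) blast
  have ne: "{1..K} \<noteq> {}" using que_range[of 0] by auto
  define C' where "C' = W ^ l * real K ^ l"
  have C': "0 \<le> C'" using W by (simp add: C'_def)
  show ?thesis
  proof (intro exI[of _ "C' * (real K * C)"] conjI allI impI)
    fix m and \<nu> :: "real measure" assume \<nu>: "prob_space \<nu>" "sets \<nu> = sets borel" "AE s in \<nu>. 0 \<le> s"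
    have "(\<integral>\<^sup>+e. ennreal (weight m e ^ l) \<partial>arrival_law {1..K} lam \<nu>)
        \<le> (\<integral>\<^sup>+e. ennreal C' * (\<Sum>j\<in>{1..K}. ennreal (real (e j) ^ l)) \<partial>arrival_law {1..K} lam \<nu>)"
    proof (intro nn_integral_mono)
      fix e :: "nat \<Rightarrow> nat"
      have "weight m e \<le> W * (\<Sum>j\<in>{1..K}. real (e j))"
        unfolding weight_def sum_distrib_left using W by (intro sum_mono mult_right_mono) auto
      then have "weight m e ^ l \<le> (W * (\<Sum>j\<in>{1..K}. real (e j))) ^ l"
        by (intro power_mono weight_nonneg)
      also have "\<dots> \<le> W ^ l * (real (card {1..K}) ^ l * (\<Sum>j\<in>{1..K}. real (e j) ^ l))"
        unfolding power_mult_distrib using W ne by (intro mult_left_mono sum_power_le) auto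
      also have "\<dots> = C' * (\<Sum>j\<in>{1..K}. real (e j) ^ l)" by (simp add: C'_def mult.assoc One_nat_def)
      finally show "ennreal (weight m e ^ l) \<le> ennreal C' * (\<Sum>j\<in>{1..K}. ennreal (real (e j) ^ l))"
        using C' by (subst sum_ennreal) (auto simp: ennreal_mult'[symmetric] intro: ennreal_leI)
    qed
    also have "\<dots> = ennreal C' * (\<Sum>j\<in>{1..K}. \<integral>\<^sup>+e. ennreal (real (e j) ^ l) \<partial>arrival_law {1..K} lam \<nu>)"
      by (simp add: nn_integral_cmult nn_integral_sum del: sum_ennreal)
    also have "\<dots> \<le> ennreal C' * (\<Sum>j\<in>{1..K}. ennreal C * (1 + (\<integral>\<^sup>+s. ennreal (s ^ l) \<partial>\<nu>)))"
      by (intro mult_left_mono sum_mono C(2)[OF \<nu>]) auto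
    also have "\<dots> = ennreal (C' * (real K * C)) * (1 + (\<integral>\<^sup>+s. ennreal (s ^ l) \<partial>\<nu>))"
      using C' C(1) by (simp add: ennreal_mult' ennreal_of_nat_eq_real_of_nat mult_ac One_nat_def)
    finally show "(\<integral>\<^sup>+e. ennreal (weight m e ^ l) \<partial>arrival_law {1..K} lam \<nu>)
        \<le> ennreal (C' * (real K * C)) * (1 + (\<integral>\<^sup>+s. ennreal (s ^ l) \<partial>\<nu>))" .
  qed (use C(1) C' in auto)
qed

text \<open>The arrivals during the switchover are split off, the visit is handled by
  \<open>weight_visit_drift\<close>, and the shift \<kappa> is split off again. The law of the
  switchover time enters only through its moment, so \<beta> and \<open>C\<close> do not depend on
  it.\<close>

lemma weight_drift:
  assumes S: "\<And>k. k \<in> {1..K} \<Longrightarrow> integrable (SD k) (\<lambda>x. x ^ l)" and l: "1 \<le> l"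
  shows "\<exists>\<beta> C. 0 < \<beta> \<and> \<beta> < 1 \<and> 0 \<le> C \<and> (\<forall>m x (\<nu> :: real measure).
    prob_space \<nu> \<longrightarrow> sets \<nu> = sets borel \<longrightarrow> (AE s in \<nu>. 0 \<le> s) \<longrightarrow>
    (\<integral>\<^sup>+z. \<integral>\<^sup>+e. ennreal (weight (Suc m) (\<lambda>k. z k + e k) ^ l) \<partial>arrival_law {1..K} lam \<nu> \<partial>visit_kernel m x)
      \<le> ennreal \<beta> * ennreal (weight m x ^ l) + ennreal C * (1 + (\<integral>\<^sup>+s. ennreal (s ^ l) \<partial>\<nu>)))"
proof -
  define \<gamma>' where "\<gamma>' = (1 + \<gamma>) / 2"
  have \<gamma>': "\<gamma> < \<gamma>'" "0 < \<gamma>'" "\<gamma>' < 1" using \<gamma> by (auto simp: \<gamma>'_def)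
  \<comment> \<open>Each of the two splittings costs a factor 1 + \<epsilon>. Since the square of
    that factor is at most 1 + 3 \<epsilon>, a quarter of the gap below 1 is small enough.\<close>
  define \<epsilon> where "\<epsilon> = (1 - \<gamma>') / 4"
  have \<epsilon>: "0 < \<epsilon>" "\<epsilon> < 1" using \<gamma>' by (auto simp: \<epsilon>_def)
  define \<beta> where "\<beta> = (1 + \<epsilon>) * ((1 + \<epsilon>) * \<gamma>')"
  have "(1 + \<epsilon>) * (1 + \<epsilon>) \<le> 1 + 3 * \<epsilon>"
    using \<epsilon> mult_left_le[of \<epsilon> \<epsilon>] by (simp add: algebra_simps)
  then have "\<beta> \<le> (1 + 3 * \<epsilon>) * \<gamma>'" unfolding \<beta>_def mult.assoc[symmetric] using \<gamma>' by (intro mult_right_mono) auto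
  also have "\<dots> < 1"
  proof -
    have "3 * \<epsilon> * \<gamma>' \<le> 3 * \<epsilon> * 1" using \<gamma>' \<epsilon> by (intro mult_left_mono) auto
    then have "(1 + 3 * \<epsilon>) * \<gamma>' \<le> \<gamma>' + 3 * \<epsilon>" by (simp add: distrib_right)
    also have "\<dots> < 1" using \<gamma>'(3) by (simp add: \<epsilon>_def field_simps)
    finally show ?thesis .
  qed
  finally have \<beta>: "0 < \<beta>" "\<beta> < 1" using \<epsilon> \<gamma>' by (auto simp: \<beta>_def)
  obtain C1 where C1: "0 \<le> C1" "\<And>a b. 0 \<le> a \<Longrightarrow> 0 \<le> b \<Longrightarrow> (a + b) ^ l \<le> (1 + \<epsilon>) * a ^ l + C1 * b ^ l"
    using power_add_le_eps[OF \<epsilon>(1), of l] by blast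
  obtain \<kappa> where \<kappa>: "1 \<le> \<kappa>" "\<And>m x. (\<integral>\<^sup>+z. ennreal ((\<kappa> + weight (Suc m) z) ^ l) \<partial>visit_kernel m x)
    \<le> ennreal ((\<kappa> + \<gamma>' * weight m x) ^ l)"
    using weight_visit_drift[OF S \<gamma>'(1)] by blast
  obtain C2 where C2: "0 \<le> C2" "\<And>m (\<nu> :: real measure). prob_space \<nu> \<Longrightarrow> sets \<nu> = sets borel \<Longrightarrow> (AE s in \<nu>. 0 \<le> s) \<Longrightarrow>
    (\<integral>\<^sup>+e. ennreal (weight m e ^ l) \<partial>arrival_law {1..K} lam \<nu>) \<le> ennreal C2 * (1 + (\<integral>\<^sup>+s. ennreal (s ^ l) \<partial>\<nu>))"
    using weight_arrivals_moment[of l] by blast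
  define C where "C = (1 + \<epsilon>) * (C1 * \<kappa> ^ l) + C1 * C2"
  have C: "0 \<le> C" using C1 C2 \<kappa>(1) \<epsilon> by (simp add: C_def)
  have "(\<integral>\<^sup>+z. \<integral>\<^sup>+e. ennreal (weight (Suc m) (\<lambda>k. z k + e k) ^ l) \<partial>arrival_law {1..K} lam \<nu> \<partial>visit_kernel m x)
      \<le> ennreal \<beta> * ennreal (weight m x ^ l) + ennreal C * (1 + (\<integral>\<^sup>+s. ennreal (s ^ l) \<partial>\<nu>))"
    if \<nu>: "prob_space \<nu>" "sets \<nu> = sets borel" "AE s in \<nu>. 0 \<le> s" for m x and \<nu> :: "real measure"
  proof -
    let ?v = "1 + (\<integral>\<^sup>+s. ennreal (s ^ l) \<partial>\<nu>)"
    have "(\<integral>\<^sup>+z. \<integral>\<^sup>+e. ennreal (weight (Suc m) (\<lambda>k. z k + e k) ^ l) \<partial>arrival_law {1..K} lam \<nu> \<partial>visit_kernel m x)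
        \<le> (\<integral>\<^sup>+z. \<integral>\<^sup>+e. ennreal (1 + \<epsilon>) * ennreal ((\<kappa> + weight (Suc m) z) ^ l) + ennreal C1 * ennreal (weight (Suc m) e ^ l)
            \<partial>arrival_law {1..K} lam \<nu> \<partial>visit_kernel m x)"
    proof (intro nn_integral_mono)
      fix z e :: "nat \<Rightarrow> nat"
      note n = weight_nonneg[of "Suc m" z] weight_nonneg[of "Suc m" e]
      have "weight (Suc m) (\<lambda>k. z k + e k) ^ l \<le> ((\<kappa> + weight (Suc m) z) + weight (Suc m) e) ^ l"
        unfolding weight_add using \<kappa>(1) n by (intro power_mono) auto
      also have "\<dots> \<le> (1 + \<epsilon>) * (\<kappa> + weight (Suc m) z) ^ l + C1 * weight (Suc m) e ^ l"
        using \<kappa>(1) n by (intro C1) auto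
      finally show "ennreal (weight (Suc m) (\<lambda>k. z k + e k) ^ l)
          \<le> ennreal (1 + \<epsilon>) * ennreal ((\<kappa> + weight (Suc m) z) ^ l) + ennreal C1 * ennreal (weight (Suc m) e ^ l)"
        using \<epsilon> C1(1) \<kappa>(1) n by (simp add: ennreal_mult[symmetric] ennreal_plus[symmetric] ennreal_leI del: ennreal_plus)
    qed
    also have "\<dots> = ennreal (1 + \<epsilon>) * (\<integral>\<^sup>+z. ennreal ((\<kappa> + weight (Suc m) z) ^ l) \<partial>visit_kernel m x)
        + ennreal C1 * (\<integral>\<^sup>+e. ennreal (weight (Suc m) e ^ l) \<partial>arrival_law {1..K} lam \<nu>)"
      by (simp add: nn_integral_add nn_integral_cmult emeasure_pmf)
    also have "\<dots> \<le> ennreal (1 + \<epsilon>) * ennreal ((\<kappa> + \<gamma>' * weight m x) ^ l) + ennreal C1 * (ennreal C2 * ?v)"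
      by (intro add_mono mult_left_mono \<kappa> C2 \<nu>) auto
    also have "ennreal (1 + \<epsilon>) * ennreal ((\<kappa> + \<gamma>' * weight m x) ^ l)
        \<le> ennreal (\<beta> * weight m x ^ l + (1 + \<epsilon>) * (C1 * \<kappa> ^ l))"
    proof -
      note n = weight_nonneg[of m x]
      have "(\<kappa> + \<gamma>' * weight m x) ^ l \<le> (1 + \<epsilon>) * (\<gamma>' * weight m x) ^ l + C1 * \<kappa> ^ l"
        using C1(2)[of "\<gamma>' * weight m x" \<kappa>] \<kappa>(1) n \<gamma>' by (simp add: add.commute)
      also have "(\<gamma>' * weight m x) ^ l \<le> \<gamma>' * weight m x ^ l"
        unfolding power_mult_distrib using \<gamma>' l n power_decreasing[of 1 l \<gamma>'] by (intro mult_right_mono) auto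
      finally have "(1 + \<epsilon>) * (\<kappa> + \<gamma>' * weight m x) ^ l \<le> (1 + \<epsilon>) * ((1 + \<epsilon>) * (\<gamma>' * weight m x ^ l) + C1 * \<kappa> ^ l)"
        using \<epsilon> by (intro mult_left_mono) auto
      also have "\<dots> = \<beta> * weight m x ^ l + (1 + \<epsilon>) * (C1 * \<kappa> ^ l)" by (simp add: \<beta>_def algebra_simps)
      finally show ?thesis using \<epsilon> by (subst ennreal_mult'[symmetric]) (auto intro!: ennreal_leI)
    qed
    also have "ennreal (\<beta> * weight m x ^ l + (1 + \<epsilon>) * (C1 * \<kappa> ^ l)) + ennreal C1 * (ennreal C2 * ?v)
        \<le> ennreal \<beta> * ennreal (weight m x ^ l) + ennreal C * ?v"
    proof -
      define a where "a = (1 + \<epsilon>) * (C1 * \<kappa> ^ l)"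
      have a: "0 \<le> a" using C1(1) \<kappa>(1) \<epsilon> by (simp add: a_def)
      have "ennreal a * 1 \<le> ennreal a * ?v"
        by (intro mult_left_mono) auto
      moreover have "ennreal C = ennreal a + ennreal C1 * ennreal C2"
        unfolding C_def a_def[symmetric] ennreal_mult'[OF C1(1), symmetric] using a C1(1) C2(1) by (intro ennreal_plus) auto
      then have "ennreal C * ?v = ennreal a * ?v + ennreal C1 * (ennreal C2 * ?v)"
        by (simp only: distrib_right mult.assoc)
      moreover have "ennreal (\<beta> * weight m x ^ l + a) = ennreal \<beta> * ennreal (weight m x ^ l) + ennreal a"
        using \<beta> a weight_nonneg[of m x] by (subst ennreal_plus) (auto simp: ennreal_mult')
      ultimately show ?thesis unfolding a_def[symmetric] by (simp add: add.assoc add_left_mono add_right_mono)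
    qed
    finally show ?thesis by (simp add: add_right_mono)
  qed
  then show ?thesis using \<beta> C by (intro exI[of _ \<beta>] exI[of _ C]) auto
qed

text \<open>The mean change of a visit is linear with nonnegative coefficients, and
  \<open>w_other\<close> and \<open>w_own\<close> bound its weighted column sums by \<gamma>.
  Absolute values thus extend the contraction to signed vectors.\<close>

lemma weight_contraction:
  fixes y :: "nat \<Rightarrow> real"
  shows "(\<Sum>j\<in>{1..K}. w (Suc m) j * \<bar>visit_mean m y j\<bar>) \<le> \<gamma> * (\<Sum>j\<in>{1..K}. w m j * \<bar>y j\<bar>)"
proof -
  let ?k = "que m" and ?r = "r (stage m)" and ?R = "{1..K} - {que m}"
  note k = que_range[of m]
  have f1: "(\<Sum>j\<in>?R. w (Suc m) j * \<bar>visit_mean m y j\<bar>)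
      \<le> (\<Sum>j\<in>?R. \<gamma> * (w m j * \<bar>y j\<bar>) + ?r * \<bar>y ?k\<bar> * (w (Suc m) j * gain ?k j))"
  proof (intro sum_mono)
    fix j assume j: "j \<in> ?R"
    have g: "0 \<le> gain ?k j" using j by (intro gain_nonneg k) auto
    have "\<bar>visit_mean m y j\<bar> \<le> \<bar>y j\<bar> + \<bar>y ?k * ?r * gain ?k j\<bar>" using j by (simp add: visit_mean_def)
    also have "\<bar>y ?k * ?r * gain ?k j\<bar> = ?r * \<bar>y ?k\<bar> * gain ?k j" using policy[of m] g by (simp add: abs_mult)
    finally have "w (Suc m) j * \<bar>visit_mean m y j\<bar> \<le> w (Suc m) j * (\<bar>y j\<bar> + ?r * \<bar>y ?k\<bar> * gain ?k j)"
      using j w_pos[of j "Suc m"] by (intro mult_left_mono) auto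
    also have "\<dots> = w (Suc m) j * \<bar>y j\<bar> + ?r * \<bar>y ?k\<bar> * (w (Suc m) j * gain ?k j)" by (simp add: algebra_simps)
    also have "w (Suc m) j * \<bar>y j\<bar> \<le> \<gamma> * w m j * \<bar>y j\<bar>" using j by (intro mult_right_mono w_other) auto
    finally show "w (Suc m) j * \<bar>visit_mean m y j\<bar> \<le> \<gamma> * (w m j * \<bar>y j\<bar>) + ?r * \<bar>y ?k\<bar> * (w (Suc m) j * gain ?k j)"
      by (simp add: mult.assoc)
  qed
  have f2: "w (Suc m) ?k * \<bar>visit_mean m y ?k\<bar> = (1 - ?r) * w (Suc m) ?k * \<bar>y ?k\<bar>"
    using policy[of m] by (simp add: visit_mean_def abs_mult)
  have f3: "(1 - ?r) * w (Suc m) ?k * \<bar>y ?k\<bar> + (\<Sum>j\<in>?R. ?r * \<bar>y ?k\<bar> * (w (Suc m) j * gain ?k j))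
      \<le> \<gamma> * (w m ?k * \<bar>y ?k\<bar>)"
  proof -
    have "(1 - ?r) * w (Suc m) ?k * \<bar>y ?k\<bar> + (\<Sum>j\<in>?R. ?r * \<bar>y ?k\<bar> * (w (Suc m) j * gain ?k j))
        = ((1 - ?r) * w (Suc m) ?k + ?r * (\<Sum>j\<in>?R. w (Suc m) j * gain ?k j)) * \<bar>y ?k\<bar>"
      unfolding sum_distrib_left[symmetric] by (simp add: distrib_right distrib_left mult_ac)
    also have "\<dots> \<le> \<gamma> * w m ?k * \<bar>y ?k\<bar>" by (intro mult_right_mono w_own) simp
    finally show ?thesis by (simp add: mult.assoc)
  qed
  have "w (Suc m) ?k * \<bar>visit_mean m y ?k\<bar> + (\<Sum>j\<in>?R. w (Suc m) j * \<bar>visit_mean m y j\<bar>)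
      \<le> \<gamma> * (w m ?k * \<bar>y ?k\<bar>) + (\<Sum>j\<in>?R. \<gamma> * (w m j * \<bar>y j\<bar>))"
    unfolding f2 using f1 f3 unfolding sum.distrib by linarith
  also have "\<dots> = \<gamma> * (\<Sum>j\<in>{1..K}. w m j * \<bar>y j\<bar>)"
    using k by (simp add: sum.remove[of "{1..K}" ?k] sum_distrib_left algebra_simps)
  finally show ?thesis using k by (simp add: sum.remove[of "{1..K}" ?k])
qed

end

subsection \<open>Stationary moments\<close>

text \<open>For a finite mean one would subtract in E f \<le> \<beta> E f + b. Here the truncated
  integrals are finite and can be cancelled. Where \<open>f\<close> is at most \<open>n\<close>, the
  truncation of \<beta> f + b plus (1 - \<beta>) f is at most f + b; elsewhere the truncation of
  \<open>f\<close> is already \<open>n\<close>. Monotone convergence removes the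
  restriction.\<close>

lemma truncation_bound:
  fixes f :: "'w \<Rightarrow> real"
  assumes M: "prob_space M" and f [measurable]: "f \<in> borel_measurable M" "\<And>\<omega>. \<omega> \<in> space M \<Longrightarrow> 0 \<le> f \<omega>"
    and \<beta>: "0 \<le> \<beta>" "\<beta> < 1" and b: "0 \<le> b"
    and le: "\<And>n :: nat. (\<integral>\<^sup>+\<omega>. min (ennreal (f \<omega>)) (of_nat n) \<partial>M) \<le> (\<integral>\<^sup>+\<omega>. min (ennreal (\<beta> * f \<omega> + b)) (of_nat n) \<partial>M)"
  shows "(\<integral>\<^sup>+\<omega>. ennreal (f \<omega>) \<partial>M) \<le> ennreal (b / (1 - \<beta>))"
proof -
  interpret prob_space M by fact
  let ?g = "\<lambda>n \<omega>. ennreal (f \<omega>) * indicator {\<omega>. f \<omega> \<le> real n} \<omega>"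
  have part: "ennreal (1 - \<beta>) * (\<integral>\<^sup>+\<omega>. ?g n \<omega> \<partial>M) \<le> ennreal b" for n :: nat
  proof -
    let ?t = "\<lambda>\<omega>. min (ennreal (\<beta> * f \<omega> + b)) (of_nat n)"
    have fin: "(\<integral>\<^sup>+\<omega>. ?t \<omega> \<partial>M) \<noteq> \<top>"
    proof -
      have "(\<integral>\<^sup>+\<omega>. ?t \<omega> \<partial>M) \<le> (\<integral>\<^sup>+\<omega>. of_nat n \<partial>M)" by (intro nn_integral_mono) simp
      also have "\<dots> < \<top>" by (simp add: emeasure_space_1 ennreal_of_nat_eq_real_of_nat)
      finally show ?thesis by simp
    qed
    have "(\<integral>\<^sup>+\<omega>. ?t \<omega> \<partial>M) + ennreal (1 - \<beta>) * (\<integral>\<^sup>+\<omega>. ?g n \<omega> \<partial>M)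
        = (\<integral>\<^sup>+\<omega>. ?t \<omega> + ennreal (1 - \<beta>) * ?g n \<omega> \<partial>M)"
      by (simp add: nn_integral_add nn_integral_cmult)
    also have "\<dots> \<le> (\<integral>\<^sup>+\<omega>. min (ennreal (f \<omega>)) (of_nat n) + ennreal b \<partial>M)"
    proof (intro nn_integral_mono)
      fix \<omega> assume w: "\<omega> \<in> space M"
      show "?t \<omega> + ennreal (1 - \<beta>) * ?g n \<omega> \<le> min (ennreal (f \<omega>)) (of_nat n) + ennreal b"
      proof (cases "f \<omega> \<le> real n")
        case True
        have "?t \<omega> + ennreal (1 - \<beta>) * ?g n \<omega> \<le> ennreal (\<beta> * f \<omega> + b) + ennreal (1 - \<beta>) * ennreal (f \<omega>)"
          using True by (intro add_mono) auto
        also have "\<dots> = ennreal (f \<omega> + b)"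
        proof -
          have "ennreal (1 - \<beta>) * ennreal (f \<omega>) = ennreal ((1 - \<beta>) * f \<omega>)" using \<beta> by (simp add: ennreal_mult')
          moreover have "ennreal (\<beta> * f \<omega> + b) + ennreal ((1 - \<beta>) * f \<omega>) = ennreal ((\<beta> * f \<omega> + b) + (1 - \<beta>) * f \<omega>)"
            using \<beta> b f(2)[OF w] by (intro ennreal_plus[symmetric]) auto
          moreover have "(\<beta> * f \<omega> + b) + (1 - \<beta>) * f \<omega> = f \<omega> + b" by (simp add: algebra_simps)
          ultimately show ?thesis by metis
        qed
        also have "\<dots> = min (ennreal (f \<omega>)) (of_nat n) + ennreal b"
          using True b f(2)[OF w] by (simp add: ennreal_of_nat_eq_real_of_nat min_absorb1)
        finally show ?thesis .
      next
        case False
        then have "min (ennreal (f \<omega>)) (of_nat n) = of_nat n"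
          using f(2)[OF w] by (simp add: ennreal_of_nat_eq_real_of_nat min_absorb2 ennreal_le_iff2)
        then show ?thesis using False by (simp add: add_increasing2)
      qed
    qed
    also have "\<dots> = (\<integral>\<^sup>+\<omega>. min (ennreal (f \<omega>)) (of_nat n) \<partial>M) + ennreal b"
      by (simp add: nn_integral_add emeasure_space_1)
    also have "\<dots> \<le> (\<integral>\<^sup>+\<omega>. ?t \<omega> \<partial>M) + ennreal b" by (intro add_right_mono le)
    finally show ?thesis using fin by (simp add: ennreal_add_left_cancel_le)
  qed
  have "(\<integral>\<^sup>+\<omega>. ennreal (f \<omega>) \<partial>M) = (\<integral>\<^sup>+\<omega>. (SUP n. ?g n \<omega>) \<partial>M)"
  proof (intro nn_integral_cong antisym)
    fix \<omega>
    obtain n :: nat where "f \<omega> \<le> real n" using real_arch_simple by blast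
    then show "ennreal (f \<omega>) \<le> (SUP n. ?g n \<omega>)" by (intro SUP_upper2[of n]) auto
    show "(SUP n. ?g n \<omega>) \<le> ennreal (f \<omega>)" by (intro SUP_least) (simp add: indicator_def)
  qed
  also have "\<dots> = (SUP n. \<integral>\<^sup>+\<omega>. ?g n \<omega> \<partial>M)"
    by (rule nn_integral_monotone_convergence_SUP) (auto simp: mono_def le_fun_def indicator_def)
  finally have "ennreal (1 - \<beta>) * (\<integral>\<^sup>+\<omega>. ennreal (f \<omega>) \<partial>M) = (SUP n. ennreal (1 - \<beta>) * (\<integral>\<^sup>+\<omega>. ?g n \<omega> \<partial>M))"
    by (simp add: SUP_mult_left_ennreal)
  also have "\<dots> \<le> ennreal b" by (intro SUP_least part)
  finally have main: "ennreal (1 - \<beta>) * (\<integral>\<^sup>+\<omega>. ennreal (f \<omega>) \<partial>M) \<le> ennreal b" .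
  show ?thesis
  proof (cases "(\<integral>\<^sup>+\<omega>. ennreal (f \<omega>) \<partial>M)")
    case (real e)
    then have "(1 - \<beta>) * e \<le> b" using main \<beta> b by (simp add: ennreal_mult'[symmetric])
    then show ?thesis using real \<beta> by (auto intro!: ennreal_leI simp: field_simps)
  next
    case top
    then show ?thesis using main \<beta> by (simp add: ennreal_mult_top top_unique)
  qed
qed

locale weighted_bep_model =
  weighted_polling_model K I p lam mu SD s r \<gamma> w + stationary_bep_system K I p lam SD r VD X
  for K I p lam mu SD s r \<gamma> w VD and X :: "'w polling_primitives"
begin

sublocale bep_model K I p lam mu SD s r VD X ..

declare One_nat_def [simp del] source_events.simps [simp del] epoch_state.simps(2) [simp del]

lemma switch_law:
  assumes "i \<in> {1..I}"
  shows "prob_space (VD i)" "sets (VD i) = sets borel" "AE x in VD i. 0 \<le> x"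
proof -
  have eq: "VD i = distr (sample_space X) borel (switchover_time X 0 i)" by (rule switchover_distr[OF assms, symmetric])
  note m = switchover_measurable[OF assms, of 0]
  show "prob_space (VD i)" unfolding eq by (rule P.prob_space_distr[OF m])
  show "sets (VD i) = sets borel" unfolding eq by simp
  show "AE x in VD i. 0 \<le> x" unfolding eq
    by (subst AE_distr_iff[OF m]) (auto intro!: AE_I2 switchover_nonneg[OF assms])
qed

lemma nn_integral_step:
  "(\<integral>\<^sup>+\<omega>. F (Qv (Suc m) \<omega>) \<partial>sample_space X)
    = (\<integral>\<^sup>+\<omega>. \<integral>\<^sup>+z. \<integral>\<^sup>+e. F (\<lambda>k. z k + e k) \<partial>switch_arrivals m \<partial>visit_kernel m (Qv m \<omega>) \<partial>sample_space X)"
  unfolding nn_integral_switch using nn_integral_visit[of "\<lambda>z. \<integral>\<^sup>+e. F (\<lambda>k. z k + e k) \<partial>switch_arrivals m" m] .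

lemma stationary_Qv:
  fixes F :: "(nat \<Rightarrow> nat) \<Rightarrow> ennreal"
  shows "(\<integral>\<^sup>+\<omega>. F (Qv I \<omega>) \<partial>sample_space X) = (\<integral>\<^sup>+\<omega>. F (Qv 0 \<omega>) \<partial>sample_space X)"
proof -
  let ?P = "Pi\<^sub>M {1..K} (\<lambda>_. count_space UNIV) :: (nat \<Rightarrow> nat) measure"
  \<comment> \<open>\<open>queue_law\<close> lives on functions that are undefined off the queues,
    while \<open>Qv\<close> is 0 there; \<open>F'\<close> translates between the two.\<close>
  define F' where "F' = (\<lambda>g. F (\<lambda>k. if k \<in> {1..K} then g k else 0))"
  have "(\<lambda>g k. if k \<in> {1..K} then g k else (0 :: nat)) \<in> measurable ?P (count_space UNIV)"
  proof (rule measurable_vecs[of "{1..K}"])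
    fix k assume k: "k \<in> {1..K}"
    then have "(\<lambda>g. g k) \<in> measurable ?P (count_space UNIV)" by (rule measurable_component_singleton)
    then show "(\<lambda>g. if k \<in> {1..K} then g k else (0 :: nat)) \<in> measurable ?P (count_space UNIV)"
      using k by simp
  qed (auto simp: vecs_def)
  then have F': "F' \<in> borel_measurable ?P" unfolding F'_def by (rule measurable_compose) simp
  have law: "(\<integral>\<^sup>+g. F' g \<partial>queue_law K I p X c 1) = (\<integral>\<^sup>+\<omega>. F (Qv (c * I) \<omega>) \<partial>sample_space X)" for c
  proof -
    have m: "(\<lambda>\<omega>. \<lambda>k\<in>{1..K}. queue_at_epoch I p X c 1 k \<omega>) \<in> measurable (sample_space X) ?P"
    proof (rule measurable_restrict)
      fix k assume k: "k \<in> {1..K}"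
      have "(\<lambda>\<omega>. Qv (c * I + (1 - 1)) \<omega> k) \<in> measurable (sample_space X) (count_space UNIV)"
        by (rule measurable_compose[OF measurable_Qv]) simp
      then show "queue_at_epoch I p X c 1 k \<in> measurable (sample_space X) (count_space UNIV)"
        unfolding queue_at_epoch_Qv[OF k, symmetric] .
    qed
    have "(\<integral>\<^sup>+g. F' g \<partial>queue_law K I p X c 1) = (\<integral>\<^sup>+\<omega>. F' (\<lambda>k\<in>{1..K}. queue_at_epoch I p X c 1 k \<omega>) \<partial>sample_space X)"
      unfolding queue_law_def by (rule nn_integral_distr[OF m]) (simp add: F')
    also have "\<dots> = (\<integral>\<^sup>+\<omega>. F (Qv (c * I) \<omega>) \<partial>sample_space X)"
    proof (rule nn_integral_cong)
      fix \<omega>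
      have "(\<lambda>k. if k \<in> {1..K} then (\<lambda>k\<in>{1..K}. queue_at_epoch I p X c 1 k \<omega>) k else 0) = Qv (c * I) \<omega>"
        using in_vecs(1)[of "c * I" \<omega>] queue_at_epoch_Qv[of _ c 1 \<omega>] by (auto simp: fun_eq_iff vecs_def)
      then show "F' (\<lambda>k\<in>{1..K}. queue_at_epoch I p X c 1 k \<omega>) = F (Qv (c * I) \<omega>)" by (simp only: F'_def)
    qed
    finally show ?thesis .
  qed
  show ?thesis using law[of 1] law[of 0] steady_state by simp
qed

lemma weight_I: "weight I = weight 0"
  using w_periodic[of 0] by (simp add: weight_def fun_eq_iff)

text \<open>The drift is iterated over one full cycle, after which stationarity returns to the
  initial law. Truncation has to be carried along, since finiteness is only obtained at the end. The
  first constant bounds epoch 0 by a geometric series; \<open>m * b\<close> accounts for moving on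
  to epoch \<open>m\<close>.\<close>

lemma chain_bound:
  fixes F :: "nat \<Rightarrow> (nat \<Rightarrow> nat) \<Rightarrow> real"
  assumes F: "\<And>m x. 0 \<le> F m x" "F I = F 0" and \<beta>: "0 < \<beta>" "\<beta> < 1" and b: "0 \<le> b"
    and drift: "\<And>m x. (\<integral>\<^sup>+z. \<integral>\<^sup>+e. ennreal (F (Suc m) (\<lambda>k. z k + e k)) \<partial>switch_arrivals m \<partial>visit_kernel m x)
      \<le> ennreal \<beta> * ennreal (F m x) + ennreal b"
  shows "(\<integral>\<^sup>+\<omega>. ennreal (F m (Qv m \<omega>)) \<partial>sample_space X) \<le> ennreal ((real I / (1 - \<beta> ^ I) + real m) * b)"
proof -
  let ?M = "sample_space X"
  define Y where "Y = (\<lambda>m \<omega>. ennreal (F m (Qv m \<omega>)))"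
  have [measurable]: "(\<lambda>\<omega>. F m (Qv m \<omega>)) \<in> borel_measurable ?M" for m
    by (rule measurable_compose[OF measurable_Qv]) simp
  have [measurable]: "Y m \<in> borel_measurable ?M" for m unfolding Y_def by measurable
  \<comment> \<open>The conditional mean of a truncated affine function is at most the truncation
    level and at most the affine function of the conditional mean. The inequality keeps its shape,
    so it can be iterated.\<close>
  have step: "(\<integral>\<^sup>+\<omega>. min (ennreal a * Y (Suc m) \<omega> + c) M \<partial>?M) \<le> (\<integral>\<^sup>+\<omega>. min (ennreal (a * \<beta>) * Y m \<omega> + (ennreal b + c)) M \<partial>?M)"
    if a: "0 \<le> a" "a \<le> 1" for a c M m
  proof -
    let ?W = "\<lambda>z e. ennreal (F (Suc m) (\<lambda>k. z k + e k))"
    have "(\<integral>\<^sup>+\<omega>. min (ennreal a * Y (Suc m) \<omega> + c) M \<partial>?M)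
        = (\<integral>\<^sup>+\<omega>. \<integral>\<^sup>+z. \<integral>\<^sup>+e. min (ennreal a * ?W z e + c) M \<partial>switch_arrivals m \<partial>visit_kernel m (Qv m \<omega>) \<partial>?M)"
      unfolding Y_def by (rule nn_integral_step)
    also have "\<dots> \<le> (\<integral>\<^sup>+\<omega>. min (ennreal (a * \<beta>) * Y m \<omega> + (ennreal b + c)) M \<partial>?M)"
    proof (intro nn_integral_mono)
      fix \<omega>
      let ?x = "Qv m \<omega>"
      have "(\<integral>\<^sup>+z. \<integral>\<^sup>+e. min (ennreal a * ?W z e + c) M \<partial>switch_arrivals m \<partial>visit_kernel m ?x)
          \<le> (\<integral>\<^sup>+z. \<integral>\<^sup>+e. ennreal a * ?W z e + c \<partial>switch_arrivals m \<partial>visit_kernel m ?x)"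
        by (intro nn_integral_mono) simp
      also have "\<dots> = ennreal a * (\<integral>\<^sup>+z. \<integral>\<^sup>+e. ?W z e \<partial>switch_arrivals m \<partial>visit_kernel m ?x) + c"
        by (simp add: nn_integral_add nn_integral_cmult emeasure_pmf)
      also have "\<dots> \<le> ennreal a * (ennreal \<beta> * ennreal (F m ?x) + ennreal b) + c"
        by (intro add_right_mono mult_left_mono drift) auto
      also have "\<dots> \<le> ennreal (a * \<beta>) * Y m \<omega> + (ennreal b + c)"
      proof -
        have "ennreal a * ennreal b \<le> 1 * ennreal b" using a by (intro mult_right_mono) (auto simp: ennreal_le_1)
        then show ?thesis using a \<beta> by (simp add: Y_def distrib_left ennreal_mult' mult.assoc add.assoc add_left_mono add_right_mono)
      qed
      finally have 1: "(\<integral>\<^sup>+z. \<integral>\<^sup>+e. min (ennreal a * ?W z e + c) M \<partial>switch_arrivals m \<partial>visit_kernel m ?x)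
          \<le> ennreal (a * \<beta>) * Y m \<omega> + (ennreal b + c)" .
      have "(\<integral>\<^sup>+z. \<integral>\<^sup>+e. min (ennreal a * ?W z e + c) M \<partial>switch_arrivals m \<partial>visit_kernel m ?x)
          \<le> (\<integral>\<^sup>+z. \<integral>\<^sup>+e. M \<partial>switch_arrivals m \<partial>visit_kernel m ?x)"
        by (intro nn_integral_mono) simp
      then have "(\<integral>\<^sup>+z. \<integral>\<^sup>+e. min (ennreal a * ?W z e + c) M \<partial>switch_arrivals m \<partial>visit_kernel m ?x) \<le> M"
        by (simp add: emeasure_pmf)
      with 1 show "(\<integral>\<^sup>+z. \<integral>\<^sup>+e. min (ennreal a * ?W z e + c) M \<partial>switch_arrivals m \<partial>visit_kernel m ?x)
          \<le> min (ennreal (a * \<beta>) * Y m \<omega> + (ennreal b + c)) M" by simp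
    qed
    finally show ?thesis .
  qed
  have iter: "(\<integral>\<^sup>+\<omega>. min (ennreal a * Y m \<omega> + c) M \<partial>?M) \<le> (\<integral>\<^sup>+\<omega>. min (ennreal (a * \<beta> ^ m) * Y 0 \<omega> + (ennreal (real m * b) + c)) M \<partial>?M)"
    if a: "0 \<le> a" "a \<le> 1" for a c M m
    using that
  proof (induction m arbitrary: a c)
    case (Suc m)
    have "(\<integral>\<^sup>+\<omega>. min (ennreal a * Y (Suc m) \<omega> + c) M \<partial>?M) \<le> (\<integral>\<^sup>+\<omega>. min (ennreal (a * \<beta>) * Y m \<omega> + (ennreal b + c)) M \<partial>?M)"
      by (rule step[OF Suc.prems])
    also have "\<dots> \<le> (\<integral>\<^sup>+\<omega>. min (ennreal (a * \<beta> * \<beta> ^ m) * Y 0 \<omega> + (ennreal (real m * b) + (ennreal b + c))) M \<partial>?M)"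
      using Suc.prems \<beta> by (intro Suc.IH) (auto intro: mult_le_one)
    also have "ennreal (real m * b) + (ennreal b + c) = ennreal (real (Suc m) * b) + c"
      using b by (simp add: add.assoc[symmetric] ennreal_plus[symmetric] algebra_simps del: ennreal_plus)
    finally show ?case by (simp add: mult.assoc)
  qed simp
  have bI: "\<beta> ^ I < 1" using \<beta> I_pos by (simp add: power_Suc_less_one power_less_one_iff)
  have Y0: "(\<integral>\<^sup>+\<omega>. Y 0 \<omega> \<partial>?M) \<le> ennreal (real I * b / (1 - \<beta> ^ I))"
    unfolding Y_def
  proof (rule truncation_bound)
    show "prob_space ?M" by (rule prob_space_sample)
    show "(\<lambda>\<omega>. F 0 (Qv 0 \<omega>)) \<in> borel_measurable ?M" by measurable
    show "0 \<le> F 0 (Qv 0 \<omega>)" for \<omega> by (simp add: F(1))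
    fix n :: nat
    have "(\<integral>\<^sup>+\<omega>. min (ennreal (F 0 (Qv 0 \<omega>))) (of_nat n) \<partial>?M)
        = (\<integral>\<^sup>+\<omega>. min (ennreal 1 * Y I \<omega> + 0) (of_nat n) \<partial>?M)"
      using stationary_Qv[of "\<lambda>x. min (ennreal (F 0 x)) (of_nat n)"] by (simp add: Y_def F(2))
    also have "\<dots> \<le> (\<integral>\<^sup>+\<omega>. min (ennreal (1 * \<beta> ^ I) * Y 0 \<omega> + (ennreal (real I * b) + 0)) (of_nat n) \<partial>?M)"
      by (rule iter) auto
    also have "\<dots> = (\<integral>\<^sup>+\<omega>. min (ennreal (\<beta> ^ I * F 0 (Qv 0 \<omega>) + real I * b)) (of_nat n) \<partial>?M)"
      using \<beta> b F(1)[of 0] by (simp add: Y_def ennreal_mult'[symmetric] ennreal_plus[symmetric] del: ennreal_plus)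
    finally show "(\<integral>\<^sup>+\<omega>. min (ennreal (F 0 (Qv 0 \<omega>))) (of_nat n) \<partial>?M)
        \<le> (\<integral>\<^sup>+\<omega>. min (ennreal (\<beta> ^ I * F 0 (Qv 0 \<omega>) + real I * b)) (of_nat n) \<partial>?M)" .
  qed (use \<beta> b bI in auto)
  have "(\<integral>\<^sup>+\<omega>. Y m \<omega> \<partial>?M) = (\<integral>\<^sup>+\<omega>. min (ennreal 1 * Y m \<omega> + 0) \<top> \<partial>?M)" by simp
  also have "\<dots> \<le> (\<integral>\<^sup>+\<omega>. min (ennreal (1 * \<beta> ^ m) * Y 0 \<omega> + (ennreal (real m * b) + 0)) \<top> \<partial>?M)"
    by (rule iter) auto
  also have "\<dots> = ennreal (\<beta> ^ m) * (\<integral>\<^sup>+\<omega>. Y 0 \<omega> \<partial>?M) + ennreal (real m * b)"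
    by (simp add: nn_integral_add nn_integral_cmult P.emeasure_space_1)
  also have "\<dots> \<le> 1 * ennreal (real I * b / (1 - \<beta> ^ I)) + ennreal (real m * b)"
    using \<beta> Y0 by (intro add_right_mono mult_mono) (auto simp: ennreal_le_1 power_le_one)
  also have "\<dots> = ennreal ((real I / (1 - \<beta> ^ I) + real m) * b)"
    using b bI by (simp add: ennreal_plus[symmetric] distrib_right del: ennreal_plus)
  finally show ?thesis unfolding Y_def .
qed

end

section \<open>Drift of the squared deviation from the means\<close>

context weighted_polling_model
begin

declare One_nat_def [simp del]

lemma visit_mean_diff:
  "visit_mean m x j - visit_mean m y j = visit_mean m (\<lambda>j. x j - y j) j"
  by (simp add: visit_mean_def algebra_simps)

lemma visit_kernel_square_uniform:
  assumes S: "\<And>k. k \<in> {1..K} \<Longrightarrow> integrable (SD k) (\<lambda>x. x ^ 2)"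
  shows "\<exists>C\<ge>0. \<forall>m x. \<forall>j\<in>{1..K}. (\<integral>\<^sup>+z. ennreal ((real (z j) - visit_mean m (\<lambda>j. real (x j)) j) ^ 2) \<partial>visit_kernel m x)
    \<le> ennreal (C * real (x (que m)))"
proof -
  let ?P = "\<lambda>m j C. 0 \<le> C \<and> (\<forall>x. (\<integral>\<^sup>+z. ennreal ((real (z j) - visit_mean m (\<lambda>j. real (x j)) j) ^ 2) \<partial>visit_kernel m x)
    \<le> ennreal (C * real (x (que m))))"
  define C where "C = (\<lambda>m j. SOME C. ?P m j C)"
  have P: "?P m j (C m j)" if "j \<in> {1..K}" for m j
    unfolding C_def by (rule someI_ex, rule visit_kernel_square[OF that S[OF que_range]])
  have C_nonneg: "0 \<le> C m j" if "j \<in> {1..K}" for m j using P[OF that] by (rule conjunct1)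
  have C_le: "(\<integral>\<^sup>+z. ennreal ((real (z j) - visit_mean m (\<lambda>j. real (x j)) j) ^ 2) \<partial>visit_kernel m x)
      \<le> ennreal (C m j * real (x (que m)))" if "j \<in> {1..K}" for m j x
    by (rule P[OF that, THEN conjunct2, rule_format])
  note C = C_nonneg C_le
  define D where "D = (\<Sum>m<I. \<Sum>j\<in>{1..K}. C m j)"
  have D: "C m j \<le> D" if m: "m < I" and j: "j \<in> {1..K}" for m j
  proof -
    have "C m j \<le> (\<Sum>j\<in>{1..K}. C m j)" using j C(1) by (intro member_le_sum) auto
    also have "\<dots> \<le> D" unfolding D_def using m C(1)
      by (intro member_le_sum[of m "{..<I}" "\<lambda>m. \<Sum>j\<in>{1..K}. C m j"]) (auto intro!: sum_nonneg)
    finally show ?thesis .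
  qed
  have per: "(visit_mean m, visit_kernel m, que m) = (visit_mean (m mod I), visit_kernel (m mod I), que (m mod I))" for m
    by (rule periodic_mod[of "\<lambda>m. (visit_mean m, visit_kernel m, que m)"])
      (simp add: visit_kernel_periodic visit_mean_def fun_eq_iff stage_add_I)
  show ?thesis
  proof (intro exI[of _ D] conjI allI ballI)
    show "0 \<le> D" unfolding D_def using C(1) by (intro sum_nonneg) auto
    fix m x j assume j: "j \<in> {1..K}"
    let ?m = "m mod I"
    have "(\<integral>\<^sup>+z. ennreal ((real (z j) - visit_mean ?m (\<lambda>j. real (x j)) j) ^ 2) \<partial>visit_kernel ?m x)
        \<le> ennreal (C ?m j * real (x (que ?m)))" by (rule C(2)[OF j])
    also have "\<dots> \<le> ennreal (D * real (x (que ?m)))"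
      using D[of ?m j] j I_pos by (intro ennreal_leI mult_right_mono) auto
    finally show "(\<integral>\<^sup>+z. ennreal ((real (z j) - visit_mean m (\<lambda>j. real (x j)) j) ^ 2) \<partial>visit_kernel m x)
        \<le> ennreal (D * real (x (que m)))" using per[of m] by simp
  qed
qed

text \<open>The law of total variance for a mixed Poisson variable: the variance of the duration
  times the squared rate, plus the mean number of arrivals. The cross term stands on the left so
  that it is cancelled rather than subtracted.\<close>

lemma arrivals_variance:
  fixes \<nu> :: "real measure"
  assumes \<nu>: "prob_space \<nu>" "sets \<nu> = sets borel" "AE s in \<nu>. 0 \<le> s" and v: "(\<integral>\<^sup>+s. ennreal s \<partial>\<nu>) = ennreal v" "(\<integral>\<^sup>+s. ennreal (s ^ 2) \<partial>\<nu>) = ennreal \<sigma>"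
    and nn: "0 \<le> v" "v ^ 2 \<le> \<sigma>" and j: "j \<in> {1..K}"
  shows "(\<integral>\<^sup>+e. ennreal ((real (e j) - lam j * v) ^ 2) \<partial>arrival_law {1..K} lam \<nu>)
    = ennreal (lam j ^ 2 * (\<sigma> - v ^ 2) + lam j * v)"
proof -
  let ?E = "\<lambda>f. \<integral>\<^sup>+e. f e \<partial>arrival_law {1..K} lam \<nu>"
  have l: "0 \<le> lam j" using arrival_rate[OF j] by simp
  have \<sigma>: "0 \<le> \<sigma>" using nn(2) zero_le_power2[of v] by linarith
  note c = mult_nonneg_nonneg[OF l nn(1)]
  have mn: "?E (\<lambda>e. of_nat (e j)) = ennreal (lam j) * (\<integral>\<^sup>+s. ennreal s \<partial>\<nu>)"
    by (rule arrival_law_mean) (use \<nu> j l in auto)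
  have sq: "?E (\<lambda>e. of_nat (e j) ^ 2)
      = ennreal ((lam j) ^ 2) * (\<integral>\<^sup>+s. ennreal (s ^ 2) \<partial>\<nu>) + ennreal (lam j) * (\<integral>\<^sup>+s. ennreal s \<partial>\<nu>)"
    by (rule arrival_law_square) (use \<nu> j l in auto)
  have "?E (\<lambda>e. ennreal ((real (e j) - lam j * v) ^ 2)) + ennreal (2 * (lam j * v)) * ?E (\<lambda>e. of_nat (e j))
      = ?E (\<lambda>e. ennreal ((real (e j) - lam j * v) ^ 2) + ennreal (2 * (lam j * v)) * of_nat (e j))"
    by (simp add: nn_integral_add nn_integral_cmult)
  also have "\<dots> = ?E (\<lambda>e. of_nat (e j) ^ 2 + ennreal ((lam j * v) ^ 2))"
  proof (rule nn_integral_cong)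
    fix e :: "nat \<Rightarrow> nat"
    have "ennreal ((real (e j) - lam j * v) ^ 2) + ennreal (2 * (lam j * v)) * ennreal (real (e j))
        = ennreal ((real (e j) - lam j * v) ^ 2 + 2 * (lam j * v) * real (e j))"
      using c by (subst ennreal_mult'[symmetric]) (auto intro!: ennreal_plus[symmetric])
    also have "(real (e j) - lam j * v) ^ 2 + 2 * (lam j * v) * real (e j) = real (e j) ^ 2 + (lam j * v) ^ 2"
      by (simp add: power2_eq_square algebra_simps)
    also have "ennreal \<dots> = ennreal (real (e j) ^ 2) + ennreal ((lam j * v) ^ 2)" by (intro ennreal_plus) auto
    finally show "ennreal ((real (e j) - lam j * v) ^ 2) + ennreal (2 * (lam j * v)) * of_nat (e j)
        = of_nat (e j) ^ 2 + ennreal ((lam j * v) ^ 2)"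
      by (simp add: ennreal_of_nat_eq_real_of_nat ennreal_power)
  qed
  also have "\<dots> = ?E (\<lambda>e. of_nat (e j) ^ 2) + ennreal ((lam j * v) ^ 2)"
    by (simp add: nn_integral_add emeasure_pmf)
  also have "?E (\<lambda>e. of_nat (e j) ^ 2) = ennreal (lam j ^ 2 * \<sigma> + lam j * v)"
    unfolding sq v using l \<sigma> nn(1)
    by (simp add: ennreal_mult'[symmetric] ennreal_plus[symmetric] del: ennreal_plus)
  also have "?E (\<lambda>e. of_nat (e j)) = ennreal (lam j * v)"
    unfolding mn v using l by (simp add: ennreal_mult')
  finally have eq: "?E (\<lambda>e. ennreal ((real (e j) - lam j * v) ^ 2)) + ennreal (2 * (lam j * v) * (lam j * v))
      = ennreal (lam j ^ 2 * \<sigma> + lam j * v + (lam j * v) ^ 2)"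
    using c l \<sigma> nn(1) by (simp add: ennreal_mult'[symmetric] ennreal_plus[symmetric] del: ennreal_plus)
  have "lam j ^ 2 * v ^ 2 \<le> lam j ^ 2 * \<sigma>" using nn(2) by (intro mult_left_mono) auto
  then have p: "0 \<le> lam j ^ 2 * (\<sigma> - v ^ 2) + lam j * v" using c by (simp add: algebra_simps)
  have "ennreal (lam j ^ 2 * \<sigma> + lam j * v + (lam j * v) ^ 2)
      = ennreal ((lam j ^ 2 * (\<sigma> - v ^ 2) + lam j * v) + 2 * (lam j * v) * (lam j * v))"
    by (rule arg_cong[of _ _ ennreal]) (simp add: power2_eq_square algebra_simps)
  also have "\<dots> = ennreal (lam j ^ 2 * (\<sigma> - v ^ 2) + lam j * v) + ennreal (2 * (lam j * v) * (lam j * v))"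
    using p c by (intro ennreal_plus) auto
  finally have "?E (\<lambda>e. ennreal ((real (e j) - lam j * v) ^ 2)) + ennreal (2 * (lam j * v) * (lam j * v))
      = ennreal (lam j ^ 2 * (\<sigma> - v ^ 2) + lam j * v) + ennreal (2 * (lam j * v) * (lam j * v))" using eq by simp
  then show ?thesis
    unfolding add.commute[of _ "ennreal (2 * (lam j * v) * (lam j * v))"] ennreal_add_left_cancel by simp
qed

definition deviation :: "nat \<Rightarrow> (nat \<Rightarrow> real) \<Rightarrow> (nat \<Rightarrow> nat) \<Rightarrow> real" where
  "deviation m a x = (\<Sum>j\<in>{1..K}. w m j * \<bar>real (x j) - a j\<bar>)"

lemma deviation_nonneg: "0 \<le> deviation m a x"
  unfolding deviation_def using w_pos by (intro sum_nonneg mult_nonneg_nonneg) (auto intro: less_imp_le)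

lemma component_le_deviation:
  assumes "j \<in> {1..K}"
  shows "w m j * \<bar>real (x j) - a j\<bar> \<le> deviation m a x"
  unfolding deviation_def using assms w_pos[THEN less_imp_le]
  by (intro member_le_sum[of j "{1..K}" "\<lambda>j. w m j * \<bar>real (x j) - a j\<bar>"]) auto

text \<open>By linearity of \<open>visit_mean\<close> the old deviation is propagated by the
  contraction; what remains is the noise of the visit and of the switchover.\<close>

lemma deviation_step:
  assumes a': "\<And>j. j \<in> {1..K} \<Longrightarrow> a' j = visit_mean m a j + c j"
  shows "deviation (Suc m) a' (\<lambda>k. z k + e k) \<le> \<gamma> * deviation m a x
    + (\<Sum>j\<in>{1..K}. w (Suc m) j * (\<bar>real (z j) - visit_mean m (\<lambda>j. real (x j)) j\<bar> + \<bar>real (e j) - c j\<bar>))"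
proof -
  have "deviation (Suc m) a' (\<lambda>k. z k + e k)
      \<le> (\<Sum>j\<in>{1..K}. w (Suc m) j * \<bar>visit_mean m (\<lambda>j. real (x j) - a j) j\<bar>
        + w (Suc m) j * (\<bar>real (z j) - visit_mean m (\<lambda>j. real (x j)) j\<bar> + \<bar>real (e j) - c j\<bar>))"
    unfolding deviation_def distrib_left[symmetric]
  proof (intro sum_mono mult_left_mono)
    fix j assume j: "j \<in> {1..K}"
    show "\<bar>real (z j + e j) - a' j\<bar> \<le> \<bar>visit_mean m (\<lambda>j. real (x j) - a j) j\<bar>
        + (\<bar>real (z j) - visit_mean m (\<lambda>j. real (x j)) j\<bar> + \<bar>real (e j) - c j\<bar>)"
      unfolding visit_mean_diff[symmetric] a'[OF j] by simp
  qed (use w_pos[THEN less_imp_le] in auto)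
  also have "\<dots> = (\<Sum>j\<in>{1..K}. w (Suc m) j * \<bar>visit_mean m (\<lambda>j. real (x j) - a j) j\<bar>)
      + (\<Sum>j\<in>{1..K}. w (Suc m) j * (\<bar>real (z j) - visit_mean m (\<lambda>j. real (x j)) j\<bar> + \<bar>real (e j) - c j\<bar>))"
    by (rule sum.distrib)
  also have "(\<Sum>j\<in>{1..K}. w (Suc m) j * \<bar>visit_mean m (\<lambda>j. real (x j) - a j) j\<bar>) \<le> \<gamma> * deviation m a x"
    unfolding deviation_def by (rule weight_contraction)
  finally show ?thesis by simp
qed

text \<open>
  The drift inequality is centred at the means, so the error term is linear in the means while
  the squared deviation scales quadratically.
\<close>

lemma deviation_drift:
  assumes S: "\<And>k. k \<in> {1..K} \<Longrightarrow> integrable (SD k) (\<lambda>x. x ^ 2)"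
  shows "\<exists>\<beta> C. 0 < \<beta> \<and> \<beta> < 1 \<and> 0 \<le> C \<and> (\<forall>m x (\<nu> :: real measure) v \<sigma> a a'.
    prob_space \<nu> \<longrightarrow> sets \<nu> = sets borel \<longrightarrow> (AE s in \<nu>. 0 \<le> s) \<longrightarrow>
    (\<integral>\<^sup>+s. ennreal s \<partial>\<nu>) = ennreal v \<longrightarrow> (\<integral>\<^sup>+s. ennreal (s ^ 2) \<partial>\<nu>) = ennreal \<sigma> \<longrightarrow>
    0 \<le> v \<longrightarrow> v ^ 2 \<le> \<sigma> \<longrightarrow> 0 \<le> a (que m) \<longrightarrow> (\<forall>j\<in>{1..K}. a' j = visit_mean m a j + lam j * v) \<longrightarrow>
    (\<integral>\<^sup>+z. \<integral>\<^sup>+e. ennreal (deviation (Suc m) a' (\<lambda>k. z k + e k) ^ 2) \<partial>arrival_law {1..K} lam \<nu> \<partial>visit_kernel m x)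
      \<le> ennreal \<beta> * ennreal (deviation m a x ^ 2) + ennreal (C * (1 + a (que m) + v + (\<sigma> - v ^ 2))))"
proof -
  \<comment> \<open>The first factor is the price for splitting off the noise, and the product is
    still below 1. \<beta> is the midpoint between it and 1; the gap gained will absorb a term that
    is linear in the deviation.\<close>
  define \<beta>0 where "\<beta>0 = (1 + (1 - \<gamma>) / 2) * \<gamma> ^ 2"
  define \<beta> where "\<beta> = (1 + \<beta>0) / 2"
  have "\<beta>0 \<le> (1 + (1 - \<gamma>)) * (\<gamma> * \<gamma>)" unfolding \<beta>0_def power2_eq_square using \<gamma> by (intro mult_right_mono) auto
  also have "\<dots> = 1 - (1 - \<gamma>) * (1 + \<gamma> - \<gamma> * \<gamma>)" by (simp add: algebra_simps)
  also have "\<dots> < 1"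
  proof -
    have "\<gamma> * \<gamma> \<le> 1" using \<gamma> by (simp add: mult_le_one)
    then have "0 < (1 - \<gamma>) * (1 + \<gamma> - \<gamma> * \<gamma>)" using \<gamma> by (intro mult_pos_pos) auto
    then show ?thesis by simp
  qed
  finally have "\<beta>0 < 1" .
  moreover have "0 < \<beta>0" unfolding \<beta>0_def using \<gamma> by (intro mult_pos_pos zero_less_power add_pos_pos) auto
  ultimately have \<beta>: "0 < \<beta>0" "\<beta>0 < 1" "0 < \<beta>" "\<beta> < 1" by (auto simp: \<beta>_def)
  obtain C1 where C1: "0 \<le> C1" "\<And>a b. 0 \<le> a \<Longrightarrow> 0 \<le> b \<Longrightarrow> (a + b) ^ 2 \<le> (1 + (1 - \<gamma>) / 2) * a ^ 2 + C1 * b ^ 2"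
    using power_add_le_eps[of "(1 - \<gamma>) / 2" 2] \<gamma> by auto
  obtain C2 where C2: "0 \<le> C2" "\<And>m x j. j \<in> {1..K} \<Longrightarrow>
    (\<integral>\<^sup>+z. ennreal ((real (z j) - visit_mean m (\<lambda>j. real (x j)) j) ^ 2) \<partial>visit_kernel m x) \<le> ennreal (C2 * real (x (que m)))"
    using visit_kernel_square_uniform[OF S] by blast
  obtain W \<omega> where W: "1 \<le> W" "0 < \<omega>" "\<And>m j. j \<in> {1..K} \<Longrightarrow> w m j \<le> W" "\<And>m j. j \<in> {1..K} \<Longrightarrow> \<omega> \<le> w m j"
    by (rule weight_bounds) blast
  have ne: "{1..K} \<noteq> {}" using que_range[of 0] by auto
  define C3 where "C3 = C1 * (real K ^ 2 * (W ^ 2 * 4))"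
  define L where "L = (\<Sum>j\<in>{1..K}. lam j ^ 2 + lam j)"
  define G where "G = C3 * (real K * C2)"
  define C where "C = G + G ^ 2 / (4 * \<omega> ^ 2 * ((1 - \<beta>0) / 2)) + C3 * L"
  have lam: "0 \<le> lam j" if "j \<in> {1..K}" for j using arrival_rate[OF that] by simp
  have C3: "0 \<le> C3" using C1 by (simp add: C3_def)
  have L: "0 \<le> L" unfolding L_def using lam by (intro sum_nonneg) auto
  have G: "0 \<le> G" using C3 C2 by (simp add: G_def)
  have C: "0 \<le> C" unfolding C_def using G C3 L \<beta> W(2) by (intro add_nonneg_nonneg) auto
  have "(\<integral>\<^sup>+z. \<integral>\<^sup>+e. ennreal (deviation (Suc m) a' (\<lambda>k. z k + e k) ^ 2) \<partial>arrival_law {1..K} lam \<nu> \<partial>visit_kernel m x)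
      \<le> ennreal \<beta> * ennreal (deviation m a x ^ 2) + ennreal (C * (1 + a (que m) + v + (\<sigma> - v ^ 2)))"
    if \<nu>: "prob_space \<nu>" "sets \<nu> = sets borel" "AE s in \<nu>. 0 \<le> s" "(\<integral>\<^sup>+s. ennreal s \<partial>\<nu>) = ennreal v" "(\<integral>\<^sup>+s. ennreal (s ^ 2) \<partial>\<nu>) = ennreal \<sigma>" "0 \<le> v" "v ^ 2 \<le> \<sigma>"
      and a: "0 \<le> a (que m)" "\<forall>j\<in>{1..K}. a' j = visit_mean m a j + lam j * v"
    for m x v \<sigma> a a' and \<nu> :: "real measure"
  proof -
    let ?D = "deviation m a x"
    let ?f = "\<lambda>z j. (real (z j) - visit_mean m (\<lambda>j. real (x j)) j) ^ 2" and ?g = "\<lambda>e j. (real (e j) - lam j * v) ^ 2"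
    have "(\<integral>\<^sup>+z. \<integral>\<^sup>+e. ennreal (deviation (Suc m) a' (\<lambda>k. z k + e k) ^ 2) \<partial>arrival_law {1..K} lam \<nu> \<partial>visit_kernel m x)
        \<le> (\<integral>\<^sup>+z. \<integral>\<^sup>+e. ennreal (\<beta>0 * ?D ^ 2) + ennreal C3 * ((\<Sum>j\<in>{1..K}. ennreal (?f z j)) + (\<Sum>j\<in>{1..K}. ennreal (?g e j)))
            \<partial>arrival_law {1..K} lam \<nu> \<partial>visit_kernel m x)"
    proof (intro nn_integral_mono)
      fix z e :: "nat \<Rightarrow> nat"
      let ?u = "\<lambda>j. \<bar>real (z j) - visit_mean m (\<lambda>j. real (x j)) j\<bar>" and ?t = "\<lambda>j. \<bar>real (e j) - lam j * v\<bar>"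
      let ?R = "\<Sum>j\<in>{1..K}. w (Suc m) j * (?u j + ?t j)"
      have R0: "0 \<le> ?R" using w_pos[THEN less_imp_le] by (intro sum_nonneg) auto
      have "deviation (Suc m) a' (\<lambda>k. z k + e k) ^ 2 \<le> (\<gamma> * ?D + ?R) ^ 2"
        using a(2) by (intro power_mono deviation_step deviation_nonneg) auto
      also have "\<dots> \<le> (1 + (1 - \<gamma>) / 2) * (\<gamma> * ?D) ^ 2 + C1 * ?R ^ 2"
        using \<gamma> deviation_nonneg[of m a x] R0 by (intro C1(2)) auto
      also have "(1 + (1 - \<gamma>) / 2) * (\<gamma> * ?D) ^ 2 = \<beta>0 * ?D ^ 2" by (simp add: \<beta>0_def power_mult_distrib)
      also have "?R ^ 2 \<le> real K ^ 2 * (W ^ 2 * 4) * ((\<Sum>j\<in>{1..K}. ?f z j) + (\<Sum>j\<in>{1..K}. ?g e j))"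
      proof -
        have "?R ^ 2 \<le> real (card {1..K}) ^ 2 * (\<Sum>j\<in>{1..K}. (w (Suc m) j * (?u j + ?t j)) ^ 2)"
          using ne w_pos[THEN less_imp_le] by (intro sum_power_le) auto
        also have "\<dots> \<le> real (card {1..K}) ^ 2 * (\<Sum>j\<in>{1..K}. W ^ 2 * 4 * (?f z j + ?g e j))"
        proof (intro mult_left_mono sum_mono)
          fix j assume j: "j \<in> {1..K}"
          have "(w (Suc m) j * (?u j + ?t j)) ^ 2 \<le> (W * (?u j + ?t j)) ^ 2"
            using W(3)[OF j] w_pos[OF j, of "Suc m"] by (intro power_mono mult_right_mono) auto
          also have "\<dots> = W ^ 2 * (?u j + ?t j) ^ 2" by (rule power_mult_distrib)
          also have "W ^ 2 * (?u j + ?t j) ^ 2 \<le> W ^ 2 * (2 ^ 2 * (?u j ^ 2 + ?t j ^ 2))"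
            by (intro mult_left_mono power_add_le) auto
          also have "\<dots> = W ^ 2 * 4 * (?f z j + ?g e j)" by simp
          finally show "(w (Suc m) j * (?u j + ?t j)) ^ 2 \<le> W ^ 2 * 4 * (?f z j + ?g e j)" .
        qed simp
        also have "\<dots> = real K ^ 2 * (W ^ 2 * 4) * ((\<Sum>j\<in>{1..K}. ?f z j) + (\<Sum>j\<in>{1..K}. ?g e j))"
          unfolding sum.distrib[symmetric] sum_distrib_left[symmetric] by (simp add: One_nat_def)
        finally show ?thesis .
      qed
      finally have "deviation (Suc m) a' (\<lambda>k. z k + e k) ^ 2 \<le> \<beta>0 * ?D ^ 2 + C3 * ((\<Sum>j\<in>{1..K}. ?f z j) + (\<Sum>j\<in>{1..K}. ?g e j))"
        using C1(1) by (simp add: C3_def mult_left_mono mult.assoc)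
      then have "ennreal (deviation (Suc m) a' (\<lambda>k. z k + e k) ^ 2) \<le> ennreal (\<beta>0 * ?D ^ 2 + C3 * ((\<Sum>j\<in>{1..K}. ?f z j) + (\<Sum>j\<in>{1..K}. ?g e j)))"
        by (rule ennreal_leI)
      also have "\<dots> = ennreal (\<beta>0 * ?D ^ 2) + ennreal (C3 * ((\<Sum>j\<in>{1..K}. ?f z j) + (\<Sum>j\<in>{1..K}. ?g e j)))"
        using \<beta> C3 by (intro ennreal_plus) (auto intro!: mult_nonneg_nonneg add_nonneg_nonneg sum_nonneg)
      also have "ennreal (C3 * ((\<Sum>j\<in>{1..K}. ?f z j) + (\<Sum>j\<in>{1..K}. ?g e j)))
          = ennreal C3 * (ennreal (\<Sum>j\<in>{1..K}. ?f z j) + ennreal (\<Sum>j\<in>{1..K}. ?g e j))"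
        unfolding ennreal_mult'[OF C3] by (subst ennreal_plus) (auto intro!: sum_nonneg)
      also have "\<dots> = ennreal C3 * ((\<Sum>j\<in>{1..K}. ennreal (?f z j)) + (\<Sum>j\<in>{1..K}. ennreal (?g e j)))"
        by (subst (1 2) sum_ennreal) auto
      finally show "ennreal (deviation (Suc m) a' (\<lambda>k. z k + e k) ^ 2)
          \<le> ennreal (\<beta>0 * ?D ^ 2) + ennreal C3 * ((\<Sum>j\<in>{1..K}. ennreal (?f z j)) + (\<Sum>j\<in>{1..K}. ennreal (?g e j)))" .
    qed
    also have "\<dots> = ennreal (\<beta>0 * ?D ^ 2) + ennreal C3 * ((\<Sum>j\<in>{1..K}. \<integral>\<^sup>+z. ennreal (?f z j) \<partial>visit_kernel m x)
        + (\<Sum>j\<in>{1..K}. \<integral>\<^sup>+e. ennreal (?g e j) \<partial>arrival_law {1..K} lam \<nu>))"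
      by (simp add: nn_integral_add nn_integral_cmult nn_integral_sum emeasure_pmf del: sum_ennreal)
    also have "\<dots> \<le> ennreal (\<beta>0 * ?D ^ 2) + ennreal C3 * ((\<Sum>j\<in>{1..K}. ennreal (C2 * real (x (que m))))
        + (\<Sum>j\<in>{1..K}. ennreal ((lam j ^ 2 + lam j) * (v + (\<sigma> - v ^ 2)))))"
    proof (intro add_left_mono mult_left_mono add_mono sum_mono C2)
      fix j assume j: "j \<in> {1..K}"
      have "lam j ^ 2 * (\<sigma> - v ^ 2) + lam j * v \<le> (lam j ^ 2 + lam j) * (v + (\<sigma> - v ^ 2))"
      proof -
        have "0 \<le> lam j * (\<sigma> - v ^ 2)" "0 \<le> lam j ^ 2 * v" using lam[OF j] \<nu>(6,7) by auto
        moreover have "(x + y) * (v + d) = x * v + x * d + y * v + y * d" for x y d :: real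
          by (simp add: algebra_simps)
        ultimately show ?thesis by simp
      qed
      then show "(\<integral>\<^sup>+e. ennreal (?g e j) \<partial>arrival_law {1..K} lam \<nu>) \<le> ennreal ((lam j ^ 2 + lam j) * (v + (\<sigma> - v ^ 2)))"
        unfolding arrivals_variance[OF \<nu> j] by (rule ennreal_leI)
    qed auto
    also have "\<dots> = ennreal (\<beta>0 * ?D ^ 2 + (G * real (x (que m)) + C3 * (L * (v + (\<sigma> - v ^ 2)))))"
    proof -
      have vs: "0 \<le> v + (\<sigma> - v ^ 2)" using \<nu>(6,7) by simp
      have s1: "(\<Sum>j\<in>{1..K}. ennreal (C2 * real (x (que m)))) = ennreal (real K * C2 * real (x (que m)))"
        using C2(1) by (subst sum_ennreal) (auto simp: One_nat_def mult.assoc)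
      have s2: "(\<Sum>j\<in>{1..K}. ennreal ((lam j ^ 2 + lam j) * (v + (\<sigma> - v ^ 2)))) = ennreal (L * (v + (\<sigma> - v ^ 2)))"
        unfolding L_def sum_distrib_right using lam vs by (intro sum_ennreal) auto
      have n1: "0 \<le> real K * C2 * real (x (que m))" using C2(1) by simp
      have n2: "0 \<le> L * (v + (\<sigma> - v ^ 2))" using L vs by (rule mult_nonneg_nonneg)
      have n3: "0 \<le> \<beta>0 * ?D ^ 2" using \<beta> by simp
      show ?thesis
        unfolding s1 s2 ennreal_plus[OF n1 n2, symmetric] ennreal_mult'[OF C3, symmetric]
          ennreal_plus[OF n3 mult_nonneg_nonneg[OF C3 add_nonneg_nonneg[OF n1 n2]], symmetric]
        by (simp add: G_def distrib_left mult.assoc)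
    qed
    also have "\<dots> \<le> ennreal (\<beta> * ?D ^ 2 + C * (1 + a (que m) + v + (\<sigma> - v ^ 2)))"
    proof (rule ennreal_leI)
      have "\<omega> * \<bar>real (x (que m)) - a (que m)\<bar> \<le> ?D"
        using order_trans[OF mult_right_mono[OF W(4)[OF que_range]] component_le_deviation[OF que_range]] by auto
      moreover have "\<omega> * (real (x (que m)) - a (que m)) \<le> \<omega> * \<bar>real (x (que m)) - a (que m)\<bar>"
        using W(2) by (intro mult_left_mono) auto
      ultimately have "\<omega> * (real (x (que m)) - a (que m)) \<le> ?D" by linarith
      then have x: "real (x (que m)) \<le> a (que m) + ?D / \<omega>" using W(2) by (simp add: field_simps)
      let ?d = "(1 - \<beta>0) / 2"
      have d: "0 < ?d" using \<beta> by simp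
      \<comment> \<open>The variance of a visit is linear in the queue length, hence at most its
        mean plus a multiple of \<open>?D\<close>. Completing the square trades
        \<open>G * (?D / \<omega>)\<close> for \<open>?d * ?D ^ 2\<close> and a constant, which
        explains the second summand of \<open>C\<close>.\<close>
      have "0 \<le> (G / (2 * \<omega> * ?d) - ?D) ^ 2" by simp
      then have "?d * 0 \<le> ?d * (G / (2 * \<omega> * ?d) - ?D) ^ 2" using d by (intro mult_left_mono) auto
      also have "?d * (G / (2 * \<omega> * ?d) - ?D) ^ 2 = G ^ 2 / (4 * \<omega> ^ 2 * ?d) - G * (?D / \<omega>) + ?d * ?D ^ 2"
      proof -
        have "d * (G / (2 * \<omega> * d) - y) ^ 2 = G ^ 2 / (4 * \<omega> ^ 2 * d) - G * (y / \<omega>) + d * y ^ 2" if "d \<noteq> 0" for d y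
          using that W(2) by (simp add: power2_eq_square field_simps)
        from this[of ?d ?D] show ?thesis using d by linarith
      qed
      finally have "G * (?D / \<omega>) \<le> ?d * ?D ^ 2 + G ^ 2 / (4 * \<omega> ^ 2 * ((1 - \<beta>0) / 2))" by linarith
      moreover have "G * real (x (que m)) \<le> G * a (que m) + G * (?D / \<omega>)"
        unfolding distrib_left[symmetric] using G x by (intro mult_left_mono)
      moreover have "\<beta> * ?D ^ 2 = \<beta>0 * ?D ^ 2 + ?d * ?D ^ 2" by (simp add: \<beta>_def field_simps)
      moreover have "G * a (que m) + G ^ 2 / (4 * \<omega> ^ 2 * ((1 - \<beta>0) / 2)) + C3 * (L * (v + (\<sigma> - v ^ 2)))
          \<le> C * (1 + a (que m) + v + (\<sigma> - v ^ 2))"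
      proof -
        let ?H = "G ^ 2 / (4 * \<omega> ^ 2 * ((1 - \<beta>0) / 2))"
        have H: "0 \<le> ?H" using \<beta> by simp
        have CL: "0 \<le> C3 * L" using C3 L by simp
        have "C * (1 + a (que m) + (v + (\<sigma> - v ^ 2))) = C * a (que m) + C + C * (v + (\<sigma> - v ^ 2))" by (simp add: algebra_simps)
        moreover have "G * a (que m) \<le> C * a (que m)" using a H CL by (intro mult_right_mono) (auto simp: C_def)
        moreover have "C3 * L * (v + (\<sigma> - v ^ 2)) \<le> C * (v + (\<sigma> - v ^ 2))" using \<nu>(6,7) H G by (intro mult_right_mono) (auto simp: C_def)
        moreover have "?H \<le> C" using G CL by (simp add: C_def)
        ultimately show ?thesis by (simp add: add.assoc mult.assoc)
      qed
      ultimately show "\<beta>0 * ?D ^ 2 + (G * real (x (que m)) + C3 * (L * (v + (\<sigma> - v ^ 2))))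
          \<le> \<beta> * ?D ^ 2 + C * (1 + a (que m) + v + (\<sigma> - v ^ 2))" by linarith
    qed
    also have "\<dots> = ennreal \<beta> * ennreal (?D ^ 2) + ennreal (C * (1 + a (que m) + v + (\<sigma> - v ^ 2)))"
      using \<beta>(3) C a(1) \<nu>(6,7) by (subst ennreal_plus) (auto simp: ennreal_mult')
    finally show ?thesis .
  qed
  then show ?thesis using \<beta> C by (intro exI[of _ \<beta>] exI[of _ C] conjI allI impI) auto
qed

end

section \<open>Moment bounds with constants common to all systems\<close>

lemma (in bep_model) queue_length_Qv:
  "k \<in> {1..K} \<Longrightarrow> queue_length X \<omega> (epoch_state I p X \<omega> m) k = Qv m \<omega> k"
  by (simp add: Qv_def queue_vec_def)

context weighted_polling_model
begin

declare One_nat_def [simp del]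

lemma visit_mean_nonneg:
  assumes "\<And>j. j \<in> {1..K} \<Longrightarrow> 0 \<le> x j" "j \<in> {1..K}"
  shows "0 \<le> visit_mean m x j"
  using assms(1)[OF que_range[of m]] assms policy[of m] gain_nonneg[OF que_range assms(2), of m]
  by (auto simp: visit_mean_def)

lemma weighted_bep_modelI:
  "stationary_bep_system K I p lam SD r VD X \<Longrightarrow> weighted_bep_model K I p lam mu SD s r \<gamma> w VD X"
  by (intro weighted_bep_model.intro weighted_polling_model_axioms)

text \<open>The constant is chosen before the system and before the bound \<open>B\<close> on its
  switchover moments. With \<open>B\<close> of order n ^ l this becomes a bound on scaled queue
  lengths that is uniform in \<open>n\<close>.\<close>

lemma queue_moment_bound:
  assumes S: "\<And>k. k \<in> {1..K} \<Longrightarrow> integrable (SD k) (\<lambda>x. x ^ l)" and l: "1 \<le> l"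
  shows "\<exists>C\<ge>0. \<forall>VD (X :: 'w polling_primitives) B. stationary_bep_system K I p lam SD r VD X \<longrightarrow> 0 \<le> B \<longrightarrow>
    (\<forall>i\<in>{1..I}. (\<integral>\<^sup>+x. ennreal (x ^ l) \<partial>VD i) \<le> ennreal B) \<longrightarrow>
    (\<forall>k\<in>{1..K}. (\<integral>\<^sup>+\<omega>. ennreal (real (queue_length X \<omega> (epoch_state I p X \<omega> m) k) ^ l) \<partial>sample_space X) \<le> ennreal (C * (1 + B)))"
proof -
  obtain \<beta> C where \<beta>: "0 < \<beta>" "\<beta> < 1" "0 \<le> C" and dr: "\<And>m x (\<nu> :: real measure).
    prob_space \<nu> \<Longrightarrow> sets \<nu> = sets borel \<Longrightarrow> (AE s in \<nu>. 0 \<le> s) \<Longrightarrow>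
    (\<integral>\<^sup>+z. \<integral>\<^sup>+e. ennreal (weight (Suc m) (\<lambda>k. z k + e k) ^ l) \<partial>arrival_law {1..K} lam \<nu> \<partial>visit_kernel m x)
      \<le> ennreal \<beta> * ennreal (weight m x ^ l) + ennreal C * (1 + (\<integral>\<^sup>+s. ennreal (s ^ l) \<partial>\<nu>))"
    using weight_drift[OF S l] by blast
  obtain C' where C': "0 \<le> C'" "\<And>m x k. k \<in> {1..K} \<Longrightarrow> real (x k) ^ l \<le> C' * weight m x ^ l"
    using power_le_weight[of l] by blast
  define R where "R = real I / (1 - \<beta> ^ I) + real m"
  have "\<beta> ^ I \<le> 1" using \<beta> by (simp add: power_le_one)
  then have R: "0 \<le> R" by (simp add: R_def)
  show ?thesis
  proof (intro exI[of _ "C' * (R * C)"] conjI allI impI ballI)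
    fix VD :: "nat \<Rightarrow> real measure" and X :: "'w polling_primitives" and B k
    assume sys: "stationary_bep_system K I p lam SD r VD X" and B: "0 \<le> B"
      and V: "\<forall>i\<in>{1..I}. (\<integral>\<^sup>+x. ennreal (x ^ l) \<partial>VD i) \<le> ennreal B" and k: "k \<in> {1..K}"
    interpret W: weighted_bep_model K I p lam mu SD s r \<gamma> w VD X by (rule weighted_bep_modelI[OF sys])
    have drift: "(\<integral>\<^sup>+z. \<integral>\<^sup>+e. ennreal (weight (Suc m) (\<lambda>k. z k + e k) ^ l) \<partial>W.switch_arrivals m \<partial>visit_kernel m x)
        \<le> ennreal \<beta> * ennreal (weight m x ^ l) + ennreal (C * (1 + B))" for m x
    proof -
      have "(\<integral>\<^sup>+z. \<integral>\<^sup>+e. ennreal (weight (Suc m) (\<lambda>k. z k + e k) ^ l) \<partial>W.switch_arrivals m \<partial>visit_kernel m x)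
          \<le> ennreal \<beta> * ennreal (weight m x ^ l) + ennreal C * (1 + (\<integral>\<^sup>+s. ennreal (s ^ l) \<partial>VD (stage m)))"
        unfolding W.switch_arrivals_def by (rule dr[OF W.switch_law[OF stage_range]])
      also have "\<dots> \<le> ennreal \<beta> * ennreal (weight m x ^ l) + ennreal C * (1 + ennreal B)"
        by (intro add_left_mono mult_left_mono V[rule_format] stage_range) auto
      also have "ennreal C * (1 + ennreal B) = ennreal (C * (1 + B))"
        unfolding ennreal_mult'[OF \<beta>(3)] using B by (subst ennreal_plus) auto
      finally show ?thesis .
    qed
    have "(\<integral>\<^sup>+\<omega>. ennreal (real (queue_length X \<omega> (epoch_state I p X \<omega> m) k) ^ l) \<partial>sample_space X)
        \<le> (\<integral>\<^sup>+\<omega>. ennreal C' * ennreal (weight m (W.Qv m \<omega>) ^ l) \<partial>sample_space X)"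
      unfolding W.queue_length_Qv[OF k] ennreal_mult'[OF C'(1), symmetric]
      by (intro nn_integral_mono ennreal_leI C'(2) k)
    also have "\<dots> = ennreal C' * (\<integral>\<^sup>+\<omega>. ennreal (weight m (W.Qv m \<omega>) ^ l) \<partial>sample_space X)"
      by (rule nn_integral_cmult, rule measurable_compose[OF W.measurable_Qv[of m]]) simp
    also have "\<dots> \<le> ennreal C' * ennreal (R * (C * (1 + B)))"
      unfolding R_def
      by (intro mult_left_mono W.chain_bound[where F = "\<lambda>m x. weight m x ^ l"] \<beta>)
        (use drift weight_nonneg W.weight_I \<beta> B in auto)
    also have "\<dots> = ennreal (C' * (R * C) * (1 + B))"
      unfolding ennreal_mult'[OF C'(1), symmetric] by (simp add: mult.assoc)
    finally show "(\<integral>\<^sup>+\<omega>. ennreal (real (queue_length X \<omega> (epoch_state I p X \<omega> m) k) ^ l) \<partial>sample_space X)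
      \<le> ennreal (C' * (R * C) * (1 + B))" .
  qed (use C' R \<beta> in auto)
qed

text \<open>Here \<open>a\<close> is a periodic solution of the recursion for the means. For system
  \<open>n\<close> the bound \<open>B\<close> is of order \<open>n\<close> plus the variances of the
  switchover times, which is what makes the scaled second moment of the deviation vanish.\<close>

lemma queue_variance_bound:
  assumes S: "\<And>k. k \<in> {1..K} \<Longrightarrow> integrable (SD k) (\<lambda>x. x ^ 2)"
  shows "\<exists>C\<ge>0. \<forall>VD (X :: 'w polling_primitives) v \<sigma> a B. stationary_bep_system K I p lam SD r VD X \<longrightarrow>
    (\<forall>i\<in>{1..I}. (\<integral>\<^sup>+x. ennreal x \<partial>VD i) = ennreal (v i) \<and> (\<integral>\<^sup>+x. ennreal (x ^ 2) \<partial>VD i) = ennreal (\<sigma> i)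
      \<and> 0 \<le> v i \<and> (v i) ^ 2 \<le> \<sigma> i) \<longrightarrow>
    (\<forall>m. \<forall>j\<in>{1..K}. 0 \<le> a m j \<and> a (Suc m) j = visit_mean m (a m) j + lam j * v (stage m)) \<longrightarrow> a I = a 0 \<longrightarrow>
    (\<forall>m. 1 + a m (que m) + v (stage m) + (\<sigma> (stage m) - (v (stage m)) ^ 2) \<le> B) \<longrightarrow>
    (\<forall>k\<in>{1..K}. (\<integral>\<^sup>+\<omega>. ennreal ((real (queue_length X \<omega> (epoch_state I p X \<omega> m) k) - a m k) ^ 2) \<partial>sample_space X)
      \<le> ennreal (C * B))"
proof -
  obtain \<beta> C where \<beta>: "0 < \<beta>" "\<beta> < 1" "0 \<le> C" and dr: "\<And>m x (\<nu> :: real measure) v \<sigma> a a'.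
    prob_space \<nu> \<Longrightarrow> sets \<nu> = sets borel \<Longrightarrow> (AE s in \<nu>. 0 \<le> s) \<Longrightarrow>
    (\<integral>\<^sup>+s. ennreal s \<partial>\<nu>) = ennreal v \<Longrightarrow> (\<integral>\<^sup>+s. ennreal (s ^ 2) \<partial>\<nu>) = ennreal \<sigma> \<Longrightarrow>
    0 \<le> v \<Longrightarrow> v ^ 2 \<le> \<sigma> \<Longrightarrow> 0 \<le> a (que m) \<Longrightarrow> (\<forall>j\<in>{1..K}. a' j = visit_mean m a j + lam j * v) \<Longrightarrow>
    (\<integral>\<^sup>+z. \<integral>\<^sup>+e. ennreal (deviation (Suc m) a' (\<lambda>k. z k + e k) ^ 2) \<partial>arrival_law {1..K} lam \<nu> \<partial>visit_kernel m x)
      \<le> ennreal \<beta> * ennreal (deviation m a x ^ 2) + ennreal (C * (1 + a (que m) + v + (\<sigma> - v ^ 2)))"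
    using deviation_drift[OF S] by blast
  obtain W' \<omega>0 where \<omega>0: "0 < \<omega>0" "\<And>m j. j \<in> {1..K} \<Longrightarrow> \<omega>0 \<le> w m j" by (rule weight_bounds) blast
  define R where "R = real I / (1 - \<beta> ^ I) + real m"
  have "\<beta> ^ I \<le> 1" using \<beta> by (simp add: power_le_one)
  then have R: "0 \<le> R" by (simp add: R_def)
  show ?thesis
  proof (intro exI[of _ "1 / \<omega>0 ^ 2 * (R * C)"] conjI allI impI ballI)
    fix VD :: "nat \<Rightarrow> real measure" and X :: "'w polling_primitives" and v \<sigma> a B k
    assume sys: "stationary_bep_system K I p lam SD r VD X"
      and V: "\<forall>i\<in>{1..I}. (\<integral>\<^sup>+x. ennreal x \<partial>VD i) = ennreal (v i) \<and> (\<integral>\<^sup>+x. ennreal (x ^ 2) \<partial>VD i) = ennreal (\<sigma> i)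
        \<and> 0 \<le> v i \<and> (v i) ^ 2 \<le> \<sigma> i"
      and a: "\<forall>m. \<forall>j\<in>{1..K}. 0 \<le> a m j \<and> a (Suc m) j = visit_mean m (a m) j + lam j * v (stage m)" "a I = a 0"
      and B: "\<forall>m. 1 + a m (que m) + v (stage m) + (\<sigma> (stage m) - (v (stage m)) ^ 2) \<le> B" and k: "k \<in> {1..K}"
    interpret W: weighted_bep_model K I p lam mu SD s r \<gamma> w VD X by (rule weighted_bep_modelI[OF sys])
    note V' = V[rule_format, OF stage_range]
    have a0: "0 \<le> a m (que m)" for m using a(1) que_range by blast
    have B0: "0 \<le> B" using B[rule_format, of 0] a0[of 0] V'[of 0] by linarith
    have drift: "(\<integral>\<^sup>+z. \<integral>\<^sup>+e. ennreal (deviation (Suc m) (a (Suc m)) (\<lambda>k. z k + e k) ^ 2) \<partial>W.switch_arrivals m \<partial>visit_kernel m x)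
        \<le> ennreal \<beta> * ennreal (deviation m (a m) x ^ 2) + ennreal (C * B)" for m x
    proof -
      have "(\<integral>\<^sup>+z. \<integral>\<^sup>+e. ennreal (deviation (Suc m) (a (Suc m)) (\<lambda>k. z k + e k) ^ 2) \<partial>W.switch_arrivals m \<partial>visit_kernel m x)
          \<le> ennreal \<beta> * ennreal (deviation m (a m) x ^ 2)
            + ennreal (C * (1 + a m (que m) + v (stage m) + (\<sigma> (stage m) - (v (stage m)) ^ 2)))"
        unfolding W.switch_arrivals_def
        by (rule dr[OF W.switch_law[OF stage_range]]) (use V'[of m] a(1) a0 in auto)
      also have "\<dots> \<le> ennreal \<beta> * ennreal (deviation m (a m) x ^ 2) + ennreal (C * B)"
        by (intro add_left_mono ennreal_leI mult_left_mono B[rule_format] \<beta>(3))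
      finally show ?thesis .
    qed
    have "(\<integral>\<^sup>+\<omega>. ennreal ((real (queue_length X \<omega> (epoch_state I p X \<omega> m) k) - a m k) ^ 2) \<partial>sample_space X)
        \<le> (\<integral>\<^sup>+\<omega>. ennreal (1 / \<omega>0 ^ 2) * ennreal (deviation m (a m) (W.Qv m \<omega>) ^ 2) \<partial>sample_space X)"
    proof (intro nn_integral_mono)
      fix \<omega>
      let ?y = "real (W.Qv m \<omega> k) - a m k"
      have "\<omega>0 * \<bar>?y\<bar> \<le> w m k * \<bar>?y\<bar>" using \<omega>0(2)[OF k] by (intro mult_right_mono) auto
      also have "\<dots> \<le> deviation m (a m) (W.Qv m \<omega>)" by (rule component_le_deviation[OF k])
      finally have "(\<omega>0 * \<bar>?y\<bar>) ^ 2 \<le> deviation m (a m) (W.Qv m \<omega>) ^ 2" using \<omega>0(1) by (intro power_mono) auto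
      then have "?y ^ 2 \<le> 1 / \<omega>0 ^ 2 * deviation m (a m) (W.Qv m \<omega>) ^ 2"
        using \<omega>0(1) by (simp add: power_mult_distrib field_simps)
      then have "ennreal (?y ^ 2) \<le> ennreal (1 / \<omega>0 ^ 2 * deviation m (a m) (W.Qv m \<omega>) ^ 2)" by (rule ennreal_leI)
      then show "ennreal ((real (queue_length X \<omega> (epoch_state I p X \<omega> m) k) - a m k) ^ 2)
          \<le> ennreal (1 / \<omega>0 ^ 2) * ennreal (deviation m (a m) (W.Qv m \<omega>) ^ 2)"
        unfolding W.queue_length_Qv[OF k] by (subst ennreal_mult'[symmetric]) auto
    qed
    also have "\<dots> = ennreal (1 / \<omega>0 ^ 2) * (\<integral>\<^sup>+\<omega>. ennreal (deviation m (a m) (W.Qv m \<omega>) ^ 2) \<partial>sample_space X)"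
      by (rule nn_integral_cmult, rule measurable_compose[OF W.measurable_Qv[of m]]) simp
    also have "\<dots> \<le> ennreal (1 / \<omega>0 ^ 2) * ennreal (R * (C * B))"
      unfolding R_def
    proof (intro mult_left_mono W.chain_bound[where F = "\<lambda>m x. deviation m (a m) x ^ 2"])
      show "(\<lambda>x. deviation I (a I) x ^ 2) = (\<lambda>x. deviation 0 (a 0) x ^ 2)"
        using w_periodic[of 0] a(2) by (simp add: deviation_def)
    qed (use drift \<beta> B0 in auto)
    also have "\<dots> = ennreal (1 / \<omega>0 ^ 2 * (R * C) * B)"
      by (subst ennreal_mult'[symmetric]) (auto simp: mult.assoc)
    finally show "(\<integral>\<^sup>+\<omega>. ennreal ((real (queue_length X \<omega> (epoch_state I p X \<omega> m) k) - a m k) ^ 2) \<partial>sample_space X)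
      \<le> ennreal (1 / \<omega>0 ^ 2 * (R * C) * B)" .
  qed (use R \<beta> in auto)
qed

text \<open>The stationary means, finite by the moment bound of order one, obey the same recursion
  as \<open>a\<close>. Their weighted distance to \<open>a\<close> shrinks by \<gamma> at every
  stage, yet stationarity restores it after a cycle, so it is 0. Thus the mean is exact and not only
  asymptotic.\<close>

lemma queue_mean:
  fixes X :: "'w polling_primitives" and a :: "nat \<Rightarrow> nat \<Rightarrow> real"
  assumes sys: "stationary_bep_system K I p lam SD r VD X"
    and v: "\<And>i. i \<in> {1..I} \<Longrightarrow> has_bochner_integral (VD i) (\<lambda>x. x) (v i)"
    and a: "\<And>m j. j \<in> {1..K} \<Longrightarrow> a (Suc m) j = visit_mean m (a m) j + lam j * v (stage m)" "a I = a 0"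
    and k: "k \<in> {1..K}"
  shows "has_bochner_integral (sample_space X) (\<lambda>\<omega>. real (queue_length X \<omega> (epoch_state I p X \<omega> m) k)) (a m k)"
proof -
  interpret W: weighted_bep_model K I p lam mu SD s r \<gamma> w VD X by (rule weighted_bep_modelI[OF sys])
  let ?M = "sample_space X"
  define Q where "Q = (\<lambda>m j \<omega>. real (W.Qv m \<omega> j))"
  have Qm [measurable]: "Q m j \<in> borel_measurable ?M" for m j
    unfolding Q_def by (rule measurable_compose[OF W.measurable_Qv[of m]]) simp
  have lam: "0 \<le> lam j" if "j \<in> {1..K}" for j using arrival_rate[OF that] by simp
  have v0: "0 \<le> v i" and vi: "(\<integral>\<^sup>+x. ennreal x \<partial>VD i) = ennreal (v i)" if i: "i \<in> {1..I}" for i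
  proof -
    have e: "(\<integral>x. x \<partial>VD i) = v i" and n: "integrable (VD i) (\<lambda>x. x)" using v[OF i] by (auto simp: has_bochner_integral_iff)
    show "0 \<le> v i" unfolding e[symmetric] by (rule integral_nonneg_AE[OF W.switch_law(3)[OF i]])
    show "(\<integral>\<^sup>+x. ennreal x \<partial>VD i) = ennreal (v i)"
      unfolding e[symmetric] by (rule nn_integral_eq_integral[OF n W.switch_law(3)[OF i]])
  qed
  have Qint: "integrable ?M (Q m j)" if j: "j \<in> {1..K}" for m j
  proof -
    have S: "integrable (SD k) (\<lambda>x. x ^ 1)" if "k \<in> {1..K}" for k using service_mean[OF that] by (simp add: has_bochner_integral_iff)
    define B where "B = (\<Sum>i\<in>{1..I}. v i)"
    have B: "0 \<le> B" unfolding B_def using v0 by (intro sum_nonneg)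
    obtain C where C: "\<And>VD (X :: 'w polling_primitives) B k. stationary_bep_system K I p lam SD r VD X \<Longrightarrow> 0 \<le> B \<Longrightarrow>
      (\<forall>i\<in>{1..I}. (\<integral>\<^sup>+x. ennreal (x ^ 1) \<partial>VD i) \<le> ennreal B) \<Longrightarrow> k \<in> {1..K} \<Longrightarrow>
      (\<integral>\<^sup>+\<omega>. ennreal (real (queue_length X \<omega> (epoch_state I p X \<omega> m) k) ^ 1) \<partial>sample_space X) \<le> ennreal (C * (1 + B))"
      using queue_moment_bound[OF S order_refl, where m = m] by blast
    have "(\<integral>\<^sup>+x. ennreal (x ^ 1) \<partial>VD i) \<le> ennreal B" if "i \<in> {1..I}" for i
      unfolding power_one_right vi[OF that] B_def using v0 that by (intro ennreal_leI member_le_sum) auto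
    then have "(\<integral>\<^sup>+\<omega>. ennreal (real (queue_length X \<omega> (epoch_state I p X \<omega> m) j) ^ 1) \<partial>?M) \<le> ennreal (C * (1 + B))"
      by (intro C[OF sys B] ballI j)
    then have "(\<integral>\<^sup>+\<omega>. ennreal (Q m j \<omega>) \<partial>?M) < \<top>"
      unfolding W.queue_length_Qv[OF j] power_one_right Q_def by (rule order.strict_trans1) simp
    then show ?thesis using Qm[of m j] by (intro integrableI_nonneg) (auto simp: Q_def)
  qed
  define E where "E = (\<lambda>m j. \<integral>\<omega>. Q m j \<omega> \<partial>?M)"
  have step: "E (Suc m) j = visit_mean m (E m) j + lam j * v (stage m)" if j: "j \<in> {1..K}" for m j
  proof -
    let ?c = "lam j * v (stage m)" and ?g = "\<lambda>\<omega>. visit_mean m (\<lambda>j. Q m j \<omega>) j"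
    have c: "0 \<le> ?c" using lam[OF j] v0[OF stage_range] by simp
    have g0: "0 \<le> ?g \<omega>" for \<omega> using j by (intro visit_mean_nonneg) (auto simp: Q_def)
    have arr: "(\<integral>\<^sup>+e. ennreal (real (e j)) \<partial>W.switch_arrivals m) = ennreal ?c"
    proof -
      have "(\<integral>\<^sup>+e. of_nat (e j) \<partial>W.switch_arrivals m) = ennreal (lam j) * (\<integral>\<^sup>+s. ennreal s \<partial>VD (stage m))"
        unfolding W.switch_arrivals_def
        by (rule arrival_law_mean) (use W.switch_law[OF stage_range] j lam in auto)
      then show ?thesis unfolding vi[OF stage_range] ennreal_mult'[OF lam[OF j]] ennreal_of_nat_eq_real_of_nat .
    qed
    have "(\<integral>\<^sup>+\<omega>. ennreal (Q (Suc m) j \<omega>) \<partial>?M)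
        = (\<integral>\<^sup>+\<omega>. \<integral>\<^sup>+z. \<integral>\<^sup>+e. ennreal (real (z j + e j)) \<partial>W.switch_arrivals m \<partial>visit_kernel m (W.Qv m \<omega>) \<partial>?M)"
      unfolding Q_def by (rule W.nn_integral_step)
    also have "\<dots> = (\<integral>\<^sup>+\<omega>. ennreal (?g \<omega> + ?c) \<partial>?M)"
    proof (rule nn_integral_cong)
      fix \<omega>
      have "(\<integral>\<^sup>+z. \<integral>\<^sup>+e. ennreal (real (z j + e j)) \<partial>W.switch_arrivals m \<partial>visit_kernel m (W.Qv m \<omega>))
          = (\<integral>\<^sup>+z. ennreal (real (z j)) \<partial>visit_kernel m (W.Qv m \<omega>)) + (\<integral>\<^sup>+e. ennreal (real (e j)) \<partial>W.switch_arrivals m)"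
        by (simp add: nn_integral_add emeasure_pmf)
      also have "\<dots> = ennreal (?g \<omega> + ?c)"
        unfolding arr visit_kernel_mean[OF j] using ennreal_plus[OF g0[of \<omega>] c, symmetric] unfolding Q_def .
      finally show "(\<integral>\<^sup>+z. \<integral>\<^sup>+e. ennreal (real (z j + e j)) \<partial>W.switch_arrivals m \<partial>visit_kernel m (W.Qv m \<omega>)) = ennreal (?g \<omega> + ?c)" .
    qed
    finally have nn: "(\<integral>\<^sup>+\<omega>. ennreal (Q (Suc m) j \<omega>) \<partial>?M) = (\<integral>\<^sup>+\<omega>. ennreal (?g \<omega> + ?c) \<partial>?M)" .
    have gm [measurable]: "?g \<in> borel_measurable ?M" unfolding visit_mean_def by measurable
    have "E (Suc m) j = enn2real (\<integral>\<^sup>+\<omega>. ennreal (Q (Suc m) j \<omega>) \<partial>?M)"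
      unfolding E_def by (rule integral_eq_nn_integral[OF Qm]) (simp add: Q_def)
    also have "\<dots> = (\<integral>\<omega>. ?g \<omega> + ?c \<partial>?M)"
      unfolding nn using g0 c by (intro integral_eq_nn_integral[symmetric]) (auto intro!: AE_I2 add_nonneg_nonneg)
    also have "\<dots> = visit_mean m (E m) j + ?c"
      using Qint[OF j, of m] Qint[OF que_range[of m], of m]
      by (simp add: visit_mean_def E_def W.P.prob_space)
    finally show ?thesis .
  qed
  define e where "e = (\<lambda>m. \<Sum>j\<in>{1..K}. w m j * \<bar>E m j - a m j\<bar>)"
  have e0: "0 \<le> e m" for m unfolding e_def using w_pos[THEN less_imp_le] by (intro sum_nonneg) auto
  have contr: "e (Suc m) \<le> \<gamma> * e m" for m
  proof -
    have "e (Suc m) = (\<Sum>j\<in>{1..K}. w (Suc m) j * \<bar>visit_mean m (\<lambda>j. E m j - a m j) j\<bar>)"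
      unfolding e_def by (intro sum.cong refl) (simp add: step a(1) visit_mean_diff[symmetric])
    also have "\<dots> \<le> \<gamma> * e m" unfolding e_def by (rule weight_contraction)
    finally show ?thesis .
  qed
  have pow: "e m \<le> \<gamma> ^ m * e 0" for m
  proof (induction m)
    case (Suc m)
    have "e (Suc m) \<le> \<gamma> * (\<gamma> ^ m * e 0)" using contr[of m] mult_left_mono[OF Suc, of \<gamma>] \<gamma> by linarith
    then show ?case by (simp add: mult.assoc)
  qed simp
  have "E I j = E 0 j" for j
  proof -
    have E: "E m j = enn2real (\<integral>\<^sup>+\<omega>. ennreal (real (W.Qv m \<omega> j)) \<partial>?M)" for m
      unfolding E_def Q_def by (rule integral_eq_nn_integral) (use Qm[of m j] in \<open>auto simp: Q_def\<close>)
    show ?thesis unfolding E using W.stationary_Qv[of "\<lambda>x. ennreal (real (x j))"] by simp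
  qed
  then have "e I = e 0" using w_periodic[of 0] a(2) by (simp add: e_def)
  then have "e 0 * (1 - \<gamma> ^ I) \<le> 0" using pow[of I] by (simp add: algebra_simps)
  moreover have "0 < 1 - \<gamma> ^ I" using \<gamma> I_pos by (simp add: power_less_one_iff)
  ultimately have "e 0 \<le> 0" by (simp add: mult_le_0_iff)
  then have "e m = 0" using pow[of m] e0[of m] e0[of 0] by auto
  then have "w m k * \<bar>E m k - a m k\<bar> = 0"
    unfolding e_def using w_pos[THEN less_imp_le] k by (subst (asm) sum_nonneg_eq_0_iff) auto
  then have "E m k = a m k" using w_pos[OF k, of m] by simp
  then show ?thesis
    unfolding W.queue_length_Qv[OF k] using Qint[OF k, of m] by (simp add: has_bochner_integral_iff E_def Q_def)
qed

end

subsection \<open>Convergence of moments\<close>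

lemma integrable_square_bound:
  fixes f :: "'w \<Rightarrow> real"
  assumes [measurable]: "f \<in> borel_measurable M" and b: "(\<integral>\<^sup>+\<omega>. ennreal ((f \<omega>) ^ 2) \<partial>M) \<le> ennreal b" "0 \<le> b"
  shows "integrable M (\<lambda>\<omega>. (f \<omega>) ^ 2)" "(\<integral>\<omega>. (f \<omega>) ^ 2 \<partial>M) \<le> b"
proof -
  show int: "integrable M (\<lambda>\<omega>. (f \<omega>) ^ 2)"
    using le_less_trans[OF b(1) ennreal_less_top] by (intro integrableI_nonneg) auto
  have "(\<integral>\<^sup>+\<omega>. ennreal ((f \<omega>) ^ 2) \<partial>M) = ennreal (\<integral>\<omega>. (f \<omega>) ^ 2 \<partial>M)"
    by (rule nn_integral_eq_integral[OF int]) simp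
  from b(1)[unfolded this] show "(\<integral>\<omega>. (f \<omega>) ^ 2 \<partial>M) \<le> b" unfolding ennreal_le_iff[OF b(2)] .
qed

text \<open>The means are exact, so the difference between E[f g] and x y is the mean of the product
  of the two deviations, and this is dominated by the sum of their squares.\<close>

lemma tendsto_integral_product:
  fixes f g :: "nat \<Rightarrow> 'w \<Rightarrow> real"
  assumes P: "\<And>n. 1 \<le> n \<Longrightarrow> prob_space (M n)"
    and f: "\<And>n. 1 \<le> n \<Longrightarrow> has_bochner_integral (M n) (f n) x"
    and g: "\<And>n. 1 \<le> n \<Longrightarrow> has_bochner_integral (M n) (g n) y"
    and f2: "\<And>n. 1 \<le> n \<Longrightarrow> (\<integral>\<^sup>+\<omega>. ennreal ((f n \<omega> - x) ^ 2) \<partial>M n) \<le> ennreal (b n)"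
    and g2: "\<And>n. 1 \<le> n \<Longrightarrow> (\<integral>\<^sup>+\<omega>. ennreal ((g n \<omega> - y) ^ 2) \<partial>M n) \<le> ennreal (b n)"
    and b: "\<And>n. 1 \<le> n \<Longrightarrow> 0 \<le> b n" "b \<longlonglongrightarrow> 0"
  shows "\<And>n. 1 \<le> n \<Longrightarrow> integrable (M n) (\<lambda>\<omega>. f n \<omega> * g n \<omega>)"
    and "(\<lambda>n. \<integral>\<omega>. f n \<omega> * g n \<omega> \<partial>M n) \<longlonglongrightarrow> x * y"
proof -
  have *: "integrable (M n) (\<lambda>\<omega>. f n \<omega> * g n \<omega>) \<and> \<bar>(\<integral>\<omega>. f n \<omega> * g n \<omega> \<partial>M n) - x * y\<bar> \<le> 2 * b n" if n: "1 \<le> n" for n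
  proof -
    interpret prob_space "M n" by (rule P[OF n])
    have fi: "integrable (M n) (f n)" "(\<integral>\<omega>. f n \<omega> \<partial>M n) = x" and gi: "integrable (M n) (g n)" "(\<integral>\<omega>. g n \<omega> \<partial>M n) = y"
      using f[OF n] g[OF n] by (auto simp: has_bochner_integral_iff)
    note [measurable] = borel_measurable_integrable[OF fi(1)] borel_measurable_integrable[OF gi(1)]
    have sf: "integrable (M n) (\<lambda>\<omega>. (f n \<omega> - x) ^ 2)" "(\<integral>\<omega>. (f n \<omega> - x) ^ 2 \<partial>M n) \<le> b n"
      by (rule integrable_square_bound[OF _ f2[OF n] b(1)[OF n]], measurable)+
    have sg: "integrable (M n) (\<lambda>\<omega>. (g n \<omega> - y) ^ 2)" "(\<integral>\<omega>. (g n \<omega> - y) ^ 2 \<partial>M n) \<le> b n"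
      by (rule integrable_square_bound[OF _ g2[OF n] b(1)[OF n]], measurable)+
    let ?h = "\<lambda>\<omega>. (f n \<omega> - x) * (g n \<omega> - y)"
    have le: "\<bar>?h \<omega>\<bar> \<le> (f n \<omega> - x) ^ 2 + (g n \<omega> - y) ^ 2" for \<omega>
    proof -
      have "0 \<le> (\<bar>f n \<omega> - x\<bar> - \<bar>g n \<omega> - y\<bar>) ^ 2" by simp
      then have "2 * \<bar>?h \<omega>\<bar> \<le> (f n \<omega> - x) ^ 2 + (g n \<omega> - y) ^ 2" by (simp add: power2_diff abs_mult)
      then show ?thesis by (smt (verit) abs_ge_zero)
    qed
    have hi: "integrable (M n) ?h"
      by (rule Bochner_Integration.integrable_bound[OF Bochner_Integration.integrable_add[OF sf(1) sg(1)]]) (use le in \<open>auto intro!: AE_I2\<close>)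
    have eq: "f n \<omega> * g n \<omega> = ?h \<omega> + (x * g n \<omega> + y * f n \<omega> - x * y)" for \<omega> by (simp add: algebra_simps)
    have i: "integrable (M n) (\<lambda>\<omega>. f n \<omega> * g n \<omega>)"
      unfolding eq using hi fi gi by (intro Bochner_Integration.integrable_add Bochner_Integration.integrable_diff) auto
    have "(\<integral>\<omega>. f n \<omega> * g n \<omega> \<partial>M n) = (\<integral>\<omega>. ?h \<omega> \<partial>M n) + (\<integral>\<omega>. x * g n \<omega> + y * f n \<omega> - x * y \<partial>M n)"
      unfolding eq using hi fi gi by (intro Bochner_Integration.integral_add) auto
    also have "(\<integral>\<omega>. x * g n \<omega> + y * f n \<omega> - x * y \<partial>M n) = x * y" using fi gi by (simp add: prob_space mult.commute)
    finally have "(\<integral>\<omega>. f n \<omega> * g n \<omega> \<partial>M n) - x * y = (\<integral>\<omega>. ?h \<omega> \<partial>M n)" by simp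
    moreover have "\<bar>\<integral>\<omega>. ?h \<omega> \<partial>M n\<bar> \<le> (\<integral>\<omega>. (f n \<omega> - x) ^ 2 + (g n \<omega> - y) ^ 2 \<partial>M n)"
      by (rule order_trans[OF integral_abs_bound], rule integral_mono) (use hi sf sg le in auto)
    moreover have "\<dots> = (\<integral>\<omega>. (f n \<omega> - x) ^ 2 \<partial>M n) + (\<integral>\<omega>. (g n \<omega> - y) ^ 2 \<partial>M n)"
      by (rule Bochner_Integration.integral_add[OF sf(1) sg(1)])
    ultimately show ?thesis using i sf(2) sg(2) by linarith
  qed
  then show "\<And>n. 1 \<le> n \<Longrightarrow> integrable (M n) (\<lambda>\<omega>. f n \<omega> * g n \<omega>)" by blast
  have "(\<lambda>n. (\<integral>\<omega>. f n \<omega> * g n \<omega> \<partial>M n) - x * y) \<longlonglongrightarrow> 0"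
  proof (rule Lim_null_comparison)
    show "\<forall>\<^sub>F n in sequentially. norm ((\<integral>\<omega>. f n \<omega> * g n \<omega> \<partial>M n) - x * y) \<le> 2 * b n"
      using * by (intro eventually_sequentiallyI[of 1]) auto
    show "(\<lambda>n. 2 * b n) \<longlonglongrightarrow> 0" using tendsto_mult_right_zero[OF b(2), of 2] by simp
  qed
  then show "(\<lambda>n. \<integral>\<omega>. f n \<omega> * g n \<omega> \<partial>M n) \<longlonglongrightarrow> x * y" by (rule LIM_zero_cancel)
qed

lemma power_diff_bound:
  fixes u x :: real
  assumes "0 \<le> u" "0 \<le> x"
  shows "\<bar>u ^ Suc k - x ^ Suc k\<bar> \<le> real (Suc k) * (\<bar>u - x\<bar> * (u + x) ^ k)"
proof (induction k)
  case (Suc k)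
  have "u ^ Suc (Suc k) - x ^ Suc (Suc k) = u * (u ^ Suc k - x ^ Suc k) + (u - x) * x ^ Suc k" by (simp add: algebra_simps)
  then have "\<bar>u ^ Suc (Suc k) - x ^ Suc (Suc k)\<bar> \<le> \<bar>u * (u ^ Suc k - x ^ Suc k)\<bar> + \<bar>(u - x) * x ^ Suc k\<bar>" by simp
  also have "\<bar>u * (u ^ Suc k - x ^ Suc k)\<bar> = u * \<bar>u ^ Suc k - x ^ Suc k\<bar>" using assms by (simp add: abs_mult)
  also have "\<bar>(u - x) * x ^ Suc k\<bar> = \<bar>u - x\<bar> * x ^ Suc k" using assms by (simp add: abs_mult)
  finally have 1: "\<bar>u ^ Suc (Suc k) - x ^ Suc (Suc k)\<bar> \<le> u * \<bar>u ^ Suc k - x ^ Suc k\<bar> + \<bar>u - x\<bar> * x ^ Suc k" .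
  have "u * \<bar>u ^ Suc k - x ^ Suc k\<bar> \<le> (u + x) * (real (Suc k) * (\<bar>u - x\<bar> * (u + x) ^ k))"
    using assms by (intro mult_mono Suc) auto
  also have "\<dots> = real (Suc k) * (\<bar>u - x\<bar> * (u + x) ^ Suc k)" by simp
  finally have 2: "u * \<bar>u ^ Suc k - x ^ Suc k\<bar> \<le> real (Suc k) * (\<bar>u - x\<bar> * (u + x) ^ Suc k)" .
  have 3: "\<bar>u - x\<bar> * x ^ Suc k \<le> \<bar>u - x\<bar> * (u + x) ^ Suc k" using assms by (intro mult_left_mono power_mono) auto
  have "real (Suc (Suc k)) * c = real (Suc k) * c + c" for c by (simp add: algebra_simps)
  then show ?case using 1 2 3 by (simp only:)
qed simp

text \<open>The difference of powers is bounded by the deviation times a power of degree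
  \<open>k\<close>. Its mean is small because the deviation is small in L2 while the powers stay
  bounded in L2.\<close>

lemma tendsto_integral_power:
  fixes f :: "nat \<Rightarrow> 'w \<Rightarrow> real"
  assumes P: "\<And>n. 1 \<le> n \<Longrightarrow> prob_space (M n)"
    and f [measurable]: "\<And>n. 1 \<le> n \<Longrightarrow> f n \<in> borel_measurable (M n)" and f0: "\<And>n \<omega>. 0 \<le> f n \<omega>" and x: "0 \<le> x"
    and f2: "\<And>n. 1 \<le> n \<Longrightarrow> (\<integral>\<^sup>+\<omega>. ennreal ((f n \<omega> - x) ^ 2) \<partial>M n) \<le> ennreal (b n)"
    and b: "\<And>n. 1 \<le> n \<Longrightarrow> 0 < b n" "b \<longlonglongrightarrow> 0"
    and l: "\<And>n. 1 \<le> n \<Longrightarrow> integrable (M n) (\<lambda>\<omega>. f n \<omega> ^ Suc k)"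
    and B: "0 \<le> B" "\<And>n. 1 \<le> n \<Longrightarrow> (\<integral>\<^sup>+\<omega>. ennreal ((f n \<omega> ^ k) ^ 2) \<partial>M n) \<le> ennreal B"
  shows "(\<lambda>n. \<integral>\<omega>. f n \<omega> ^ Suc k \<partial>M n) \<longlonglongrightarrow> x ^ Suc k"
proof -
  define D where "D = 1 + 2 ^ (2 * k) * (B + x ^ (2 * k))"
  have *: "\<bar>(\<integral>\<omega>. f n \<omega> ^ Suc k \<partial>M n) - x ^ Suc k\<bar> \<le> real (Suc k) * (sqrt (b n) * D)" if n: "1 \<le> n" for n
  proof -
    interpret prob_space "M n" by (rule P[OF n])
    note [measurable] = f[OF n]
    note bn = b(1)[OF n]
    have sf: "integrable (M n) (\<lambda>\<omega>. (f n \<omega> - x) ^ 2)" "(\<integral>\<omega>. (f n \<omega> - x) ^ 2 \<partial>M n) \<le> b n"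
      by (rule integrable_square_bound[OF _ f2[OF n] less_imp_le[OF bn]], measurable)+
    have sB: "integrable (M n) (\<lambda>\<omega>. (f n \<omega> ^ k) ^ 2)" "(\<integral>\<omega>. (f n \<omega> ^ k) ^ 2 \<partial>M n) \<le> B"
      by (rule integrable_square_bound[OF _ B(2)[OF n] B(1)], measurable)+
    \<comment> \<open>In place of the Cauchy-Schwarz inequality a weighted sum of squares is used.
      The weight \<open>sqrt (b n)\<close> makes both parts of order \<open>sqrt (b n)\<close>;
      \<open>b n\<close> must be positive because of the division.\<close>
    let ?t = "sqrt (b n)"
    have t: "0 < ?t" "?t * ?t = b n" using bn by auto
    let ?G = "\<lambda>\<omega>. real (Suc k) * ((f n \<omega> - x) ^ 2 / ?t + ?t * (2 ^ (2 * k) * ((f n \<omega> ^ k) ^ 2 + x ^ (2 * k))))"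
    have le: "\<bar>f n \<omega> ^ Suc k - x ^ Suc k\<bar> \<le> ?G \<omega>" for \<omega>
    proof -
      let ?u = "\<bar>f n \<omega> - x\<bar>" and ?y = "(f n \<omega> + x) ^ k"
      have y: "0 \<le> ?y" using f0 x by simp
      have "0 \<le> (?u - ?t * ?y) ^ 2" by simp
      then have "2 * (?t * (?u * ?y)) \<le> ?u ^ 2 + ?t ^ 2 * ?y ^ 2" by (simp add: power2_diff power_mult_distrib mult_ac)
      moreover have "0 \<le> ?t * (?u * ?y)" using y t(1) by simp
      ultimately have "?t * (?u * ?y) \<le> ?u ^ 2 + ?t ^ 2 * ?y ^ 2" by linarith
      then have "?u * ?y \<le> (?u ^ 2 + ?t ^ 2 * ?y ^ 2) / ?t" using t(1) by (simp add: pos_le_divide_eq mult.commute)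
      also have "\<dots> = ?u ^ 2 / ?t + ?t * ?y ^ 2"
      proof -
        have "c ^ 2 * d / c = c * d" if "0 < c" for c d :: real using that by (simp add: power2_eq_square)
        from this[OF t(1)] show ?thesis by (simp only: add_divide_distrib)
      qed
      also have "?y ^ 2 = (f n \<omega> + x) ^ (2 * k)" by (simp add: power_mult[symmetric] mult.commute)
      also have "?t * (f n \<omega> + x) ^ (2 * k) \<le> ?t * (2 ^ (2 * k) * (f n \<omega> ^ (2 * k) + x ^ (2 * k)))"
        using t(1) f0 x by (intro mult_left_mono power_add_le) auto
      finally have "?u * ?y \<le> (f n \<omega> - x) ^ 2 / ?t + ?t * (2 ^ (2 * k) * ((f n \<omega> ^ k) ^ 2 + x ^ (2 * k)))"
        by (simp add: power_mult[symmetric] mult.commute)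
      then have "real (Suc k) * (?u * ?y) \<le> ?G \<omega>" by (rule mult_left_mono) simp
      with power_diff_bound[OF f0 x, of n \<omega> k] show ?thesis by (rule order_trans)
    qed
    have Gi: "integrable (M n) ?G" using sf sB by (intro integrable_mult_right Bochner_Integration.integrable_add) auto
    have "(\<integral>\<omega>. f n \<omega> ^ Suc k \<partial>M n) - x ^ Suc k = (\<integral>\<omega>. f n \<omega> ^ Suc k - x ^ Suc k \<partial>M n)"
    proof -
      have "(\<integral>\<omega>. x ^ Suc k \<partial>M n) = x ^ Suc k" by (simp add: prob_space del: power_Suc)
      then show ?thesis
        using Bochner_Integration.integral_diff[OF l[OF n] integrable_const[of "x ^ Suc k"]] by linarith
    qed
    also have "\<bar>\<dots>\<bar> \<le> (\<integral>\<omega>. ?G \<omega> \<partial>M n)"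
      by (rule order_trans[OF integral_abs_bound], rule integral_mono[OF _ Gi le])
        (use l[OF n] in \<open>simp del: power_Suc\<close>)
    also have "\<dots> = real (Suc k) * ((\<integral>\<omega>. (f n \<omega> - x) ^ 2 \<partial>M n) / ?t + ?t * (2 ^ (2 * k) * ((\<integral>\<omega>. (f n \<omega> ^ k) ^ 2 \<partial>M n) + x ^ (2 * k))))"
      using sf(1) sB(1) by (simp add: prob_space)
    also have "\<dots> \<le> real (Suc k) * (b n / ?t + ?t * (2 ^ (2 * k) * (B + x ^ (2 * k))))"
      using sf(2) sB(2) t(1) by (intro mult_left_mono add_mono divide_right_mono) auto
    also have "b n / ?t = ?t" using t by (simp add: real_div_sqrt less_imp_le[OF bn])
    finally show ?thesis by (simp add: D_def distrib_left)
  qed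
  have "(\<lambda>n. (\<integral>\<omega>. f n \<omega> ^ Suc k \<partial>M n) - x ^ Suc k) \<longlonglongrightarrow> 0"
  proof (rule Lim_null_comparison)
    show "\<forall>\<^sub>F n in sequentially. norm ((\<integral>\<omega>. f n \<omega> ^ Suc k \<partial>M n) - x ^ Suc k) \<le> real (Suc k) * (sqrt (b n) * D)"
      using * by (intro eventually_sequentiallyI[of 1]) (auto simp del: power_Suc)
    have "(\<lambda>n. real (Suc k) * (sqrt (b n) * D)) \<longlonglongrightarrow> real (Suc k) * (sqrt 0 * D)" by (intro tendsto_intros b)
    then show "(\<lambda>n. real (Suc k) * (sqrt (b n) * D)) \<longlonglongrightarrow> 0" by simp
  qed
  then show ?thesis by (rule LIM_zero_cancel)
qed

text \<open>Since $\int f (f - s)^2 \ge 0$, the third moment controls the second from above.\<close>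

lemma tendsto_second_moment:
  fixes f :: "nat \<Rightarrow> 'w \<Rightarrow> real"
  assumes P: "\<And>n. 1 \<le> n \<Longrightarrow> prob_space (M n)" and f0: "\<And>n. 1 \<le> n \<Longrightarrow> AE x in M n. 0 \<le> f n x"
    and f: "\<And>n. 1 \<le> n \<Longrightarrow> has_bochner_integral (M n) (f n) s"
    and f2: "\<And>n. 1 \<le> n \<Longrightarrow> integrable (M n) (\<lambda>x. f n x ^ 2)" and f3: "\<And>n. 1 \<le> n \<Longrightarrow> integrable (M n) (\<lambda>x. f n x ^ 3)"
    and lim: "(\<lambda>n. \<integral>x. f n x ^ 3 \<partial>M n) \<longlonglongrightarrow> s ^ 3" and s: "0 \<le> s"
  shows "(\<lambda>n. \<integral>x. f n x ^ 2 \<partial>M n) \<longlonglongrightarrow> s ^ 2"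
proof (cases "s = 0")
  \<comment> \<open>Division by \<open>s\<close> is impossible here, but a nonnegative variable of
    mean 0 vanishes almost everywhere.\<close>
  case True
  have "(\<integral>x. f n x ^ 2 \<partial>M n) = s ^ 2" if n: "1 \<le> n" for n
  proof -
    have "integrable (M n) (f n)" "(\<integral>x. f n x \<partial>M n) = 0" using f[OF n] True by (auto simp: has_bochner_integral_iff)
    then have "AE x in M n. f n x = 0" using integral_nonneg_eq_0_iff_AE[OF _ f0[OF n]] by blast
    then have "(\<integral>x. f n x ^ 2 \<partial>M n) = (\<integral>x. 0 \<partial>M n)" using f2[OF n] by (intro integral_cong_AE) auto
    then show ?thesis using True by simp
  qed
  then show ?thesis by (intro tendsto_eventually eventually_sequentiallyI[of 1])
next
  case False
  then have s: "0 < s" using s by simp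
  have *: "s ^ 2 \<le> (\<integral>x. f n x ^ 2 \<partial>M n)" "(\<integral>x. f n x ^ 2 \<partial>M n) \<le> ((\<integral>x. f n x ^ 3 \<partial>M n) + s ^ 3) / (2 * s)" if n: "1 \<le> n" for n
  proof -
    interpret prob_space "M n" by (rule P[OF n])
    have fi: "integrable (M n) (f n)" "(\<integral>x. f n x \<partial>M n) = s" using f[OF n] by (auto simp: has_bochner_integral_iff)
    show "s ^ 2 \<le> (\<integral>x. f n x ^ 2 \<partial>M n)"
      using variance_eq[OF fi(1) f2[OF n]] variance_positive[of "f n"] fi(2) by simp
    have "0 \<le> (\<integral>x. f n x ^ 3 - 2 * s * f n x ^ 2 + s ^ 2 * f n x \<partial>M n)"
    proof (rule integral_nonneg_AE, use f0[OF n] in eventually_elim)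
      fix y assume y: "0 \<le> f n y"
      have "f n y ^ 3 - 2 * s * f n y ^ 2 + s ^ 2 * f n y = f n y * (f n y - s) ^ 2"
        by (simp add: power2_eq_square power3_eq_cube algebra_simps)
      then show "0 \<le> f n y ^ 3 - 2 * s * f n y ^ 2 + s ^ 2 * f n y" using y by simp
    qed
    also have "\<dots> = (\<integral>x. f n x ^ 3 \<partial>M n) - 2 * s * (\<integral>x. f n x ^ 2 \<partial>M n) + s ^ 2 * s"
      using fi f2[OF n] f3[OF n] by simp
    finally show "(\<integral>x. f n x ^ 2 \<partial>M n) \<le> ((\<integral>x. f n x ^ 3 \<partial>M n) + s ^ 3) / (2 * s)"
      using s by (simp add: pos_le_divide_eq power3_eq_cube power2_eq_square algebra_simps)
  qed
  show ?thesis
  proof (rule tendsto_sandwich[of "\<lambda>_. s ^ 2" _ _ "\<lambda>n. ((\<integral>x. f n x ^ 3 \<partial>M n) + s ^ 3) / (2 * s)"])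
    have "(\<lambda>n. ((\<integral>x. f n x ^ 3 \<partial>M n) + s ^ 3) / (2 * s)) \<longlonglongrightarrow> (s ^ 3 + s ^ 3) / (2 * s)" using s by (intro tendsto_intros lim) auto
    moreover have "(s ^ 3 + s ^ 3) / (2 * s) = s ^ 2" using s by (simp add: power2_eq_square power3_eq_cube)
    ultimately show "(\<lambda>n. ((\<integral>x. f n x ^ 3 \<partial>M n) + s ^ 3) / (2 * s)) \<longlonglongrightarrow> s ^ 2" by simp
  qed (use * in \<open>auto intro!: eventually_sequentiallyI[of 1]\<close>)
qed

lemma power_le_exp:
  fixes x t :: real
  assumes "0 \<le> x" "0 < t"
  shows "x ^ l \<le> fact l / t ^ l * exp (t * x)"
proof -
  have "(\<Sum>n\<in>{l}. (t * x) ^ n /\<^sub>R fact n) \<le> (\<Sum>n. (t * x) ^ n /\<^sub>R fact n)"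
    using assms by (intro sum_le_suminf summable_exp_generic) auto
  then have "(t * x) ^ l / fact l \<le> exp (t * x)" by (simp add: exp_def divide_inverse mult.commute)
  then show ?thesis using assms(2) by (simp add: power_mult_distrib field_simps)
qed

lemma integrable_power_of_exp:
  fixes M :: "real measure"
  assumes "sets M = sets borel" "AE x in M. 0 \<le> x" "0 < t" "integrable M (\<lambda>x. exp (t * x))"
  shows "integrable M (\<lambda>x. x ^ l)"
proof (rule Bochner_Integration.integrable_bound)
  show "integrable M (\<lambda>x. fact l / t ^ l * exp (t * x))" using assms(4) by (rule integrable_mult_right)
  show "(\<lambda>x. x ^ l) \<in> borel_measurable M" by (rule borel_measurable_power[OF measurable_ident_sets[OF assms(1)]])
  show "AE x in M. norm (x ^ l) \<le> norm (fact l / t ^ l * exp (t * x))"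
    using assms(2)
  proof eventually_elim
    case (elim x)
    have "norm (x ^ l) = x ^ l" using elim by simp
    also have "\<dots> \<le> fact l / t ^ l * exp (t * x)" by (rule power_le_exp[OF elim assms(3)])
    also have "\<dots> = norm (fact l / t ^ l * exp (t * x))" using assms(3) by simp
    finally show ?case .
  qed
qed

lemma (in polling_model) weighted_model_exists:
  obtains \<gamma> w where "weighted_polling_model K I p lam mu SD s r \<gamma> w"
proof (rule weights_exist)
  fix \<gamma> :: real and w :: "nat \<Rightarrow> nat \<Rightarrow> real"
  assume A: "0 < \<gamma>" "\<gamma> < 1"
    "\<And>m j. j \<in> {1..K} \<Longrightarrow> 0 < w m j"
    "\<And>m j. w (m + I) j = w m j"
    "\<And>m j. j \<in> {1..K} \<Longrightarrow> j \<noteq> que m \<Longrightarrow> w (Suc m) j \<le> \<gamma> * w m j"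
    "\<And>m. (1 - r (stage m)) * w (Suc m) (que m)
      + r (stage m) * (\<Sum>j\<in>{1..K} - {que m}. w (Suc m) j * gain (que m) j) \<le> \<gamma> * w m (que m)"
  show thesis
    by (rule that[of \<gamma> w], intro weighted_polling_model.intro weighted_polling_model_axioms.intro polling_model_axioms)
      (fact A)+
qed

theorem theorem6p1:
  fixes K I :: nat
    and p :: "nat \<Rightarrow> nat"
    and lam mu :: "nat \<Rightarrow> real"
    and SD :: "nat \<Rightarrow> real measure"
    and s r :: "nat \<Rightarrow> real"
    and VD :: "nat \<Rightarrow> nat \<Rightarrow> real measure"
    and X :: "nat \<Rightarrow> 'w polling_primitives"
    and q :: "nat \<Rightarrow> nat \<Rightarrow> real"
  assumes model: "polling_model K I p lam mu SD s r"
    and systems: "\<And>n. 1 \<le> n \<Longrightarrow> stationary_bep_system K I p lam SD r (VD n) (X n)"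
    and V_weak: "\<And>i. i \<in> {1..I} \<Longrightarrow>
      weak_conv_m (\<lambda>n. distr (VD n i) borel (\<lambda>x. x / real n)) (return borel (s i))"
    and V_mean: "\<And>n i. 1 \<le> n \<Longrightarrow> i \<in> {1..I} \<Longrightarrow>
      has_bochner_integral (VD n i) (\<lambda>x. x) (real n * s i)"
    and q: "polling_equations K I p lam mu s r q"
  shows
    "(\<forall>n\<ge>1. \<forall>c. \<forall>k\<in>{1..K}. \<forall>i\<in>{1..I}.
        has_bochner_integral (sample_space (X n))
          (\<lambda>\<omega>. real (queue_at_epoch I p (X n) c i k \<omega>) / real n) (q k i))
    \<and> ((\<forall>k\<in>{1..K}. integrable (SD k) (\<lambda>x. x ^ 2)) \<longrightarrow>
       (\<forall>n\<ge>1. \<forall>i\<in>{1..I}. integrable (VD n i) (\<lambda>x. x ^ 2)) \<longrightarrow>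
       (\<forall>i\<in>{1..I}. (\<lambda>n. \<integral>x. (x / real n) ^ 2 \<partial>VD n i) \<longlonglongrightarrow> (s i) ^ 2) \<longrightarrow>
       (\<forall>c. \<forall>k\<in>{1..K}. \<forall>j\<in>{1..K}. \<forall>i\<in>{1..I}.
          (\<forall>n\<ge>1. integrable (sample_space (X n))
             (\<lambda>\<omega>. real (queue_at_epoch I p (X n) c i k \<omega>) * real (queue_at_epoch I p (X n) c i j \<omega>))) \<and>
          (\<lambda>n. \<integral>\<omega>. (real (queue_at_epoch I p (X n) c i k \<omega>) / real n)
                     * (real (queue_at_epoch I p (X n) c i j \<omega>) / real n) \<partial>sample_space (X n))
            \<longlonglongrightarrow> q k i * q j i))
    \<and> ((\<forall>k\<in>{1..K}. \<exists>\<epsilon>>0. \<forall>t\<in>{-\<epsilon><..<\<epsilon>}. integrable (SD k) (\<lambda>x. exp (t * x))) \<longrightarrow>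
       (\<forall>n\<ge>1. \<forall>i\<in>{1..I}. \<forall>t\<ge>0. integrable (VD n i) (\<lambda>x. exp (t * x))) \<longrightarrow>
       (\<forall>l\<ge>3. \<forall>i\<in>{1..I}. (\<lambda>n. \<integral>x. (x / real n) ^ l \<partial>VD n i) \<longlonglongrightarrow> (s i) ^ l) \<longrightarrow>
       (\<forall>c. \<forall>l\<ge>3. \<forall>k\<in>{1..K}. \<forall>i\<in>{1..I}.
          (\<forall>n\<ge>1. integrable (sample_space (X n))
             (\<lambda>\<omega>. real (queue_at_epoch I p (X n) c i k \<omega>) ^ l)) \<and>
          (\<lambda>n. \<integral>\<omega>. (real (queue_at_epoch I p (X n) c i k \<omega>) / real n) ^ l \<partial>sample_space (X n))
            \<longlonglongrightarrow> (q k i) ^ l))"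
proof -
  interpret polling_model K I p lam mu SD s r by (rule model)
  obtain \<gamma> w where "weighted_polling_model K I p lam mu SD s r \<gamma> w" by (rule weighted_model_exists)
  then interpret weighted_polling_model K I p lam mu SD s r \<gamma> w .
  note [simp del] = One_nat_def
  let ?M = "\<lambda>n. sample_space (X n)"
  let ?Q = "\<lambda>n c i k \<omega>. real (queue_at_epoch I p (X n) c i k \<omega>)"
  \<comment> \<open>Epochs are numbered through all cycles, so n q becomes a periodic sequence that
    solves the recursion for the means of system \<open>n\<close>.\<close>
  define a where "a = (\<lambda>n m j. real n * q j (stage m))"
  have stage_Suc: "stage (Suc m) = (if stage m = I then 1 else stage m + 1)" for m
    using I_pos by (auto simp: stage_def mod_Suc)
  have a_step: "a n (Suc m) j = visit_mean m (a n m) j + lam j * (real n * s (stage m))" if j: "j \<in> {1..K}" for n m j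
  proof -
    have g: "gain (que m) j = lam j * (1 / (mu (que m) * (1 - lam (que m) / mu (que m))))" by (simp add: gain_def)
    have "q j (stage (Suc m)) = (if j = que m then s (stage m) * lam j + (1 - r (stage m)) * q j (stage m)
        else s (stage m) * lam j + q j (stage m) + q (que m) (stage m) * r (stage m) * gain (que m) j)"
      using q[unfolded polling_equations_def, rule_format, OF j stage_range[of m]]
      unfolding stage_Suc que_def g[unfolded que_def] mult.assoc .
    then show ?thesis by (simp add: a_def visit_mean_def algebra_simps)
  qed
  have a_I: "a n I = a n 0" for n using stage_add_I[of 0] by (simp add: a_def)
  have idx: "a n (c * I + (i - 1)) k = real n * q k i" if "i \<in> {1..I}" for n c i k
  proof -
    have "(c * I + (i - 1)) mod I = (i - 1) mod I" by (rule mod_mult_self3)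
    also have "\<dots> = i - 1" using that by (intro mod_less) auto
    finally have "stage (c * I + (i - 1)) = i" unfolding stage_def using that by (simp only:) simp
    then show ?thesis by (simp only: a_def)
  qed
  have law: "prob_space (VD n i)" "sets (VD n i) = sets borel" "AE x in VD n i. 0 \<le> x"
    if n: "1 \<le> n" and i: "i \<in> {1..I}" for n i
    using weighted_bep_model.switch_law[OF weighted_bep_modelI[OF systems[OF n]] i] by this+
  have P: "prob_space (?M n)" if "1 \<le> n" for n
    using systems[OF that] by (simp add: stationary_bep_system_def bep_system_def)
  have Q: "has_bochner_integral (?M n) (?Q n c i k) (real n * q k i)"
    if n: "1 \<le> n" and k: "k \<in> {1..K}" and i: "i \<in> {1..I}" for n c k i
    unfolding queue_at_epoch_def idx[OF i, of n c k, symmetric]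
    by (rule queue_mean[OF systems[OF n] V_mean[OF n] a_step a_I k])
  have Qm: "?Q n c i k \<in> borel_measurable (?M n)"
    if n: "1 \<le> n" and k: "k \<in> {1..K}" and i: "i \<in> {1..I}" for n c k i
    using Q[OF that] by (auto simp: has_bochner_integral_iff)
  have mean: "has_bochner_integral (?M n) (\<lambda>\<omega>. ?Q n c i k \<omega> / real n) (q k i)"
    if n: "1 \<le> n" and k: "k \<in> {1..K}" and i: "i \<in> {1..I}" for n c k i
    using has_bochner_integral_divide_zero[OF Q[OF that, of c], of "real n"] n by simp
  \<comment> \<open>Nonnegativity of the solution need not be derived from the linear system: the
    values are expectations of queue lengths in system 1.\<close>
  have q0: "0 \<le> q k i" if k: "k \<in> {1..K}" and i: "i \<in> {1..I}" for k i
  proof -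
    have "(\<integral>\<omega>. ?Q 1 0 i k \<omega> / real 1 \<partial>?M 1) = q k i" using mean[OF order_refl k i, of 0] by (simp add: has_bochner_integral_iff)
    moreover have "0 \<le> (\<integral>\<omega>. ?Q 1 0 i k \<omega> / real 1 \<partial>?M 1)" by (rule integral_nonneg_AE) simp
    ultimately show ?thesis by linarith
  qed
  have var: "\<exists>b. (\<forall>n\<ge>1. 0 < b n \<and> (\<forall>k\<in>{1..K}. (\<integral>\<^sup>+\<omega>. ennreal ((?Q n c i k \<omega> / real n - q k i) ^ 2) \<partial>?M n) \<le> ennreal (b n)))
      \<and> b \<longlonglongrightarrow> 0"
    if S: "\<And>k. k \<in> {1..K} \<Longrightarrow> integrable (SD k) (\<lambda>x. x ^ 2)"
      and V: "\<And>n i. 1 \<le> n \<Longrightarrow> i \<in> {1..I} \<Longrightarrow> integrable (VD n i) (\<lambda>x. x ^ 2)"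
      and lim: "\<And>i. i \<in> {1..I} \<Longrightarrow> (\<lambda>n. \<integral>x. (x / real n) ^ 2 \<partial>VD n i) \<longlonglongrightarrow> (s i) ^ 2"
      and i: "i \<in> {1..I}" for c i
  proof -
    let ?m = "c * I + (i - 1)"
    obtain C where C: "0 \<le> C" and Cb: "\<And>VD (X :: 'w polling_primitives) v \<sigma> a B k. stationary_bep_system K I p lam SD r VD X \<Longrightarrow>
      (\<forall>i\<in>{1..I}. (\<integral>\<^sup>+x. ennreal x \<partial>VD i) = ennreal (v i) \<and> (\<integral>\<^sup>+x. ennreal (x ^ 2) \<partial>VD i) = ennreal (\<sigma> i)
        \<and> 0 \<le> v i \<and> (v i) ^ 2 \<le> \<sigma> i) \<Longrightarrow>
      (\<forall>m. \<forall>j\<in>{1..K}. 0 \<le> a m j \<and> a (Suc m) j = visit_mean m (a m) j + lam j * v (stage m)) \<Longrightarrow> a I = a 0 \<Longrightarrow>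
      (\<forall>m. 1 + a m (que m) + v (stage m) + (\<sigma> (stage m) - (v (stage m)) ^ 2) \<le> B) \<Longrightarrow> k \<in> {1..K} \<Longrightarrow>
      (\<integral>\<^sup>+\<omega>. ennreal ((real (queue_length X \<omega> (epoch_state I p X \<omega> ?m) k) - a ?m k) ^ 2) \<partial>sample_space X)
        \<le> ennreal (C * B)"
      using queue_variance_bound[OF S, where m = ?m] by blast
    define \<sigma> where "\<sigma> = (\<lambda>n i. \<integral>x. x ^ 2 \<partial>VD n i)"
    \<comment> \<open>A crude bound for the mean queue plus the mean switchover time of any stage,
      divided by \<open>n\<close>; all summands are nonnegative.\<close>
    define A where "A = (\<Sum>j\<in>{1..K}. \<Sum>i\<in>{1..I}. q j i) + (\<Sum>i\<in>{1..I}. s i)"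
    define B where "B = (\<lambda>n. 1 + real n * A + (\<Sum>i\<in>{1..I}. \<sigma> n i - (real n * s i) ^ 2))"
    \<comment> \<open>This equals \<open>(C * B n + 1) / n ^ 2\<close>, expanded in
      \<open>1 / n\<close> and scaled variances so that the limit 0 is visible. The last summand
      serves to make \<open>b n\<close> positive, as \<open>tendsto_integral_power\<close>
      requires.\<close>
    define b where "b = (\<lambda>n. C * (1 / real n * (1 / real n) + 1 / real n * A
      + (\<Sum>i\<in>{1..I}. (\<integral>x. (x / real n) ^ 2 \<partial>VD n i) - (s i) ^ 2)) + 1 / real n * (1 / real n))"
    have Vn: "(\<integral>\<^sup>+x. ennreal x \<partial>VD n i) = ennreal (real n * s i) \<and> (\<integral>\<^sup>+x. ennreal (x ^ 2) \<partial>VD n i) = ennreal (\<sigma> n i)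
        \<and> 0 \<le> real n * s i \<and> (real n * s i) ^ 2 \<le> \<sigma> n i" if n: "1 \<le> n" and i: "i \<in> {1..I}" for n i
    proof -
      interpret V: prob_space "VD n i" by (rule law(1)[OF n i])
      have v: "integrable (VD n i) (\<lambda>x. x)" "(\<integral>x. x \<partial>VD n i) = real n * s i"
        using V_mean[OF n i] by (auto simp: has_bochner_integral_iff)
      have "(real n * s i) ^ 2 \<le> \<sigma> n i"
        using V.variance_eq[OF v(1) V[OF n i]] V.variance_positive[of "\<lambda>x. x"] v(2) by (simp add: \<sigma>_def)
      moreover have "(\<integral>\<^sup>+x. ennreal x \<partial>VD n i) = ennreal (real n * s i)"
        using nn_integral_eq_integral[OF v(1) law(3)[OF n i]] v(2) by simp
      moreover have "(\<integral>\<^sup>+x. ennreal (x ^ 2) \<partial>VD n i) = ennreal (\<sigma> n i)"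
        unfolding \<sigma>_def by (rule nn_integral_eq_integral[OF V[OF n i]]) simp
      ultimately show ?thesis using switch_nonneg[OF i] by simp
    qed
    have Bn: "1 + a n m (que m) + real n * s (stage m) + (\<sigma> n (stage m) - (real n * s (stage m)) ^ 2) \<le> B n" if n: "1 \<le> n" for n m
    proof -
      have "q (que m) (stage m) \<le> (\<Sum>i\<in>{1..I}. q (que m) i)"
        by (rule member_le_sum[OF stage_range]) (use q0 que_range in auto)
      also have "\<dots> \<le> (\<Sum>j\<in>{1..K}. \<Sum>i\<in>{1..I}. q j i)"
        by (rule member_le_sum[OF que_range, where f = "\<lambda>j. \<Sum>i\<in>{1..I}. q j i"]) (use q0 in \<open>auto intro!: sum_nonneg\<close>)
      finally have "q (que m) (stage m) \<le> (\<Sum>j\<in>{1..K}. \<Sum>i\<in>{1..I}. q j i)" .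
      moreover have "s (stage m) \<le> (\<Sum>i\<in>{1..I}. s i)"
        by (rule member_le_sum[OF stage_range]) (use switch_nonneg in auto)
      ultimately have "q (que m) (stage m) + s (stage m) \<le> A" unfolding A_def by linarith
      then have "real n * (q (que m) (stage m) + s (stage m)) \<le> real n * A" by (rule mult_left_mono) simp
      moreover have "\<sigma> n (stage m) - (real n * s (stage m)) ^ 2 \<le> (\<Sum>i\<in>{1..I}. \<sigma> n i - (real n * s i) ^ 2)"
        by (rule member_le_sum[OF stage_range, where f = "\<lambda>i. \<sigma> n i - (real n * s i) ^ 2"]) (use Vn[OF n] in auto)
      ultimately show ?thesis unfolding B_def a_def distrib_left by linarith
    qed
    have b_eq: "b n = (C * B n + 1) / (real n) ^ 2" if n: "1 \<le> n" for n
    proof -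
      have "(\<Sum>i\<in>{1..I}. (\<integral>x. (x / real n) ^ 2 \<partial>VD n i) - (s i) ^ 2) = (\<Sum>i\<in>{1..I}. \<sigma> n i - (real n * s i) ^ 2) / (real n) ^ 2"
        unfolding sum_divide_distrib using n
        by (intro sum.cong refl) (simp add: \<sigma>_def power_divide power_mult_distrib diff_divide_distrib)
      then show ?thesis unfolding b_def B_def using n by (simp add: power2_eq_square field_simps)
    qed
    have bound: "(\<integral>\<^sup>+\<omega>. ennreal ((?Q n c i k \<omega> / real n - q k i) ^ 2) \<partial>?M n) \<le> ennreal (b n)"
      if n: "1 \<le> n" and k: "k \<in> {1..K}" for n k
    proof -
      have "(\<integral>\<^sup>+\<omega>. ennreal ((?Q n c i k \<omega> / real n - q k i) ^ 2) \<partial>?M n)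
          = (\<integral>\<^sup>+\<omega>. ennreal (1 / (real n) ^ 2) * ennreal ((?Q n c i k \<omega> - real n * q k i) ^ 2) \<partial>?M n)"
      proof (rule nn_integral_cong)
        fix \<omega>
        have "x / real n - q k i = (x - real n * q k i) / real n" for x using n by (simp add: field_simps)
        then have "(x / real n - q k i) ^ 2 = 1 / (real n) ^ 2 * (x - real n * q k i) ^ 2" for x by (simp add: power_divide)
        then show "ennreal ((?Q n c i k \<omega> / real n - q k i) ^ 2)
            = ennreal (1 / (real n) ^ 2) * ennreal ((?Q n c i k \<omega> - real n * q k i) ^ 2)"
          by (subst ennreal_mult'[symmetric]) auto
      qed
      also have "\<dots> = ennreal (1 / (real n) ^ 2) * (\<integral>\<^sup>+\<omega>. ennreal ((?Q n c i k \<omega> - real n * q k i) ^ 2) \<partial>?M n)"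
        by (intro nn_integral_cmult measurable_compose[OF _ measurable_ennreal] borel_measurable_power
            borel_measurable_diff Qm n k i) simp
      also have "\<dots> \<le> ennreal (1 / (real n) ^ 2) * ennreal (C * B n)"
      proof (rule mult_left_mono)
        show "(\<integral>\<^sup>+\<omega>. ennreal ((?Q n c i k \<omega> - real n * q k i) ^ 2) \<partial>?M n) \<le> ennreal (C * B n)"
          unfolding queue_at_epoch_def idx[OF i, of n c k, symmetric]
        proof (rule Cb[OF systems[OF n], where v = "\<lambda>i. real n * s i" and \<sigma> = "\<sigma> n"])
          show "\<forall>m. \<forall>j\<in>{1..K}. 0 \<le> a n m j \<and> a n (Suc m) j = visit_mean m (a n m) j + lam j * (real n * s (stage m))"
            using a_step q0[OF _ stage_range] by (simp add: a_def)
        qed (use Vn[OF n] Bn[OF n] a_I k in auto)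
      qed simp
      also have "\<dots> = ennreal (C * B n / (real n) ^ 2)" by (subst ennreal_mult'[symmetric]) auto
      also have "\<dots> \<le> ennreal (b n)" unfolding b_eq[OF n] by (intro ennreal_leI divide_right_mono) auto
      finally show ?thesis .
    qed
    have "0 < b n" if n: "1 \<le> n" for n
    proof -
      have "0 \<le> a n 0 (que 0)" using q0[OF que_range stage_range] by (simp add: a_def)
      then have "0 \<le> B n" using Bn[OF n, of 0] Vn[OF n stage_range, of 0] by linarith
      then show ?thesis unfolding b_eq[OF n] using C n by (intro divide_pos_pos add_nonneg_pos mult_nonneg_nonneg) auto
    qed
    moreover have "b \<longlonglongrightarrow> 0"
    proof -
      have "b \<longlonglongrightarrow> C * (0 * 0 + 0 * A + (\<Sum>i\<in>{1..I}. (s i) ^ 2 - (s i) ^ 2)) + 0 * 0"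
        unfolding b_def by (intro tendsto_intros lim lim_1_over_n)
      then show ?thesis by simp
    qed
    ultimately show ?thesis using bound by (intro exI[of _ b]) auto
  qed
  show ?thesis
  proof (rule conjI[OF _ conjI[OF impI[OF impI[OF impI]] impI[OF impI[OF impI]]]])
    show "\<forall>n\<ge>1. \<forall>c. \<forall>k\<in>{1..K}. \<forall>i\<in>{1..I}.
        has_bochner_integral (sample_space (X n))
          (\<lambda>\<omega>. real (queue_at_epoch I p (X n) c i k \<omega>) / real n) (q k i)"
      using mean by blast
  next
    assume S: "\<forall>k\<in>{1..K}. integrable (SD k) (\<lambda>x. x ^ 2)"
      and V: "\<forall>n\<ge>1. \<forall>i\<in>{1..I}. integrable (VD n i) (\<lambda>x. x ^ 2)"
      and lim: "\<forall>i\<in>{1..I}. (\<lambda>n. \<integral>x. (x / real n) ^ 2 \<partial>VD n i) \<longlonglongrightarrow> (s i) ^ 2"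
    show "\<forall>c. \<forall>k\<in>{1..K}. \<forall>j\<in>{1..K}. \<forall>i\<in>{1..I}.
          (\<forall>n\<ge>1. integrable (sample_space (X n))
             (\<lambda>\<omega>. real (queue_at_epoch I p (X n) c i k \<omega>) * real (queue_at_epoch I p (X n) c i j \<omega>))) \<and>
          (\<lambda>n. \<integral>\<omega>. (real (queue_at_epoch I p (X n) c i k \<omega>) / real n)
                     * (real (queue_at_epoch I p (X n) c i j \<omega>) / real n) \<partial>sample_space (X n))
            \<longlonglongrightarrow> q k i * q j i"
    proof (rule allI, rule ballI, rule ballI, rule ballI)
      fix c k j i assume k: "k \<in> {1..K}" and j: "j \<in> {1..K}" and i: "i \<in> {1..I}"
      obtain b where b: "\<And>n. 1 \<le> n \<Longrightarrow> 0 < b n" "\<And>n k. 1 \<le> n \<Longrightarrow> k \<in> {1..K} \<Longrightarrow>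
          (\<integral>\<^sup>+\<omega>. ennreal ((?Q n c i k \<omega> / real n - q k i) ^ 2) \<partial>?M n) \<le> ennreal (b n)" "b \<longlonglongrightarrow> 0"
        using var[OF S[rule_format] V[rule_format] lim[rule_format] i, of c] by blast
      note prod = tendsto_integral_product[OF P mean[OF _ k i] mean[OF _ j i] b(2)[OF _ k] b(2)[OF _ j] less_imp_le[OF b(1)] b(3)]
      have prod1: "integrable (?M n) (\<lambda>\<omega>. ?Q n c i k \<omega> / real n * (?Q n c i j \<omega> / real n))" if "1 \<le> n" for n
        by (rule prod(1)) (use that in auto)
      have prod2: "(\<lambda>n. \<integral>\<omega>. ?Q n c i k \<omega> / real n * (?Q n c i j \<omega> / real n) \<partial>?M n) \<longlonglongrightarrow> q k i * q j i"
        by (rule prod(2)) auto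
      have "integrable (?M n) (\<lambda>\<omega>. ?Q n c i k \<omega> * ?Q n c i j \<omega>)" if n: "1 \<le> n" for n
      proof -
        have "(\<lambda>\<omega>. ?Q n c i k \<omega> * ?Q n c i j \<omega>)
            = (\<lambda>\<omega>. (real n) ^ 2 * (?Q n c i k \<omega> / real n * (?Q n c i j \<omega> / real n)))"
          using n by (simp add: power2_eq_square)
        then show ?thesis using integrable_mult_right[OF prod1[OF n], of "(real n) ^ 2"] by simp
      qed
      with prod2 show "(\<forall>n\<ge>1. integrable (?M n) (\<lambda>\<omega>. ?Q n c i k \<omega> * ?Q n c i j \<omega>)) \<and>
          (\<lambda>n. \<integral>\<omega>. (?Q n c i k \<omega> / real n) * (?Q n c i j \<omega> / real n) \<partial>?M n) \<longlonglongrightarrow> q k i * q j i" by blast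
    qed
  next
    assume S: "\<forall>k\<in>{1..K}. \<exists>\<epsilon>>0. \<forall>t\<in>{-\<epsilon><..<\<epsilon>}. integrable (SD k) (\<lambda>x. exp (t * x))"
      and V: "\<forall>n\<ge>1. \<forall>i\<in>{1..I}. \<forall>t\<ge>0. integrable (VD n i) (\<lambda>x. exp (t * x))"
      and lim: "\<forall>l\<ge>3. \<forall>i\<in>{1..I}. (\<lambda>n. \<integral>x. (x / real n) ^ l \<partial>VD n i) \<longlonglongrightarrow> (s i) ^ l"
    have Sl: "integrable (SD k) (\<lambda>x. x ^ l)" if k: "k \<in> {1..K}" for k l
    proof -
      obtain \<epsilon> where \<epsilon>: "0 < \<epsilon>" "\<And>t. t \<in> {-\<epsilon><..<\<epsilon>} \<Longrightarrow> integrable (SD k) (\<lambda>x. exp (t * x))" using S k by blast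
      have "0 < \<epsilon> / 2" "\<epsilon> / 2 \<in> {-\<epsilon><..<\<epsilon>}" using \<epsilon>(1) by auto
      then show ?thesis using integrable_power_of_exp[OF service_law(2,3)[OF k] _ \<epsilon>(2)] by blast
    qed
    have Vl: "integrable (VD n i) (\<lambda>x. x ^ l)" if n: "1 \<le> n" and i: "i \<in> {1..I}" for n i l
      using integrable_power_of_exp[OF law(2,3)[OF n i] zero_less_one V[rule_format, OF n i zero_le_one]] .
    \<comment> \<open>The hypothesis starts at order three, while the deviation bound uses second
      moments. These are recovered from the exact means and the third moments.\<close>
    have lim2: "(\<lambda>n. \<integral>x. (x / real n) ^ 2 \<partial>VD n i) \<longlonglongrightarrow> (s i) ^ 2" if i: "i \<in> {1..I}" for i
    proof (rule tendsto_second_moment[OF law(1)[OF _ i]])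
      fix n :: nat assume n: "1 \<le> n"
      show "AE x in VD n i. 0 \<le> x / real n" using law(3)[OF n i] by eventually_elim simp
      show "has_bochner_integral (VD n i) (\<lambda>x. x / real n) (s i)"
        using has_bochner_integral_divide_zero[OF V_mean[OF n i], of "real n"] n by simp
      show "integrable (VD n i) (\<lambda>x. (x / real n) ^ 2)" "integrable (VD n i) (\<lambda>x. (x / real n) ^ 3)"
        unfolding power_divide by (rule integrable_divide_zero, rule Vl[OF n i])+
    qed (use lim i switch_nonneg in auto)
    have mom: "\<exists>D\<ge>0. \<forall>n\<ge>1. \<forall>k\<in>{1..K}. (\<integral>\<^sup>+\<omega>. ennreal ((?Q n c i k \<omega> / real n) ^ l) \<partial>?M n) \<le> ennreal D"
      if l: "3 \<le> l" and i: "i \<in> {1..I}" for c i l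
    proof -
      let ?m = "c * I + (i - 1)"
      have l1: "1 \<le> l" using l by simp
      obtain C where C: "0 \<le> C" and Cb: "\<And>VD (X :: 'w polling_primitives) B k. stationary_bep_system K I p lam SD r VD X \<Longrightarrow> 0 \<le> B \<Longrightarrow>
        (\<forall>i\<in>{1..I}. (\<integral>\<^sup>+x. ennreal (x ^ l) \<partial>VD i) \<le> ennreal B) \<Longrightarrow> k \<in> {1..K} \<Longrightarrow>
        (\<integral>\<^sup>+\<omega>. ennreal (real (queue_length X \<omega> (epoch_state I p X \<omega> ?m) k) ^ l) \<partial>sample_space X) \<le> ennreal (C * (1 + B))"
        using queue_moment_bound[OF Sl l1, where m = ?m] by blast
      let ?S = "\<lambda>n. \<Sum>i\<in>{1..I}. \<integral>x. (x / real n) ^ l \<partial>VD n i"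
      \<comment> \<open>A convergent sequence is bounded; this gives a bound on the scaled
        switchover moments for all \<open>n\<close>, and the sum covers all stages at once.\<close>
      have "?S \<longlonglongrightarrow> (\<Sum>i\<in>{1..I}. (s i) ^ l)" using lim l by (intro tendsto_sum) auto
      then have "Bseq ?S" by (intro convergent_imp_Bseq convergentI)
      then obtain H where H: "0 < H" "\<And>n. norm (?S n) \<le> H" by (auto elim: BseqE)
      have "(\<integral>\<^sup>+\<omega>. ennreal ((?Q n c i k \<omega> / real n) ^ l) \<partial>?M n) \<le> ennreal (C * (1 + H))"
        if n: "1 \<le> n" and k: "k \<in> {1..K}" for n k
      proof -
        define B where "B = (\<Sum>i\<in>{1..I}. \<integral>x. x ^ l \<partial>VD n i)"
        have m0: "0 \<le> (\<integral>x. x ^ l \<partial>VD n i)" if "i \<in> {1..I}" for i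
          by (rule integral_nonneg_AE, use law(3)[OF n that] in eventually_elim) simp
        have B0: "0 \<le> B" unfolding B_def by (intro sum_nonneg m0)
        have mB: "\<forall>i\<in>{1..I}. (\<integral>\<^sup>+x. ennreal (x ^ l) \<partial>VD n i) \<le> ennreal B"
        proof
          fix i assume i: "i \<in> {1..I}"
          have "(\<integral>\<^sup>+x. ennreal (x ^ l) \<partial>VD n i) = ennreal (\<integral>x. x ^ l \<partial>VD n i)"
            by (rule nn_integral_eq_integral[OF Vl[OF n i]], use law(3)[OF n i] in eventually_elim) simp
          also have "\<dots> \<le> ennreal B"
            unfolding B_def using i m0 by (intro ennreal_leI member_le_sum[of i "{1..I}" "\<lambda>i. \<integral>x. x ^ l \<partial>VD n i"]) auto
          finally show "(\<integral>\<^sup>+x. ennreal (x ^ l) \<partial>VD n i) \<le> ennreal B" .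
        qed
        have "?S n = B / (real n) ^ l" by (simp add: B_def power_divide sum_divide_distrib)
        moreover have "?S n \<le> H" using H(2)[of n] unfolding real_norm_def by linarith
        ultimately have "B / (real n) ^ l \<le> H" by (simp only:)
        moreover have "1 / (real n) ^ l \<le> 1"
        proof -
          have "1 \<le> real n ^ l" using n by (intro one_le_power) simp
          then show ?thesis using n by (subst divide_le_eq_1_pos) auto
        qed
        ultimately have "(1 + B) / (real n) ^ l \<le> 1 + H" by (simp only: add_divide_distrib)
        then have le: "C * ((1 + B) / (real n) ^ l) \<le> C * (1 + H)" using C by (rule mult_left_mono)
        have "(\<integral>\<^sup>+\<omega>. ennreal ((?Q n c i k \<omega> / real n) ^ l) \<partial>?M n)
            = (\<integral>\<^sup>+\<omega>. ennreal (1 / (real n) ^ l) * ennreal (?Q n c i k \<omega> ^ l) \<partial>?M n)"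
          by (intro nn_integral_cong, subst ennreal_mult'[symmetric]) (auto simp: power_divide)
        also have "\<dots> = ennreal (1 / (real n) ^ l) * (\<integral>\<^sup>+\<omega>. ennreal (?Q n c i k \<omega> ^ l) \<partial>?M n)"
          by (intro nn_integral_cmult measurable_compose[OF _ measurable_ennreal] borel_measurable_power Qm n k i)
        also have "\<dots> \<le> ennreal (1 / (real n) ^ l) * ennreal (C * (1 + B))"
          unfolding queue_at_epoch_def by (intro mult_left_mono Cb[OF systems[OF n] B0 mB k]) simp
        also have "\<dots> = ennreal (C * ((1 + B) / (real n) ^ l))" by (subst ennreal_mult'[symmetric]) auto
        also have "\<dots> \<le> ennreal (C * (1 + H))" by (rule ennreal_leI[OF le])
        finally show ?thesis .
      qed
      then show ?thesis using C H(1) by (intro exI[of _ "C * (1 + H)"]) auto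
    qed
    show "\<forall>c. \<forall>l\<ge>3. \<forall>k\<in>{1..K}. \<forall>i\<in>{1..I}.
          (\<forall>n\<ge>1. integrable (sample_space (X n))
             (\<lambda>\<omega>. real (queue_at_epoch I p (X n) c i k \<omega>) ^ l)) \<and>
          (\<lambda>n. \<integral>\<omega>. (real (queue_at_epoch I p (X n) c i k \<omega>) / real n) ^ l \<partial>sample_space (X n))
            \<longlonglongrightarrow> (q k i) ^ l"
    proof (rule allI, rule allI, rule impI, rule ballI, rule ballI)
      fix c l k i assume l: "3 \<le> (l :: nat)" and k: "k \<in> {1..K}" and i: "i \<in> {1..I}"
      obtain D where D: "\<And>n. 1 \<le> n \<Longrightarrow> (\<integral>\<^sup>+\<omega>. ennreal ((?Q n c i k \<omega> / real n) ^ l) \<partial>?M n) \<le> ennreal D"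
        using mom[OF l i, of c] k by blast
      have int: "integrable (?M n) (\<lambda>\<omega>. (?Q n c i k \<omega> / real n) ^ l)" if n: "1 \<le> n" for n
        by (rule integrableI_nonneg, intro borel_measurable_power borel_measurable_divide Qm n k i)
          (use le_less_trans[OF D[OF n] ennreal_less_top] in auto)
      have "integrable (?M n) (\<lambda>\<omega>. ?Q n c i k \<omega> ^ l)" if n: "1 \<le> n" for n
      proof -
        have "(\<lambda>\<omega>. ?Q n c i k \<omega> ^ l) = (\<lambda>\<omega>. (real n) ^ l * (?Q n c i k \<omega> / real n) ^ l)"
          using n by (simp add: power_divide)
        then show ?thesis using integrable_mult_right[OF int[OF n], of "(real n) ^ l"] by simp
      qed
      moreover have "(\<lambda>n. \<integral>\<omega>. (?Q n c i k \<omega> / real n) ^ l \<partial>?M n) \<longlonglongrightarrow> (q k i) ^ l"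
      proof -
        \<comment> \<open>The interpolation uses the moment of order 2 (l - 1), which is at least 4
          and hence within the orders covered by the moment bound \<open>mom\<close>.\<close>
        define l' where "l' = l - 1"
        have l': "l = Suc l'" "3 \<le> l' * 2" using l by (auto simp: l'_def)
        obtain b where b: "\<And>n. 1 \<le> n \<Longrightarrow> 0 < b n" "\<And>n k. 1 \<le> n \<Longrightarrow> k \<in> {1..K} \<Longrightarrow>
            (\<integral>\<^sup>+\<omega>. ennreal ((?Q n c i k \<omega> / real n - q k i) ^ 2) \<partial>?M n) \<le> ennreal (b n)" "b \<longlonglongrightarrow> 0"
          using var[OF Sl Vl lim2 i, of c] by blast
        obtain B where B: "0 \<le> B" "\<And>n. 1 \<le> n \<Longrightarrow> (\<integral>\<^sup>+\<omega>. ennreal ((?Q n c i k \<omega> / real n) ^ (l' * 2)) \<partial>?M n) \<le> ennreal B"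
          using mom[OF l'(2) i, of c] k by blast
        have meas: "(\<lambda>\<omega>. ?Q n c i k \<omega> / real n) \<in> borel_measurable (?M n)" if "1 \<le> n" for n
          by (intro borel_measurable_divide Qm that k i) simp
        show ?thesis
          unfolding l'(1)
          by (rule tendsto_integral_power[OF P meas _ q0[OF k i] b(2)[OF _ k] b(1) b(3) int[unfolded l'(1)] B(1) B(2)[unfolded power_mult]])
            auto
      qed
      ultimately show "(\<forall>n\<ge>1. integrable (?M n) (\<lambda>\<omega>. ?Q n c i k \<omega> ^ l)) \<and>
          (\<lambda>n. \<integral>\<omega>. (?Q n c i k \<omega> / real n) ^ l \<partial>?M n) \<longlonglongrightarrow> (q k i) ^ l" by blast
    qed
  qed
qed

end
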